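(* Let $X$ be a Riemannian manifold, $\mu$ a probability measure on $\varGamma_X$, $\{\eta_x\}_{x\in X}$ a measurable family of probability measures on $\mathfrak{X}=\bigsqcup_{n=0}^\infty X^n$, and $\mu_{\mathrm{cl}}$ the corresponding cluster measure, and assume that the standing assumptions (A1)–(A4) listed in the context hold. Then for any $F_1,F_2\in\mathcal{FC}(\varGamma_X)$ and $V\in\mathcal{FV}(\varGamma_X)$, $$\int_{\varGamma_X}\sum_{x\in\gamma}\nabla_xF_1(\gamma)\cdot V(\gamma)_x\,F_2(\gamma)\,\mu_{\mathrm{cl}}(d\gamma)=-\int_{\varGamma_X}F_1(\gamma)\sum_{x\in\gamma}\nabla_xF_2(\gamma)\cdot V(\gamma)_x\,\mu_{\mathrm{cl}}(d\gamma)-\int_{\varGamma_X}F_1(\gamma)F_2(\gamma)B^V_{\mu_{\mathrm{cl}}}(\gamma)\,\mu_{\mathrm{cl}}(d\gamma).$$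
   Context: Configurations: a configuration in $S$ is a measure $\gamma=\sum_i\delta_{s_i}$ (countably many points); it is proper if finite on compact sets and without multiple points; $\varGamma_S$ is the set of proper configurations with the $\sigma$-algebra generated by $\gamma\mapsto\gamma(B)$. $\langle f,\gamma\rangle=\sum_{s\in\gamma}f(s)$. For $\bar y=(y_i)\in\mathfrak{X}$: $\mathfrak{p}(\bar y)=\sum_i\delta_{y_i}$, $N_X(\bar y)$ is the number of coordinates, $\mathfrak{X}_B$ is the set of $\bar y$ with at least one coordinate in $B$; $\mathcal{Z}=X\times\mathfrak{X}$, $\mathcal{Z}_B=X\times\mathfrak{X}_B$. $\mathfrak{X}$ carries the componentwise Riemannian structure and volume $d\bar y$. "Measurable family" means $x\mapsto\eta_x(\bar B)$ is measurable for each Borel $\bar B\subset\mathfrak{X}$. $\mathcal{M}^1_\theta(\varGamma_X)$: the probability measures $\mu$ on $\varGamma_X$ with $\int|\langle f,\gamma\rangle|\,d\mu<\infty$ for all $f\in L^1(X,\theta)$ (elements of $L^1$ being classes of $\theta$-a.e. equal functions, so that $\langle f,\gamma\rangle$ is required to be $\mu$-a.s. independent of the representative). Cluster measure $\mu_{\mathrm{cl}}$: the law of $\sum_{x\in\gamma_c}\gamma'_x$, where $\gamma_c\sim\mu$ and, given $\gamma_c$, the $\gamma'_x$ are independent with laws $\eta_x\circ\mathfrak{p}^{-1}$ (supported on $\varGamma_X$ under the present assumptions). $\hat\mu(d\hat\gamma)=\bigotimes_{x\in\gamma}\eta_x(d\bar y_x)\,\mu(d\gamma)$ on $\varGamma_{\mathcal{Z}}$,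 $\hat\gamma=\sum_{x\in\gamma}\delta_{(x,\bar y_x)}$; $\mathfrak{q}(\hat\gamma)=\sum_{(x,\bar y)\in\hat\gamma}\mathfrak{p}(\bar y)$, so that $\mu_{\mathrm{cl}}=\hat\mu\circ\mathfrak{q}^{-1}$. For $G\in L^1(\hat\mu)$, $\mathcal{I}^*_{\mathfrak{q}}G\in L^1(\mu_{\mathrm{cl}})$ is determined by $\int F\,\mathcal{I}^*_{\mathfrak{q}}G\,d\mu_{\mathrm{cl}}=\int (F\circ\mathfrak{q})\,G\,d\hat\mu$ for all $F\in L^\infty(\mu_{\mathrm{cl}})$. $\mathrm{Vect}_0(X)$: compactly supported $C^\infty$ vector fields on $X$. $\mathcal{FC}(\varGamma_X)$: functions $F(\gamma)=f(\langle\phi_1,\gamma\rangle,\dots,\langle\phi_k,\gamma\rangle)$ with $k\in\mathbb{N}$, $f\in C_b^\infty(\mathbb{R}^k)$ (bounded with all derivatives), $\phi_i\in C_0^\infty(X)$. For $x\in\gamma$, $\nabla_xF(\gamma)$ is the gradient at $y=x$ of $y\mapsto F((\gamma\setminus\{x\})\cup\{y\})$; the dot is the inner product in $T_xX$. $\mathcal{FV}(\varGamma_X)$: vector fields $V(\gamma)=(V(\gamma)_x)_{x\in\gamma}$ with $V(\gamma)_x=\sum_{j=1}^kG_j(\gamma)v_j(x)$, $G_j\in\mathcal{FC}(\varGamma_X)$, $v_j\in\mathrm{Vect}_0(X)$, $k\in\mathbb{N}$. For $v\in\mathrm{Vect}_0(X)$: $\hat v(x,\bar y):=(v(y_i))_{y_i\in\bar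 y}$. With $h_x(\bar y)=\eta_x(d\bar y)/d\bar y$: $\beta_\eta(x,\bar y):=\nabla h_x(\bar y)/h_x(\bar y)\in T_{\bar y}\mathfrak{X}$, with components $\beta_\eta(x,\bar y)_i$; $\|\beta_\eta(x,\bar y)\|_1:=\sum_i|\beta_\eta(x,\bar y)_i|$; and $\beta_\eta^{\hat v}(x,\bar y):=(\beta_\eta(x,\bar y),\hat v(x,\bar y))_{T_{\bar y}\mathfrak{X}}+\sum_{y_i\in\bar y}\mathrm{div}\,v(y_i)$. Put $B^{\hat v}_{\hat\mu}(\hat\gamma):=\sum_{(x,\bar y)\in\hat\gamma}\beta_\eta^{\hat v}(x,\bar y)$, $B^v_{\mu_{\mathrm{cl}}}:=\mathcal{I}^*_{\mathfrak{q}}B^{\hat v}_{\hat\mu}\in L^1(\varGamma_X,\mu_{\mathrm{cl}})$ and, for $V=\sum_jG_jv_j\in\mathcal{FV}(\varGamma_X)$, $$B^V_{\mu_{\mathrm{cl}}}(\gamma)=\sum_{j=1}^k\Bigl(G_j(\gamma)B^{v_j}_{\mu_{\mathrm{cl}}}(\gamma)+\sum_{x\in\gamma}\nabla_xG_j(\gamma)\cdot v_j(x)\Bigr).$$ Standing assumptions: (A1) there is a measure $\theta$ on $X$, finite on compact sets, with $\mu\in\mathcal{M}^1_\theta(\varGamma_X)$; (A2) for every compact $B\subset X$, $\int_X\eta_x(\mathfrak{X}_B)\,\theta(dx)<\infty$ and $\int_X\int_{\mathfrak{X}_B}N_X(\bar y)\,\eta_x(d\bar y)\,\theta(dx)<\infty$;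 (A3) each $\eta_x$ is absolutely continuous with respect to $d\bar y$ with differentiable density $h_x$ and satisfies, for all $v\in\mathrm{Vect}_0(X)$ and $f\in C_0^\infty(\mathfrak{X})$, $\int_{\mathfrak{X}}\nabla^{\hat v}f\,d\eta_x=-\int_{\mathfrak{X}}f(\bar y)\,\beta_\eta^{\hat v}(x,\bar y)\,\eta_x(d\bar y)$, where $\nabla^{\hat v}$ is the derivative along $\hat v$; (A4) $\int_{\mathcal{Z}_B}\|\beta_\eta(z)\|_1\,\hat\sigma(dz)<\infty$ for every compact $B\subset X$, where $\hat\sigma(dx\times d\bar y)=\eta_x(d\bar y)\,\theta(dx)$. *)

theory Defs
  imports "HOL-Probability.Probability"
begin

section \<open>Smooth functions\<close>

fun iter_deriv :: "('a::real_normed_vector \<Rightarrow> 'b::real_normed_vector) \<Rightarrow> 'a list \<Rightarrow> 'a \<Rightarrow> 'b" where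
  "iter_deriv f [] = f"
| "iter_deriv f (u # us) = (\<lambda>x. frechet_derivative (iter_deriv f us) (at x) u)"

text \<open>Meant for open \<open>S\<close> only.\<close>
definition smooth_on :: "'a::real_normed_vector set \<Rightarrow> ('a \<Rightarrow> 'b::real_normed_vector) \<Rightarrow> bool" where
  "smooth_on S f \<longleftrightarrow> (\<forall>us. \<forall>x\<in>S. iter_deriv f us differentiable (at x))"

text \<open>
  Lists of length \<open>n\<close> over a Euclidean space \<open>'e\<close> play the role of the space \<open>'e\<close>-to-the-\<open>n\<close>, because
  \<open>n\<close> has to vary inside formulas. \<open>list_has_deriv F L as\<close> says that \<open>F\<close>, restricted to lists of the
  length of \<open>as\<close>, is (totally) differentiable at \<open>as\<close> with gradient \<open>L\<close>.
\<close>
definition list_has_deriv :: "('e::euclidean_space list \<Rightarrow> real) \<Rightarrow> 'e list \<Rightarrow> 'e list \<Rightarrow> bool" where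
  "list_has_deriv F L as \<longleftrightarrow> length L = length as \<and>
     (\<forall>\<epsilon>>0. \<exists>\<delta>>0. \<forall>bs. length bs = length as \<and> (\<forall>i<length as. norm (bs ! i - as ! i) < \<delta>) \<longrightarrow>
        \<bar>F bs - F as - (\<Sum>i<length as. L ! i \<bullet> (bs ! i - as ! i))\<bar>
          \<le> \<epsilon> * (\<Sum>i<length as. norm (bs ! i - as ! i)))"

definition list_grad :: "('e::euclidean_space list \<Rightarrow> real) \<Rightarrow> 'e list \<Rightarrow> 'e list" where
  "list_grad F as = (THE L. list_has_deriv F L as)"

text \<open>Iterated derivatives; \<open>(i, u)\<close> stands for the direction \<open>u\<close> in the \<open>i\<close>-th slot.\<close>
fun list_iter_deriv :: "('e::euclidean_space list \<Rightarrow> real) \<Rightarrow> (nat \<times> 'e) list \<Rightarrow> 'e list \<Rightarrow> real" where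
  "list_iter_deriv F [] = F"
| "list_iter_deriv F ((i, u) # ds) = (\<lambda>as. list_grad (list_iter_deriv F ds) as ! i \<bullet> u)"

definition list_smooth_on :: "nat \<Rightarrow> 'e::euclidean_space list set \<Rightarrow> ('e list \<Rightarrow> real) \<Rightarrow> bool" where
  "list_smooth_on n S F \<longleftrightarrow>
     (\<forall>ds. fst ` set ds \<subseteq> {..<n} \<longrightarrow> (\<forall>as\<in>S. \<exists>L. list_has_deriv (list_iter_deriv F ds) L as))"

definition Cb_smooth :: "nat \<Rightarrow> (real list \<Rightarrow> real) \<Rightarrow> bool" where
  "Cb_smooth k f \<longleftrightarrow> list_smooth_on k {as. length as = k} f \<and>
     (\<forall>ds. fst ` set ds \<subseteq> {..<k} \<longrightarrow> bounded (list_iter_deriv f ds ` {as. length as = k}))"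


section \<open>Riemannian manifolds\<close>

text \<open>A chart is a pair of a domain and a coordinate map.\<close>
type_synonym ('x, 'n) chart = "'x set \<times> ('x \<Rightarrow> real ^ 'n)"

definition chart_inv :: "('x, 'n) chart \<Rightarrow> real ^ 'n \<Rightarrow> 'x" where
  "chart_inv c = inv_into (fst c) (snd c)"

text \<open>
  The manifold is the whole (Hausdorff, second countable) type \<open>'x\<close>; its dimension is \<open>CARD('n)\<close>.
  A preferred chart \<open>chart_at M x\<close> around each point is part of the data, and the tangent space
  at \<open>x\<close> is \<open>real ^ 'n\<close>, a tangent vector being represented by its coordinates in the chart
  \<open>chart_at M x\<close>. In particular, \<open>metric M x\<close> is the inner product of the tangent space at \<open>x\<close> in
  these coordinates.
\<close>
record ('x, 'n) riemannian =
  atlas :: "('x, 'n) chart set"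
  chart_at :: "'x \<Rightarrow> ('x, 'n) chart"
  metric :: "'x \<Rightarrow> real ^ 'n \<Rightarrow> real ^ 'n \<Rightarrow> real"

text \<open>Conversion between coordinates in a chart \<open>c\<close> around \<open>x\<close> and the tangent space at \<open>x\<close>.\<close>
definition to_tangent ::
    "('x, 'n::finite) riemannian \<Rightarrow> ('x, 'n) chart \<Rightarrow> 'x \<Rightarrow> real ^ 'n \<Rightarrow> real ^ 'n" where
  "to_tangent M c x = frechet_derivative (snd (chart_at M x) \<circ> chart_inv c) (at (snd c x))"

definition from_tangent ::
    "('x, 'n::finite) riemannian \<Rightarrow> ('x, 'n) chart \<Rightarrow> 'x \<Rightarrow> real ^ 'n \<Rightarrow> real ^ 'n" where
  "from_tangent M c x =
     frechet_derivative (snd c \<circ> chart_inv (chart_at M x)) (at (snd (chart_at M x) x))"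

text \<open>The Gram matrix of the metric in the chart \<open>c\<close>, as a function of the coordinates.\<close>
definition gram :: "('x, 'n::finite) riemannian \<Rightarrow> ('x, 'n) chart \<Rightarrow> real ^ 'n \<Rightarrow> real ^ 'n ^ 'n" where
  "gram M c p = (let x = chart_inv c p in
     \<chi> i j. metric M x (to_tangent M c x (axis i 1)) (to_tangent M c x (axis j 1)))"

definition riemannian_manifold ::
    "('x::{t2_space,second_countable_topology}, 'n::finite) riemannian \<Rightarrow> bool" where
  "riemannian_manifold M \<longleftrightarrow>
     (\<forall>(U, \<phi>)\<in>atlas M. open U \<and> open (\<phi> ` U) \<and> homeomorphism U (\<phi> ` U) \<phi> (inv_into U \<phi>)) \<and>
     (\<forall>c\<in>atlas M. \<forall>d\<in>atlas M. smooth_on (snd c ` (fst c \<inter> fst d)) (snd d \<circ> chart_inv c)) \<and>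
     (\<forall>x. chart_at M x \<in> atlas M \<and> x \<in> fst (chart_at M x)) \<and>
     (\<forall>x. bilinear (metric M x) \<and> (\<forall>u w. metric M x u w = metric M x w u) \<and>
          (\<forall>u. u \<noteq> 0 \<longrightarrow> metric M x u u > 0)) \<and>
     (\<forall>c\<in>atlas M. \<forall>i j. smooth_on (snd c ` fst c) (\<lambda>p. gram M c p $ i $ j))"

definition differential :: "('x, 'n::finite) riemannian \<Rightarrow> ('x \<Rightarrow> real) \<Rightarrow> 'x \<Rightarrow> real ^ 'n \<Rightarrow> real" where
  "differential M f x =
     frechet_derivative (f \<circ> chart_inv (chart_at M x)) (at (snd (chart_at M x) x))"

definition grad :: "('x, 'n::finite) riemannian \<Rightarrow> ('x \<Rightarrow> real) \<Rightarrow> 'x \<Rightarrow> real ^ 'n" where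
  "grad M f x = (THE w. \<forall>u. metric M x w u = differential M f x u)"

definition tangent_norm :: "('x, 'n::finite) riemannian \<Rightarrow> 'x \<Rightarrow> real ^ 'n \<Rightarrow> real" where
  "tangent_norm M x u = sqrt (metric M x u u)"

text \<open>
  Riemannian divergence, by the coordinate formula
  \<open>div v = (1 / sqrt G) (\<Sum>i. \<partial>\<^sub>i (sqrt G v\<^sup>i))\<close> with \<open>G = det (g\<^sub>i\<^sub>j)\<close>.
\<close>
definition divergence :: "('x, 'n::finite) riemannian \<Rightarrow> ('x \<Rightarrow> real ^ 'n) \<Rightarrow> 'x \<Rightarrow> real" where
  "divergence M v x = (let c = chart_at M x; p = snd c x in
     (\<Sum>i\<in>UNIV. frechet_derivative
        (\<lambda>q. sqrt (det (gram M c q)) * from_tangent M c (chart_inv c q) (v (chart_inv c q)) $ i)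
        (at p) (axis i 1)) / sqrt (det (gram M c p)))"

text \<open>The Riemannian volume: in every chart it has density \<open>sqrt (det (g\<^sub>i\<^sub>j))\<close>.\<close>
definition volume :: "('x::{t2_space,second_countable_topology}, 'n::finite) riemannian \<Rightarrow> 'x measure" where
  "volume M = (THE \<nu>. sets \<nu> = sets borel \<and>
     (\<forall>c\<in>atlas M. \<forall>B\<in>sets borel. B \<subseteq> fst c \<longrightarrow>
        emeasure \<nu> B = (\<integral>\<^sup>+p\<in>snd c ` B. ennreal (sqrt (det (gram M c p))) \<partial>lborel)))"

definition test_functions ::
    "('x::{t2_space,second_countable_topology}, 'n::finite) riemannian \<Rightarrow> ('x \<Rightarrow> real) set" where
  "test_functions M = {f. (\<forall>c\<in>atlas M. smooth_on (snd c ` fst c) (f \<circ> chart_inv c)) \<and>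
     compact (closure {x. f x \<noteq> 0})}"

definition Vect0 ::
    "('x::{t2_space,second_countable_topology}, 'n::finite) riemannian \<Rightarrow> ('x \<Rightarrow> real ^ 'n) set" where
  "Vect0 M = {v. (\<forall>c\<in>atlas M. smooth_on (snd c ` fst c)
       (\<lambda>p. from_tangent M c (chart_inv c p) (v (chart_inv c p)))) \<and>
     compact (closure {x. v x \<noteq> 0})}"


section \<open>The space of finite tuples (clusters)\<close>

text \<open>
  The disjoint union of the powers of \<open>X\<close> is represented by \<open>'x list\<close>, a tuple of length \<open>n\<close> being
  a list of length \<open>n\<close>.
\<close>
definition list_topology :: "'x::topological_space list topology" where
  "list_topology = pullback_topology UNIV (\<lambda>ys. (length ys, \<lambda>i\<in>{..<length ys}. ys ! i))
     (sum_topology (\<lambda>n. product_topology (\<lambda>_. euclidean) {..<n}) UNIV)"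

definition borel_of :: "'s topology \<Rightarrow> 's measure" where
  "borel_of T = sigma (topspace T) {U. openin T U}"

abbreviation list_borel :: "'x::topological_space list measure" where
  "list_borel \<equiv> borel_of list_topology"

abbreviation Z_topology :: "('x::topological_space \<times> 'x list) topology" where
  "Z_topology \<equiv> prod_topology euclidean list_topology"

definition list_volume ::
    "('x::{t2_space,second_countable_topology}, 'n::finite) riemannian \<Rightarrow> 'x list measure" where
  "list_volume M = measure_of UNIV (sets list_borel)
     (\<lambda>B. \<Sum>n. emeasure (distr (PiM {..<n} (\<lambda>_. volume M)) list_borel (\<lambda>f. map f [0..<n])) B)"

definition hits :: "'x set \<Rightarrow> 'x list set" where
  "hits B = {ys. set ys \<inter> B \<noteq> {}}"

text \<open>The function \<open>f\<close> on tuples, expressed in the product of the charts \<open>cs\<close>.\<close>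
definition in_charts :: "('x, 'n) chart list \<Rightarrow> ('x list \<Rightarrow> real) \<Rightarrow> (real ^ 'n) list \<Rightarrow> real" where
  "in_charts cs f as = f (map2 chart_inv cs as)"

definition list_differentiable ::
    "('x, 'n::finite) riemannian \<Rightarrow> ('x list \<Rightarrow> real) \<Rightarrow> 'x list \<Rightarrow> bool" where
  "list_differentiable M f ys \<longleftrightarrow>
     (\<exists>L. list_has_deriv (in_charts (map (chart_at M) ys) f) L (map (\<lambda>y. snd (chart_at M y) y) ys))"

definition list_test_functions ::
    "('x::{t2_space,second_countable_topology}, 'n::finite) riemannian \<Rightarrow> ('x list \<Rightarrow> real) set" where
  "list_test_functions M = {f.
     (\<forall>cs. set cs \<subseteq> atlas M \<longrightarrow>
        list_smooth_on (length cs) {as. list_all2 (\<lambda>c a. a \<in> snd c ` fst c) cs as} (in_charts cs f)) \<and>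
     compactin list_topology (list_topology closure_of {ys. f ys \<noteq> 0})}"

text \<open>
  Derivative of \<open>f\<close> along the vector field on tuples with components \<open>v (ys ! i)\<close>.
\<close>
definition hat_deriv ::
    "('x, 'n::finite) riemannian \<Rightarrow> ('x \<Rightarrow> real ^ 'n) \<Rightarrow> ('x list \<Rightarrow> real) \<Rightarrow> 'x list \<Rightarrow> real" where
  "hat_deriv M v f ys = (\<Sum>i<length ys. differential M (\<lambda>y. f (ys[i := y])) (ys ! i) (v (ys ! i)))"


section \<open>Configurations\<close>

text \<open>
  Configurations are measures; \<open>point_sum T I s\<close> is the sum over \<open>i \<in> I\<close> of the Dirac measures at
  \<open>s i\<close>, and \<open>superpose T I \<omega>\<close> is the sum of the measures \<open>\<omega> i\<close>.
\<close>
definition point_sum :: "'s topology \<Rightarrow> 'i set \<Rightarrow> ('i \<Rightarrow> 's) \<Rightarrow> 's measure" where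
  "point_sum T I s = distr (count_space I) (borel_of T) s"

definition superpose :: "'s topology \<Rightarrow> 'i set \<Rightarrow> ('i \<Rightarrow> 's measure) \<Rightarrow> 's measure" where
  "superpose T I \<omega> = measure_of (topspace T) (sets (borel_of T))
     (\<lambda>B. \<integral>\<^sup>+i. emeasure (\<omega> i) B \<partial>count_space I)"

definition configurations :: "'s topology \<Rightarrow> 's measure set" where
  "configurations T = {point_sum T I s | (I :: nat set) s. s ` I \<subseteq> topspace T}"

definition proper_configurations :: "'s topology \<Rightarrow> 's measure set" where
  "proper_configurations T = {\<gamma> \<in> configurations T.
     (\<forall>K. compactin T K \<longrightarrow> emeasure \<gamma> K < \<infinity>) \<and> (\<forall>x\<in>topspace T. emeasure \<gamma> {x} \<le> 1)}"

definition count_algebra :: "'s topology \<Rightarrow> 's measure set \<Rightarrow> 's measure measure" where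
  "count_algebra T \<Omega> = (SUP B\<in>sets (borel_of T). vimage_algebra \<Omega> (\<lambda>\<gamma>. emeasure \<gamma> B) borel)"

abbreviation Gamma_all :: "'s topology \<Rightarrow> 's measure measure" where
  "Gamma_all T \<equiv> count_algebra T (configurations T)"

abbreviation Gamma :: "'s topology \<Rightarrow> 's measure measure" where
  "Gamma T \<equiv> count_algebra T (proper_configurations T)"

abbreviation Gamma_X :: "'x::topological_space measure measure" where
  "Gamma_X \<equiv> Gamma euclidean"

text \<open>\<open>x \<in> points \<gamma>\<close> is what is usually written \<open>x \<in> \<gamma>\<close>.\<close>
definition points :: "'s measure \<Rightarrow> 's set" where
  "points \<gamma> = {x \<in> space \<gamma>. emeasure \<gamma> {x} \<noteq> 0}"

definition pairing :: "('s \<Rightarrow> real) \<Rightarrow> 's measure \<Rightarrow> real" where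
  "pairing f \<gamma> = (\<Sum>\<^sub>\<infinity>s\<in>points \<gamma>. f s)"

text \<open>
  The class of probability measures with intensity controlled by \<open>\<theta>\<close>. Since \<open>infsum\<close> is 0 for
  divergent sums, almost sure convergence is required explicitly; the last clause says that
  the pairing does not depend on the representative of the class of \<open>f\<close> modulo \<open>\<theta>\<close>.
\<close>
definition M1 :: "'x::topological_space measure \<Rightarrow> 'x measure measure set" where
  "M1 \<theta> = {\<mu>. prob_space \<mu> \<and> sets \<mu> = sets Gamma_X \<and>
     (\<forall>f::'x \<Rightarrow> real. integrable \<theta> f \<longrightarrow>
        (AE \<gamma> in \<mu>. f summable_on points \<gamma>) \<and> integrable \<mu> (\<lambda>\<gamma>. \<bar>pairing f \<gamma>\<bar>) \<and>
        (\<forall>g. integrable \<theta> g \<and> (AE x in \<theta>. f x = g x) \<longrightarrow> (AE \<gamma> in \<mu>. pairing f \<gamma> = pairing g \<gamma>)))}"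


section \<open>Cylinder functions and vector fields on the configuration space\<close>

definition FC :: "('x::{t2_space,second_countable_topology}, 'n::finite) riemannian
    \<Rightarrow> ('x measure \<Rightarrow> real) set" where
  "FC M = {F. \<exists>f \<phi>s. Cb_smooth (length \<phi>s) f \<and> set \<phi>s \<subseteq> test_functions M \<and>
     (\<forall>\<gamma>\<in>space Gamma_X. F \<gamma> = f (map (\<lambda>\<phi>. pairing \<phi> \<gamma>) \<phi>s))}"

definition move_point :: "'x::topological_space measure \<Rightarrow> 'x \<Rightarrow> 'x \<Rightarrow> 'x measure" where
  "move_point \<gamma> x y = point_sum euclidean ((points \<gamma> - {x}) \<union> {y}) (\<lambda>s. s)"

definition config_grad :: "('x::{t2_space,second_countable_topology}, 'n::finite) riemannian
    \<Rightarrow> 'x \<Rightarrow> ('x measure \<Rightarrow> real) \<Rightarrow> 'x measure \<Rightarrow> real ^ 'n" where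
  "config_grad M x F \<gamma> = grad M (\<lambda>y. F (move_point \<gamma> x y)) x"

text \<open>The sum over \<open>x \<in> \<gamma>\<close> of the inner products of \<open>config_grad M x F \<gamma>\<close> with \<open>w x\<close>.\<close>
definition config_deriv :: "('x::{t2_space,second_countable_topology}, 'n::finite) riemannian
    \<Rightarrow> ('x measure \<Rightarrow> real) \<Rightarrow> ('x \<Rightarrow> real ^ 'n) \<Rightarrow> 'x measure \<Rightarrow> real" where
  "config_deriv M F w \<gamma> = (\<Sum>\<^sub>\<infinity>x\<in>points \<gamma>. metric M x (config_grad M x F \<gamma>) (w x))"

text \<open>
  \<open>FV_rep M k G v V\<close>: \<open>V\<close> is the cylinder vector field given by the representation
  \<open>(\<Sum>j<k. G j v j)\<close>. The representation is kept explicit, since the logarithmic derivative along \<open>V\<close>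
  is defined through it.
\<close>
definition FV_rep :: "('x::{t2_space,second_countable_topology}, 'n::finite) riemannian \<Rightarrow> nat
    \<Rightarrow> (nat \<Rightarrow> 'x measure \<Rightarrow> real) \<Rightarrow> (nat \<Rightarrow> 'x \<Rightarrow> real ^ 'n)
    \<Rightarrow> ('x measure \<Rightarrow> 'x \<Rightarrow> real ^ 'n) \<Rightarrow> bool" where
  "FV_rep M k G v V \<longleftrightarrow> (\<forall>j<k. G j \<in> FC M \<and> v j \<in> Vect0 M) \<and>
     (\<forall>\<gamma>\<in>space Gamma_X. \<forall>x\<in>points \<gamma>. V \<gamma> x = (\<Sum>j<k. G j \<gamma> *\<^sub>R v j x))"


section \<open>Cluster measures\<close>

definition cluster_family :: "('x::topological_space \<Rightarrow> 'x list measure) \<Rightarrow> bool" where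
  "cluster_family \<eta> \<longleftrightarrow> (\<forall>x. prob_space (\<eta> x) \<and> sets (\<eta> x) = sets list_borel) \<and>
     (\<forall>B\<in>sets list_borel. (\<lambda>x. emeasure (\<eta> x) B) \<in> borel_measurable borel)"

definition proj_p :: "'x::topological_space list \<Rightarrow> 'x measure" where
  "proj_p ys = point_sum euclidean {..<length ys} (\<lambda>i. ys ! i)"

text \<open>
  The law of the sum of independent configurations with laws \<open>\<eta> x \<circ> p\<^sup>-\<^sup>1\<close> is formed on the space
  of all configurations and then restricted to the proper ones, which carry it.
\<close>
definition cluster_measure ::
    "'x::topological_space measure measure \<Rightarrow> ('x \<Rightarrow> 'x list measure) \<Rightarrow> 'x measure measure" where
  "cluster_measure \<mu> \<eta> = restrict_space
     (\<mu> \<bind> (\<lambda>\<gamma>. distr (PiM (points \<gamma>) (\<lambda>x. distr (\<eta> x) (Gamma_all euclidean) proj_p))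
        (Gamma_all euclidean) (superpose euclidean (points \<gamma>))))
     (space Gamma_X)"

definition hat_measure ::
    "'x::topological_space measure measure \<Rightarrow> ('x \<Rightarrow> 'x list measure) \<Rightarrow> ('x \<times> 'x list) measure measure" where
  "hat_measure \<mu> \<eta> = \<mu> \<bind> (\<lambda>\<gamma>. distr (PiM (points \<gamma>) \<eta>) (Gamma Z_topology)
     (\<lambda>\<omega>. point_sum Z_topology (points \<gamma>) (\<lambda>x. (x, \<omega> x))))"

definition proj_q :: "('x::topological_space \<times> 'x list) measure \<Rightarrow> 'x measure" where
  "proj_q \<xi> = superpose euclidean (points \<xi>) (\<lambda>(x, ys). proj_p ys)"

text \<open>
  The adjoint of the composition with \<open>proj_q\<close>. Almost every \<open>\<xi>\<close> has a proper projection; the exceptional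
  null set is left out of the integral because \<open>F\<close> is only a function on proper configurations.
\<close>
definition I_star :: "'x::topological_space measure measure \<Rightarrow> ('x \<Rightarrow> 'x list measure)
    \<Rightarrow> (('x \<times> 'x list) measure \<Rightarrow> real) \<Rightarrow> 'x measure \<Rightarrow> real" where
  "I_star \<mu> \<eta> G = (SOME H. integrable (cluster_measure \<mu> \<eta>) H \<and>
     (\<forall>F\<in>borel_measurable (cluster_measure \<mu> \<eta>). (\<exists>C. AE \<gamma> in cluster_measure \<mu> \<eta>. \<bar>F \<gamma>\<bar> \<le> C) \<longrightarrow>
        (\<integral>\<gamma>. F \<gamma> * H \<gamma> \<partial>cluster_measure \<mu> \<eta>) =
        (LINT \<xi>:{\<xi> \<in> space (hat_measure \<mu> \<eta>). proj_q \<xi> \<in> space Gamma_X}|hat_measure \<mu> \<eta>.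
           F (proj_q \<xi>) * G \<xi>)))"

definition sigma_hat ::
    "('x::topological_space \<Rightarrow> 'x list measure) \<Rightarrow> 'x measure \<Rightarrow> ('x \<times> 'x list) measure" where
  "sigma_hat \<eta> \<theta> = measure_of UNIV (sets (borel_of Z_topology))
     (\<lambda>C. \<integral>\<^sup>+x. emeasure (\<eta> x) {ys. (x, ys) \<in> C} \<partial>\<theta>)"


section \<open>Logarithmic derivatives\<close>

text \<open>
  Here \<open>h x\<close> is the density of \<open>\<eta> x\<close>. For the componentwise Riemannian structure, the
  \<open>i\<close>-th component of the gradient of \<open>h x\<close> is its gradient in the \<open>i\<close>-th variable.
\<close>
definition beta :: "('x, 'n::finite) riemannian \<Rightarrow> ('x \<Rightarrow> 'x list \<Rightarrow> real)
    \<Rightarrow> 'x \<Rightarrow> 'x list \<Rightarrow> nat \<Rightarrow> real ^ 'n" where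
  "beta M h x ys i = grad M (\<lambda>y. h x (ys[i := y])) (ys ! i) /\<^sub>R h x ys"

definition beta_norm1 :: "('x, 'n::finite) riemannian \<Rightarrow> ('x \<Rightarrow> 'x list \<Rightarrow> real)
    \<Rightarrow> 'x \<Rightarrow> 'x list \<Rightarrow> real" where
  "beta_norm1 M h x ys = (\<Sum>i<length ys. tangent_norm M (ys ! i) (beta M h x ys i))"

definition beta_along :: "('x, 'n::finite) riemannian \<Rightarrow> ('x \<Rightarrow> 'x list \<Rightarrow> real)
    \<Rightarrow> ('x \<Rightarrow> real ^ 'n) \<Rightarrow> 'x \<Rightarrow> 'x list \<Rightarrow> real" where
  "beta_along M h v x ys = (\<Sum>i<length ys. metric M (ys ! i) (beta M h x ys i) (v (ys ! i)))
     + (\<Sum>i<length ys. divergence M v (ys ! i))"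

definition B_hat :: "('x, 'n::finite) riemannian \<Rightarrow> ('x \<Rightarrow> 'x list \<Rightarrow> real)
    \<Rightarrow> ('x \<Rightarrow> real ^ 'n) \<Rightarrow> ('x \<times> 'x list) measure \<Rightarrow> real" where
  "B_hat M h v \<xi> = (\<Sum>\<^sub>\<infinity>(x, ys)\<in>points \<xi>. beta_along M h v x ys)"

definition B_cl :: "('x::topological_space, 'n::finite) riemannian \<Rightarrow> 'x measure measure
    \<Rightarrow> ('x \<Rightarrow> 'x list measure) \<Rightarrow> ('x \<Rightarrow> 'x list \<Rightarrow> real) \<Rightarrow> ('x \<Rightarrow> real ^ 'n)
    \<Rightarrow> 'x measure \<Rightarrow> real" where
  "B_cl M \<mu> \<eta> h v = I_star \<mu> \<eta> (B_hat M h v)"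

definition B_cl_field :: "('x::{t2_space,second_countable_topology}, 'n::finite) riemannian
    \<Rightarrow> 'x measure measure \<Rightarrow> ('x \<Rightarrow> 'x list measure) \<Rightarrow> ('x \<Rightarrow> 'x list \<Rightarrow> real)
    \<Rightarrow> nat \<Rightarrow> (nat \<Rightarrow> 'x measure \<Rightarrow> real) \<Rightarrow> (nat \<Rightarrow> 'x \<Rightarrow> real ^ 'n) \<Rightarrow> 'x measure \<Rightarrow> real" where
  "B_cl_field M \<mu> \<eta> h k G v \<gamma> =
     (\<Sum>j<k. G j \<gamma> * B_cl M \<mu> \<eta> h (v j) \<gamma> + config_deriv M (G j) (v j) \<gamma>)"

end

theory Submission
 imports Defs
begin

text \<open>
 Freeze all clusters but one. As a function of the remaining cluster, a cylinder function composed
 with the projection to configurations is smooth, but not compactly supported; multiplied by a cut-off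
 it is a test function, so (A3) gives integration by parts in one cluster, and the cut-off is removed
 by dominated convergence with (A4). Only clusters that meet the support of the field contribute. Their
 expected total contribution is bounded by integrals against the intensity measure, via (A1), (A2) and
 (A4), so that the identities for the single clusters can be summed by Fubini over the product of the
 cluster laws and over the law of the centres. The result is pushed forward to the cluster measure,
 where the conditional expectation turns the sum of logarithmic derivatives into the field
 \<open>B_cl_field\<close>. A field \<open>\<Sum>j. G j * v j\<close> is reduced to the single fields \<open>v j\<close> by applying
 the product rule to the cylinder functions \<open>F1 * F2 * G j\<close>.
\<close>

text \<open>The product over the points of a configuration has an index set that varies with the
  configuration, so it offers no common space for Fubini. The points are therefore enumerated
  measurably by naturals (\<open>pt\<close>, \<open>val\<close>), an independent cluster is attached
  to every natural (\<open>Q\<close>; indices outside \<open>val\<close> carry a dummy that is never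
  summed), and the joint law \<open>P\<close> of centres and clusters becomes the working space:
  \<open>hat_measure\<close> is an image of \<open>P\<close>, and so is
  \<open>cluster_measure\<close> after a change on a null set. Freezing all clusters but one then
  means resampling one coordinate. Three facts that informal notation hides take up much of the
  proof. Joint measurability of \<open>h\<close> is recovered from that of the family of laws, by
  averaging over shrinking boxes. The projected configuration has no multiple points because the
  volume has no atoms, so that diagonals are null. Divergence and volume are defined through charts,
  so their chart independence must precede every statement on continuity or integrals.\<close>

abbreviation (input) "NI \<equiv> nn_integral"
abbreviation (input) "LI \<equiv> lebesgue_integral"
abbreviation (input) "bm \<equiv> borel_measurable"
abbreviation (input) "em \<equiv> emeasure"
abbreviation (input) "Ind \<equiv> indicator"
abbreviation (input) "LB \<equiv> list_borel"
abbreviation (input) "cinv \<equiv> chart_inv"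
abbreviation (input) "Cnt \<equiv> count_space"
abbreviation (input) "fder f x \<equiv> frechet_derivative f (at x)"
abbreviation (input) "lbox_on n S \<equiv> {as. length as = n & (ALL i<n. as!i : S i)}"
abbreviation (input) "Dv M f v \<equiv> (%y. differential M f y (v y))"
abbreviation (input) "hitlen B ys \<equiv> Ind (hits B) ys * real (length ys)"
lemmas integral_congB = Bochner_Integration.integral_cong
lemmas integrable_sumB = Bochner_Integration.integrable_sum
lemmas integral_sumB = Bochner_Integration.integral_sum
lemmas integrable_boundB = Bochner_Integration.integrable_bound
lemmas meas_comp = measurable_compose and meas_cong = measurable_cong_sets
notation (input) measurable (infixr "->M" 60)
notation (input) pair_measure (infixr "XM" 80)
notation (input) scaleR (infixr "*R" 75)

section \<open>Smooth functions\<close>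

lemma fder_cong:
 assumes "eventually (%y. f y = g y) (nhds x)"
 shows "fder f x = fder g x"
proof -
 have "f x = g x" using assms by (rule eventually_nhds_x_imp_x)
 moreover have "eventually (%y. f y = g y) (at x)" using assms by (simp add: eventually_at_filter eventually_mono)
 ultimately have "(f has_derivative D) (at x) \<longleftrightarrow> (g has_derivative D) (at x)" for D
  using has_derivative_transform_eventually[of f D x UNIV g] has_derivative_transform_eventually[of g D x UNIV f]
  by (auto simp: eq_commute)
 thus ?thesis by (simp add: frechet_derivative_def)
qed

lemma eventually_nhds_open_eq:
 assumes "open S" "x:S" "!!y. y:S ==> f y = g y"
 shows "eventually (%y. f y = g y) (nhds x)"
 using assms eventually_nhds by blast

lemma differentiable_cong_open:
 assumes "open S" "x:S" "!!y. y:S ==> f y = g y" "f differentiable at x"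
 shows "g differentiable at x"
 using assms has_derivative_transform_within_open unfolding differentiable_def by blast

lemma frechetI:
 "f differentiable at x ==> (f has_derivative fder f x) (at x)"
 by (simp add: frechet_derivative_works)

lemma frechet_eqI: "(f has_derivative D) (at x) ==> fder f x = D"
 using frechet_derivative_at by metis

lemma iter_deriv_append: "iter_deriv f (us @ vs) = iter_deriv (iter_deriv f vs) us"
 by (induction us) auto

lemma iter_deriv_cong_open:
 assumes "open S" "!!y. y:S ==> f y = g y" "x:S"
 shows "iter_deriv f us x = iter_deriv g us x"
 using assms(3)
proof (induction us arbitrary: x)
 case (Cons u us)
 have "fder (iter_deriv f us) x = fder (iter_deriv g us) x"
  by (rule fder_cong, rule eventually_nhds_open_eq[OF assms(1)]) (use Cons in auto)
 thus ?case by simp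
qed (use assms in auto)

lemma smooth_diff: "smooth_on S f ==> x:S ==> f differentiable at x"
 unfolding smooth_on_def by (metis iter_deriv.simps(1))

lemma smooth_iter_diff: "smooth_on S f ==> x:S ==> iter_deriv f us differentiable at x"
 unfolding smooth_on_def by blast

lemma smooth_on_iter_deriv: "smooth_on S f ==> smooth_on S (iter_deriv f vs)"
 unfolding smooth_on_def by (metis iter_deriv_append)

lemma smooth_on_cong:
 assumes "open S" "!!y. y:S ==> f y = g y" "smooth_on S f"
 shows "smooth_on S g"
 unfolding smooth_on_def
proof safe
 fix us x assume "x:S"
 show "iter_deriv g us differentiable at x"
  by (rule differentiable_cong_open[OF assms(1) \<open>x : S\<close> iter_deriv_cong_open[OF assms(1,2)]
     smooth_iter_diff[OF assms(3) \<open>x : S\<close>]])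
qed

lemma smooth_on_local:
 assumes "!!x. x:S ==> EX T. x:T & smooth_on T f"
 shows "smooth_on S f"
 using assms unfolding smooth_on_def by blast

lemma smooth_cont: "smooth_on S f ==> continuous_on S f"
 using smooth_diff differentiable_imp_continuous_within
 by (metis continuous_at_imp_continuous_on)

text \<open>The Leibniz rule keeps derivatives of sums and products inside such an algebra, so
  smoothness of all members can be read off from the derivatives of the generators alone.\<close>

inductive_set falg :: "('a => real) set => ('a => real) set" for \<G> where
 base: "g:\<G> ==> g:falg \<G>"
| const: "(%x. c):falg \<G>"
| add: "f:falg \<G> ==> g:falg \<G> ==> (%x. f x+g x):falg \<G>"
| mult: "f:falg \<G> ==> g:falg \<G> ==> (%x. f x*g x):falg \<G>"

lemma falg_sum: "(!!i. i:I ==> f i:falg \<G>) ==> (%x. \<Sum>i\<in>I. f i x):falg \<G>"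
proof (induction I rule: infinite_finite_induct)
 case (insert i I) thus ?case using falg.add[of "f i" \<G> "%x. \<Sum>i\<in>I. f i x"] by auto
qed (auto intro: falg.const)

text \<open>
  A set of functions that is closed, up to equality on \<open>S\<close>, under directional derivatives consists
  of smooth functions. All smoothness statements below come from exhibiting such sets.
\<close>
lemma smooth_on_class:
 assumes S: "open S"
  and d: "!!f x. f:\<A> ==> x:S ==> f differentiable at x"
  and c: "!!f u. f:\<A> ==> EX g:\<A>. ALL x:S. fder f x u = g x"
  and f: "f:\<A>"
 shows "smooth_on S f"
proof -
 have *: "EX g:\<A>. ALL x:S. iter_deriv f us x = g x" for us
 proof (induction us)
  case (Cons u us)
  then obtain g where g: "g:\<A>" "ALL x:S. iter_deriv f us x = g x" by blast
  obtain g' where g': "g':\<A>" "ALL x:S. fder g x u = g' x" using c[OF g(1)] by blast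
  have "iter_deriv f (u # us) x = g' x" if "x:S" for x
  proof -
   have "fder (iter_deriv f us) x = fder g x"
    by (rule fder_cong, rule eventually_nhds_open_eq[OF S that]) (use g in auto)
   thus ?thesis using g' that by simp
  qed
  thus ?case using g' by blast
 qed (use f in auto)
 show ?thesis unfolding smooth_on_def
 proof safe
  fix us x assume x: "x:S"
  obtain g where "g:\<A>" "ALL x:S. iter_deriv f us x = g x" using * by blast
  thus "iter_deriv f us differentiable at x"
   using differentiable_cong_open[OF S x, of g "iter_deriv f us"] d x by auto
 qed
qed

text \<open>The derivative of a generator may be any polynomial in the generators; the product rule
  then closes the whole algebra under derivatives. This takes the place of explicit formulas for
  higher derivatives.\<close>

lemma smooth_on_falg:
 assumes S: "open S"
  and d: "!!f x. f:\<G> ==> x:S ==> f differentiable at x"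
  and c: "!!f u. f:\<G> ==> EX g:falg \<G>. ALL x:S. fder f x u = g x"
  and f: "f:falg \<G>"
 shows "smooth_on S f"
proof (rule smooth_on_class[OF S _ _ f])
 have dd: "f differentiable at x" if "f:falg \<G>" "x:S" for f x
  using that by induction (auto intro: d)
 thus "f differentiable at x" if "f:falg \<G>" "x:S" for f x using that .
 show "EX g:falg \<G>. ALL x:S. fder f x u = g x" if "f:falg \<G>" for f u
  using that
 proof induction
  case (base g) thus ?case by (rule c)
 next
  case (const c) show ?case by (rule bexI[OF _ falg.const[of 0]]) simp
 next
  case (add f g)
  then obtain f' g' where "f':falg \<G>" "ALL x:S. fder f x u = f' x"
   "g':falg \<G>" "ALL x:S. fder g x u = g' x" by blast
  moreover have "fder (%x. f x+g x) x u = f' x+g' x" if "x:S" for x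
  proof -
   have "((%x. f x+g x) has_derivative (%u. fder f x u+fder g x u)) (at x)"
    using dd add that by (intro has_derivative_add frechetI) auto
   thus ?thesis using calculation that by (simp add: frechet_eqI)
  qed
  ultimately show ?case by (intro bexI[OF _ falg.add[of f' _ g']]) auto
 next
  case (mult f g)
  then obtain f' g' where fg: "f':falg \<G>" "ALL x:S. fder f x u = f' x"
   "g':falg \<G>" "ALL x:S. fder g x u = g' x" by blast
  have "fder (%x. f x*g x) x u = f x*g' x+f' x*g x" if "x:S" for x
  proof -
   have "((%x. f x*g x) has_derivative (%u. f x*fder g x u+fder f x u*g x)) (at x)"
    using dd mult that by (intro has_derivative_mult frechetI) auto
   thus ?thesis using fg that by (simp add: frechet_eqI)
  qed
  thus ?case using fg mult by (intro bexI[OF _ falg.add[OF falg.mult[of f _ g'] falg.mult[of f' _ g]]]) auto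
 qed
qed

lemma smooth_on_frechet: "smooth_on S f ==> smooth_on S (%x. fder f x u)"
 using smooth_on_iter_deriv[of S f "[u]"] by simp

lemma smooth_on_const: "smooth_on S (%x. c)"
proof -
 have "EX d. iter_deriv (%x::'a. c) us = (%x. d)" for us
  by (induction us) auto
 thus ?thesis unfolding smooth_on_def by (metis differentiable_const)
qed

lemma smooth_on_falg_smooth:
 assumes "open S" "f:falg {g. smooth_on S g}"
 shows "smooth_on S f"
proof (rule smooth_on_falg[OF assms(1) _ _ assms(2)])
 show "EX h:falg {g. smooth_on S g}. ALL x:S. fder g x u = h x" if "g:{g. smooth_on S g}" for g u
  using that by (intro bexI[of _ "%x. fder g x u"] falg.base) (simp_all add: smooth_on_frechet)
qed (simp add: smooth_diff)

lemma smooth_on_add: "open S ==> smooth_on S f ==> smooth_on S g ==> smooth_on S (%x. f x+g x)" for f g :: "'a::real_normed_vector => real"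
 by (rule smooth_on_falg_smooth) (auto intro: falg.intros)

lemma smooth_on_mult: "open S ==> smooth_on S f ==> smooth_on S g ==> smooth_on S (%x. f x*g x)" for f g :: "'a::real_normed_vector => real"
 by (rule smooth_on_falg_smooth) (auto intro: falg.intros)

lemma smooth_on_diff: "open S ==> smooth_on S f ==> smooth_on S g ==> smooth_on S (%x. f x-g x)" for f g :: "'a::real_normed_vector => real"
 using smooth_on_add[OF _ _ smooth_on_mult[OF _ smooth_on_const[of S "-1"], of g], of f] by simp

lemma smooth_on_sum: "open S ==> (!!i. i:I ==> smooth_on S (f i)) ==> smooth_on S (%x. \<Sum>i\<in>I. f i x :: real)"
 by (erule smooth_on_falg_smooth) (intro falg_sum falg.base, simp)

lemma smooth_on_prod: "open S ==> (!!i. i:I ==> smooth_on S (f i)) ==> smooth_on S (%x. \<Prod>i\<in>I. f i x :: real)"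
 by (induction I rule: infinite_finite_induct) (auto intro: smooth_on_const smooth_on_mult)

lemma smooth_on_inner_const:
 fixes f :: "'a::real_normed_vector => 'b::euclidean_space"
 assumes S: "open S" and f: "smooth_on S f"
 shows "smooth_on S (%x. f x \<bullet> e)"
proof -
 let ?A = "{%x. iter_deriv f us x \<bullet> e | us. True}"
 have D: "((%x. iter_deriv f us x \<bullet> e) has_derivative (%u. fder (iter_deriv f us) x u \<bullet> e)) (at x)" if "x:S" for us x
  by (rule has_derivative_inner_left, rule frechetI, rule smooth_iter_diff[OF f that])
 show ?thesis
 proof (rule smooth_on_class[OF S, of ?A])
  fix h assume "h:?A"
  then obtain us where h: "h = (%x. iter_deriv f us x \<bullet> e)" by blast
  show "h differentiable at x" if "x:S" for x
   using D[OF that] differentiable_def unfolding h by blast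
  show "EX g:?A. ALL x:S. fder h x u = g x" for u
  proof (rule bexI[of _ "%x. iter_deriv f (u # us) x \<bullet> e"])
   show "ALL x:S. fder h x u = iter_deriv f (u # us) x \<bullet> e"
    unfolding h by (simp add: frechet_eqI[OF D])
  qed blast
 next
  show "(%x. f x \<bullet> e):?A" by (rule CollectI, rule exI[of _ "[]"]) simp
 qed
qed

text \<open>The chain rule writes a derivative of \<open>iter_deriv g us (f x)\<close> as a sum over
  the basis of a smooth coefficient times a longer iterated derivative of \<open>g\<close> at
  \<open>f x\<close>. Generators of both kinds together are therefore closed in the sense of
  \<open>smooth_on_falg\<close>.\<close>

lemma smooth_on_compose:
 fixes f :: "'a::real_normed_vector => 'b::euclidean_space" and g :: "'b => real"
 assumes S: "open S" and f: "smooth_on S f" and g: "smooth_on T g" and fS: "!!x. x:S ==> f x:T"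
 shows "smooth_on S (%x. g (f x))"
proof -
 let ?G = "{%x. iter_deriv g us (f x) | us. True} Un {h. smooth_on S h}"
 have D: "((%x. iter_deriv g us (f x)) has_derivative
   (%u. fder (iter_deriv g us) (f x) (fder f x u))) (at x)" if "x:S" for us x
  by (rule has_derivative_compose[OF frechetI[OF smooth_diff[OF f that]]
     frechetI[OF smooth_iter_diff[OF g fS[OF that]]]])
 show ?thesis
 proof (rule smooth_on_falg[OF S, of ?G])
  show "h differentiable at x" if hG: "h:?G" and xS: "x:S" for h x
  proof (cases "smooth_on S h")
   case True thus ?thesis using smooth_diff xS by blast
  next
   case False
   then obtain us where h: "h = (%x. iter_deriv g us (f x))" using hG by auto
   show ?thesis unfolding h differentiable_def using D[OF xS] by blast
  qed
  show "EX g:falg ?G. ALL x:S. fder h x u = g x" if hG: "h:?G" for h u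
  proof (cases "smooth_on S h")
   case True
   show ?thesis
    by (rule bexI[of _ "%x. fder h x u"], simp, rule falg.base) (simp add: smooth_on_frechet[OF True])
  next
   case False
   then obtain us where h: "h = (%x. iter_deriv g us (f x))" using hG by auto
   have "fder h x u =
     (\<Sum>e\<in>Basis. (fder f x u \<bullet> e)*iter_deriv g (e # us) (f x))" if x: "x:S" for x
   proof -
    have lin: "linear (fder (iter_deriv g us) (f x))"
     using frechetI[OF smooth_iter_diff[OF g fS[OF x]]] has_derivative_linear by blast
    have "fder h x u = fder (iter_deriv g us) (f x) (fder f x u)"
     unfolding h frechet_eqI[OF D[OF x]] ..
    also have "... = fder (iter_deriv g us) (f x) (\<Sum>e\<in>Basis. (fder f x u \<bullet> e) *R e)"
     by (simp add: euclidean_representation)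
    finally show ?thesis by (simp add: linear_sum[OF lin] linear_cmul[OF lin])
   qed
   moreover have "(%x. \<Sum>e\<in>Basis. (fder f x u \<bullet> e)*iter_deriv g (e # us) (f x)):falg ?G"
   proof (rule falg_sum, rule falg.mult)
    fix e :: 'b
    show "(%x. fder f x u \<bullet> e):falg ?G"
     by (rule falg.base, rule UnI2) (simp add: smooth_on_inner_const[OF S] smooth_on_frechet f)
    show "(%x. iter_deriv g (e # us) (f x)):falg ?G"
     by (rule falg.base, rule UnI1, blast)
   qed
   ultimately show ?thesis by (intro bexI[of _ "%x. \<Sum>e\<in>Basis. (fder f x u \<bullet> e)*iter_deriv g (e # us) (f x)"] ballI)
  qed
  have "(%x. iter_deriv g [] (f x)):?G" by (rule UnI1) blast
  hence "(%x. iter_deriv g [] (f x)):falg ?G" by (rule falg.base)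
  thus "(%x. g (f x)):falg ?G" unfolding iter_deriv.simps .
 qed
qed

lemma smooth_on_inverse: "smooth_on (- {0}) (inverse :: real => real)"
proof (rule smooth_on_falg[of _ "{inverse}"])
 show "EX g:falg {inverse}. ALL x:- {0}. fder f x u = g x" if "f:{inverse}" for f :: "real => real" and u
 \<comment> \<open>The derivative -u/x^2, written as a polynomial in the only generator.\<close>
 proof (rule bexI[of _ "%x. (inverse x*u)*(inverse x*-1)"])
  show "ALL x:- {0}. fder f x u = inverse x*u*(inverse x*- 1)"
   using that by (auto simp: frechet_eqI[OF has_derivative_inverse'])
 qed (intro falg.mult falg.const falg.base, auto)
qed (auto intro: falg.base)

lemma smooth_on_inner: "smooth_on UNIV (%p::'a::euclidean_space. p \<bullet> e)"
proof (rule smooth_on_falg[of _ "{%p. p \<bullet> e}"])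
 show "EX g:falg {%p. p \<bullet> e}. ALL x:UNIV. fder f x u = g x" if "f:{%p. p \<bullet> e}" for f :: "'a => real" and u
  using that by (intro bexI[OF _ falg.const[of "u \<bullet> e"]]) (auto intro!: fun_cong[OF frechet_eqI] derivative_eq_intros)
qed (auto intro: falg.base)

section \<open>A smooth bump function built from the flat function exp(-1/t)\<close>

definition exp_cut :: "real => real" where
 "exp_cut t = (if t > 0 then exp (- (1/t)) else 0)"

lemma poly_exp_tendsto_0: "((%s::real. poly p s*exp (- s)) \<longlongrightarrow> 0) at_top"
proof -
 have "((%s. \<Sum>i\<le>degree p. coeff p i*(s ^ i/exp s)) \<longlongrightarrow> (\<Sum>i\<le>degree p. coeff p i*0)) at_top"
  by (intro tendsto_intros tendsto_power_div_exp_0)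
 thus ?thesis by (simp add: poly_altdef exp_minus sum_distrib_right divide_inverse mult.assoc)
qed

text \<open>In the variable s = 1/t the derivative is -s^2 d/ds, which maps p(s) exp(-s) to s^2 (p -
  p')(s) exp(-s); hence the factor \<open>[:0, 0, 1:]\<close>. At 0 both one-sided difference
  quotients tend to 0, so the family is closed under differentiation on the whole line.\<close>

lemma exp_cut_poly_deriv:
 "((%t. if t > 0 then poly p (1/t)*exp (- (1/t)) else 0) has_real_derivative
   (if t > 0 then poly ([:0, 0, 1:]*(p-pderiv p)) (1/t)*exp (- (1/t)) else 0)) (at t)"
proof -
 let ?F = "%t. if t > 0 then poly p (1/t)*exp (- (1/t)) else (0::real)"
 consider "t > 0" | "t < 0" | "t = 0" by linarith
 thus ?thesis
 proof cases
  case 1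
  have "((%t. poly p (1/t)*exp (- (1/t))) has_real_derivative
    poly ([:0, 0, 1:]*(p-pderiv p)) (1/t)*exp (- (1/t))) (at t)"
   using 1 by (auto intro!: derivative_eq_intros poly_DERIV[THEN DERIV_chain2] simp: field_simps power2_eq_square)
  from has_field_derivative_transform_within_open[OF this, of "{0<..}" ?F] 1
  show ?thesis by simp
 next
  case 2
  have "((%t. 0) has_real_derivative 0) (at t)" by simp
  from has_field_derivative_transform_within_open[OF this, of "{..<0}" ?F] 2
  show ?thesis by simp
 next
  case 3
  \<comment> \<open>With s = 1/t the right-hand difference quotient at 0 is s p(s) exp(-s), hence
    \<open>pCons 0 p\<close>.\<close>
  have "((%s. poly (pCons 0 p) s*exp (- s)) \<longlongrightarrow> 0) at_top" by (rule poly_exp_tendsto_0)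
  hence "((%t. poly (pCons 0 p) (inverse t)*exp (- inverse t)) \<longlongrightarrow> 0) (at_right 0)"
   by (rule filterlim_compose[OF _ filterlim_inverse_at_top_right])
  hence "((%h. (?F (0+h)-?F 0)/h) \<longlongrightarrow> 0) (at_right 0)"
   by (rule Lim_transform_eventually) (auto simp: eventually_at_right_field inverse_eq_divide intro!: exI[of _ 1])
  moreover have "((%h. (?F (0+h)-?F 0)/h) \<longlongrightarrow> 0) (at_left 0)"
   by (rule Lim_transform_eventually[OF tendsto_const]) (auto simp: eventually_at_left_field intro!: exI[of _ "-1"])
  ultimately show ?thesis using 3 by (auto simp: DERIV_def filterlim_split_at)
 qed
qed

lemma smooth_on_exp_cut: "smooth_on UNIV exp_cut"
proof -
 \<comment> \<open>The scalar \<open>c\<close> absorbs the direction \<open>u\<close> of each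
   derivative.\<close>
 let ?A = "{%t. c*(if t > 0 then poly p (1/t)*exp (- (1/t)) else 0) | p c :: real. True}"
 note D = DERIV_cmult[OF exp_cut_poly_deriv, unfolded has_field_derivative_def]
 show ?thesis
 proof (rule smooth_on_class[of _ ?A])
  fix h assume "h:?A"
  then obtain p c where h: "h = (%t. c*(if t > 0 then poly p (1/t)*exp (- (1/t)) else 0))" by blast
  show "h differentiable at x" for x using D differentiable_def unfolding h by blast
  show "EX g:?A. ALL x:UNIV. fder h x u = g x" for u
   unfolding h by (rule bexI[of _ "%t. (c*u)*(if t > 0 then poly ([:0, 0, 1:]*(p-pderiv p)) (1/t)*exp (- (1/t)) else 0)"],
     subst frechet_eqI[OF D], simp, blast)
 next
  show "exp_cut:?A"
   by (rule CollectI, rule exI[of _ "[:1:]"], rule exI[of _ 1]) (auto simp: exp_cut_def)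
 qed simp
qed

definition smooth_step :: "real => real" where
 "smooth_step t = exp_cut t*inverse (exp_cut t+exp_cut (1-t))"

lemma exp_cut_pos: "exp_cut t+exp_cut (1-t) > 0"
 by (auto simp: exp_cut_def add_pos_pos)

lemma smooth_on_smooth_step: "smooth_on UNIV smooth_step"
proof -
 have 1: "smooth_on UNIV (%t::real. 1-t)"
  using smooth_on_diff[OF open_UNIV smooth_on_const[of UNIV 1] smooth_on_inner[of "1::real"]] by simp
 have 2: "smooth_on UNIV (%t. exp_cut t+exp_cut (1-t))"
  by (intro smooth_on_add smooth_on_compose[OF _ 1 smooth_on_exp_cut] smooth_on_exp_cut) auto
 have "smooth_on UNIV (%t. inverse (exp_cut t+exp_cut (1-t)))"
  by (rule smooth_on_compose[OF _ 2 smooth_on_inverse]) (auto simp: less_imp_neq[OF exp_cut_pos, symmetric])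
 thus ?thesis unfolding smooth_step_def[abs_def]
  by (intro smooth_on_mult smooth_on_exp_cut) auto
qed

lemma smooth_step_bounds: "0 <= smooth_step t" "smooth_step t <= 1"
proof -
 have nn: "0 <= exp_cut t" "0 <= exp_cut (1-t)" by (simp_all add: exp_cut_def)
 have e: "smooth_step t = exp_cut t/(exp_cut t+exp_cut (1-t))"
  by (simp add: smooth_step_def divide_inverse)
 show "0 <= smooth_step t" unfolding e using nn by simp
 show "smooth_step t <= 1" unfolding e using nn exp_cut_pos[of t] by (subst divide_le_eq_1_pos) auto
qed

lemma smooth_step_eq: "t <= 0 ==> smooth_step t = 0" "t >= 1 ==> smooth_step t = 1"
 by (auto simp: smooth_step_def exp_cut_def)

lemma bump_function_exists:
 fixes a :: "'a::euclidean_space"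
 assumes "0 < r"
 obtains b :: "'a => real" where "smooth_on UNIV b" "!!p. 0 <= b p" "!!p. b p <= 1"
  "!!p. dist p a <= r ==> b p = 1" "!!p. dist p a >= 2*r ==> b p = 0"
proof -
 \<comment> \<open>A polynomial in the coordinates, equal to 2 - (dist p a / r)^2: at least 1 within
   distance r of \<open>a\<close> and at most -2 beyond distance 2 r.\<close>
 let ?q = "%p. 2-inverse (r\<^sup>2)*(\<Sum>e\<in>Basis. (p \<bullet> e-a \<bullet> e)*(p \<bullet> e-a \<bullet> e))"
 have q: "?q p = 2-(dist p a/r)\<^sup>2" for p
 proof -
  have "(dist p a)\<^sup>2 = (\<Sum>e\<in>Basis. (p \<bullet> e-a \<bullet> e)*(p \<bullet> e-a \<bullet> e))"
   unfolding dist_norm power2_norm_eq_inner by (subst euclidean_inner) (simp add: inner_diff_left)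
  thus ?thesis by (simp add: power_mult_distrib divide_inverse mult.commute power_inverse)
 qed
 have sq: "smooth_on UNIV ?q"
 proof -
  have 1: "smooth_on UNIV (%p. p \<bullet> e-a \<bullet> e)" for e
   by (rule smooth_on_diff[OF open_UNIV smooth_on_inner smooth_on_const])
  have 2: "smooth_on UNIV (%p. \<Sum>e\<in>Basis. (p \<bullet> e-a \<bullet> e)*(p \<bullet> e-a \<bullet> e))"
   by (rule smooth_on_sum[OF open_UNIV smooth_on_mult[OF open_UNIV 1 1]])
  show ?thesis
   by (rule smooth_on_diff[OF open_UNIV smooth_on_const smooth_on_mult[OF open_UNIV smooth_on_const 2]])
 qed
 let ?b = "%p. smooth_step (?q p)"
 show ?thesis
 proof (rule that[of ?b])
  show "smooth_on UNIV ?b" by (rule smooth_on_compose[OF _ sq smooth_on_smooth_step]) auto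
  show "?b p = 1" if "dist p a <= r" for p
  proof (rule smooth_step_eq(2))
   have "dist p a/r <= 1" using that assms by simp
   hence "(dist p a/r)\<^sup>2 <= 1" using assms by (simp add: power_le_one)
   thus "1 <= ?q p" unfolding q by simp
  qed
  show "?b p = 0" if "dist p a >= 2*r" for p
  proof (rule smooth_step_eq(1))
   have "2 <= dist p a/r" using that assms by (simp add: field_simps)
   hence "2\<^sup>2 <= (dist p a/r)\<^sup>2" by (intro power_mono) auto
   thus "?q p <= 0" unfolding q by simp
  qed
 qed (auto simp: smooth_step_bounds)
qed

section \<open>Symmetry of second derivatives\<close>

lemma DERIV_along_line:
 fixes g :: "'a::real_normed_vector => real"
 assumes "g differentiable at (y+s *R u)"
 shows "((%s. g (y+s *R u)) has_real_derivative fder g (y+s *R u) u) (at s)"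
proof -
 have g: "(g has_derivative fder g (y+s *R u)) (at (y+s *R u))"
  by (rule frechetI[OF assms])
 have l: "((%s. y+s *R u) has_derivative (%h. h *R u)) (at s)"
  by (auto intro!: derivative_eq_intros)
 have "((%s. g (y+s *R u)) has_derivative (%h. fder g (y+s *R u) (h *R u))) (at s)"
  by (rule has_derivative_compose[OF l g])
 moreover have "fder g (y+s *R u) (h *R u) = fder g (y+s *R u) u*h" for h
  using linear_cmul[OF has_derivative_linear[OF g]] by simp
 ultimately show ?thesis unfolding has_field_derivative_def by simp
qed

text \<open>The mean value theorem is applied along \<open>u\<close> to the difference of
  \<open>f\<close> and its translate by \<open>h w\<close>, and then along \<open>w\<close>. The
  left-hand side is symmetric in \<open>u\<close> and \<open>w\<close>; the symmetry of second
  derivatives rests on this.\<close>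

lemma second_difference_MVT:
 fixes f :: "'a::real_normed_vector => real"
 assumes f: "smooth_on S f" and h: "h > 0"
  and sub: "!!s t. 0 <= s ==> s <= h ==> 0 <= t ==> t <= h ==> x+s *R u+t *R w:S"
 shows "EX s t. 0 <= s & s <= h & 0 <= t & t <= h &
  f (x+h *R u+h *R w)-f (x+h *R u)-f (x+h *R w)+f x
   = h*(h*iter_deriv f [w, u] (x+s *R u+t *R w))"
proof -
 let ?D = "iter_deriv f [u]"
 have 1: "((%s. f ((x+h *R w)+s *R u)-f (x+s *R u)) has_real_derivative
   ?D ((x+h *R w)+s *R u)-?D (x+s *R u)) (at s)" if "0 <= s" "s <= h" for s
 proof -
  have "(x+h *R w)+s *R u:S" "x+s *R u:S"
   using sub[of s h] sub[of s 0] that h by (simp_all add: add_ac)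
  from this[THEN smooth_diff[OF f]] show ?thesis
   unfolding iter_deriv.simps by (intro DERIV_diff DERIV_along_line)
 qed
 obtain s where s: "0 < s" "s < h"
  "(f ((x+h *R w)+h *R u)-f (x+h *R u))-(f ((x+h *R w)+0 *R u)-f (x+0 *R u))
    = (h-0)*(?D ((x+h *R w)+s *R u)-?D (x+s *R u))"
  using MVT2[OF h 1] by blast
 have 2: "((%t. ?D ((x+s *R u)+t *R w)) has_real_derivative iter_deriv f [w, u] ((x+s *R u)+t *R w)) (at t)"
  if "0 <= t" "t <= h" for t
 proof -
  have "(x+s *R u)+t *R w:S" using sub[of s t] that s by simp
  from DERIV_along_line[OF smooth_iter_diff[OF f this, of "[u]"]]
  show ?thesis by simp
 qed
 obtain t where t: "0 < t" "t < h"
  "?D ((x+s *R u)+h *R w)-?D ((x+s *R u)+0 *R w) = (h-0)*iter_deriv f [w, u] ((x+s *R u)+t *R w)"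
  using MVT2[OF h 2] by blast
 show ?thesis
 proof (rule exI[of _ s], rule exI[of _ t], intro conjI)
  have e: "(x+h *R w)+s *R u = (x+s *R u)+h *R w" "(x+h *R w)+h *R u = x+h *R u+h *R w"
   by (simp_all add: add_ac)
  have "f (x+h *R u+h *R w)-f (x+h *R u)-f (x+h *R w)+f x
   = h*(?D ((x+s *R u)+h *R w)-?D (x+s *R u))"
   using s(3) unfolding e by simp
  also have "?D ((x+s *R u)+h *R w)-?D (x+s *R u) = h*iter_deriv f [w, u] (x+s *R u+t *R w)"
   using t(3) by simp
  finally show "f (x+h *R u+h *R w)-f (x+h *R u)-f (x+h *R w)+f x
   = h*(h*iter_deriv f [w, u] (x+s *R u+t *R w))" .
 qed (use s t in auto)
qed

text \<open>Evaluating the same second difference in both orders gives points arbitrarily near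
  \<open>x\<close> where one mixed derivative equals the other; continuity of both at
  \<open>x\<close> then excludes different values there.\<close>

lemma iter_deriv_swap_real:
 fixes f :: "'a::real_normed_vector => real"
 assumes S: "open S" and f: "smooth_on S f" and x: "x:S"
 shows "iter_deriv f [u, w] x = iter_deriv f [w, u] x"
proof (rule ccontr)
 let ?A = "iter_deriv f [u, w]" and ?B = "iter_deriv f [w, u]"
 assume ne: "?A x ~= ?B x"
 define e where "e = abs (?A x-?B x)/2"
 have e: "e > 0" using ne by (simp add: e_def)
 have c: "isCont ?A x" "isCont ?B x"
  using smooth_iter_diff[OF f x] differentiable_imp_continuous_within by blast+
 obtain d1 where d1: "d1 > 0" "!!y. dist y x < d1 ==> dist (?A y) (?A x) < e"
  using c(1) e unfolding continuous_at_eps_delta by blast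
 obtain d2 where d2: "d2 > 0" "!!y. dist y x < d2 ==> dist (?B y) (?B x) < e"
  using c(2) e unfolding continuous_at_eps_delta by blast
 obtain d3 where d3: "d3 > 0" "ball x d3 <= S" using S x open_contains_ball by blast
 define d where "d = min d1 (min d2 d3)"
 have d: "d > 0" using d1 d2 d3 by (simp add: d_def)
 \<comment> \<open>Small enough that the parallelogram spanned at \<open>x\<close> by
   \<open>h u\<close> and \<open>h w\<close> stays within distance \<open>d\<close>; the summand 1
   covers the case that both directions vanish.\<close>
 define h where "h = d/(2*(norm u+norm w+1))"
 have np: "norm u+norm w+1 > 0" using norm_ge_zero[of u] norm_ge_zero[of w] by linarith
 have h: "h > 0" using d np by (simp add: h_def)
 have near: "dist (x+s *R u+t *R w) x < d" if "0 <= s" "s <= h" "0 <= t" "t <= h" for s t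
 proof -
  have "dist (x+s *R u+t *R w) x = norm (s *R u+t *R w)" by (simp add: dist_norm)
  also have "... <= s*norm u+t*norm w" using norm_triangle_ineq[of "s *R u" "t *R w"] that by simp
  also have "... <= h*norm u+h*norm w" using that by (intro add_mono mult_right_mono) auto
  also have "... < h*(2*(norm u+norm w+1))" using h np by (simp add: algebra_simps add_pos_nonneg add_nonneg_pos)
  also have "... = d" using np by (simp add: h_def)
  finally show ?thesis .
 qed
 have inS: "x+s *R u+t *R w:S" "x+s *R w+t *R u:S"
  if "0 <= s" "s <= h" "0 <= t" "t <= h" for s t
  using near[OF that] near[OF that(3,4,1,2)] d3(2) by (auto simp: d_def dist_commute subset_iff add_ac)
 obtain s t where st: "0 <= s" "s <= h" "0 <= t" "t <= h"
  "f (x+h *R u+h *R w)-f (x+h *R u)-f (x+h *R w)+f x = h*(h*?B (x+s *R u+t *R w))"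
  using second_difference_MVT[OF f h inS(1)] by blast
 obtain s' t' where st': "0 <= s'" "s' <= h" "0 <= t'" "t' <= h"
  "f (x+h *R w+h *R u)-f (x+h *R w)-f (x+h *R u)+f x = h*(h*?A (x+s' *R w+t' *R u))"
  using second_difference_MVT[OF f h inS(2)] by blast
 have "h*(h*?B (x+s *R u+t *R w)) = h*(h*?A (x+s' *R w+t' *R u))"
  using st(5) st'(5) by (simp add: algebra_simps)
 hence eq: "?B (x+s *R u+t *R w) = ?A (x+s' *R w+t' *R u)" using h by simp
 have "dist (?B (x+s *R u+t *R w)) (?B x) < e"
  using near[OF st(1-4)] by (intro d2) (simp add: d_def)
 moreover have "dist (?A (x+s' *R w+t' *R u)) (?A x) < e"
  using near[OF st'(3,4,1,2)] by (intro d1) (simp add: d_def add_ac)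
 ultimately have "dist (?A x) (?B x) < 2*e"
  unfolding eq using dist_triangle_less_add[of "?A x" "?A (x+s' *R w+t' *R u)" e "?B x" e] by (simp add: dist_commute)
 thus False by (simp add: e_def dist_real_def)
qed

lemma iter_deriv_inner:
 fixes f :: "'a::real_normed_vector => 'b::euclidean_space"
 assumes S: "open S" and f: "smooth_on S f" and x: "x:S"
 shows "iter_deriv (%x. f x \<bullet> e) us x = iter_deriv f us x \<bullet> e"
 using x
proof (induction us arbitrary: x)
 case (Cons u us)
 have "fder (iter_deriv (%x. f x \<bullet> e) us) x = fder (%x. iter_deriv f us x \<bullet> e) x"
  by (rule fder_cong, rule eventually_nhds_open_eq[OF S Cons.prems], rule Cons.IH)
 also have "... = (%u. fder (iter_deriv f us) x u \<bullet> e)"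
  by (rule frechet_eqI, rule has_derivative_inner_left, rule frechetI,
    rule smooth_iter_diff[OF f Cons.prems])
 finally show ?case by simp
qed simp

lemma iter_deriv_swap:
 fixes f :: "'a::real_normed_vector => 'b::euclidean_space"
 assumes S: "open S" and f: "smooth_on S f" and x: "x:S"
 shows "iter_deriv f [u, w] x = iter_deriv f [w, u] x"
proof (rule euclidean_eqI)
 fix e :: 'b
 show "iter_deriv f [u, w] x \<bullet> e = iter_deriv f [w, u] x \<bullet> e"
  using iter_deriv_swap_real[OF S smooth_on_inner_const[OF S f] x, of e u w]
  unfolding iter_deriv_inner[OF S f x] .
qed

section \<open>The derivative of the determinant\<close>

text \<open>A permutation other than the identity moves at least two indices. After one factor of
  its product is differentiated, an off-diagonal entry of the identity matrix is still left, so only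
  the identity permutation contributes.\<close>

lemma has_derivative_det_at_mat1:
 fixes A :: "'a::real_normed_vector => real ^ 'n ^ 'n"
 assumes A: "(A has_derivative A') (at x)" and 1: "A x = mat 1"
 shows "((%y. det (A y)) has_derivative (%u. trace (A' u))) (at x)"
proof -
 have ent: "((%y. A y $ i $ j) has_derivative (%u. A' u $ i $ j)) (at x)" for i j
  by (intro bounded_linear.has_derivative[OF bounded_linear_vec_nth] A)
 have D: "((%y. det (A y)) has_derivative
   (%u. \<Sum>p\<in>{p. p permutes UNIV}. of_int (sign p)*(\<Sum>i\<in>UNIV. A' u $ i $ p i*(\<Prod>j\<in>UNIV-{i}. A x $ j $ p j)))) (at x)"
  unfolding det_def
  by (intro has_derivative_sum has_derivative_mult_right has_derivative_prod ent)
 have z: "(\<Prod>j\<in>UNIV-{i}. A x $ j $ p j) = 0" if p: "p permutes UNIV" "p ~= id" for p :: "'n => 'n" and i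
 proof -
  have "EX j. j ~= i & p j ~= j"
  proof (rule ccontr)
   assume "~ (EX j. j ~= i & p j ~= j)"
   hence pfix: "!!j. j ~= i ==> p j = j" by blast
   have "p i = i"
   proof (rule ccontr)
    assume "p i ~= i"
    hence "p (p i) = p i" by (rule pfix)
    hence "p i = i" using permutes_inj[OF p(1)] by (auto dest: injD)
    thus False using \<open>p i ~= i\<close> by simp
   qed
   hence "p = id" using pfix by (metis eq_id_iff)
   thus False using p by simp
  qed
  then obtain j where "j ~= i" "p j ~= j" by blast
  hence "j:UNIV-{i}" "A x $ j $ p j = 0" by (simp_all add: 1 mat_def)
  thus ?thesis by (meson finite_Diff finite prod_zero)
 qed
 have "(\<Sum>p\<in>{p. p permutes UNIV}. of_int (sign p)*(\<Sum>i\<in>UNIV. A' u $ i $ p i*(\<Prod>j\<in>UNIV-{i}. A x $ j $ p j)))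
   = trace (A' u)" for u
 proof -
  have "(\<Sum>p\<in>{p. p permutes UNIV}. of_int (sign p)*(\<Sum>i\<in>UNIV. A' u $ i $ p i*(\<Prod>j\<in>UNIV-{i}. A x $ j $ p j)))
    = (\<Sum>p\<in>{id}. of_int (sign p)*(\<Sum>i\<in>UNIV. A' u $ i $ p i*(\<Prod>j\<in>UNIV-{i}. A x $ j $ p j)))"
   by (rule sum.mono_neutral_right) (auto simp: finite_permutations permutes_id z)
  also have "... = trace (A' u)"
   by (simp add: trace_def 1 mat_def sign_id)
  finally show ?thesis .
 qed
 thus ?thesis using D by simp
qed

text \<open>Left multiplication by the constant inverse of \<open>A x\<close> moves the base point
  to the identity matrix; multiplicativity of the determinant undoes it.\<close>

lemma has_derivative_det:
 fixes A :: "'a::real_normed_vector => real ^ 'n ^ 'n"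
 assumes A: "(A has_derivative A') (at x)" and inv: "invertible (A x)"
 shows "((%y. det (A y)) has_derivative (%u. det (A x)*trace (matrix_inv (A x) ** A' u))) (at x)"
proof -
 let ?C = "matrix_inv (A x)"
 have C: "?C ** A x = mat 1" "A x ** ?C = mat 1"
  using inv unfolding invertible_def matrix_inv_def by (metis (mono_tags, lifting) someI_ex)+
 have "linear (%X :: real ^ 'n ^ 'n. ?C ** X)"
  by (rule linearI) (simp_all add: matrix_add_ldistrib matrix_scalar_ac scalar_matrix_assoc)
 hence bl: "bounded_linear (%X :: real ^ 'n ^ 'n. ?C ** X)" by (simp add: linear_conv_bounded_linear)
 have "((%y. det (?C ** A y)) has_derivative (%u. trace (?C ** A' u))) (at x)"
  by (rule has_derivative_det_at_mat1[OF bounded_linear.has_derivative[OF bl A]]) (rule C)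
 hence "((%y. det (A x)*det (?C ** A y)) has_derivative (%u. det (A x)*trace (?C ** A' u))) (at x)"
  by (rule has_derivative_mult_right)
 moreover have "det (A x)*det (?C ** A y) = det (A y)" for y
  unfolding det_mul[symmetric] matrix_mul_assoc C by simp
 ultimately show ?thesis by simp
qed

section \<open>Differentiable functions of lists\<close>

text \<open>The l1 distance is the quantity on the right of the estimate in
  \<open>list_has_deriv_def\<close>, so one number serves both as size of a neighbourhood and as
  error scale. It is meant for lists of equal length.\<close>

definition ldist :: "'e::real_normed_vector list => 'e list => real" where
 "ldist as bs = (\<Sum>i<length as. norm (bs!i-as!i))"

lemma ldist_nonneg: "0 <= ldist as bs"
 by (simp add: ldist_def sum_nonneg)

lemma norm_nth_le_ldist: "i < length as ==> norm (bs!i-as!i) <= ldist as bs"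
 unfolding ldist_def by (rule member_le_sum) auto

lemma list_has_deriv_iff:
 "list_has_deriv F L as \<longleftrightarrow> length L = length as &
   (ALL ep>0. EX de>0. ALL bs. length bs = length as & ldist as bs < de -->
    abs (F bs-F as-(\<Sum>i<length as. L!i \<bullet> (bs!i-as!i))) <= ep*ldist as bs)"
proof -
 have "(EX de>0. ALL bs. length bs = length as & (ALL i<length as. norm (bs!i-as!i) < de) --> P bs) \<longleftrightarrow>
    (EX de>0. ALL bs. length bs = length as & ldist as bs < de --> P bs)" for P
 proof safe
  fix de :: real assume de: "de > 0" "ALL bs. length bs = length as & (ALL i<length as. norm (bs!i-as!i) < de) --> P bs"
  have "ALL bs. length bs = length as & ldist as bs < de --> P bs"
   using de(2) norm_nth_le_ldist[of _ as] by (meson le_less_trans)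
  thus "EX de>0. ALL bs. length bs = length as & ldist as bs < de --> P bs" using de(1) by blast
 next
  fix de :: real assume de: "de > 0" "ALL bs. length bs = length as & ldist as bs < de --> P bs"
  \<comment> \<open>Dividing by the length bounds the sum over the slots; the summand 1 covers the
    empty list.\<close>
  let ?d = "de/(length as+1)"
  have "ldist as bs < de" if "ALL i<length as. norm (bs!i-as!i) < ?d" for bs
  proof -
   have "ldist as bs <= (\<Sum>i<length as. ?d)" unfolding ldist_def using that by (intro sum_mono) (auto intro: less_imp_le)
   also have "... = length as*?d" by simp
   also have "... < de" using de(1) by (simp add: field_simps)
   finally show ?thesis .
  qed
  thus "EX de>0. ALL bs. length bs = length as & (ALL i<length as. norm (bs!i-as!i) < de) --> P bs"
   using de by (intro exI[of _ ?d]) auto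
 qed
 thus ?thesis unfolding list_has_deriv_def ldist_def[symmetric] by simp
qed

lemma list_has_deriv_length: "list_has_deriv F L as ==> length L = length as"
 by (simp add: list_has_deriv_def)

lemma list_has_derivD:
 assumes "list_has_deriv F L as" "ep > 0"
 obtains de where "de > 0" "!!bs. length bs = length as ==> ldist as bs < de ==>
    abs (F bs-F as-(\<Sum>i<length as. L!i \<bullet> (bs!i-as!i))) <= ep*ldist as bs"
 using assms unfolding list_has_deriv_iff by metis

lemma sum_update_slot:
 assumes "i < length as"
 shows "(\<Sum>j<length as. L!j \<bullet> (as[i:=y]!j-as!j)) = L!i \<bullet> (y-as!i)"
proof -
 have "(\<Sum>j<length as. L!j \<bullet> (as[i:=y]!j-as!j)) = (\<Sum>j\<in>{i}. L!j \<bullet> (as[i:=y]!j-as!j))"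
  using assms by (intro sum.mono_neutral_right) auto
 thus ?thesis using assms by simp
qed

lemma ldist_update_slot:
 assumes "i < length as"
 shows "ldist as (as[i:=y]) = norm (y-as!i)"
proof -
 have "ldist as (as[i:=y]) = (\<Sum>j\<in>{i}. norm (as[i:=y]!j-as!j))"
  unfolding ldist_def using assms by (intro sum.mono_neutral_right) auto
 thus ?thesis using assms by simp
qed

lemma list_has_deriv_slot:
 assumes F: "list_has_deriv F L as" and i: "i < length as"
 shows "((%y. F (as[i:=y])) has_derivative (%u. L!i \<bullet> u)) (at (as!i))"
 unfolding has_derivative_at_alt
proof (intro conjI allI impI)
 show "bounded_linear (%u. L!i \<bullet> u)" by (rule bounded_linear_inner_right)
 fix e :: real assume "e > 0"
 obtain de where de: "de > 0" "!!bs. length bs = length as ==> ldist as bs < de ==>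
    abs (F bs-F as-(\<Sum>i<length as. L!i \<bullet> (bs!i-as!i))) <= e*ldist as bs"
  using list_has_derivD[OF F \<open>e > 0\<close>] by blast
 show "EX d>0. ALL y. norm (y-as!i) < d -->
    norm (F (as[i:=y])-F (as[i:=as!i])-L!i \<bullet> (y-as!i)) <= e*norm (y-as!i)"
 proof (intro exI[of _ de] conjI allI impI)
  fix y assume "norm (y-as!i) < de"
  thus "norm (F (as[i:=y])-F (as[i:=as!i])-L!i \<bullet> (y-as!i)) <= e*norm (y-as!i)"
   using de(2)[of "as[i:=y]"] i by (simp add: sum_update_slot ldist_update_slot)
 qed (rule de)
qed

lemma list_has_deriv_unique:
 assumes "list_has_deriv F L as" "list_has_deriv F L' as"
 shows "L = L'"
proof (rule nth_equalityI)
 show len: "length L = length L'" using assms by (simp add: list_has_deriv_def)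
 fix i assume "i < length L"
 hence i: "i < length as" using assms by (simp add: list_has_deriv_def)
 have "(%u. L!i \<bullet> u) = (%u. L'!i \<bullet> u)"
  by (rule has_derivative_unique[OF list_has_deriv_slot[OF assms(1) i] list_has_deriv_slot[OF assms(2) i]])
 thus "L!i = L'!i" by (metis inner_commute vector_eq_rdot)
qed

lemma list_grad_eqI: "list_has_deriv F L as ==> list_grad F as = L"
 unfolding list_grad_def by (rule the_equality) (auto intro: list_has_deriv_unique)

lemma list_has_deriv_cong_local:
 assumes F: "list_has_deriv F L as" and de: "de > 0"
  and eq: "!!bs. length bs = length as ==> (ALL i<length as. norm (bs!i-as!i) < de) ==> F bs = G bs"
 shows "list_has_deriv G L as"
 unfolding list_has_deriv_def
proof (intro conjI allI impI)
 show "length L = length as" by (rule list_has_deriv_length[OF F])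
 fix ep :: real assume "ep > 0"
 then obtain d where d: "d > 0" "ALL bs. length bs = length as & (ALL i<length as. norm (bs!i-as!i) < d) -->
    abs (F bs-F as-(\<Sum>i<length as. L!i \<bullet> (bs!i-as!i)))
     <= ep*(\<Sum>i<length as. norm (bs!i-as!i))"
  using F unfolding list_has_deriv_def by blast
 have "F as = G as" using de by (intro eq) auto
 thus "EX de>0. ALL bs. length bs = length as & (ALL i<length as. norm (bs!i-as!i) < de) -->
    abs (G bs-G as-(\<Sum>i<length as. L!i \<bullet> (bs!i-as!i)))
     <= ep*(\<Sum>i<length as. norm (bs!i-as!i))"
  using d de eq by (intro exI[of _ "min de d"]) auto
qed

lemma list_has_deriv_bound:
 assumes "list_has_deriv F L as"
 obtains de C where "de > 0" "C > 0" "!!bs. length bs = length as ==> ldist as bs < de ==> abs (F bs-F as) <= C*ldist as bs"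
proof -
 obtain de where de: "de > 0" "!!bs. length bs = length as ==> ldist as bs < de ==>
    abs (F bs-F as-(\<Sum>i<length as. L!i \<bullet> (bs!i-as!i))) <= 1*ldist as bs"
  using list_has_derivD[OF assms zero_less_one] by blast
 let ?C = "(\<Sum>i<length as. norm (L!i))+1"
 have lin: "abs (\<Sum>i<length as. L!i \<bullet> (bs!i-as!i)) <= (\<Sum>i<length as. norm (L!i))*ldist as bs" for bs
 proof -
  have "abs (\<Sum>i<length as. L!i \<bullet> (bs!i-as!i)) <= (\<Sum>i<length as. norm (L!i)*ldist as bs)"
  proof (rule order_trans[OF sum_abs], rule sum_mono)
   fix i assume "i:{..<length as}"
   hence "norm (bs!i-as!i) <= ldist as bs" by (intro norm_nth_le_ldist) simp
   thus "abs (L!i \<bullet> (bs!i-as!i)) <= norm (L!i)*ldist as bs"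
    using order_trans[OF Cauchy_Schwarz_ineq2 mult_left_mono] norm_ge_zero by blast
  qed
  thus ?thesis by (simp add: sum_distrib_right)
 qed
 show ?thesis
 proof (rule that[of de ?C])
  show "?C > 0" by (simp add: add_nonneg_pos sum_nonneg)
  fix bs assume "length bs = length as" "ldist as bs < de"
  hence "abs (F bs-F as) <= ldist as bs+(\<Sum>i<length as. norm (L!i))*ldist as bs"
   using de(2)[of bs] lin[of bs] by linarith
  thus "abs (F bs-F as) <= ?C*ldist as bs" by (simp add: algebra_simps)
 qed (rule de)
qed

lemma list_has_deriv_continuous:
 assumes "list_has_deriv F L as" "ep > 0"
 obtains de where "de > 0" "!!bs. length bs = length as ==> ldist as bs < de ==> abs (F bs-F as) < ep"
proof -
 obtain de C where de: "de > 0" "C > 0" "!!bs. length bs = length as ==> ldist as bs < de ==> abs (F bs-F as) <= C*ldist as bs"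
  using list_has_deriv_bound[OF assms(1)] by blast
 show ?thesis
 proof (rule that[of "min de (ep/C)"])
  fix bs assume bs: "length bs = length as" "ldist as bs < min de (ep/C)"
  hence "C*ldist as bs < ep" using de(2) by (simp add: field_simps)
  thus "abs (F bs-F as) < ep" using de(3)[of bs] bs by linarith
 qed (use de assms in auto)
qed

text \<open>
  The chain rule for an outer function of lists. The inner functions live on an arbitrary filter, so
  that the inner variable can be a vector as well as a list.
\<close>
lemma chain_rule_little_o:
 fixes ps D :: "nat => 'z => real"
 assumes F: "list_has_deriv F L (map ps0 [0..<k])"
  and r0: "!!z. 0 <= r z" and r: "!!de. de > 0 ==> eventually (%z. r z < de) Z"
  and ps: "!!l ep. l < k ==> ep > 0 ==> eventually (%z. abs (ps l z-ps0 l-D l z) <= ep*r z) Z"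
  and D: "!!l. l < k ==> EX C. ALL z. abs (D l z) <= C*r z"
  and ep: "ep > 0"
 shows "eventually (%z. abs (F (map (%l. ps l z) [0..<k])-F (map ps0 [0..<k])-(\<Sum>l<k. L!l*D l z)) <= ep*r z) Z"
proof -
 let ?p = "map ps0 [0..<k]"
 let ?q = "%z. map (%l. ps l z) [0..<k]"
 obtain C where C: "!!l z. l < k ==> abs (D l z) <= C l*r z" using D by metis
 define K where "K = (\<Sum>l<k. abs (C l)+1)"
 have K0: "K >= 0" by (auto simp: K_def intro!: sum_nonneg)
 define N where "N = (\<Sum>l<k. abs (L!l))"
 have N0: "N >= 0" by (auto simp: N_def intro!: sum_nonneg)
 \<comment> \<open>The error splits into two halves: \<open>e\<close> controls the remainder of
   \<open>F\<close>, whose argument moves by at most \<open>K r\<close>, and \<open>e'\<close> the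
   remainders of the inner functions, weighted by \<open>N\<close>. The cap of 1 in
   \<open>e'\<close> is what allows \<open>K\<close> to be fixed before \<open>ep\<close>.\<close>
 define e where "e = ep/2/(K+1)"
 have e: "e > 0" using ep K0 by (simp add: e_def)
 define e' where "e' = min 1 (ep/2/(N+1))"
 have e': "e' > 0" using ep N0 by (simp add: e'_def)
 obtain de where de: "de > 0" "!!bs. length bs = k ==> ldist ?p bs < de ==>
    abs (F bs-F ?p-(\<Sum>i<k. L!i \<bullet> (bs!i-?p!i))) <= e*ldist ?p bs"
  using list_has_derivD[OF F e] by auto
 have ev1: "eventually (%z. ALL l<k. abs (ps l z-ps0 l-D l z) <= e'*r z) Z"
  using eventually_ball_finite[of "{..<k}" "%z l. abs (ps l z-ps0 l-D l z) <= e'*r z" Z] ps e' by (simp add: Ball_def)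
 have ev2: "eventually (%z. r z < de/(K+1)) Z" using de(1) K0 by (intro r) simp
 from ev1 ev2 show ?thesis
 proof eventually_elim
  case (elim z)
  have small: "abs (ps l z-ps0 l-D l z) <= e'*r z" if "l < k" for l using elim that by blast
  have ld: "ldist ?p (?q z) = (\<Sum>l<k. abs (ps l z-ps0 l))" by (simp add: ldist_def)
  have "ldist ?p (?q z) <= (\<Sum>l<k. (abs (C l)+1)*r z)"
   unfolding ld
  proof (rule sum_mono)
   fix l assume "l:{..<k}"
   hence l: "l < k" by simp
   have "abs (ps l z-ps0 l) <= e'*r z+C l*r z" using small[OF l] C[OF l, of z] by linarith
   also have "... <= 1*r z+abs (C l)*r z"
    using r0[of z] by (intro add_mono mult_right_mono) (auto simp: e'_def)
   finally show "abs (ps l z-ps0 l) <= (abs (C l)+1)*r z" by (simp add: algebra_simps)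
  qed
  hence ldK: "ldist ?p (?q z) <= K*r z" by (simp add: K_def sum_distrib_right)
  also have "... <= (K+1)*r z" using r0[of z] by (simp add: algebra_simps)
  also have "... < de" using elim(2) K0 by (simp add: field_simps)
  finally have "abs (F (?q z)-F ?p-(\<Sum>i<k. L!i \<bullet> (?q z!i-?p!i))) <= e*ldist ?p (?q z)"
   by (intro de(2)) auto
  also have "... <= e*(K*r z)" using ldK e by (intro mult_left_mono) auto
  also have "... <= ep/2*r z"
  proof -
   have "e*K <= e*(K+1)" using e by simp
   also have "... = ep/2" unfolding e_def using nonzero_eq_divide_eq[of "K+1" "ep/2/(K+1)" "ep/2"] K0 by auto
   finally have "(e*K)*r z <= ep/2*r z" using r0[of z] by (intro mult_right_mono) auto
   thus ?thesis by (simp add: mult.assoc)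
  qed
  finally have a: "abs (F (?q z)-F ?p-(\<Sum>i<k. L!i*(ps i z-ps0 i))) <= ep/2*r z" by simp
  have "abs ((\<Sum>i<k. L!i*(ps i z-ps0 i))-(\<Sum>l<k. L!l*D l z)) = abs (\<Sum>l<k. L!l*(ps l z-ps0 l-D l z))"
   by (simp only: sum_subtractf[symmetric] right_diff_distrib[symmetric])
  also have "... <= (\<Sum>l<k. abs (L!l)*(e'*r z))"
  proof (rule order_trans[OF sum_abs], rule sum_mono)
   fix l assume "l:{..<k}"
   hence "abs (ps l z-ps0 l-D l z) <= e'*r z" by (intro small) simp
   thus "abs (L!l*(ps l z-ps0 l-D l z)) <= abs (L!l)*(e'*r z)"
    unfolding abs_mult by (rule mult_left_mono) simp
  qed
  also have "... = (N*e')*r z" by (simp add: N_def sum_distrib_right mult.assoc)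
  also have "... <= ep/2*r z"
  proof (rule mult_right_mono[OF _ r0])
   have "e' <= ep/2/(N+1)" by (simp add: e'_def)
   hence "N*e' <= (N+1)*(ep/2/(N+1))" using N0 e' by (intro mult_mono) linarith+
   also have "... = ep/2" using nonzero_eq_divide_eq[of "N+1" "ep/2/(N+1)" "ep/2"] N0 by (simp add: mult.commute)
   finally show "N*e' <= ep/2" .
  qed
  finally have b: "abs ((\<Sum>i<k. L!i*(ps i z-ps0 i))-(\<Sum>l<k. L!l*D l z)) <= ep/2*r z" .
  have "ep*r z = ep/2*r z+ep/2*r z" by simp
  thus ?case using a b by linarith
 qed
qed

lemma has_derivative_list_comp:
 fixes ps :: "nat => 'a::real_normed_vector => real"
 assumes F: "list_has_deriv F L (map (%l. ps l x) [0..<k])"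
  and ps: "!!l. l < k ==> (ps l has_derivative D l) (at x)"
 shows "((%y. F (map (%l. ps l y) [0..<k])) has_derivative (%u. \<Sum>l<k. L!l*D l u)) (at x)"
 unfolding has_derivative_at_alt
proof (intro conjI allI impI)
 show "bounded_linear (%u. \<Sum>l<k. L!l*D l u)"
  using ps has_derivative_bounded_linear by (intro bounded_linear_sum bounded_linear_mult_right[THEN bounded_linear_compose]) blast
 fix e :: real assume e: "e > 0"
 have "eventually (%y. abs (F (map (%l. ps l y) [0..<k])-F (map (%l. ps l x) [0..<k])-(\<Sum>l<k. L!l*D l (y-x)))
   <= e*norm (y-x)) (nhds x)"
 proof (rule chain_rule_little_o[OF F norm_ge_zero _ _ _ e])
  show "eventually (%y. norm (y-x) < de) (nhds x)" if "de > 0" for de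
   using that by (auto simp: eventually_nhds_metric dist_norm)
  show "eventually (%y. abs (ps l y-ps l x-D l (y-x)) <= ep*norm (y-x)) (nhds x)" if "l < k" "ep > 0" for l ep
   using ps[OF that(1)] that(2) unfolding has_derivative_at_alt eventually_nhds_metric dist_norm real_norm_def by blast
  show "EX C. ALL y. abs (D l (y-x)) <= C*norm (y-x)" if "l < k" for l
  proof -
   have bl: "bounded_linear (D l)" using ps[OF that] by (rule has_derivative_bounded_linear)
   show ?thesis using bounded_linear.bounded[OF bl] unfolding real_norm_def by (metis mult.commute)
  qed
 qed
 thus "EX d>0. ALL y. norm (y-x) < d -->
   norm (F (map (%l. ps l y) [0..<k])-F (map (%l. ps l x) [0..<k])-(\<Sum>l<k. L!l*D l (y-x))) <= e*norm (y-x)"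
  unfolding eventually_nhds_metric dist_norm real_norm_def .
qed

text \<open>Neighbourhoods of \<open>as\<close> among lists of the same length, as a filter: the
  form in which the chain rule above accepts lists as inner variable.\<close>

definition lnhds :: "'e::real_normed_vector list => 'e list filter" where
 "lnhds as = (INF de\<in>{0<..}. principal {bs. length bs = length as & ldist as bs < de})"

lemma eventually_lnhds:
 "eventually P (lnhds as) \<longleftrightarrow> (EX de>0. ALL bs. length bs = length as & ldist as bs < de --> P bs)"
 unfolding lnhds_def
proof (subst eventually_INF_base)
 show "EX x:{0<..}. principal {bs. length bs = length as & ldist as bs < x}
   <= inf (principal {bs. length bs = length as & ldist as bs < a}) (principal {bs. length bs = length as & ldist as bs < b})"
  if "a:{0<..}" "b:{0<..}" for a b
  using that by (intro bexI[of _ "min a b"]) auto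
qed (auto simp: eventually_principal)

lemma list_has_deriv_comp:
 fixes ps :: "nat => 'e::euclidean_space list => real"
 assumes F: "list_has_deriv F L (map (%l. ps l as) [0..<k])"
  and ps: "!!l. l < k ==> list_has_deriv (ps l) (M l) as"
 shows "list_has_deriv (%bs. F (map (%l. ps l bs) [0..<k])) (map (%i. \<Sum>l<k. L!l *R (M l!i)) [0..<length as]) as"
 unfolding list_has_deriv_iff
proof (intro conjI allI impI)
 fix e :: real assume e: "e > 0"
 let ?D = "%l bs. \<Sum>i<length as. M l!i \<bullet> (bs!i-as!i)"
 have "eventually (%bs. abs (F (map (%l. ps l bs) [0..<k])-F (map (%l. ps l as) [0..<k])-(\<Sum>l<k. L!l*?D l bs))
   <= e*ldist as bs) (lnhds as)"
 proof (rule chain_rule_little_o[OF F ldist_nonneg _ _ _ e])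
  show "eventually (%bs. ldist as bs < de) (lnhds as)" if "de > 0" for de
   using that by (auto simp: eventually_lnhds)
  show "eventually (%bs. abs (ps l bs-ps l as-?D l bs) <= ep*ldist as bs) (lnhds as)" if "l < k" "ep > 0" for l ep
   using ps[OF that(1)] that(2) unfolding list_has_deriv_iff eventually_lnhds by blast
  show "EX C. ALL bs. abs (?D l bs) <= C*ldist as bs" if "l < k" for l
  proof (intro exI allI)
   fix bs
   have "abs (?D l bs) <= (\<Sum>i<length as. norm (M l!i)*ldist as bs)"
   proof (rule order_trans[OF sum_abs], rule sum_mono)
    fix i assume "i:{..<length as}"
    hence "norm (bs!i-as!i) <= ldist as bs" by (intro norm_nth_le_ldist) simp
    thus "abs (M l!i \<bullet> (bs!i-as!i)) <= norm (M l!i)*ldist as bs"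
     using order_trans[OF Cauchy_Schwarz_ineq2 mult_left_mono] norm_ge_zero by blast
   qed
   thus "abs (?D l bs) <= (\<Sum>i<length as. norm (M l!i))*ldist as bs" by (simp add: sum_distrib_right)
  qed
 qed
 moreover have "(\<Sum>l<k. L!l*?D l bs) = (\<Sum>i<length as. map (%i. \<Sum>l<k. L!l *R (M l!i)) [0..<length as]!i \<bullet> (bs!i-as!i))" for bs
 proof -
  have "(\<Sum>l<k. L!l*?D l bs) = (\<Sum>l<k. \<Sum>i<length as. L!l*(M l!i \<bullet> (bs!i-as!i)))"
   by (simp add: sum_distrib_left)
  also have "... = (\<Sum>i<length as. \<Sum>l<k. L!l*(M l!i \<bullet> (bs!i-as!i)))" by (rule sum.swap)
  also have "... = (\<Sum>i<length as. map (%i. \<Sum>l<k. L!l *R (M l!i)) [0..<length as]!i \<bullet> (bs!i-as!i))"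
   by (rule sum.cong) (auto simp: inner_sum_left)
  finally show ?thesis .
 qed
 ultimately show "EX de>0. ALL bs. length bs = length as & ldist as bs < de -->
   abs (F (map (%l. ps l bs) [0..<k])-F (map (%l. ps l as) [0..<k])
    - (\<Sum>i<length as. map (%i. \<Sum>l<k. L!l *R (M l!i)) [0..<length as]!i \<bullet> (bs!i-as!i))) <= e*ldist as bs"
  unfolding eventually_lnhds by simp
qed simp


text \<open>The counterpart of \<open>smooth_on_class\<close> for lists. The premise on
  \<open>S\<close> says that it is open among the lists of length \<open>n\<close>; the premise on
  the class says that each partial derivative agrees on \<open>S\<close> with a member.\<close>

lemma list_smooth_class_deriv:
 assumes S: "!!as. as:S ==> length as = n & (EX de>0. ALL bs. length bs = n & (ALL i<n. norm (bs!i-as!i) < de) --> bs:S)"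
  and A: "!!f. f:\<A> ==> EX f'. (ALL as:S. list_has_deriv f (f' as) as) & (ALL i<n. ALL u. EX g:\<A>. ALL as:S. f' as!i \<bullet> u = g as)"
  and f: "f:\<A>" and ds: "fst ` set ds <= {..<n}"
 shows "EX g:\<A>. ALL as:S. list_iter_deriv f ds as = g as"
 using ds
proof (induction ds)
 case Nil thus ?case using f by auto
next
 case (Cons d ds)
 obtain i u where d: "d = (i, u)" by (cases d)
 obtain g where g: "g:\<A>" "ALL as:S. list_iter_deriv f ds as = g as" using Cons by auto
 obtain g' where g': "ALL as:S. list_has_deriv g (g' as) as" "ALL i<n. ALL u. EX h:\<A>. ALL as:S. g' as!i \<bullet> u = h as"
  using A[OF g(1)] by blast
 have "i < n" using Cons.prems d by auto
 then obtain h where h: "h:\<A>" "ALL as:S. g' as!i \<bullet> u = h as" using g'(2) by blast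
 have "list_iter_deriv f (d # ds) as = h as" if as: "as:S" for as
 proof -
  obtain de where de: "de > 0" "ALL bs. length bs = n & (ALL i<n. norm (bs!i-as!i) < de) --> bs:S" and n: "length as = n"
   using S[OF as] by blast
  have "list_has_deriv (list_iter_deriv f ds) (g' as) as"
  proof (rule list_has_deriv_cong_local[OF _ de(1)])
   show "list_has_deriv g (g' as) as" using g'(1) as by blast
   fix bs assume "length bs = length as" "ALL i<length as. norm (bs!i-as!i) < de"
   hence "bs:S" using de(2) n by simp
   thus "g bs = list_iter_deriv f ds bs" using g(2) by simp
  qed
  thus ?thesis using h as by (simp add: d list_grad_eqI)
 qed
 thus ?case using h(1) by blast
qed

lemma list_smooth_class:
 assumes S: "!!as. as:S ==> length as = n & (EX de>0. ALL bs. length bs = n & (ALL i<n. norm (bs!i-as!i) < de) --> bs:S)"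
  and A: "!!f. f:\<A> ==> EX f'. (ALL as:S. list_has_deriv f (f' as) as) & (ALL i<n. ALL u. EX g:\<A>. ALL as:S. f' as!i \<bullet> u = g as)"
  and f: "f:\<A>"
 shows "list_smooth_on n S f"
 unfolding list_smooth_on_def
proof (intro allI impI ballI)
 fix ds :: "(nat \<times> 'a) list" and as assume ds: "fst ` set ds <= {..<n}" and as: "as:S"
 obtain g where g: "g:\<A>" "ALL as:S. list_iter_deriv f ds as = g as"
  using list_smooth_class_deriv[OF S A f ds] by blast
 obtain de where de: "de > 0" "ALL bs. length bs = n & (ALL i<n. norm (bs!i-as!i) < de) --> bs:S" and n: "length as = n"
  using S[OF as] by blast
 obtain L where "list_has_deriv g L as" using A[OF g(1)] as by blast
 hence "list_has_deriv (list_iter_deriv f ds) L as"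
 proof (rule list_has_deriv_cong_local[OF _ de(1)])
  fix bs assume "length bs = length as" "ALL i<length as. norm (bs!i-as!i) < de"
  hence "bs:S" using de(2) n by simp
  thus "g bs = list_iter_deriv f ds bs" using g(2) by simp
 qed
 thus "EX L. list_has_deriv (list_iter_deriv f ds) L as" by blast
qed

section \<open>Algebras of smooth functions of lists\<close>

text \<open>The vector that represents a linear functional through the inner product.\<close>

definition gvec :: "('e::euclidean_space => real) => 'e" where
 "gvec D = (\<Sum>e\<in>Basis. D e *R e)"

lemma gvec_inner: "linear D ==> gvec D \<bullet> u = D u"
proof -
 assume D: "linear D"
 have "D u = D (\<Sum>e\<in>Basis. (u \<bullet> e) *R e)" by (simp add: euclidean_representation)
 also have "... = (\<Sum>e\<in>Basis. (u \<bullet> e)*D e)" by (simp add: linear_sum[OF D] linear_cmul[OF D])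
 finally show ?thesis by (simp add: gvec_def inner_sum_left inner_commute[of u] mult.commute)
qed

lemma list_has_deriv_nth:
 assumes g: "(g has_derivative D) (at (as!i))" and i: "i < length as"
 shows "list_has_deriv (%bs. g (bs!i)) (map (%j. if j = i then gvec D else 0) [0..<length as]) as"
 unfolding list_has_deriv_iff
proof (intro conjI allI impI)
 fix e :: real assume "e > 0"
 obtain d where d: "d > 0" "ALL y. norm (y-as!i) < d --> norm (g y-g (as!i)-D (y-as!i)) <= e*norm (y-as!i)"
  using g \<open>e > 0\<close> unfolding has_derivative_at_alt by blast
 show "EX de>0. ALL bs. length bs = length as & ldist as bs < de -->
   abs (g (bs!i)-g (as!i)-(\<Sum>j<length as. map (%j. if j = i then gvec D else 0) [0..<length as]!j \<bullet> (bs!j-as!j))) <= e*ldist as bs"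
 proof (intro exI[of _ d] conjI allI impI)
  fix bs assume bs: "length bs = length as & ldist as bs < d"
  have "(\<Sum>j<length as. map (%j. if j = i then gvec D else 0) [0..<length as]!j \<bullet> (bs!j-as!j))
   = (\<Sum>j\<in>{i}. gvec D \<bullet> (bs!j-as!j))"
   using i by (intro sum.mono_neutral_cong_right) auto
  hence s: "(\<Sum>j<length as. map (%j. if j = i then gvec D else 0) [0..<length as]!j \<bullet> (bs!j-as!j)) = D (bs!i-as!i)"
   by (simp add: gvec_inner[OF has_derivative_linear[OF g]])
  have n: "norm (bs!i-as!i) <= ldist as bs" by (rule norm_nth_le_ldist[OF i])
  hence "norm (g (bs!i)-g (as!i)-D (bs!i-as!i)) <= e*norm (bs!i-as!i)" using d(2) bs by auto
  also have "... <= e*ldist as bs" using n \<open>e > 0\<close> by simp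
  finally show "abs (g (bs!i)-g (as!i)-(\<Sum>j<length as. map (%j. if j = i then gvec D else 0) [0..<length as]!j \<bullet> (bs!j-as!j))) <= e*ldist as bs"
   unfolding s by simp
 qed (rule d)
qed simp

lemma list_has_deriv_const: "list_has_deriv (%bs. c) (replicate (length as) 0) as"
 by (auto simp: list_has_deriv_iff ldist_nonneg intro!: exI[of _ 1])

lemma list_has_deriv_plus: "list_has_deriv (%rs :: real list. rs!0+rs!1) [1, 1] [a, b]"
 by (auto simp: list_has_deriv_iff ldist_nonneg numeral_2_eq_2 intro!: exI[of _ 1])

lemma list_has_deriv_times: "list_has_deriv (%rs :: real list. rs!0*rs!1) [b, a] [a, b]"
 unfolding list_has_deriv_iff
proof (intro conjI allI impI)
 fix e :: real assume e: "e > 0"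
 show "EX de>0. ALL bs. length bs = length [a, b] & ldist [a, b] bs < de -->
   abs (bs!0*bs!1-[a, b]!0*[a, b]!1-(\<Sum>i<length [a, b]. [b, a]!i \<bullet> (bs!i-[a, b]!i))) <= e*ldist [a, b] bs"
 proof (intro exI[of _ e] conjI allI impI)
  fix bs assume bs: "length bs = length [a, b] & ldist [a, b] bs < e"
  have eq: "bs!0*bs!1-[a, b]!0*[a, b]!1-(\<Sum>i<length [a, b]. [b, a]!i \<bullet> (bs!i-[a, b]!i))
    = (bs!0-a)*(bs!1-b)"
   by (simp add: numeral_2_eq_2 algebra_simps)
  have "norm (bs!0-[a, b]!0) <= ldist [a, b] bs" "norm (bs!1-[a, b]!1) <= ldist [a, b] bs"
   by (rule norm_nth_le_ldist, simp)+
  hence "abs (bs!0-a)*abs (bs!1-b) <= e*ldist [a, b] bs"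
   using bs e by (intro mult_mono) auto
  thus "abs (bs!0*bs!1-[a, b]!0*[a, b]!1-(\<Sum>i<length [a, b]. [b, a]!i \<bullet> (bs!i-[a, b]!i))) <= e*ldist [a, b] bs"
   unfolding eq abs_mult .
 qed (rule e)
qed simp

text \<open>Addition and multiplication are outer functions of a list with two entries, so the sum
  and product rules become instances of the chain rule.\<close>

lemma list_has_deriv_binary:
 fixes f g :: "'e::euclidean_space list => real"
 assumes F: "list_has_deriv F [p, q] [f as, g as]" and f: "list_has_deriv f L as" and g: "list_has_deriv g M as"
 shows "list_has_deriv (%bs. F [f bs, g bs]) (map (%i. p *R L!i+q *R M!i) [0..<length as]) as"
proof -
 have e: "map (%l. ([f, g]!l) bs) [0..<2] = [f bs, g bs]" for bs by (simp add: numeral_2_eq_2 upt_rec)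
 have "list_has_deriv (%bs. F (map (%l. ([f, g]!l) bs) [0..<2]))
   (map (%i. \<Sum>l<2. [p, q]!l *R (([L, M]!l)!i)) [0..<length as]) as"
 proof (rule list_has_deriv_comp)
  show "list_has_deriv F [p, q] (map (%l. ([f, g]!l) as) [0..<2])" unfolding e by (rule F)
  show "list_has_deriv ([f, g]!l) ([L, M]!l) as" if "l < 2" for l
   using that f g by (auto simp: less_2_cases_iff)
 qed
 moreover have "(\<Sum>l<2. [p, q]!l *R (([L, M]!l)!i)) = p *R L!i+q *R M!i" for i
  by (simp add: numeral_2_eq_2)
 ultimately show ?thesis unfolding e by simp
qed

lemma list_has_deriv_add:
 assumes f: "list_has_deriv f L as" and g: "list_has_deriv g M as"
 shows "list_has_deriv (%bs. f bs+g bs) (map (%i. L!i+M!i) [0..<length as]) as"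
 using list_has_deriv_binary[OF list_has_deriv_plus f g] by simp

lemma list_has_deriv_mult:
 assumes f: "list_has_deriv f L as" and g: "list_has_deriv g M as"
 shows "list_has_deriv (%bs. f bs*g bs) (map (%i. g as *R L!i+f as *R M!i) [0..<length as]) as"
 using list_has_deriv_binary[OF list_has_deriv_times f g] by simp

lemma list_smooth_on_has_deriv:
 "list_smooth_on n S f ==> as:S ==> list_has_deriv f (list_grad f as) as"
proof -
 assume f: "list_smooth_on n S f" "as:S"
 have "ALL ds. fst ` set ds <= {..<n} --> (ALL as:S. EX L. list_has_deriv (list_iter_deriv f ds) L as)"
  using f(1) unfolding list_smooth_on_def .
 from spec[OF this, of "[]"] have "EX L. list_has_deriv f L as" using f(2) by simp
 thus ?thesis by (metis list_grad_eqI)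
qed

lemma list_iter_deriv_append: "list_iter_deriv f (ds @ es) = list_iter_deriv (list_iter_deriv f es) ds"
 by (induction ds) auto

lemma list_smooth_on_list_iter_deriv:
 assumes "list_smooth_on n S f" "fst ` set es <= {..<n}"
 shows "list_smooth_on n S (list_iter_deriv f es)"
 unfolding list_smooth_on_def
proof (intro allI impI)
 fix ds :: "(nat \<times> 'a) list" assume "fst ` set ds <= {..<n}"
 hence "fst ` set (ds @ es) <= {..<n}" using assms(2) by (simp add: image_Un)
 thus "ALL as:S. EX L. list_has_deriv (list_iter_deriv (list_iter_deriv f es) ds) L as"
  using assms(1) unfolding list_smooth_on_def list_iter_deriv_append[symmetric] by blast
qed

text \<open>Cylinder functions of one cluster belong to this algebra once they are written in
  charts: smooth functions of single slots are combined by sums, products and smooth outer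
  functions.\<close>

inductive_set list_alg :: "nat => (nat => 'e::euclidean_space set) => ('e list => real) set" for n S where
 slot: "i < n ==> smooth_on (S i) g ==> (%as. g (as!i)):list_alg n S"
| const: "(%as. c):list_alg n S"
| add: "f:list_alg n S ==> g:list_alg n S ==> (%as. f as+g as):list_alg n S"
| mult: "f:list_alg n S ==> g:list_alg n S ==> (%as. f as*g as):list_alg n S"
| comp: "list_smooth_on k {rs. length rs = k} f ==> (!!l. l < k ==> ps l:list_alg n S) ==>
  (%as. f (map (%l. ps l as) [0..<k])):list_alg n S"

lemma list_alg_sum: "(!!i. i:I ==> f i:list_alg n S) ==> (%x. \<Sum>i\<in>I. f i x):list_alg n S"
proof (induction I rule: infinite_finite_induct)
 case (insert i I) thus ?case using list_alg.add[of "f i" n S "%x. \<Sum>i\<in>I. f i x"] by auto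
qed (auto intro: list_alg.const)

lemma list_alg_prod: "(!!i. i:I ==> f i:list_alg n S) ==> (%x. \<Prod>i\<in>I. f i x):list_alg n S"
proof (induction I rule: infinite_finite_induct)
 case (insert i I) thus ?case using list_alg.mult[of "f i" n S "%x. \<Prod>i\<in>I. f i x"] by auto
qed (auto intro: list_alg.const)

lemma list_alg_deriv:
 fixes S :: "nat => 'e::euclidean_space set"
 assumes "f:list_alg n S"
 shows "EX f'. (ALL as:(lbox_on n S). list_has_deriv f (f' as) as) &
  (ALL i<n. ALL u. EX g:list_alg n S. ALL as:(lbox_on n S). f' as!i \<bullet> u = g as)"
 using assms
proof induction
 case (slot i g)
 let ?f' = "%as. map (%j. if j = i then gvec (fder g (as!i)) else 0) [0..<length as]"
 have D: "(g has_derivative fder g (as!i)) (at (as!i))" if "length as = n & (ALL i<n. as!i:S i)" for as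
  using smooth_diff[OF slot(2)] slot(1) that by (intro frechetI) auto
 show ?case
 proof (intro exI[of _ ?f'] conjI ballI allI impI, goal_cases)
  case (1 as)
  thus ?case using slot(1) by (intro list_has_deriv_nth D) auto
 next
  case (2 j u)
  show ?case
  proof (cases "j = i")
   case True
   show ?thesis
   proof (intro bexI[of _ "%as. fder g (as!i) u"] ballI)
    fix as assume as: "as:(lbox_on n S)"
    hence "gvec (fder g (as!i)) \<bullet> u = fder g (as!i) u"
     by (intro gvec_inner[OF has_derivative_linear[OF D]]) simp
    thus "?f' as!j \<bullet> u = fder g (as!i) u"
     using as True 2 by simp
   next
    show "(%as. fder g (as!i) u):list_alg n S"
     by (rule list_alg.slot[where g="%x. fder g x u" and i=i and S=S and n=n, OF slot(1)]) (rule smooth_on_frechet[OF slot(2)])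
   qed
  next
   case False
   thus ?thesis using 2 by (intro bexI[of _ "%as. 0"] list_alg.const) simp
  qed
 qed
next
 case (const c)
 show ?case
 proof (intro exI[of _ "%as. replicate (length as) 0"] conjI ballI allI impI, goal_cases)
  case 1 show ?case by (rule list_has_deriv_const)
 next
  case 2 thus ?case by (intro bexI[of _ "%as. 0"] list_alg.const) simp
 qed
next
 case (add f g)
 then obtain f' g' where f': "ALL as:(lbox_on n S). list_has_deriv f (f' as) as"
   "ALL i<n. ALL u. EX g:list_alg n S. ALL as:(lbox_on n S). f' as!i \<bullet> u = g as"
  and g': "ALL as:(lbox_on n S). list_has_deriv g (g' as) as"
   "ALL i<n. ALL u. EX h:list_alg n S. ALL as:(lbox_on n S). g' as!i \<bullet> u = h as" by blast
 show ?case
 proof (intro exI[of _ "%as. map (%i. f' as!i+g' as!i) [0..<length as]"] conjI ballI allI impI, goal_cases)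
  case (1 as) thus ?case using f'(1) g'(1) by (intro list_has_deriv_add) auto
 next
  case (2 i u)
  obtain p q where "p:list_alg n S" "ALL as:(lbox_on n S). f' as!i \<bullet> u = p as"
    "q:list_alg n S" "ALL as:(lbox_on n S). g' as!i \<bullet> u = q as"
   using f'(2) g'(2) 2 by meson
  thus ?case using 2
   by (intro bexI[of _ "%as. p as+q as"] list_alg.add ballI) (simp_all add: inner_add_left)
 qed
next
 case (mult f g)
 then obtain f' g' where f': "ALL as:(lbox_on n S). list_has_deriv f (f' as) as"
   "ALL i<n. ALL u. EX g:list_alg n S. ALL as:(lbox_on n S). f' as!i \<bullet> u = g as"
  and g': "ALL as:(lbox_on n S). list_has_deriv g (g' as) as"
   "ALL i<n. ALL u. EX h:list_alg n S. ALL as:(lbox_on n S). g' as!i \<bullet> u = h as" by blast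
 show ?case
 proof (intro exI[of _ "%as. map (%i. g as *R f' as!i+f as *R g' as!i) [0..<length as]"] conjI ballI allI impI, goal_cases)
  case (1 as) thus ?case using f'(1) g'(1) by (intro list_has_deriv_mult) auto
 next
  case (2 i u)
  obtain p q where "p:list_alg n S" "ALL as:(lbox_on n S). f' as!i \<bullet> u = p as"
    "q:list_alg n S" "ALL as:(lbox_on n S). g' as!i \<bullet> u = q as"
   using f'(2) g'(2) 2 by meson
  thus ?case using 2 mult(1,2)
   by (intro bexI[of _ "%as. g as*p as+f as*q as"] list_alg.add list_alg.mult ballI) (simp_all add: inner_add_left)
 qed
next
 case (comp k f ps)
 let ?S = "(lbox_on n S)"
 have "ALL l:{..<k}. EX f'. (ALL as:?S. list_has_deriv (ps l) (f' as) as) & (ALL i<n. ALL u. EX g:list_alg n S. ALL as:?S. f' as!i \<bullet> u = g as)"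
  using comp.IH by simp
 from bchoice[OF this] obtain ps' where P: "ALL l:{..<k}. (ALL as:?S. list_has_deriv (ps l) (ps' l as) as) & (ALL i<n. ALL u. EX g:list_alg n S. ALL as:?S. ps' l as!i \<bullet> u = g as)" ..
 have ps'1: "list_has_deriv (ps l) (ps' l as) as" if "l < k" "as:?S" for l as
  using bspec[OF P, of l] that by simp
 have ps'2: "EX g:list_alg n S. ALL as:?S. ps' l as!i \<bullet> u = g as" if "l < k" "i < n" for l i u
  using bspec[OF P, of l] that by simp
 let ?p = "%as. map (%l. ps l as) [0..<k]"
 show ?case
 proof (intro exI[of _ "%as. map (%i. \<Sum>l<k. list_grad f (?p as)!l *R (ps' l as!i)) [0..<length as]"] conjI ballI allI impI, goal_cases)
  case (1 as) thus ?case
   by (intro list_has_deriv_comp[OF list_smooth_on_has_deriv[OF comp(1)] ps'1]) auto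
 next
  case (2 i u)
  have "ALL l:{..<k}. EX g. g:list_alg n S & (ALL as:?S. ps' l as!i \<bullet> u = g as)"
   using ps'2[OF _ 2(1), of _ u] unfolding Bex_def[symmetric] by simp
  from bchoice[OF this] obtain g where G: "ALL l:{..<k}. g l:list_alg n S & (ALL as:?S. ps' l as!i \<bullet> u = g l as)" ..
  have g: "g l:list_alg n S" if "l < k" for l using bspec[OF G, of l] that by simp
  have g2: "ps' l as!i \<bullet> u = g l as" if "l < k" "as:?S" for l as using bspec[OF G, of l] that by simp
  \<comment> \<open>Partial derivatives of \<open>f\<close> are written as
    \<open>list_iter_deriv f [(l, 1)]\<close>, which is smooth again, so the chain rule stays inside
    \<open>list_alg\<close>.\<close>
  have "(%as. \<Sum>l<k. list_iter_deriv f [(l, 1)] (?p as)*g l as):list_alg n S"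
  proof (rule list_alg_sum, rule list_alg.mult)
   fix l assume "l:{..<k}"
   hence l: "l < k" by simp
   show "g l:list_alg n S" by (rule g[OF l])
   have "list_smooth_on k {rs. length rs = k} (list_iter_deriv f [(l, 1)])"
    by (rule list_smooth_on_list_iter_deriv[OF comp(1)]) (simp add: l)
   thus "(%as. list_iter_deriv f [(l, 1)] (?p as)):list_alg n S"
    by (rule list_alg.comp) (rule comp(2))
  qed
  thus ?case
  proof (rule bexI[rotated], intro ballI)
   fix as assume as: "as:?S"
   have "(\<Sum>l<k. list_grad f (?p as)!l *R (ps' l as!i)) \<bullet> u = (\<Sum>l<k. list_iter_deriv f [(l, 1)] (?p as)*g l as)"
    using g2 as by (simp add: inner_sum_left)
   thus "map (%i. \<Sum>l<k. list_grad f (?p as)!l *R (ps' l as!i)) [0..<length as]!i \<bullet> u = (\<Sum>l<k. list_iter_deriv f [(l, 1)] (?p as)*g l as)"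
    using 2 as by simp
  qed
 qed
qed

lemma list_smooth_on_list_alg:
 fixes S :: "nat => 'e::euclidean_space set"
 assumes S: "!!i. i < n ==> open (S i)" and f: "f:list_alg n S"
 shows "list_smooth_on n (lbox_on n S) f"
proof (rule list_smooth_class[OF _ list_alg_deriv f])
 fix as :: "'e list" assume "as:(lbox_on n S)"
 hence as: "length as = n" "!!i. i < n ==> as!i:S i" by auto
 have "ALL i. EX e>0. i < n --> ball (as!i) e <= S i"
  using S as(2) open_contains_ball zero_less_one by metis
 then obtain e where e: "!!i. e i > 0" "!!i. i < n ==> ball (as!i) (e i) <= S i" by metis
 \<comment> \<open>The inserted 1 keeps the minimum defined for n = 0.\<close>
 let ?d = "Min (insert 1 (e ` {..<n}))"
 have "?d > 0" using e(1) by (subst Min_gr_iff) auto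
 moreover have "bs:(lbox_on n S)"
  if bs: "length bs = n" "ALL i<n. norm (bs!i-as!i) < ?d" for bs
 proof -
  have "bs!i:S i" if "i < n" for i
  proof -
   have "?d <= e i" using that by (intro Min_le) auto
   hence "dist (as!i) (bs!i) < e i" using bs(2) that by (auto simp: dist_norm norm_minus_commute)
   thus ?thesis using e(2)[OF that] by auto
  qed
  thus ?thesis using bs(1) by simp
 qed
 ultimately show "length as = n & (EX de>0. ALL bs. length bs = n & (ALL i<n. norm (bs!i-as!i) < de) -->
   bs:(lbox_on n S))"
  using as(1) by blast
qed

section \<open>Outer functions of cylinder functions\<close>

text \<open>The bounds on the value and on the gradient are the ones that enter the estimates below,
  and they pass to products by the Leibniz rule.\<close>

definition C1b :: "nat => (real list => real) => bool" where
 "C1b k f \<longleftrightarrow> list_smooth_on k {as. length as = k} f & (EX C. ALL as. length as = k --> abs (f as) <= C) &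
   (ALL l<k. EX C. ALL as. length as = k --> abs (list_grad f as!l) <= C)"

lemma C1b_bounded: "C1b k f ==> (!!C. (!!as. length as = k ==> abs (f as) <= C) ==> thesis) ==> thesis"
 unfolding C1b_def by blast

lemma C1b_grad_bounded:
 "C1b k f ==> l < k ==> (!!C. (!!as. length as = k ==> abs (list_grad f as!l) <= C) ==> thesis) ==> thesis"
 unfolding C1b_def by blast

lemma C1b_Cb_smooth:
 assumes "Cb_smooth k f"
 shows "C1b k f"
proof -
 have b: "bounded (list_iter_deriv f ds ` {as. length as = k})" if "fst ` set ds <= {..<k}" for ds
  using assms that by (simp add: Cb_smooth_def)
 have "bounded (f ` {as. length as = k})" using b[of "[]"] by simp
 moreover have "bounded ((%as. list_grad f as!l) ` {as. length as = k})" if "l < k" for l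
  using b[of "[(l, 1)]"] that by simp
 moreover have "EX C. ALL as. length as = k --> abs (g as) <= C" if "bounded (g ` {as. length as = k})" for g :: "real list => real"
  using that unfolding bounded_iff by auto
 moreover have "list_smooth_on k {as. length as = k} f" using assms unfolding Cb_smooth_def by (rule conjunct1)
 ultimately show ?thesis unfolding C1b_def by simp
qed

text \<open>The two factors of a product of cylinder functions are placed on disjoint blocks of one
  argument list; \<open>off\<close> is where a block begins.\<close>

lemma C1b_block:
 assumes f: "C1b k f" and n: "off+k <= n"
 defines "F \<equiv> %as. f (map (%l. as!(off+l)) [0..<k])"
 shows "F:list_alg n (%_. UNIV)"
  "EX F' B. ALL as. length as = n --> abs (F as) <= B & list_has_deriv F (F' as) as & (ALL i<n. abs (F' as!i) <= B)"
proof -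
 let ?p = "%as. map (%l. as!(off+l)) [0..<k]"
 let ?M = "%l as. map (%j. if j = off+l then gvec (%u. u) else 0) [0..<length as] :: real list"
 let ?F' = "%as. map (%i. \<Sum>l<k. list_grad f (?p as)!l *R (?M l as!i)) [0..<length as]"
 have sm: "list_smooth_on k {as. length as = k} f" using f by (simp add: C1b_def)
 have "smooth_on UNIV (%x::real. x)" using smooth_on_inner[of "1::real"] by (simp add: inner_real_def)
 thus "F:list_alg n (%_. UNIV)"
  unfolding F_def using n by (intro list_alg.comp[OF sm] list_alg.slot[of _ n _ "%x. x"]) auto
 obtain B where B: "!!as. length as = k ==> abs (f as) <= B" using C1b_bounded[OF f] by blast
 have "ALL l. EX C. l < k --> (ALL as. length as = k --> abs (list_grad f as!l) <= C)" using f unfolding C1b_def by blast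
 then obtain C where C: "!!l as. l < k ==> length as = k ==> abs (list_grad f as!l) <= C l" by metis
 have "list_has_deriv F (?F' as) as" if "length as = n" for as
  unfolding F_def
 proof (rule list_has_deriv_comp)
  show "list_has_deriv f (list_grad f (?p as)) (?p as)" by (rule list_smooth_on_has_deriv[OF sm]) simp
  show "list_has_deriv (%as. as!(off+l)) (?M l as) as" if "l < k" for l
   by (rule list_has_deriv_nth[where g="%r. r"]) (use that \<open>length as = n\<close> n in auto)
 qed
 moreover have "abs (?F' as!i) <= max B (\<Sum>l<k. C l)" if "length as = n" "i < n" for as i
 proof -
  have "abs (\<Sum>l<k. list_grad f (?p as)!l *R (?M l as!i)) <= (\<Sum>l<k. C l)"
  proof (rule order_trans[OF sum_abs], rule sum_mono)
   fix l assume "l:{..<k}"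
   hence "abs (list_grad f (?p as)!l) <= C l" using C by simp
   thus "abs (list_grad f (?p as)!l *R (?M l as!i)) <= C l" using that by (auto simp: gvec_def)
  qed
  thus ?thesis using that by simp
 qed
 moreover have "abs (F as) <= max B (\<Sum>l<k. C l)" for as unfolding F_def using B[of "?p as"] by simp
 ultimately show "EX F' B. ALL as. length as = n --> abs (F as) <= B & list_has_deriv F (F' as) as & (ALL i<n. abs (F' as!i) <= B)"
  by (intro exI[of _ ?F'] exI[of _ "max B (\<Sum>l<k. C l)"] allI impI conjI)
qed

lemma C1b_mult:
 assumes f: "C1b k f" and g: "C1b m g"
 shows "C1b (k+m) (%as. f (map (%l. as!(0+l)) [0..<k])*g (map (%l. as!(k+l)) [0..<m]))"
proof -
 let ?n = "k+m" let ?F = "%as. f (map (%l. as!(0+l)) [0..<k])" let ?G = "%as. g (map (%l. as!(k+l)) [0..<m])"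
 have n: "0+k <= ?n" "k+m <= ?n" by simp_all
 obtain F' B where F: "!!as. length as = ?n ==> abs (?F as) <= B & list_has_deriv ?F (F' as) as & (ALL i<?n. abs (F' as!i) <= B)"
  using C1b_block(2)[OF f n(1)] by blast
 obtain G' C where G: "!!as. length as = ?n ==> abs (?G as) <= C & list_has_deriv ?G (G' as) as & (ALL i<?n. abs (G' as!i) <= C)"
  using C1b_block(2)[OF g n(2)] by blast
 have "list_smooth_on ?n {as. length as = ?n & (ALL i<?n. as!i:UNIV)} (%as. ?F as*?G as)"
  by (intro list_smooth_on_list_alg list_alg.mult C1b_block(1) f g n) simp
 hence "list_smooth_on ?n {as. length as = ?n} (%as. ?F as*?G as)" by simp
 moreover have "abs (?F as*?G as) <= B*C" if "length as = ?n" for as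
  unfolding abs_mult using F[OF that] G[OF that] by (intro mult_mono) auto
 moreover have "abs (list_grad (%as. ?F as*?G as) as!l) <= C*B+B*C" if "l < ?n" "length as = ?n" for l as
 proof -
  have "list_grad (%as. ?F as*?G as) as!l = ?G as *R F' as!l+?F as *R G' as!l"
   unfolding list_grad_eqI[OF list_has_deriv_mult[OF conjunct1[OF conjunct2[OF F[OF that(2)]]] conjunct1[OF conjunct2[OF G[OF that(2)]]]]]
   using that by simp
  also have "abs ... <= abs (?G as)*abs (F' as!l)+abs (?F as)*abs (G' as!l)"
   unfolding abs_mult[symmetric] real_scaleR_def by (rule abs_triangle_ineq)
  also have "... <= C*B+B*C" using F[OF that(2)] G[OF that(2)] that(1) by (intro add_mono mult_mono) auto
  finally show ?thesis .
 qed
 ultimately show ?thesis unfolding C1b_def by blast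
qed

section \<open>Topologies and measures on lists\<close>

lemma space_borel_of [simp]: "space (borel_of T) = topspace T"
 unfolding borel_of_def by (rule space_measure_of) (auto dest: openin_subset)

lemma sets_borel_of: "sets (borel_of T) = sigma_sets (topspace T) {U. openin T U}"
 unfolding borel_of_def by (rule sets_measure_of) (auto dest: openin_subset)

lemma borel_of_openin: "openin T U ==> U:sets (borel_of T)"
 by (auto simp: sets_borel_of)

lemma borel_of_eu: "borel_of euclidean = (borel :: 'a::topological_space measure)"
 by (simp add: borel_of_def borel_def)

lemma borel_of_measurable:
 assumes "f:space M \<rightarrow> topspace T" "!!U. openin T U ==> f -` U Int space M:sets M"
 shows "f:M ->M borel_of T"
 unfolding borel_of_def
proof (rule measurable_measure_of)
 show "{U. openin T U} <= Pow (topspace T)" by (auto dest: openin_subset)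
 show "f -` A Int space M:sets M" if "A:{U. openin T U}" for A using that assms(2) by blast
qed (rule assms(1))

lemma continuous_map_measurable:
 assumes "continuous_map S T f"
 shows "f:borel_of S ->M borel_of T"
proof (rule borel_of_measurable)
 show "f:space (borel_of S) \<rightarrow> topspace T" using assms by (simp add: continuous_map_def)
 fix U assume "openin T U"
 hence "openin S {x:topspace S. f x:U}" using assms by (simp add: continuous_map_def)
 moreover have "f -` U Int space (borel_of S) = {x:topspace S. f x:U}" by auto
 ultimately show "f -` U Int space (borel_of S):sets (borel_of S)" by (simp add: borel_of_openin)
qed

definition lbox :: "'x set list => 'x list set" where
 "lbox Us = {ys. length ys = length Us & (ALL i<length Us. ys!i:Us!i)}"

abbreviation list_coords :: "'x list => nat \<times> (nat => 'x)" where
 "list_coords ys \<equiv> (length ys, \<lambda>i\<in>{..<length ys}. ys!i)"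

lemma topspace_list_topology [simp]: "topspace list_topology = UNIV"
 unfolding list_topology_def topspace_pullback_topology by (auto simp: PiE_def)

lemma openin_list_box:
 assumes "!!i. i < length Us ==> open (Us!i)"
 shows "openin list_topology (lbox Us)"
proof -
 let ?n = "length Us"
 let ?V = "{?n} \<times> PiE {..<?n} (%i. Us!i)"
 have "openin (sum_topology (%n. product_topology (%_. euclidean) {..<n}) UNIV) ?V"
  unfolding openin_sum_topology
 proof (intro conjI ballI)
  show "?V <= Sigma UNIV (topspace o (%n. product_topology (%_. euclidean) {..<n}))"
   by (auto simp: PiE_def)
  fix m :: nat
  have "{f. (m, f):?V} = (if m = ?n then PiE {..<?n} (%i. Us!i) else {})" by auto
  thus "openin (product_topology (%_. euclidean) {..<m}) {f. (m, f):?V}"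
   using assms by (auto simp: openin_PiE_gen intro: finite_subset[of _ "{..<?n}"])
 qed
 moreover have "lbox Us = list_coords -` ?V Int UNIV"
  unfolding lbox_def by (rule set_eqI) (auto simp: PiE_iff)
 ultimately show ?thesis unfolding list_topology_def openin_pullback_topology by blast
qed

lemma openin_list_topologyD:
 assumes W: "openin list_topology W" and ys: "ys:W"
 obtains Us where "!!U. U:set Us ==> open U" "ys:lbox Us" "lbox Us <= W"
proof -
 let ?n = "length ys"
 obtain V where V: "openin (sum_topology (%n. product_topology (%_. euclidean) {..<n}) UNIV) V"
   and WV: "W = list_coords -` V Int UNIV"
  using W unfolding list_topology_def openin_pullback_topology by blast
 have "openin (product_topology (%_. euclidean) {..<?n}) {f. (?n, f):V}"
  using V unfolding openin_sum_topology by blast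
 moreover have "(\<lambda>i\<in>{..<?n}. ys!i):{f. (?n, f):V}" using ys WV by simp
 ultimately obtain U where U: "ALL i:{..<?n}. openin euclidean (U i)" "(\<lambda>i\<in>{..<?n}. ys!i):Pi\<^sub>E {..<?n} U"
   "Pi\<^sub>E {..<?n} U <= {f. (?n, f):V}"
  unfolding openin_product_topology_alt by meson
 show ?thesis
 proof (rule that[of "map U [0..<?n]"])
  show "open V" if "V:set (map U [0..<?n])" for V using that U(1) by auto
  show "ys:lbox (map U [0..<?n])" using U(2) by (auto simp: lbox_def PiE_iff)
  show "lbox (map U [0..<?n]) <= W"
  proof
   fix zs assume zs: "zs:lbox (map U [0..<?n])"
   hence zn: "length zs = ?n" and P: "(\<lambda>i\<in>{..<?n}. zs!i):Pi\<^sub>E {..<?n} U" by (auto simp: lbox_def PiE_iff)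
   have "(?n, \<lambda>i\<in>{..<?n}. zs!i):V" using subsetD[OF U(3) P] by blast
   thus "zs:W" using WV zn by simp
  qed
 qed
qed

definition base_sets :: "'x::second_countable_topology set set" where
 "base_sets = (SOME B. countable B & topological_basis B)"

lemma base_sets: "countable (base_sets :: 'a::second_countable_topology set set)" "topological_basis (base_sets :: 'a set set)"
proof -
 have "EX B::'a set set. countable B & topological_basis B" using ex_countable_basis by blast
 from someI_ex[OF this] show "countable (base_sets :: 'a set set)" "topological_basis (base_sets :: 'a set set)"
  unfolding base_sets_def by auto
qed

lemma base_sets_open: "U:base_sets ==> open U"
 using base_sets(2) topological_basis_open by blast

lemma base_sets_nth_open: "Us:lists base_sets ==> i < length Us ==> open (Us!i)"
 by (rule base_sets_open) (simp add: lists_eq_set subset_iff)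

lemma base_sets_exists:
 assumes "open V" "x:V" obtains U where "U:base_sets" "x:U" "U <= V"
 by (rule topological_basisE[OF base_sets(2) assms]) (rule that)

text \<open>Lists over a countable base form a countable set, so open sets of tuples are countable
  unions of boxes. Measurability of maps into the tuple space is thereby reduced to boxes.\<close>

lemma openin_list_countable_boxes:
 fixes W :: "'x::second_countable_topology list set"
 assumes W: "openin list_topology W"
 shows "W = \<Union> (lbox ` {Us:lists base_sets. lbox Us <= W})"
proof (intro equalityI subsetI)
 fix ys assume ys: "ys:W"
 obtain Us where Us: "!!U. U:set Us ==> open U" "ys:lbox Us" "lbox Us <= W"
  using openin_list_topologyD[OF W ys] by blast
 have "ALL i:{..<length Us}. EX B. B:base_sets & ys!i:B & B <= Us!i"
 proof
  fix i assume "i:{..<length Us}"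
  hence "open (Us!i)" "ys!i:Us!i" using Us by (auto simp: lbox_def)
  thus "EX B. B:base_sets & ys!i:B & B <= Us!i" by (meson base_sets_exists)
 qed
 from bchoice[OF this] obtain B where B: "ALL i:{..<length Us}. B i:base_sets & ys!i:B i & B i <= Us!i" ..
 let ?Bs = "map B [0..<length Us]"
 have "?Bs:lists base_sets" "ys:lbox ?Bs" "lbox ?Bs <= lbox Us"
  using B Us(2) by (auto simp: lbox_def lists_eq_set)
 thus "ys:\<Union> (lbox ` {Us:lists base_sets. lbox Us <= W})" using Us(3) by blast
qed auto

lemma box_base_sets_borel: "Us:lists base_sets ==> openin list_topology (lbox Us)"
 by (rule openin_list_box) (rule base_sets_nth_open)

lemma measurable_list_borelI:
 fixes f :: "'a => 'x::second_countable_topology list"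
 assumes "!!Us. Us:lists base_sets ==> f -` lbox Us Int space M:sets M"
 shows "f:M ->M LB"
proof (rule borel_of_measurable)
 fix W :: "'x list set" assume W: "openin list_topology W"
 let ?J = "{Us:lists base_sets. lbox Us <= W}"
 have "countable ?J" by (rule countable_subset[OF _ countable_lists[OF base_sets(1)]]) auto
 hence "(\<Union>Us\<in>?J. f -` lbox Us Int space M):sets M"
  using assms by (intro sets.countable_UN'') auto
 moreover have "(\<Union>Us\<in>?J. f -` lbox Us Int space M) = f -` W Int space M"
  by (subst (2) openin_list_countable_boxes[OF W]) blast
 ultimately show "f -` W Int space M:sets M" by simp
qed simp

lemma measurable_list_borelI2:
 fixes f :: "'a => 'x::second_countable_topology list"
 assumes l: "!!n. {w:space M. length (f w) = n}:sets M"
  and c: "!!i U. open U ==> {w:space M. i < length (f w) & f w!i:U}:sets M"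
 shows "f:M ->M LB"
proof (rule measurable_list_borelI)
 fix Us :: "'x set list" assume Us: "Us:lists base_sets"
 have "{w:space M. length (f w) = length Us & (ALL i:{..<length Us}. i < length (f w) & f w!i:Us!i)}:sets M"
  by (intro sets.sets_Collect_conj sets.sets_Collect_finite_All l c base_sets_nth_open[OF Us]) auto
 moreover have "f -` lbox Us Int space M = {w:space M. length (f w) = length Us & (ALL i:{..<length Us}. i < length (f w) & f w!i:Us!i)}"
  by (auto simp: lbox_def)
 ultimately show "f -` lbox Us Int space M:sets M" by simp
qed

lemma list_borel_length: "{ys. length ys = n}:sets (LB :: 'x::second_countable_topology list measure)"
proof -
 have "{ys. length ys = n} = lbox (replicate n (UNIV :: 'x set))" by (auto simp: lbox_def)
 thus ?thesis by (auto intro!: borel_of_openin openin_list_box)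
qed

lemma measurable_length [measurable]:
 "length:(LB :: 'x::second_countable_topology list measure) ->M Cnt UNIV"
proof -
 have "length -` {n} Int space (LB :: 'x list measure) = {ys. length ys = n}" for n by auto
 thus ?thesis
  by (subst measurable_count_space_eq2_countable) (simp_all add: list_borel_length)
qed

lemma openin_nth:
 assumes "open U"
 shows "openin list_topology {ys. i < length ys & ys!i:U}"
proof (subst openin_subopen, intro ballI)
 fix ys assume ys: "ys:{ys. i < length ys & ys!i:U}"
 let ?Us = "map (%j. if j = i then U else UNIV) [0..<length ys]"
 have "openin list_topology (lbox ?Us)" using assms by (intro openin_list_box) auto
 moreover have "ys:lbox ?Us" "lbox ?Us <= {ys. i < length ys & ys!i:U}"
  using ys by (auto simp: lbox_def)
 ultimately show "EX T. openin list_topology T & ys:T & T <= {ys. i < length ys & ys!i:U}" by blast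
qed

lemma openin_length_less: "openin list_topology {ys. i < length ys}"
 using openin_nth[OF open_UNIV, of i] by simp

lemma openin_length_ge: "openin list_topology {ys :: 'a::topological_space list. length ys = n}"
proof -
 have "{ys :: 'a list. length ys = n} = lbox (replicate n UNIV)" by (auto simp: lbox_def)
 moreover have "openin list_topology (lbox (replicate n (UNIV :: 'a set)))" by (rule openin_list_box) simp
 ultimately show ?thesis by simp
qed

lemma openin_length_le: "openin list_topology {ys :: 'a::topological_space list. length ys <= i}"
proof -
 have "openin list_topology (\<Union>n\<in>{..i}. {ys :: 'a list. length ys = n})"
  by (rule openin_Union) (auto intro: openin_length_ge)
 moreover have "(\<Union>n\<in>{..i}. {ys :: 'a list. length ys = n}) = {ys. length ys <= i}" by auto
 ultimately show ?thesis by simp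
qed

lemma measurable_nth_default [measurable]:
 "(%ys. if i < length ys then ys!i else c):(LB :: 'x::second_countable_topology list measure) ->M borel"
proof (rule borel_measurableI)
 fix S :: "'x set" assume S: "open S"
 have "(%ys. if i < length ys then ys!i else c) -` S Int space LB =
   {ys. i < length ys & ys!i:S} Un (if c:S then {ys. length ys <= i} else {})" by (auto split: if_splits)
 also have "...:sets LB"
  using S by (auto intro!: borel_of_openin openin_nth openin_length_le)
 finally show "(%ys. if i < length ys then ys!i else c) -` S Int space LB:sets LB" .
qed

lemma nth_borel_sets:
 assumes "A:sets borel"
 shows "{ys. i < length ys & ys!i:A}:sets (LB :: 'x::second_countable_topology list measure)"
proof -
 have "{ys. i < length ys & ys!i:A} = (%ys. if i < length ys then ys!i else undefined) -` A Int space LB Int {ys. i < length ys}"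
  by auto
 also have "...:sets LB"
  using assms by (intro sets.Int measurable_sets[OF measurable_nth_default] borel_of_openin openin_length_less)
 finally show ?thesis .
qed

lemma measurable_list_sum_aux:
 fixes ph :: "'x::second_countable_topology => 'b::{second_countable_topology,topological_comm_monoid_add}"
 assumes ph: "ph:bm borel"
 shows "(%ys. \<Sum>i<n. if i < length ys then ph (ys!i) else 0):bm LB"
proof (rule borel_measurable_sum)
 fix i
 have "(%ys. if i < length ys then ph (if i < length ys then ys!i else undefined) else 0):bm LB"
  by (rule measurable_If) (use ph borel_of_openin[OF openin_length_less] in \<open>auto intro: meas_comp[OF measurable_nth_default]\<close>)
 thus "(%ys. if i < length ys then ph (ys!i) else 0):bm LB"
  by (simp cong: if_cong)
qed

text \<open>The number of summands varies with the list. Padding with zeros gives a sum of fixed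
  length \<open>n\<close>; substituting the countably valued \<open>length\<close> for
  \<open>n\<close> preserves measurability.\<close>

lemma measurable_list_sum:
 fixes ph :: "'x::second_countable_topology => 'b::{second_countable_topology,topological_comm_monoid_add}"
 assumes ph: "ph:bm borel"
 shows "(%ys. \<Sum>i<length ys. ph (ys!i)):bm LB"
proof -
 have "(%ys. (%n ys. \<Sum>i<n. if i < length ys then ph (ys!i) else 0) (length ys) ys):bm LB"
  by (rule measurable_compose_countable[OF measurable_list_sum_aux[OF ph] measurable_length])
 thus ?thesis by simp
qed

lemma hits_iff: "ys:hits B \<longleftrightarrow> (EX i<length ys. ys!i:B)"
proof -
 have "ys:hits B \<longleftrightarrow> (EX y. y:set ys & y:B)" unfolding hits_def by auto
 thus ?thesis by (auto simp: in_set_conv_nth)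
qed

lemma hits_sets: "B:sets borel ==> hits B:sets (LB :: 'x::second_countable_topology list measure)"
proof -
 assume "B:sets borel"
 hence "(\<Union>i. {ys. i < length ys & ys!i:B}):sets LB" by (intro sets.countable_UN'' nth_borel_sets) simp_all
 moreover have "(\<Union>i. {ys. i < length ys & ys!i:B}) = hits B" by (auto simp: hits_iff)
 ultimately show ?thesis by simp
qed

lemma list_singleton_sets: "{ys}:sets (LB :: 'x::{second_countable_topology,t2_space} list measure)"
proof -
 have "{ys} = {zs. length zs = length ys} Int (\<Inter>i\<in>{..<length ys}. {zs. length zs <= i} Un {zs. i < length zs & zs!i:{ys!i}})"
  by (auto intro: nth_equalityI)
 also have "...:sets LB"
 proof (cases "ys = []")
  case False
  thus ?thesis
   by (intro sets.Int list_borel_length sets.finite_INT sets.Un nth_borel_sets borel_of_openin openin_length_le) auto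
 qed (simp add: list_borel_length del: length_0_conv)
 finally show ?thesis .
qed

lemma list_continuous_measurable:
 fixes g :: "'x::second_countable_topology list => real"
 assumes "!!ys ep. ep > 0 ==> EX Us. (ALL U:set Us. open U) & ys:lbox Us & (ALL zs:lbox Us. abs (g zs-g ys) < ep)"
 shows "g:bm LB"
proof (rule borel_measurableI)
 fix S :: "real set" assume S: "open S"
 have "openin list_topology (g -` S)"
 proof (subst openin_subopen, intro ballI)
  fix ys assume ys: "ys:g -` S"
  obtain ep where ep: "ep > 0" "ball (g ys) ep <= S" using S ys open_contains_ball by blast
  obtain Us where Us: "ALL U:set Us. open U" "ys:lbox Us" "ALL zs:lbox Us. abs (g zs-g ys) < ep"
   using assms[OF ep(1)] by blast
  have "openin list_topology (lbox Us)" using Us(1) by (intro openin_list_box) auto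
  moreover have "lbox Us <= g -` S"
   using Us(3) ep(2) by (auto simp: subset_iff dist_real_def abs_minus_commute)
  ultimately show "EX T. openin list_topology T & ys:T & T <= g -` S" using Us(2) by blast
 qed
 thus "g -` S Int space LB:sets LB" by (simp add: borel_of_openin)
qed

section \<open>The marked space of centres with their clusters\<close>

lemma topspace_Z [simp]: "topspace Z_topology = UNIV"
 by simp

text \<open>Both factors have countable bases, so an open set of the product is a countable union of
  products of a base set with a box. Hence the Borel sets of the product topology and the product
  sigma-algebra coincide.\<close>

lemma sets_Z: "sets (borel_of (Z_topology :: ('x::second_countable_topology \<times> 'x list) topology)) = sets (borel XM LB)"
proof (intro equalityI)
 let ?Z = "Z_topology :: ('x \<times> 'x list) topology"
 have "fst:borel_of ?Z ->M borel" "snd:borel_of ?Z ->M LB"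
  using continuous_map_measurable[OF continuous_map_fst] continuous_map_measurable[OF continuous_map_snd]
  by (auto simp: borel_of_eu[symmetric])
 hence "(%z. (fst z, snd z)):borel_of ?Z ->M borel XM LB" by (rule measurable_Pair)
 hence id: "(%z. z):borel_of ?Z ->M borel XM LB" by simp
 show "sets (borel XM LB) <= sets (borel_of ?Z)"
 proof
  fix A :: "('x \<times> 'x list) set" assume A: "A:sets (borel XM LB)"
  show "A:sets (borel_of ?Z)" using measurable_sets[OF id A] by simp
 qed
 show "sets (borel_of ?Z) <= sets (borel XM LB)"
  unfolding sets_borel_of
 proof (rule sets.sigma_sets_subset')
  show "topspace ?Z:sets (borel XM LB)" using sets.top[of "borel XM LB"] by (simp add: space_pair_measure)
  show "{U. openin ?Z U} <= sets (borel XM LB)"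
  proof safe
   fix W assume W: "openin ?Z W"
   let ?J = "{(U, Us):base_sets \<times> lists base_sets. U \<times> lbox Us <= W}"
   have cJ: "countable ?J"
    by (rule countable_subset[OF _ countable_SIGMA[OF base_sets(1) countable_lists[OF base_sets(1)]]]) auto
   have "W = (\<Union>(U, Us)\<in>?J. U \<times> lbox Us)"
   proof (intro equalityI subsetI)
    fix z assume z: "z:W"
    obtain x ys where xy: "z = (x, ys)" by (cases z)
    obtain A C where AC: "open A" "openin list_topology C" "x:A" "ys:C" "A \<times> C <= W"
    proof -
     have "(x, ys):W" using z xy by simp
     hence "EX A C. openin euclidean A & openin list_topology C & x:A & ys:C & A \<times> C <= W"
      using W unfolding openin_prod_topology_alt by blast
     thus ?thesis using that by auto
    qed
    obtain U where U: "U:base_sets" "x:U" "U <= A" using base_sets_exists[OF AC(1,3)] by blast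
    obtain Us where Us: "Us:lists base_sets" "lbox Us <= C" "ys:lbox Us"
     using openin_list_countable_boxes[OF AC(2)] AC(4) by blast
    have "U \<times> lbox Us <= W" using U Us AC(5) by blast
    hence "(U, Us):?J" using U Us by simp
    moreover have "z:U \<times> lbox Us" using U Us xy by simp
    ultimately show "z:(\<Union>(U, Us)\<in>?J. U \<times> lbox Us)" by blast
   qed auto
   also have "...:sets (borel XM LB)"
   proof (rule sets.countable_UN''[OF cJ])
    fix p assume "p:?J"
    thus "(case p of (U, Us) => U \<times> lbox Us):sets (borel XM LB)"
     by (auto intro!: pair_measureI borel_of_openin box_base_sets_borel borel_open base_sets_open)
   qed
   finally show "W:sets (borel XM LB)" .
  qed
 qed
qed

lemma Z_singleton_sets: "{z}:sets (borel_of (Z_topology :: ('x::{second_countable_topology,t2_space} \<times> 'x list) topology))"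
proof -
 have "{fst z} \<times> {snd z}:sets (borel XM (LB :: 'x list measure))"
  by (rule pair_measureI[OF _ list_singleton_sets]) auto
 thus ?thesis unfolding sets_Z by simp
qed

lemma measurable_tabulate:
 "(%f. map f [0..<n]):(\<Pi>\<^sub>M i\<in>{..<n}. (borel :: 'x::second_countable_topology measure)) ->M LB"
proof (rule measurable_list_borelI2)
 let ?P = "\<Pi>\<^sub>M i\<in>{..<n}. (borel :: 'x measure)"
 show "{w:space ?P. length (map w [0..<n]) = m}:sets ?P" for m by (cases "m = n") auto
 fix i and U :: "'x set" assume U: "open U"
 show "{w:space ?P. i < length (map w [0..<n]) & map w [0..<n]!i:U}:sets ?P"
 proof (cases "i < n")
  case True
  hence "{w:space ?P. i < length (map w [0..<n]) & map w [0..<n]!i:U} = (%w. w i) -` U Int space ?P" by auto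
  also have "...:sets ?P" using True U by (intro measurable_sets[OF measurable_component_singleton]) auto
  finally show ?thesis .
 qed simp
qed

section \<open>Compact sets of tuples\<close>

lemma closedin_list_bounded:
 assumes "closed K"
 shows "closedin list_topology {ys. length ys <= n & set ys <= K}"
proof -
 have "UNIV-{ys. length ys <= n & set ys <= K} = {ys. n < length ys} Un (\<Union>i. {ys. i < length ys & ys!i:- K})"
  by (auto simp: in_set_conv_nth dest: nth_mem)
 moreover have "openin list_topology ({ys. n < length ys} Un (\<Union>i. {ys. i < length ys & ys!i:- K}))"
  by (intro openin_Un openin_length_less openin_Union ballI) (use openin_nth[OF open_Compl[OF assms]] in blast)
 ultimately show ?thesis by (simp add: closedin_def)
qed

text \<open>For each length the set is a continuous image of a power of \<open>K\<close>, and
  finitely many lengths are involved. The two bounds, on the length and on the entries, are those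
  that \<open>cutfun\<close> enforces later.\<close>

lemma compactin_list_bounded:
 assumes "compact (K :: 'x::t2_space set)"
 shows "compactin list_topology {ys. length ys <= n & set ys <= K}"
proof -
 have c: "continuous_map (product_topology (%_. euclidean) {..<m}) list_topology (%f. map f [0..<m] :: 'x list)" for m
  unfolding list_topology_def
 proof (rule continuous_map_pullback')
  show "continuous_map (product_topology (%_. euclidean) {..<m}) (sum_topology (%n. product_topology (%_. euclidean) {..<n}) UNIV)
    (list_coords o (%f. map f [0..<m] :: 'x list))"
  proof (rule continuous_map_eq[OF continuous_map_component_injection[of m]])
   fix f :: "nat => 'x" assume "f:topspace (product_topology (%_. euclidean) {..<m})"
   thus "(m, f) = (list_coords o (%f. map f [0..<m])) f"
    by (auto simp: fun_eq_iff PiE_def extensional_def)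
  qed simp
 qed simp
 have im: "{ys. length ys = m & set ys <= K} = (%f. map f [0..<m]) ` PiE {..<m} (%_. K)" for m
 proof (intro equalityI subsetI)
  fix ys assume ys: "ys:{ys. length ys = m & set ys <= K}"
  hence "ys = map (\<lambda>i\<in>{..<m}. ys!i) [0..<m]" by (intro nth_equalityI) auto
  moreover have "(\<lambda>i\<in>{..<m}. ys!i):PiE {..<m} (%_. K)" using ys by (auto simp: subset_iff)
  ultimately show "ys:(%f. map f [0..<m]) ` PiE {..<m} (%_. K)" by (rule image_eqI)
 next
  fix ys assume "ys:(%f. map f [0..<m]) ` PiE {..<m} (%_. K)"
  then obtain f where f: "ys = map f [0..<m]" "f:PiE {..<m} (%_. K)" by (rule imageE)
  have "f i:K" if "i < m" for i using PiE_mem[OF f(2), of i] that by simp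
  thus "ys:{ys. length ys = m & set ys <= K}" using f(1) by auto
 qed
 have "compactin (product_topology (%_. euclidean) {..<m}) (PiE {..<m} (%_. K))" for m
  by (rule compactin_PiE[THEN iffD2], rule disjI2) (simp add: assms)
 hence "compactin list_topology {ys. length ys = m & set ys <= K}" for m
  unfolding im by (rule image_compactin[OF _ c])
 hence "compactin list_topology (\<Union>m\<in>{..n}. {ys. length ys = m & set ys <= K})"
  by (intro compactin_Union) auto
 moreover have "(\<Union>m\<in>{..n}. {ys. length ys = m & set ys <= K}) = {ys. length ys <= n & set ys <= K}" by auto
 ultimately show ?thesis by simp
qed

lemma compactin_closure_list_bounded:
 assumes K: "compact (K :: 'x::t2_space set)" and S: "S <= {ys. length ys <= n & set ys <= K}"
 shows "compactin list_topology (list_topology closure_of S)"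
proof (rule closed_compactin[OF compactin_list_bounded[OF K]])
 show "list_topology closure_of S <= {ys. length ys <= n & set ys <= K}"
  by (rule closure_of_minimal[OF S closedin_list_bounded[OF compact_imp_closed[OF K]]])
qed simp

section \<open>Product measures on tuples and their null sets\<close>

text \<open>This is the body of \<open>list_volume\<close> with an arbitrary measure in place of the
  Riemannian volume.\<close>

definition tuple_measure :: "'x::topological_space measure => 'x list measure" where
 "tuple_measure V = measure_of UNIV (sets LB)
   (%B. \<Sum>n. em (distr (PiM {..<n} (%_. V)) LB (%f. map f [0..<n])) B)"

lemma sets_tuple_measure [simp, measurable_cong]: "sets (tuple_measure V) = sets LB"
 unfolding tuple_measure_def using sets.sets_measure_of_eq[of LB] by simp

lemma space_tuple_measure [simp]: "space (tuple_measure V) = UNIV"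
 using sets_eq_imp_space_eq[OF sets_tuple_measure] by simp

lemma emeasure_tuple_measure:
 fixes V :: "'x::second_countable_topology measure"
 assumes V: "sets V = sets borel" and A: "A:sets LB"
 shows "em (tuple_measure V) A =
  (\<Sum>n. em (PiM {..<n} (%_. V)) ((%f. map f [0..<n]) -` A Int space (PiM {..<n} (%_. V))))"
proof -
 let ?D = "%n. distr (PiM {..<n} (%_. V)) LB (%f. map f [0..<n])"
 have m: "(%f. map f [0..<n]):PiM {..<n} (%_. V) ->M LB" for n
  using measurable_tabulate[of n] V by (simp cong: meas_cong sets_PiM_cong)
 have "em (tuple_measure V) A = (\<Sum>n. em (?D n) A)"
 proof (rule emeasure_measure_of[OF tuple_measure_def])
  show "countably_additive (sets (tuple_measure V)) (%B. \<Sum>n. em (?D n) B)"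
  proof (rule countably_additiveI)
   fix F :: "nat => 'x list set" assume F: "range F <= sets (tuple_measure V)" "disjoint_family F"
   have "(\<Sum>i. \<Sum>n. em (?D n) (F i)) = (NI (Cnt UNIV) (%i. (\<Sum>n. em (?D n) (F i))))"
    by (simp add: nn_integral_count_space_nat)
   also have "... = (\<Sum>n. \<integral>\<^sup>+i. em (?D n) (F i) \<partial>Cnt UNIV)"
    by (rule nn_integral_suminf) simp
   also have "... = (\<Sum>n. em (?D n) (\<Union>i. F i))"
   proof (rule suminf_cong)
    fix n
    show "(NI (Cnt UNIV) (%i. em (?D n) (F i))) = em (?D n) (\<Union>i. F i)"
     unfolding nn_integral_count_space_nat using F by (intro suminf_emeasure) auto
   qed
   finally show "(\<Sum>i. \<Sum>n. em (?D n) (F i)) = (\<Sum>n. em (?D n) (\<Union>i. F i))" .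
  qed
 qed (use A in \<open>auto simp: positive_def\<close>)
 also have "... = (\<Sum>n. em (PiM {..<n} (%_. V)) ((%f. map f [0..<n]) -` A Int space (PiM {..<n} (%_. V))))"
  by (intro suminf_cong emeasure_distr m A)
 finally show ?thesis .
qed

lemma box_borel_sets:
 assumes "!!i. i < length Us ==> Us!i:sets (borel :: 'x::second_countable_topology measure)"
 shows "lbox Us:sets LB"
proof (cases "Us = []")
 case True
 hence "lbox Us = {ys. length ys = 0}" by (auto simp: lbox_def)
 thus ?thesis using list_borel_length by metis
next
 case False
 have "lbox Us = {ys. length ys = length Us} Int (\<Inter>i\<in>{..<length Us}. {ys. length ys <= i} Un {ys. i < length ys & ys!i:Us!i})"
  by (auto simp: lbox_def)
 also have "...:sets LB"
  using False assms by (intro sets.Int list_borel_length sets.finite_INT sets.Un nth_borel_sets borel_of_openin openin_length_le) auto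
 finally show ?thesis .
qed

lemma emeasure_tuple_measure_box:
 fixes V :: "'x::second_countable_topology measure"
 assumes V: "sets V = sets borel" "sigma_finite_measure V"
  and Us: "!!i. i < length Us ==> Us!i:sets borel"
 shows "em (tuple_measure V) (lbox Us) = (\<Prod>i<length Us. em V (Us!i))"
proof -
 interpret product_sigma_finite "%_::nat. V" using V(2) by (simp add: product_sigma_finite_def)
 let ?n = "length Us"
 have sp: "space V = UNIV" using sets_eq_imp_space_eq[OF V(1)] by simp
 have "em (tuple_measure V) (lbox Us) =
  (\<Sum>n. em (PiM {..<n} (%_. V)) ((%f. map f [0..<n]) -` lbox Us Int space (PiM {..<n} (%_. V))))"
  by (rule emeasure_tuple_measure[OF V(1) box_borel_sets[OF Us]])
 also have "... = (\<Sum>n\<in>{?n}. em (PiM {..<n} (%_. V)) ((%f. map f [0..<n]) -` lbox Us Int space (PiM {..<n} (%_. V))))"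
 proof (rule suminf_finite)
  fix n assume "n ~: {?n}"
  hence "(%f. map f [0..<n]) -` lbox Us = {}" by (auto simp: lbox_def)
  thus "em (PiM {..<n} (%_. V)) ((%f. map f [0..<n]) -` lbox Us Int space (PiM {..<n} (%_. V))) = 0"
   by simp
 qed simp
 also have "... = em (PiM {..<?n} (%_. V)) (PiE {..<?n} (%i. Us!i))"
 proof -
  have "(%f. map f [0..<?n]) -` lbox Us Int space (PiM {..<?n} (%_. V)) = PiE {..<?n} (%i. Us!i)"
   by (auto simp: lbox_def space_PiM sp PiE_iff)
  thus ?thesis by simp
 qed
 also have "... = (\<Prod>i<?n. em V (Us!i))"
  using Us V(1) by (intro emeasure_PiM) auto
 finally show ?thesis .
qed

lemma tuple_measure_hits_point:
 fixes V :: "'x::{second_countable_topology,t2_space} measure"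
 assumes V: "sets V = sets borel" "sigma_finite_measure V" and z: "em V {z} = 0"
 shows "em (tuple_measure V) (hits {z}) = 0"
proof -
 interpret product_sigma_finite "%_::nat. V" using V(2) by (simp add: product_sigma_finite_def)
 have sp: "space V = UNIV" using sets_eq_imp_space_eq[OF V(1)] by simp
 have "em (PiM {..<n} (%_. V)) ((%f. map f [0..<n]) -` hits {z} Int space (PiM {..<n} (%_. V))) = 0" for n
 proof -
  have "(%f. map f [0..<n]) -` hits {z} Int space (PiM {..<n} (%_. V)) = (\<Union>i\<in>{..<n}. PiE {..<n} (%j. if j = i then {z} else UNIV))"
   by (auto simp: hits_def space_PiM sp PiE_iff image_iff split: if_splits)
  moreover have "PiE {..<n} (%j. if j = i then {z} else UNIV):null_sets (PiM {..<n} (%_. V))" if "i < n" for i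
  proof
   show "PiE {..<n} (%j. if j = i then {z} else UNIV):sets (PiM {..<n} (%_. V))"
    using V(1) by (intro sets_PiM_I_finite) auto
   have "em (PiM {..<n} (%_. V)) (PiE {..<n} (%j. if j = i then {z} else UNIV)) = (\<Prod>j<n. em V (if j = i then {z} else UNIV))"
    using V(1) by (intro emeasure_PiM) auto
   also have "... = 0" using that z by (intro prod_zero) auto
   finally show "em (PiM {..<n} (%_. V)) (PiE {..<n} (%j. if j = i then {z} else UNIV)) = 0" .
  qed
  ultimately show ?thesis by (auto intro!: null_setsD1 null_sets.finite_UN)
 qed
 moreover have "hits {z}:sets LB" by (rule hits_sets) simp
 ultimately show ?thesis by (simp add: emeasure_tuple_measure[OF V(1)])
qed

lemma not_distinct_iff: "~ distinct ys \<longleftrightarrow> (EX i<length ys. EX j<i. ys!i = ys!j)"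
 unfolding distinct_conv_nth by (metis nat_neq_iff order.strict_trans)

lemma not_distinct_sets: "{ys. ~ distinct ys}:sets (LB :: 'x::{second_countable_topology,t2_space} list measure)"
proof -
 let ?D = "{p :: 'x \<times> 'x. fst p = snd p}"
 have "closed ?D" by (rule closed_Collect_eq) (auto intro!: continuous_intros)
 from borel_closed[OF this] have D: "?D:sets (borel XM borel)" unfolding borel_prod .
 have m: "(%ys. (if i < length ys then ys!i else undefined, if j < length ys then ys!j else undefined))
   : (LB :: 'x list measure) ->M borel XM borel" for i j
  by measurable
 have "{ys. ~ distinct ys} = (\<Union>i. \<Union>j\<in>{..<i}. {ys. i < length ys} Int
   ((%ys. (if i < length ys then ys!i else undefined, if j < length ys then ys!j else undefined)) -` ?D Int space LB))"
  by (rule set_eqI) (auto simp: not_distinct_iff)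
 also have "...:sets LB"
  by (intro sets.countable_UN'' sets.Int measurable_sets[OF m D] borel_of_openin openin_length_less) auto
 finally show ?thesis .
qed

text \<open>Diagonals are null by Fubini: once the other coordinates are fixed, coordinate
  \<open>i\<close> has to hit the single point \<open>f j\<close>.\<close>

lemma tuple_measure_not_distinct:
 fixes V :: "'x::{second_countable_topology,t2_space} measure"
 assumes V: "sets V = sets borel" "sigma_finite_measure V" and z: "!!z. em V {z} = 0"
 shows "em (tuple_measure V) {ys. ~ distinct ys} = 0"
proof -
 interpret product_sigma_finite "%_::nat. V" using V(2) by (simp add: product_sigma_finite_def)
 have sp: "space V = UNIV" using sets_eq_imp_space_eq[OF V(1)] by simp
 let ?D = "{p :: 'x \<times> 'x. fst p = snd p}"
 have "closed ?D" by (rule closed_Collect_eq) (auto intro!: continuous_intros)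
 from borel_closed[OF this] have "?D:sets (borel XM borel)" unfolding borel_prod .
 hence D: "?D:sets (V XM V)" unfolding sets_pair_measure_cong[OF V(1) V(1)] .
 have nul: "{f:space (PiM {..<n} (%_. V)). f i = f j}:null_sets (PiM {..<n} (%_. V))" if ij: "i < n" "j < n" "i ~= j" for n i j :: nat
 proof
  let ?P = "PiM {..<n} (%_. V)" and ?I = "{..<n}-{i}"
  have ins: "insert i ?I = {..<n}" using ij by auto
  have m: "(%f. (f i, f j)):?P ->M V XM V" using ij by (intro measurable_Pair measurable_component_singleton) auto
  have e: "{f:space ?P. f i = f j} = (%f. (f i, f j)) -` ?D Int space ?P" by auto
  show S: "{f:space ?P. f i = f j}:sets ?P" unfolding e by (rule measurable_sets[OF m D])
  have "em ?P {f:space ?P. f i = f j} = (NI ?P (%f. Ind {f:space ?P. f i = f j} f))"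
   using S by simp
  also have "... = (NI (PiM ?I (%_. V)) (%f. (NI V (%x. Ind {f:space ?P. f i = f j} (f(i:=x))))))"
   using product_nn_integral_insert[of ?I i "Ind {f:space ?P. f i = f j}"] S unfolding ins by simp
  also have "... = (NI (PiM ?I (%_. V)) (%f. 0))"
  proof (rule nn_integral_cong)
   fix f assume "f:space (PiM ?I (%_. V))"
   have "(NI V (%x. Ind {f:space ?P. f i = f j} (f(i:=x)))) <= (NI V (%x. Ind {f j} x))"
    using ij(3) by (intro nn_integral_mono) (auto split: split_indicator)
   also have "... = 0" using V(1) z by simp
   finally show "(NI V (%x. Ind {f:space ?P. f i = f j} (f(i:=x)))) = 0" by simp
  qed
  finally show "em ?P {f:space ?P. f i = f j} = 0" by simp
 qed
 have "em (PiM {..<n} (%_. V)) ((%f. map f [0..<n]) -` {ys. ~ distinct ys} Int space (PiM {..<n} (%_. V))) = 0" for n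
 proof -
  have e: "~ distinct (map f [0..<n]) \<longleftrightarrow> (EX i<n. EX j<i. f i = f j)" for f :: "nat => 'x"
   by (simp add: not_distinct_iff cong: conj_cong)
  have "(%f. map f [0..<n]) -` {ys. ~ distinct ys} Int space (PiM {..<n} (%_. V))
    = (\<Union>i\<in>{..<n}. \<Union>j\<in>{..<i}. {f:space (PiM {..<n} (%_. V)). f i = f j})"
   unfolding vimage_def mem_Collect_eq e by blast
  moreover have "(\<Union>i\<in>{..<n}. \<Union>j\<in>{..<i}. {f:space (PiM {..<n} (%_. V)). f i = f j}):null_sets (PiM {..<n} (%_. V))"
   by (intro null_sets_UN' nul) auto
  ultimately show ?thesis by (simp only: null_setsD1)
 qed
 thus ?thesis unfolding emeasure_tuple_measure[OF V(1) not_distinct_sets] by (simp only: suminf_zero)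
qed

section \<open>Measurable enumeration of the points of a configuration\<close>

lemma space_count_algebra [simp]: "space (count_algebra T \<Omega>) = \<Omega>"
proof -
 have "sets (borel_of T) ~= {}" using sets.empty_sets by blast
 thus ?thesis unfolding count_algebra_def space_Sup_eq_UN by simp
qed

lemma count_em_meas [measurable (raw)]:
 assumes "B:sets (borel_of T)"
 shows "(%ga. em ga B):bm (count_algebra T \<Omega>)"
 unfolding count_algebra_def
 by (rule measurable_SUP1[OF assms]) (auto intro!: measurable_vimage_algebra1)

lemma count_algebraI:
 assumes "!!w. w:space M ==> f w:\<Omega>"
  and "!!B. B:sets (borel_of T) ==> (%w. em (f w) B):bm M"
 shows "f:M ->M count_algebra T \<Omega>"
 unfolding count_algebra_def
proof (rule measurable_SUP2)
 show "sets (borel_of T) ~= {}" using sets.empty_sets by blast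
 show "f:M ->M vimage_algebra \<Omega> (%ga. em ga B) borel" if "B:sets (borel_of T)" for B
  using assms that by (intro measurable_vimage_algebra2) auto
qed simp

text \<open>Induction over \<open>f\<close>: on indicators this is measurability of counts, and
  sums, multiples and increasing limits preserve it. Configurations may have infinite mass, so the
  members of the family are arbitrary measures.\<close>

lemma measurable_count_nn_integral:
 assumes f: "f:bm (borel_of T)" and \<Omega>: "!!ga. ga:\<Omega> ==> sets ga = sets (borel_of T)"
 shows "(%ga. integral\<^sup>N ga f):bm (count_algebra T \<Omega>)" (is "_:?B")
 using f
proof induct
 have sp: "ga:\<Omega> ==> space ga = topspace T" for ga using sets_eq_imp_space_eq[OF \<Omega>] by simp
 have me: "ga:\<Omega> ==> bm ga = bm (borel_of T)" for ga
  by (rule meas_cong[OF \<Omega> refl])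
 {
  case (cong f g)
  moreover have "(%M'. \<integral>\<^sup>+M''. f M'' \<partial>M'):?B \<longleftrightarrow> (%M'. \<integral>\<^sup>+M''. g M'' \<partial>M'):?B"
   by (intro measurable_cong nn_integral_cong cong) (simp add: sp)
  ultimately show ?case by simp
 next
  case (set B)
  hence "(%M'. \<integral>\<^sup>+M''. Ind B M'' \<partial>M'):?B \<longleftrightarrow> (%M'. em M' B):?B"
   by (intro measurable_cong nn_integral_indicator) (simp add: \<Omega>)
  with set show ?case by (simp add: count_em_meas)
 next
  case (mult f c)
  hence "(%M'. \<integral>\<^sup>+M''. c*f M'' \<partial>M'):?B \<longleftrightarrow> (%M'. c * \<integral>\<^sup>+M''. f M'' \<partial>M'):?B"
   by (intro measurable_cong nn_integral_cmult) (simp add: me)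
  with mult show ?case by simp
 next
  case (add f g)
  hence "(%M'. \<integral>\<^sup>+M''. f M''+g M'' \<partial>M'):?B \<longleftrightarrow> (%M'. (\<integral>\<^sup>+M''. f M'' \<partial>M')+(\<integral>\<^sup>+M''. g M'' \<partial>M')):?B"
   by (intro measurable_cong nn_integral_add) (simp_all add: me)
  with add show ?case by (simp add: ac_simps)
 next
  case (seq F)
  hence "(%M'. \<integral>\<^sup>+M''. (SUP i. F i) M'' \<partial>M'):?B \<longleftrightarrow> (%M'. SUP i. (\<integral>\<^sup>+M''. F i M'' \<partial>M')):?B"
   unfolding SUP_apply
   by (intro measurable_cong nn_integral_monotone_convergence_SUP) (simp_all add: me)
  with seq show ?case by (simp add: ac_simps)
 }
qed

section \<open>Sums of Dirac measures\<close>

lemma sets_point_sum [simp]: "sets (point_sum T I s) = sets (borel_of T)"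
 by (simp add: point_sum_def)

lemma space_point_sum [simp]: "space (point_sum T I s) = topspace T"
 by (simp add: point_sum_def)

lemma measurable_point_sum_aux: "s ` I <= topspace T ==> s:Cnt I ->M borel_of T"
 by (simp add: image_subset_iff_funcset)

lemma nn_integral_point_sum:
 assumes "s ` I <= topspace T" "f:bm (borel_of T)"
 shows "integral\<^sup>N (point_sum T I s) f = (NI (Cnt I) (%i. f (s i)))"
 unfolding point_sum_def by (subst nn_integral_distr) (use assms measurable_point_sum_aux in simp_all)

lemma emeasure_point_sum:
 assumes "s ` I <= topspace T" "B:sets (borel_of T)"
 shows "em (point_sum T I s) B = (NI (Cnt I) (%i. Ind B (s i)))"
proof -
 have "em (point_sum T I s) B = integral\<^sup>N (point_sum T I s) (Ind B)" using assms by simp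
 also have "... = (NI (Cnt I) (%i. Ind B (s i)))"
  using assms by (intro nn_integral_point_sum) auto
 finally show ?thesis .
qed

lemma emeasure_point_sum':
 assumes "s ` I <= topspace T" "B:sets (borel_of T)"
 shows "em (point_sum T I s) B = em (Cnt I) {i:I. s i:B}"
proof -
 have "s -` B Int space (Cnt I) = {i:I. s i:B}" by auto
 thus ?thesis unfolding point_sum_def
  using emeasure_distr[OF measurable_point_sum_aux[OF assms(1)] assms(2)] by simp
qed

lemma point_sum_reindex:
 assumes "s ` J <= topspace T" "bij_betw f I J"
 shows "point_sum T J s = point_sum T I (%i. s (f i))"
proof (rule measure_eqI)
 fix B assume "B:sets (point_sum T J s)"
 hence B: "B:sets (borel_of T)" by simp
 have im: "(%i. s (f i)) ` I <= topspace T" using assms by (auto simp: bij_betw_def)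
 show "em (point_sum T J s) B = em (point_sum T I (%i. s (f i))) B"
  unfolding emeasure_point_sum[OF assms(1) B] emeasure_point_sum[OF im B]
  by (rule nn_integral_bij_count_space[OF assms(2), symmetric])
qed simp

lemma point_sum_cong: "(!!i. i:I ==> s i = s' i) ==> s ` I <= topspace T ==> point_sum T I s = point_sum T I s'"
proof (rule measure_eqI)
 assume a: "!!i. i:I ==> s i = s' i" "s ` I <= topspace T"
 hence b: "s' ` I <= topspace T" by auto
 fix B assume "B:sets (point_sum T I s)"
 hence B: "B:sets (borel_of T)" by simp
 show "em (point_sum T I s) B = em (point_sum T I s') B"
  unfolding emeasure_point_sum[OF a(2) B] emeasure_point_sum[OF b B]
  by (rule nn_integral_cong) (simp add: a)
qed simp

text \<open>The index sets in \<open>configurations\<close> are sets of naturals; a countable index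
  set of any type can be transported there.\<close>

lemma point_sum_in_configurations:
 assumes "countable I" "s ` I <= topspace T"
 shows "point_sum T I s:configurations T"
proof -
 have "bij_betw (from_nat_into I) (to_nat_on I ` I) I"
  using assms(1) by (simp add: bij_betw_def inj_on_def from_nat_into_to_nat_on image_image)
 from point_sum_reindex[OF assms(2) this] have "point_sum T I s = point_sum T (to_nat_on I ` I) (%i. s (from_nat_into I i))" .
 moreover have "(%i. s (from_nat_into I i)) ` (to_nat_on I ` I) <= topspace T"
  using assms by (auto simp: from_nat_into_to_nat_on)
 ultimately show ?thesis unfolding configurations_def by blast
qed

lemma configurationsE:
 assumes "ga:configurations T"
 obtains I :: "nat set" and s where "ga = point_sum T I s" "s ` I <= topspace T"
 using assms unfolding configurations_def by blast

lemma sets_configuration: "ga:configurations T ==> sets ga = sets (borel_of T)"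
 by (erule configurationsE) simp

lemma proper_configuration: "ga:proper_configurations T ==> ga:configurations T"
 by (simp add: proper_configurations_def)

lemma point_sum_proper:
 assumes I: "countable I" "s ` I <= topspace T" "inj_on s I"
  and fin: "!!K. compactin T K ==> finite {i:I. s i:K}"
 shows "point_sum T I s:proper_configurations T"
 unfolding proper_configurations_def
proof (intro CollectI conjI allI impI ballI)
 show "point_sum T I s:configurations T" by (rule point_sum_in_configurations[OF I(1,2)])
 fix K assume K: "compactin T K"
 show "em (point_sum T I s) K < \<infinity>"
 \<comment> \<open>A set that is compact in an abstract topology need not be Borel; in that case
   \<open>emeasure\<close> is 0 by convention.\<close>
 proof (cases "K:sets (borel_of T)")
  case True
  thus ?thesis using fin[OF K] by (simp add: emeasure_point_sum'[OF I(2)] emeasure_count_space less_top[symmetric])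
 next
  case False
  thus ?thesis using emeasure_notin_sets[of K "point_sum T I s"] by simp
 qed
next
 fix x assume "x:topspace T"
 show "em (point_sum T I s) {x} <= 1"
 proof (cases "{x}:sets (borel_of T)")
  case True
  have sub: "EX j. {i:I. s i:{x}} <= {j}" using I(3) by (auto simp: inj_on_def)
  then obtain j where j: "{i:I. s i:{x}} <= {j}" by blast
  hence f: "finite {i:I. s i:{x}}" by (rule finite_subset) simp
  have "card {i:I. s i:{x}} <= 1" using card_mono[OF _ j] by simp
  thus ?thesis using f by (simp add: emeasure_point_sum'[OF I(2) True] emeasure_count_space_finite)
 next
  case False
  thus ?thesis using emeasure_notin_sets[of "{x}" "point_sum T I s"] by simp
 qed
qed

section \<open>Proper configurations as sets of points\<close>

text \<open>This makes \<open>points\<close> detect atoms: on a singleton that is not measurable,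
  \<open>emeasure\<close> would be 0.\<close>

definition borel_singletons :: "'s topology => bool" where
 "borel_singletons T \<longleftrightarrow> (ALL z:topspace T. {z}:sets (borel_of T))"

lemma singletons_eu: "borel_singletons (euclidean :: 'x::t2_space topology)"
 unfolding borel_singletons_def borel_of_eu by simp

lemma borel_singletons_Z: "borel_singletons (Z_topology :: ('x::{t2_space,second_countable_topology} \<times> 'x list) topology)"
 unfolding borel_singletons_def by (intro ballI Z_singleton_sets)

lemma emeasure_count_space_nonzero: "A <= I ==> em (Cnt I) A ~= 0 \<longleftrightarrow> A ~= {}"
 by (auto simp add: emeasure_count_space)

lemma points_point_sum:
 assumes T: "borel_singletons T" and s: "s ` I <= topspace T"
 shows "points (point_sum T I s) = s ` I"
proof -
 have "em (point_sum T I s) {x} ~= 0 \<longleftrightarrow> x:s ` I" if "x:topspace T" for x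
 proof -
  have "{x}:sets (borel_of T)" using T that by (simp add: borel_singletons_def)
  from emeasure_point_sum'[OF s this]
  have "em (point_sum T I s) {x} ~= 0 \<longleftrightarrow> {i:I. s i:{x}} ~= {}"
   using emeasure_count_space_nonzero[of "{i:I. s i:{x}}" I] by simp
  thus ?thesis by auto
 qed
 thus ?thesis using s by (auto simp: points_def)
qed

text \<open>Multiplicity at most 1 forces an enumeration of the points to be injective, so a proper
  configuration is recovered from its support.\<close>

lemma config_points:
 assumes T: "borel_singletons T" and ga: "ga:proper_configurations T"
 shows "ga = point_sum T (points ga) (%z. z)" "countable (points ga)" "points ga <= topspace T"
proof -
 obtain I :: "nat set" and s where s: "ga = point_sum T I s" "s ` I <= topspace T"
  using ga proper_configuration configurationsE by metis
 have p: "points ga = s ` I" unfolding s(1) by (rule points_point_sum[OF T s(2)])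
 show "countable (points ga)" "points ga <= topspace T" using p s(2) by auto
 have "inj_on s I"
 proof (rule inj_onI, rule ccontr)
  fix i j assume ij: "i:I" "j:I" "s i = s j" "i ~= j"
  let ?x = "s i"
  have x: "?x:topspace T" using s(2) ij by auto
  hence xs: "{?x}:sets (borel_of T)" using T by (simp add: borel_singletons_def)
  have "em (Cnt I) {i, j} <= em (Cnt I) {k:I. s k:{?x}}"
   using ij by (intro emeasure_mono) auto
  also have "... = em ga {?x}" unfolding s(1) emeasure_point_sum'[OF s(2) xs] ..
  also have "... <= 1" using ga x by (simp add: proper_configurations_def)
  finally show False using ij by (simp add: emeasure_count_space_finite)
 qed
 hence "bij_betw s I (points ga)" by (simp add: p bij_betw_def)
 from point_sum_reindex[OF _ this, of "%z. z" T] show "ga = point_sum T (points ga) (%z. z)"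
  using \<open>points ga <= topspace T\<close> s(1) by simp
qed

lemma emeasure_proper:
 assumes T: "borel_singletons T" and ga: "ga:proper_configurations T" and B: "B:sets (borel_of T)"
 shows "em ga B = em (Cnt (points ga)) (points ga Int B)"
proof -
 note p = config_points[OF T ga]
 have "em ga B = em (point_sum T (points ga) (%z. z)) B" by (rule arg_cong2[OF p(1) refl])
 also have "... = em (Cnt (points ga)) {z:points ga. z:B}"
  using p(3) by (intro emeasure_point_sum' B) auto
 finally show ?thesis by (simp add: Int_def)
qed

lemma nn_integral_proper:
 assumes T: "borel_singletons T" and ga: "ga:proper_configurations T" and f: "f:bm (borel_of T)"
 shows "integral\<^sup>N ga f = (NI (Cnt (points ga)) f)"
proof -
 note p = config_points[OF T ga]
 have "integral\<^sup>N ga f = integral\<^sup>N (point_sum T (points ga) (%z. z)) f" by (rule arg_cong2[OF p(1) refl])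
 also have "... = (NI (Cnt (points ga)) f)"
  using p(3) by (intro nn_integral_point_sum f) auto
 finally show ?thesis .
qed

lemma finite_points_compact:
 assumes T: "borel_singletons T" and ga: "ga:proper_configurations T" and K: "compactin T K" "K:sets (borel_of T)"
 shows "finite (points ga Int K)"
proof -
 have "em ga K < \<infinity>" using ga K by (simp add: proper_configurations_def)
 thus ?thesis using emeasure_proper[OF T ga K(2)] by (auto simp: emeasure_count_space split: if_splits)
qed

section \<open>The pairing as an integral\<close>

lemma summable_on_real_iff_integrable:
 fixes f :: "'a => real"
 shows "f summable_on A \<longleftrightarrow> integrable (Cnt A) f"
 using summable_on_iff_abs_summable_on_real[of f A] abs_summable_equivalent[of f A]
 by (simp add: Infinite_Set_Sum.abs_summable_on_def)

text \<open>The two sides agree for divergent sums as well, where both are 0 by convention.\<close>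

lemma infsum_real_eq_integral:
 fixes f :: "'a => real"
 shows "infsum f A = (LI (Cnt A) f)"
proof (cases "f summable_on A")
 case True
 hence "Infinite_Set_Sum.abs_summable_on f A"
  using summable_on_iff_abs_summable_on_real[of f A] abs_summable_equivalent[of f A] by simp
 from infsetsum_infsum[OF this] show ?thesis by (simp add: infsetsum_def)
next
 case False
 thus ?thesis
  by (simp add: infsum_not_exists not_integrable_integral_eq summable_on_real_iff_integrable)
qed

text \<open>Integrals of nonnegative functions against \<open>ga\<close> are measurable in
  \<open>ga\<close>, so this form makes the pairing measurable. The case distinction reproduces the
  value 0 of a divergent sum.\<close>

lemma pairing_eq:
 fixes g :: "'s => real"
 assumes T: "borel_singletons T" and ga: "ga:proper_configurations T" and g: "g:bm (borel_of T)"
 shows "pairing g ga = (if (NI ga (%z. ennreal (g z))) < \<infinity> & (NI ga (%z. ennreal (- g z))) < \<infinity>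
   then enn2real (NI ga (%z. ennreal (g z)))-enn2real (NI ga (%z. ennreal (- g z))) else 0)"
proof -
 have e1: "(NI ga (%z. ennreal (g z))) = (NI (Cnt (points ga)) (%z. ennreal (g z)))"
  using g by (intro nn_integral_proper[OF T ga]) measurable
 have e2: "(NI ga (%z. ennreal (- g z))) = (NI (Cnt (points ga)) (%z. ennreal (- g z)))"
  using g by (intro nn_integral_proper[OF T ga]) measurable
 show ?thesis
 proof (cases "integrable (Cnt (points ga)) g")
  case True
  thus ?thesis unfolding pairing_def infsum_real_eq_integral e1 e2
   using real_lebesgue_integral_def[OF True] by (simp add: real_integrable_def less_top)
 next
  case False
  thus ?thesis unfolding pairing_def infsum_real_eq_integral e1 e2
   by (auto simp: not_integrable_integral_eq real_integrable_def less_top)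
 qed
qed

lemma measurable_pairing:
 fixes g :: "'s => real"
 assumes T: "borel_singletons T" and g: "g:bm (borel_of T)"
 shows "pairing g:bm (Gamma T)"
proof -
 have s: "sets ga = sets (borel_of T)" if "ga:proper_configurations T" for ga
  by (rule sets_configuration[OF proper_configuration[OF that]])
 have [measurable]: "(%ga. \<integral>\<^sup>+z. ennreal (g z) \<partial>ga):bm (Gamma T)"
  "(%ga. \<integral>\<^sup>+z. ennreal (- g z) \<partial>ga):bm (Gamma T)"
  using g by (intro measurable_count_nn_integral s; measurable)+
 have "(%ga. if (NI ga (%z. ennreal (g z))) < \<infinity> & (NI ga (%z. ennreal (- g z))) < \<infinity>
   then enn2real (NI ga (%z. ennreal (g z)))-enn2real (NI ga (%z. ennreal (- g z))) else 0):bm (Gamma T)"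
  by measurable
 thus ?thesis
  by (rule measurable_cong[THEN iffD1, rotated]) (simp add: pairing_eq[OF T _ g])
qed

section \<open>Superpositions\<close>

lemma emeasure_superpose:
 assumes s: "!!i. i:I ==> sets (om i) = sets (borel_of T)" and B: "B:sets (borel_of T)"
 shows "em (superpose T I om) B = (NI (Cnt I) (%i. em (om i) B))"
proof (rule emeasure_measure_of[OF superpose_def])
 have S: "sets (superpose T I om) = sets (borel_of T)"
  unfolding superpose_def using sets.sets_measure_of_eq[of "borel_of T"] by simp
 show "countably_additive (sets (superpose T I om)) (%B. \<integral>\<^sup>+i. em (om i) B \<partial>Cnt I)"
 proof (rule countably_additiveI)
  fix F :: "nat => _ set" assume F: "range F <= sets (superpose T I om)" "disjoint_family F"
  have "(\<Sum>k. \<integral>\<^sup>+i. em (om i) (F k) \<partial>Cnt I) = (NI (Cnt I) (%i. (\<Sum>k. em (om i) (F k))))"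
   by (rule nn_integral_suminf[symmetric]) simp
  also have "... = (NI (Cnt I) (%i. em (om i) (\<Union>k. F k)))"
   using F s by (intro nn_integral_cong suminf_emeasure) (auto simp: S)
  finally show "(\<Sum>k. \<integral>\<^sup>+i. em (om i) (F k) \<partial>Cnt I) = (NI (Cnt I) (%i. em (om i) (\<Union>k. F k)))" .
 qed
 show "sets (borel_of T) <= Pow (topspace T)" using sets.sets_into_space[of _ "borel_of T"] by auto
 show "B:sets (superpose T I om)" using B S by simp
qed (auto simp: positive_def)

lemma sets_superpose [simp]: "sets (superpose T I om) = sets (borel_of T)"
 unfolding superpose_def using sets.sets_measure_of_eq[of "borel_of T"] by simp

lemma space_superpose [simp]: "space (superpose T I om) = topspace T"
 using sets_eq_imp_space_eq[OF sets_superpose] by simp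

lemma nn_integral_count_space_Sigma:
 "(NI (Cnt I) (%i. (NI (Cnt (J i)) (f i)))) = (NI (Cnt (Sigma I J)) (%(i, j). f i j))"
proof -
 have "(NI (Cnt (Sigma I J)) (%(i, j). f i j)) = (NI (Cnt UNIV) (%p. (case p of (i, j) => f i j)*Ind (Sigma I J) p))"
  by (rule nn_integral_count_space_indicator) simp
 also have "... = (\<integral>\<^sup>+i. \<integral>\<^sup>+j. f i j*Ind (Sigma I J) (i, j) \<partial>Cnt UNIV \<partial>Cnt UNIV)"
  by (subst nn_integral_fst_count_space[symmetric]) simp
 also have "... = (NI (Cnt UNIV) (%i. (NI (Cnt (J i)) (f i))*Ind I i))"
 proof (rule nn_integral_cong)
  fix i
  show "(NI (Cnt UNIV) (%j. f i j*Ind (Sigma I J) (i, j))) = (NI (Cnt (J i)) (f i))*Ind I i"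
  proof (cases "i:I")
   case True
   have "(NI (Cnt (J i)) (f i)) = (NI (Cnt UNIV) (%j. f i j*Ind (J i) j))"
    by (rule nn_integral_count_space_indicator) simp
   thus ?thesis using True by (auto intro!: nn_integral_cong split: split_indicator)
  qed simp
 qed
 also have "... = (NI (Cnt I) (%i. (NI (Cnt (J i)) (f i))))"
  by (rule nn_integral_count_space_indicator[symmetric]) simp
 finally show ?thesis ..
qed

lemma superpose_point_sum:
 assumes s: "!!i. i:I ==> s i ` J i <= topspace T"
 shows "superpose T I (%i. point_sum T (J i) (s i)) = point_sum T (Sigma I J) (%(i, j). s i j)"
proof (rule measure_eqI)
 fix B assume "B:sets (superpose T I (%i. point_sum T (J i) (s i)))"
 hence B: "B:sets (borel_of T)" by simp
 have im: "(%(i, j). s i j) ` Sigma I J <= topspace T" using s by auto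
 have "em (superpose T I (%i. point_sum T (J i) (s i))) B = (NI (Cnt I) (%i. em (point_sum T (J i) (s i)) B))"
  by (rule emeasure_superpose[OF _ B]) simp
 also have "... = (NI (Cnt I) (%i. (NI (Cnt (J i)) (%j. Ind B (s i j)))))"
  by (intro nn_integral_cong emeasure_point_sum s B) simp
 also have "... = (NI (Cnt (Sigma I J)) (%(i, j). Ind B (s i j)))" by (rule nn_integral_count_space_Sigma)
 also have "... = (NI (Cnt (Sigma I J)) (%p. Ind B ((%(i, j). s i j) p)))"
  by (rule nn_integral_cong) (simp add: split_beta)
 also have "... = em (point_sum T (Sigma I J) (%(i, j). s i j)) B"
  by (rule emeasure_point_sum[OF im B, symmetric])
 finally show "em (superpose T I (%i. point_sum T (J i) (s i))) B = em (point_sum T (Sigma I J) (%(i, j). s i j)) B" .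
qed simp

lemma superpose_cong: "(!!i. i:I ==> om i = om' i) ==> superpose T I om = superpose T I om'"
proof -
 assume "!!i. i:I ==> om i = om' i"
 hence "(NI (Cnt I) (%i. em (om i) B)) = (NI (Cnt I) (%i. em (om' i) B))" for B
  by (intro nn_integral_cong) simp
 thus ?thesis unfolding superpose_def by simp
qed

lemma superpose_reindex:
 assumes "bij_betw f I J"
 shows "superpose T J om = superpose T I (%i. om (f i))"
 unfolding superpose_def by (subst nn_integral_bij_count_space[OF assms, symmetric]) simp

lemma superpose_in_configurations:
 assumes I: "countable I" and om: "!!i. i:I ==> om i:configurations T"
 shows "superpose T I om:configurations T"
proof -
 have "ALL i:I. EX p. om i = point_sum T (fst p) (snd p) & snd p ` fst p <= topspace T & countable (fst p :: nat set)"
 proof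
  fix i assume "i:I"
  then obtain J :: "nat set" and s where "om i = point_sum T J s" "s ` J <= topspace T"
   using configurationsE[OF om] by metis
  thus "EX p. om i = point_sum T (fst p) (snd p) & snd p ` fst p <= topspace T & countable (fst p :: nat set)"
   by (intro exI[of _ "(J, s)"]) simp
 qed
 from bchoice[OF this] obtain p where p: "ALL i:I. om i = point_sum T (fst (p i)) (snd (p i)) & snd (p i) ` fst (p i) <= topspace T & countable (fst (p i) :: nat set)" ..
 have "superpose T I om = superpose T I (%i. point_sum T (fst (p i)) (snd (p i)))"
  using p by (intro superpose_cong) simp
 also have "... = point_sum T (Sigma I (%i. fst (p i))) (%(i, j). snd (p i) j)"
  using p by (intro superpose_point_sum) simp
 also have "...:configurations T"
  using p I by (intro point_sum_in_configurations countable_SIGMA) auto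
 finally show ?thesis .
qed

lemma measurable_nn_integral_count_space:
 assumes I: "countable I" and f: "!!i. i:I ==> f i:bm M"
 shows "(%w. \<integral>\<^sup>+i. f i w \<partial>Cnt I):bm M"
proof -
 let ?J = "to_nat_on I ` I"
 have bij: "bij_betw (from_nat_into I) ?J I"
  using I by (simp add: bij_betw_def inj_on_def from_nat_into_to_nat_on image_image)
 have e: "(NI (Cnt I) (%i. f i w)) = (\<Sum>n. f (from_nat_into I n) w*Ind ?J n)" for w
 proof -
  have "(NI (Cnt I) (%i. f i w)) = (NI (Cnt ?J) (%n. f (from_nat_into I n) w))"
   by (rule nn_integral_bij_count_space[OF bij, symmetric])
  also have "... = (NI (Cnt UNIV) (%n. f (from_nat_into I n) w*Ind ?J n))"
   by (rule nn_integral_count_space_indicator) simp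
  finally show ?thesis by (simp add: nn_integral_count_space_nat)
 qed
 have "(%w. f (from_nat_into I n) w*Ind ?J n):bm M" for n
 proof (cases "n:?J")
  case True
  hence "from_nat_into I n:I" using I by (auto simp: from_nat_into_to_nat_on)
  thus ?thesis using f True by simp
 qed simp
 thus ?thesis unfolding e by (rule borel_measurable_suminf_order)
qed

section \<open>Cells that separate the points of a configuration\<close>

text \<open>A countable cofinal family of compact sets turns statements about all compact sets, such
  as local finiteness, into countable conjunctions.\<close>

locale exhaustion =
 fixes K :: "nat => 'x::{t2_space,second_countable_topology} set"
 assumes compact_K: "compact (K m)"
  and cover_K: "compact C ==> EX m. C <= K m"
begin

definition Ob :: "nat => 'x set" where
 "Ob = from_nat_into base_sets"

lemma Ob_separates:
 assumes "x ~= y"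
 shows "EX k. (x:Ob k) ~= (y:Ob k)"
proof -
 obtain U where U: "open U" "x:U" "y ~: U" using assms separation_t2 by blast
 obtain B where B: "B:base_sets" "x:B" "B <= U" using base_sets_exists[OF U(1,2)] by blast
 obtain k where "Ob k = B" unfolding Ob_def using from_nat_into_surj[OF base_sets(1) B(1)] by blast
 thus ?thesis using B U by auto
qed

lemma open_Ob: "open (Ob k)"
proof -
 obtain B where "B:(base_sets :: 'x set set)" using base_sets_exists[OF open_UNIV UNIV_I] by blast
 hence "Ob k:base_sets" unfolding Ob_def by (intro from_nat_into) blast
 thus ?thesis by (rule base_sets_open)
qed

text \<open>A cell collects the points of one disjoint piece of the exhaustion that have the same
  membership pattern in the first base sets. Prefixes of the bit pattern give coarser cells.\<close>

definition cell :: "nat \<times> bool list => 'x set" where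
 "cell c = disjointed K (fst c) Int {x. ALL k<length (snd c). (x:Ob k) = snd c!k}"

definition code :: "nat => 'x => bool list" where
 "code j x = map (%k. x:Ob k) [0..<j]"

lemma K_borel: "K m:sets borel"
 using compact_imp_closed[OF compact_K] by simp

lemma piece_borel: "disjointed K m:sets borel"
 unfolding disjointed_def by (intro sets.Diff K_borel sets.finite_UN) auto

lemma cell_borel: "cell c:sets borel"
proof -
 have "{x. ALL k:{..<length (snd c)}. (x:Ob k) = snd c!k}:sets borel"
 proof -
  have "{x:space borel. (x:Ob k) = snd c!k}:sets borel" for k
  proof (cases "snd c!k")
   case True thus ?thesis using open_Ob by simp
  next
   case False
   have "- Ob k:sets borel" using open_Ob by (intro borel_comp borel_open)
   moreover have "{x:space borel. (x:Ob k) = snd c!k} = - Ob k" using False by auto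
   ultimately show ?thesis by simp
  qed
  hence "{x:space borel. ALL k:{..<length (snd c)}. (x:Ob k) = snd c!k}:sets borel"
   by (intro sets.sets_Collect_finite_All) auto
  thus ?thesis by simp
 qed
 hence S: "{x. ALL k<length (snd c). (x:Ob k) = snd c!k}:sets borel" unfolding Ball_def lessThan_iff .
 show ?thesis unfolding cell_def by (rule sets.Int[OF piece_borel S])
qed

lemma in_cell_iff: "x:cell (m, S) \<longleftrightarrow> x:disjointed K m & code (length S) x = S"
proof -
 have "code (length S) x = S \<longleftrightarrow> (ALL k<length S. (x:Ob k) = S!k)"
 proof (rule iffI, intro allI impI)
  fix k assume eq: "code (length S) x = S" and k: "k < length S"
  have "code (length S) x!k = (x:Ob k)" using k by (simp add: code_def)
  thus "(x:Ob k) = S!k" unfolding eq by (rule sym)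
 next
  assume a: "ALL k<length S. (x:Ob k) = S!k"
  show "code (length S) x = S"
  proof (rule nth_equalityI)
   show l: "length (code (length S) x) = length S" by (simp add: code_def)
   fix k assume "k < length (code (length S) x)"
   hence k: "k < length S" unfolding l .
   have "code (length S) x!k = (x:Ob k)" using k by (simp add: code_def)
   thus "code (length S) x!k = S!k" using a[rule_format, OF k] by (rule trans)
  qed
 qed
 thus ?thesis unfolding cell_def Int_iff mem_Collect_eq fst_conv snd_conv by (rule conj_cong[OF refl sym])
qed

lemma take_code: "j <= l ==> take j (code l x) = code j x"
 by (simp add: code_def take_map)

lemma length_code [simp]: "length (code j x) = j"
 by (simp add: code_def)

lemma UN_piece: "EX m. x:disjointed K m"
proof -
 obtain m where "{x} <= K m" using cover_K[of "{x}"] by auto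
 hence "x:(\<Union>m. K m)" by auto
 thus ?thesis using UN_disjointed_eq[of K] by auto
qed

lemma piece_unique: "x:disjointed K m ==> x:disjointed K n ==> m = n"
 using disjoint_family_disjointed[of K] by (auto simp: disjoint_family_on_def)

text \<open>Finitely many pairs of points need finitely many separating base sets; the level is one
  more than the largest index among these.\<close>

lemma code_separates:
 assumes "finite P"
 shows "EX j. inj_on (code j) P"
proof -
 have "ALL p:P \<times> P. EX k. fst p ~= snd p --> (fst p:Ob k) ~= (snd p:Ob k)" using Ob_separates by blast
 from bchoice[OF this] obtain k where k: "ALL p:P \<times> P. fst p ~= snd p --> (fst p:Ob (k p)) ~= (snd p:Ob (k p))" ..
 define j where "j = Suc (Max (insert 0 (k ` (P \<times> P))))"
 have "inj_on (code j) P"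
 proof (rule inj_onI, rule ccontr)
  fix x y assume xy: "x:P" "y:P" "code j x = code j y" "x ~= y"
  have "k (x, y) <= Max (insert 0 (k ` (P \<times> P)))" using assms xy by (intro Max_ge) auto
  hence kj: "k (x, y) < j" by (simp add: j_def)
  have "code j x!k (x, y) = code j y!k (x, y)" using xy by simp
  hence "(x:Ob (k (x, y))) = (y:Ob (k (x, y)))" using kj by (simp add: code_def)
  thus False using k xy by force
 qed
 thus ?thesis by blast
qed

lemma finite_points_K: "ga:space Gamma_X ==> finite (points ga Int K m)"
 by (rule finite_points_compact[OF singletons_eu])
   (auto simp: compact_K K_borel borel_of_eu)

lemma emeasure_proper_cell:
 fixes ga :: "'x measure"
 assumes "ga:space Gamma_X" "A:sets borel"
 shows "em ga A = em (Cnt (points ga)) (points ga Int A)"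
 using assms by (intro emeasure_proper[OF singletons_eu]) (auto simp: borel_of_eu)

lemma emeasure_eq_1_iff:
 fixes ga :: "'x measure"
 assumes "ga:space Gamma_X" "A:sets borel"
 shows "em ga A = 1 \<longleftrightarrow> (EX x. points ga Int A = {x})"
 unfolding emeasure_proper_cell[OF assms]
 by (cases "finite (points ga Int A)") (auto simp add: emeasure_count_space card_1_singleton_iff)

text \<open>Properness as defined quantifies over uncountably many sets and points. Countably many
  counts suffice: the finitely many points in one piece are separated by the cells of some level,
  and conversely a multiple point would give some cell of every level a count above 1.\<close>

lemma proper_configurations_iff:
 "ga:proper_configurations euclidean \<longleftrightarrow> ga:configurations (euclidean :: 'x topology) &
   (ALL m. em ga (K m) < \<infinity>) & (ALL m. EX j. ALL S. length S = j --> em ga (cell (m, S)) <= 1)"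
proof (intro iffI conjI allI)
 assume ga: "ga:proper_configurations (euclidean :: 'x topology)"
 show "ga:configurations euclidean" by (rule proper_configuration[OF ga])
 show "em ga (K m) < \<infinity>" for m using ga compact_K by (simp add: proper_configurations_def)
 fix m
 have ga': "ga:space Gamma_X" using ga by simp
 have "finite (points ga Int disjointed K m)"
  using finite_points_K[OF ga', of m] by (rule rev_finite_subset) (use disjointed_subset[of K m] in blast)
 from code_separates[OF this] obtain j where j: "inj_on (code j) (points ga Int disjointed K m)" by blast
 have "em ga (cell (m, S)) <= 1" if "length S = j" for S
 proof -
  have "x = y" if "x:points ga Int cell (m, S)" "y:points ga Int cell (m, S)" for x y
   using that \<open>length S = j\<close> by (intro inj_onD[OF j]) (simp_all add: in_cell_iff)
  hence "EX x. points ga Int cell (m, S) <= {x}" by blast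
  then obtain x where x: "points ga Int cell (m, S) <= {x}" by blast
  hence "card (points ga Int cell (m, S)) <= 1" "finite (points ga Int cell (m, S))"
   using card_mono[OF _ x] finite_subset[OF x] by auto
  thus ?thesis unfolding emeasure_proper_cell[OF ga' cell_borel] by (simp add: emeasure_count_space_finite)
 qed
 thus "EX j. ALL S. length S = j --> em ga (cell (m, S)) <= 1" by blast
next
 assume a: "ga:configurations (euclidean :: 'x topology) &
   (ALL m. em ga (K m) < \<infinity>) & (ALL m. EX j. ALL S. length S = j --> em ga (cell (m, S)) <= 1)"
 hence s: "sets ga = sets borel" using sets_configuration[of ga euclidean] by (simp add: borel_of_eu)
 show "ga:proper_configurations euclidean"
  unfolding proper_configurations_def
 proof (intro CollectI conjI allI impI ballI)
  show "ga:configurations euclidean" using a by blast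
  fix C :: "'x set" assume "compactin euclidean C"
  then obtain m where "C <= K m" using cover_K by auto
  hence "em ga C <= em ga (K m)" using s K_borel by (intro emeasure_mono) auto
  thus "em ga C < \<infinity>" using a by (meson le_less_trans)
 next
  fix x :: 'x
  obtain m where m: "x:disjointed K m" using UN_piece by blast
  obtain j where j: "ALL S. length S = j --> em ga (cell (m, S)) <= 1" using a by blast
  have "em ga {x} <= em ga (cell (m, code j x))"
   using s cell_borel m by (intro emeasure_mono) (auto simp: in_cell_iff)
  also have "... <= 1" using j by simp
  finally show "em ga {x} <= 1" .
 qed
qed

lemma proper_sets: "proper_configurations euclidean:sets (Gamma_all (euclidean :: 'x topology))"
proof -
 let ?G = "Gamma_all (euclidean :: 'x topology)"
 have [measurable]: "(%ga. em ga (K m)):bm ?G" "(%ga. em ga (cell c)):bm ?G" for m c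
  by (intro count_em_meas; simp add: K_borel cell_borel borel_of_eu)+
 have "{ga:space ?G. (ALL m. em ga (K m) < \<infinity>) & (ALL m. EX j. ALL S. length S = j --> em ga (cell (m, S)) <= 1)}:sets ?G"
  by measurable
 moreover have "{ga:space ?G. (ALL m. em ga (K m) < \<infinity>) & (ALL m. EX j. ALL S. length S = j --> em ga (cell (m, S)) <= 1)} = proper_configurations euclidean"
 proof (rule set_eqI)
  fix ga :: "'x measure"
  show "ga:{ga:space ?G. (ALL m. em ga (K m) < \<infinity>) & (ALL m. EX j. ALL S. length S = j --> em ga (cell (m, S)) <= 1)} \<longleftrightarrow> ga:proper_configurations euclidean"
   unfolding mem_Collect_eq space_count_algebra by (rule proper_configurations_iff[of ga, symmetric])
 qed
 ultimately show ?thesis by (simp only:)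
qed

text \<open>The cell isolates one point while no cell of a shorter prefix does. This minimality
  makes the cell of a point unique, so no point is enumerated twice.\<close>

definition vcell :: "nat \<times> bool list => 'x measure => bool" where
 "vcell c ga \<longleftrightarrow> em ga (cell c) = 1 & (ALL j<length (snd c). em ga (cell (fst c, take j (snd c))) ~= 1)"

definition pcell :: "nat \<times> bool list => 'x measure => 'x" where
 "pcell c ga = (THE x. x:points ga Int cell c)"

lemma pcell_eq:
 assumes "ga:space Gamma_X" "vcell c ga"
 shows "points ga Int cell c = {pcell c ga}"
proof -
 obtain x where x: "points ga Int cell c = {x}"
  using assms emeasure_eq_1_iff[OF assms(1) cell_borel] by (auto simp: vcell_def)
 thus ?thesis unfolding pcell_def by simp
qed

text \<open>Two cells that contain the same point lie in one piece, and one of their codes is a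
  prefix of the other; minimality then forces equal lengths.\<close>

lemma vcell_inj:
 assumes ga: "ga:space Gamma_X" and c: "vcell c ga" and d: "vcell d ga" and eq: "pcell c ga = pcell d ga"
 shows "c = d"
proof -
 have *: False if c: "vcell c ga" and d: "vcell d ga" and eq: "pcell c ga = pcell d ga"
  and l: "length (snd c) < length (snd d)" and m: "fst c = fst d" for c d
 proof -
  have "pcell c ga:cell c" "pcell c ga:cell d" using pcell_eq[OF ga c] pcell_eq[OF ga d] eq by auto
  hence "snd c = code (length (snd c)) (pcell c ga)" "snd d = code (length (snd d)) (pcell c ga)"
   using in_cell_iff[of _ "fst c" "snd c"] in_cell_iff[of _ "fst d" "snd d"] by auto
  hence "take (length (snd c)) (snd d) = snd c" using l by (metis less_imp_le take_code)
  hence "cell (fst d, take (length (snd c)) (snd d)) = cell c" by (simp add: m[symmetric])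
  thus False using c d l by (auto simp: vcell_def)
 qed
 have pc: "pcell c ga:cell c" "pcell c ga:cell d" using pcell_eq[OF ga c] pcell_eq[OF ga d] eq by auto
 hence i: "pcell c ga:disjointed K (fst c)" "pcell c ga:disjointed K (fst d)"
  "code (length (snd c)) (pcell c ga) = snd c" "code (length (snd d)) (pcell c ga) = snd d"
  using in_cell_iff[of _ "fst c" "snd c"] in_cell_iff[of _ "fst d" "snd d"] by auto
 have m: "fst c = fst d" by (rule piece_unique[OF i(1,2)])
 have "length (snd c) = length (snd d)"
 proof (rule ccontr)
  assume "length (snd c) ~= length (snd d)"
  then consider "length (snd c) < length (snd d)" | "length (snd d) < length (snd c)" by linarith
  thus False
  proof cases
   case 1 show False by (rule *[OF c d eq 1 m])
  next
   case 2 show False by (rule *[OF d c eq[symmetric] 2 m[symmetric]])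
  qed
 qed
 hence "code (length (snd c)) (pcell c ga) = code (length (snd d)) (pcell c ga)" by (simp only:)
 hence "snd c = snd d" by (rule trans[OF i(3)[symmetric] trans[OF _ i(4)]])
 thus ?thesis using m by (simp add: prod_eq_iff)
qed

lemma vcell_surj:
 assumes ga: "ga:space Gamma_X" and x: "x:points ga"
 shows "EX c. vcell c ga & pcell c ga = x"
proof -
 obtain m where m: "x:disjointed K m" using UN_piece by blast
 have "finite (points ga Int disjointed K m)"
  using finite_points_K[OF ga, of m] by (rule rev_finite_subset) (use disjointed_subset[of K m] in blast)
 from code_separates[OF this] obtain j where j: "inj_on (code j) (points ga Int disjointed K m)" by blast
 have "points ga Int cell (m, code j x) = {x}" using j m x by (auto simp: in_cell_iff inj_on_def)
 hence ex: "em ga (cell (m, code j x)) = 1" using emeasure_eq_1_iff[OF ga cell_borel] by blast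
 define l where "l = (LEAST j. em ga (cell (m, code j x)) = 1)"
 have l1: "em ga (cell (m, code l x)) = 1" unfolding l_def by (rule LeastI[of _ j]) (rule ex)
 have l2: "em ga (cell (m, code i x)) ~= 1" if "i < l" for i
  using not_less_Least[of i "%j. em ga (cell (m, code j x)) = 1"] that unfolding l_def by blast
 have v: "vcell (m, code l x) ga" using l1 l2 by (simp add: vcell_def take_code)
 have "x:points ga Int cell (m, code l x)" using m x by (simp add: in_cell_iff)
 hence "pcell (m, code l x) ga = x" using pcell_eq[OF ga v] by simp
 thus ?thesis using v by blast
qed

text \<open>
  A measurable enumeration: \<open>pt n ga\<close>, for the indices with \<open>val n ga\<close>, runs through the points of
  \<open>ga\<close> without repetition; \<open>n\<close> encodes the coarsest cell which separates the point from the others.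
\<close>
definition val :: "nat => 'x measure => bool" where
 "val n ga \<longleftrightarrow> to_nat (from_nat n :: nat \<times> bool list) = n & vcell (from_nat n) ga"

definition pt :: "nat => 'x measure => 'x" where
 "pt n ga = (if val n ga then pcell (from_nat n) ga else undefined)"

lemma bij_pt:
 assumes "ga:space Gamma_X"
 shows "bij_betw (%n. pt n ga) {n. val n ga} (points ga)"
 unfolding bij_betw_def
proof (intro conjI equalityI subsetI)
 show "inj_on (%n. pt n ga) {n. val n ga}"
 proof (rule inj_onI)
  fix i j assume ij: "i:{n. val n ga}" "j:{n. val n ga}" "pt i ga = pt j ga"
  hence "(from_nat i :: nat \<times> bool list) = from_nat j"
   by (intro vcell_inj[OF assms]) (auto simp: pt_def val_def)
  moreover have "to_nat (from_nat i :: nat \<times> bool list) = i" "to_nat (from_nat j :: nat \<times> bool list) = j"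
   using ij(1,2) by (simp_all add: val_def)
  ultimately show "i = j" by metis
 qed
 fix x
 show "x:points ga" if x: "x:(%n. pt n ga) ` {n. val n ga}"
 proof -
  obtain n where "val n ga" "x = pt n ga" using x by auto
  thus ?thesis using pcell_eq[OF assms, of "from_nat n"] by (auto simp: pt_def val_def)
 qed
 show "x:(%n. pt n ga) ` {n. val n ga}" if x: "x:points ga"
 proof -
  obtain c where c: "vcell c ga" "pcell c ga = x" using vcell_surj[OF assms x] by blast
  hence "val (to_nat c) ga" "pt (to_nat c) ga = x" by (simp_all add: val_def pt_def)
  thus ?thesis by force
 qed
qed

lemma val_measurable [measurable]: "Measurable.pred (Gamma_X :: 'x measure measure) (val n)"
proof -
 have [measurable]: "(%ga. em ga (cell c)):bm Gamma_X" for c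
  by (intro count_em_meas; simp add: cell_borel borel_of_eu)
 show ?thesis unfolding val_def[abs_def] vcell_def by measurable
qed

text \<open>For a valid index the point lies in \<open>A\<close> exactly when the part of its cell
  inside \<open>A\<close> still has count 1, and counts are measurable.\<close>

lemma pt_measurable [measurable]: "pt n:Gamma_X ->M borel"
proof (rule measurableI)
 fix A :: "'x set" assume A: "A:sets borel"
 let ?c = "from_nat n :: nat \<times> bool list"
 have B: "cell ?c Int A:sets borel" using A cell_borel by (intro sets.Int)
 have [measurable]: "(%ga. em ga (cell ?c Int A)):bm Gamma_X"
  by (intro count_em_meas) (simp add: B borel_of_eu)
 have "{ga:space Gamma_X. (val n ga & em ga (cell ?c Int A) = 1) | (~ val n ga & undefined:A)}:sets Gamma_X"
  by measurable
 moreover have "pt n -` A Int space Gamma_X = {ga:space Gamma_X. (val n ga & em ga (cell ?c Int A) = 1) | (~ val n ga & undefined:A)}"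
 proof (rule set_eqI)
  fix ga :: "'x measure"
  have "em ga (cell ?c Int A) = 1 \<longleftrightarrow> pt n ga:A" if ga: "ga:space Gamma_X" and v: "val n ga"
  proof -
   have p: "points ga Int cell ?c = {pt n ga}" using pcell_eq[OF ga, of ?c] v by (simp add: val_def pt_def)
   show ?thesis unfolding emeasure_eq_1_iff[OF ga B] Int_assoc[symmetric] p by (cases "pt n ga:A") simp_all
  qed
  moreover have "pt n ga = undefined" if "~ val n ga" using that by (simp add: pt_def)
  ultimately show "ga:pt n -` A Int space Gamma_X \<longleftrightarrow> ga:{ga:space Gamma_X. (val n ga & em ga (cell ?c Int A) = 1) | (~ val n ga & undefined:A)}"
   by (cases "val n ga") auto
 qed
 ultimately show "pt n -` A Int space Gamma_X:sets Gamma_X" by simp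
qed simp

end

section \<open>The cluster process\<close>

lemma measurable_component_compose:
 assumes "i:I" "f:M i ->M N"
 shows "(%w. f (w i)):PiM I M ->M N"
 using measurable_comp[OF measurable_component_singleton[OF assms(1), of M] assms(2)] by (simp add: comp_def)

text \<open>Measures on an infinite product agree once they agree on cylinders, and there both sides
  are finite products.\<close>

lemma distr_PiM_map:
 assumes M: "!!i. i:I ==> prob_space (M i)" and f: "!!i. i:I ==> f i:M i ->M N i"
 shows "distr (PiM I M) (PiM I N) (%w. \<lambda>i\<in>I. f i (w i)) = PiM I (%i. distr (M i) (N i) (f i))"
proof (rule measure_eqI_PiM_infinite[symmetric, where M=N])
 let ?D = "%i. distr (M i) (N i) (f i)"
 let ?t = "%w. \<lambda>i\<in>I. f i (w i)"
 have pD: "prob_space (?D i)" if "i:I" for i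
  using M[OF that] f[OF that] by (intro prob_space.prob_space_distr)
 have t: "?t:PiM I M ->M PiM I N"
 proof (rule measurable_restrict)
  fix i assume i: "i:I"
  show "(%w. f i (w i)):PiM I M ->M N i"
   by (rule measurable_component_compose[where f="f i" and M=M, OF i f[OF i]])
 qed
 interpret prob_space "PiM I ?D" by (rule prob_space_PiM[OF pD])
 show "finite_measure (PiM I ?D)" by unfold_locales
 show "sets (PiM I ?D) = sets (PiM I N)" by (intro sets_PiM_cong) auto
 fix A J assume J: "finite J" "J <= I" and A: "!!i. i:J ==> A i:sets (N i)"
 have "em (PiM I ?D) (prod_emb I ?D J (PiE J A)) = (\<Prod>j\<in>J. em (?D j) (A j))"
  using J A by (intro emeasure_PiM_emb pD) auto
 also have "... = (\<Prod>j\<in>J. em (M j) (f j -` A j Int space (M j)))"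
  using J A f by (intro prod.cong refl emeasure_distr) auto
 also have "... = em (PiM I M) (prod_emb I M J (\<Pi>\<^sub>E j\<in>J. f j -` A j Int space (M j)))"
  using J A f by (intro emeasure_PiM_emb[symmetric] M measurable_sets) auto
 also have "prod_emb I M J (\<Pi>\<^sub>E j\<in>J. f j -` A j Int space (M j)) = ?t -` prod_emb I N J (PiE J A) Int space (PiM I M)"
  using J(2) measurable_space[OF f]
  by (auto simp: prod_emb_def space_PiM PiE_iff Pi_iff extensional_def subset_iff restrict_def)
 also have "em (PiM I M) ... = em (distr (PiM I M) (PiM I N) ?t) (prod_emb I N J (PiE J A))"
  using J A by (intro emeasure_distr[symmetric] t sets_PiM_I) auto
 finally show "em (PiM I ?D) (prod_emb I N J (PiE J A)) = em (distr (PiM I M) (PiM I N) ?t) (prod_emb I N J (PiE J A))"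
  by (simp add: prod_emb_def)
qed simp

lemma emeasure_proj_p:
 assumes "B:sets (borel :: 'x::topological_space measure)"
 shows "em (proj_p ys) B = (\<Sum>i<length ys. Ind B (ys!i))"
proof -
 have "em (proj_p ys) B = (NI (Cnt {..<length ys}) (%i. Ind B (ys!i)))"
  unfolding proj_p_def using assms by (intro emeasure_point_sum) (simp_all add: borel_of_eu)
 thus ?thesis by (simp add: nn_integral_count_space_finite)
qed

lemma sets_proj_p [simp]: "sets (proj_p ys) = sets (borel :: 'x::topological_space measure)"
 by (simp add: proj_p_def borel_of_eu)

lemma proj_p_configuration: "proj_p ys:configurations euclidean"
 unfolding proj_p_def by (rule point_sum_in_configurations) auto

lemma measurable_proj_p: "proj_p:(LB :: 'x::second_countable_topology list measure) ->M Gamma_all euclidean"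
proof (rule count_algebraI)
 show "proj_p w:configurations euclidean" for w :: "'x list" by (rule proj_p_configuration)
 fix B :: "'x set" assume "B:sets (borel_of euclidean)"
 hence B: "B:sets borel" by (simp add: borel_of_eu)
 show "(%w. em (proj_p w) B):bm LB"
  unfolding emeasure_proj_p[OF B] using B by (intro measurable_list_sum) simp
qed

lemma measurable_superpose:
 assumes "countable I"
 shows "superpose T I:PiM I (%_. Gamma_all T) ->M Gamma_all T"
proof (rule count_algebraI)
 have c: "w i:configurations T" if "w:space (PiM I (%_. Gamma_all T))" "i:I" for w i
  using that by (auto simp: space_PiM PiE_iff)
 show "superpose T I w:configurations T" if "w:space (PiM I (%_. Gamma_all T))" for w
  using c that by (intro superpose_in_configurations assms) auto
 fix B assume B: "B:sets (borel_of T)"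
 have "(%w. \<integral>\<^sup>+i. em (w i) B \<partial>Cnt I):bm (PiM I (%_. Gamma_all T))"
 proof (rule measurable_nn_integral_count_space[OF assms])
  fix i assume i: "i:I"
  show "(%w. em (w i) B):bm (PiM I (%_. Gamma_all T))"
   by (rule measurable_component_compose[where f="%ga. em ga B", OF i count_em_meas[OF B]])
 qed
 thus "(%w. em (superpose T I w) B):bm (PiM I (%_. Gamma_all T))"
  by (rule measurable_cong[THEN iffD2, rotated]) (simp add: emeasure_superpose sets_configuration[OF c] B)
qed

locale cluster_kernel = exhaustion K
 for K :: "nat => 'x::{t2_space,second_countable_topology} set" +
 fixes et :: "'x => 'x list measure"
 assumes cluster_family: "cluster_family et"
begin

lemma prob_eta: "prob_space (et x)" and sets_eta [simp]: "sets (et x) = sets LB"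
 and emeasure_eta: "B:sets LB ==> (%x. em (et x) B):bm borel"
 using cluster_family by (simp_all add: cluster_family_def)

lemma space_eta [simp]: "space (et x) = UNIV"
 using sets_eq_imp_space_eq[OF sets_eta] by simp

lemma eta_measurable: "et:borel ->M prob_algebra LB"
proof (rule measurable_prob_algebraI)
 show "et:borel ->M subprob_algebra LB"
  by (rule measurable_subprob_algebra) (auto intro: prob_space_imp_subprob_space prob_eta emeasure_eta)
qed (rule prob_eta)

abbreviation PL :: "(nat => 'x list) measure" where
 "PL \<equiv> \<Pi>\<^sub>M n\<in>UNIV. LB"

text \<open>The index set is all of \<open>nat\<close>, whatever the configuration, so
  \<open>Q\<close> is a kernel into the single space \<open>PL\<close>. At an invalid index
  \<open>pt\<close> is \<open>undefined\<close> and the coordinate is a dummy cluster.\<close>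

definition Q :: "'x measure => (nat => 'x list) measure" where
 "Q ga = (\<Pi>\<^sub>M n\<in>UNIV. et (pt n ga))"

lemma sets_Q [simp, measurable_cong]: "sets (Q ga) = sets PL"
 unfolding Q_def by (intro sets_PiM_cong) auto

lemma space_PL [simp]: "space PL = UNIV"
 by (simp add: space_PiM PiE_def extensional_def)

lemma space_Q [simp]: "space (Q ga) = UNIV"
 using sets_eq_imp_space_eq[OF sets_Q] by simp

lemma prob_Q: "prob_space (Q ga)"
 unfolding Q_def by (rule prob_space_PiM) (rule prob_eta)

text \<open>It suffices to test cylinders, whose mass is a finite product of functions
  \<open>em (et (pt j ga)) (E j)\<close>.\<close>

lemma Q_measurable: "Q:Gamma_X ->M prob_algebra PL"
proof (rule measurable_prob_algebra_generated[OF sets_PiM Int_stable_prod_algebra prod_algebra_sets_into_space])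
 show "prob_space (Q ga)" for ga by (rule prob_Q)
 show "sets (Q ga) = sets PL" for ga by simp
 fix A assume "A:prod_algebra UNIV (%_::nat. LB :: 'x list measure)"
 then obtain J E where A: "A = prod_emb UNIV (%_. LB :: 'x list measure) J (\<Pi>\<^sub>E j\<in>J. E j)"
  "finite J" "!!i. i:J ==> E i:sets LB"
  by (rule prod_algebraE) auto
 have "em (Q ga) A = (\<Prod>j\<in>J. em (et (pt j ga)) (E j))" for ga
 proof -
  have "A = prod_emb UNIV (%n. et (pt n ga)) J (\<Pi>\<^sub>E j\<in>J. E j)"
   unfolding A(1) by (simp add: prod_emb_def)
  thus ?thesis unfolding Q_def using A by (simp add: emeasure_PiM_emb prob_eta)
 qed
 moreover have "(%ga. \<Prod>j\<in>J. em (et (pt j ga)) (E j)):bm Gamma_X"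
  using A by (intro borel_measurable_prod_ennreal meas_comp[OF pt_measurable emeasure_eta]) auto
 ultimately show "(%ga. em (Q ga) A):bm Gamma_X" by simp
qed

lemma nn_integral_Q_component:
 assumes "f:bm LB"
 shows "(NI (Q ga) (%w. f (w n))) = (NI (et (pt n ga)) f)"
proof -
 have "et (pt n ga) = distr (Q ga) (et (pt n ga)) (%w. w n)"
  unfolding Q_def by (rule distr_PiM_component[symmetric]) (simp_all add: prob_eta)
 hence "(NI (et (pt n ga)) f) = (NI (distr (Q ga) (et (pt n ga)) (%w. w n)) f)" by simp
 also have "... = (NI (Q ga) (%w. f (w n)))"
 proof (rule nn_integral_distr)
  show "(%w. w n):Q ga ->M et (pt n ga)" unfolding Q_def by (rule measurable_component_singleton) simp
  show "f:bm (distr (Q ga) (et (pt n ga)) (%w. w n))" using assms by (simp cong: meas_cong)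
 qed
 finally show ?thesis ..
qed

text \<open>The coordinates are independent, so replacing one of them by a fresh sample of the same
  law leaves the product measure unchanged. This is how one cluster is integrated while the others
  stay fixed.\<close>

lemma nn_integral_Q_resample:
 assumes f: "f:bm PL"
 shows "(NI (Q ga) f) = (NI (Q ga) (%w. (NI (et (pt n ga)) (%ys. f (w(n:=ys))))))"
proof -
 interpret E: prob_space "et (pt n ga)" by (rule prob_eta)
 interpret QQ: prob_space "Q ga" by (rule prob_Q)
 interpret pair_sigma_finite "et (pt n ga)" "Q ga" ..
 have eq: "Q ga = distr (et (pt n ga) XM Q ga) (Q ga) (%(x, X). X(n:=x))"
  using distr_pair_PiM_eq_PiM[of UNIV "%n. et (pt n ga)" n] by (simp add: Q_def prob_eta insert_absorb)
 have m: "(%(x, X). X(n:=x)):et (pt n ga) XM Q ga ->M Q ga"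
 proof -
  have "(%p. (snd p)(n:=fst p)):LB XM PL ->M PL"
  proof (rule measurable_PiM_single')
   fix i :: nat
   show "(%p. ((snd p)(n:=fst p)) i):LB XM PL ->M LB"
    by (cases "i = n") (auto intro!: meas_comp[OF measurable_snd measurable_component_singleton])
  qed (auto simp: space_pair_measure)
  thus ?thesis by (simp add: split_beta' cong: meas_cong sets_pair_measure_cong)
 qed
 have fQ: "f:bm (Q ga)" using f by (simp cong: meas_cong)
 have "(NI (Q ga) f) = (NI (distr (et (pt n ga) XM Q ga) (Q ga) (%(x, X). X(n:=x))) f)"
  using eq by simp
 also have "... = (NI (et (pt n ga) XM Q ga) (%p. f ((%(x, X). X(n:=x)) p)))"
  by (rule nn_integral_distr[OF m]) (use fQ in simp)
 also have "... = (NI (Q ga) (%w. (NI (et (pt n ga)) (%ys. f ((%(x, X). X(n:=x)) (ys, w))))))"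
  by (rule nn_integral_snd[symmetric]) (rule meas_comp[OF m fQ])
 finally show ?thesis by simp
qed

text \<open>The product over the points themselves, as in the definitions of the cluster measures,
  is obtained from \<open>Q ga\<close> by forgetting the invalid indices and renaming the valid
  ones.\<close>

lemma reindex_Q:
 assumes ga: "ga:space Gamma_X"
 defines "idx \<equiv> inv_into {n. val n ga} (%n. pt n ga)"
 shows "PiM (points ga) et = distr (Q ga) (PiM (points ga) et) (%w. \<lambda>x\<in>points ga. w (idx x))"
  and "!!n. val n ga ==> idx (pt n ga) = n"
  and "(%w. \<lambda>x\<in>points ga. w (idx x)):Q ga ->M PiM (points ga) et"
proof -
 have b: "bij_betw idx (points ga) {n. val n ga}"
  unfolding idx_def by (rule bij_betw_inv_into[OF bij_pt[OF ga]])
 have p: "pt (idx x) ga = x" if "x:points ga" for x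
  unfolding idx_def using bij_betw_inv_into_right[OF bij_pt[OF ga]] that by simp
 have e: "PiM (points ga) (%x. et (pt (idx x) ga)) = PiM (points ga) et"
  by (rule PiM_cong) (simp_all add: p)
 show "PiM (points ga) et = distr (Q ga) (PiM (points ga) et) (%w. \<lambda>x\<in>points ga. w (idx x))"
  using distr_PiM_reindex[of UNIV "%n. et (pt n ga)" idx "points ga"] b
  unfolding Q_def[symmetric] e by (simp add: prob_eta bij_betw_def)
 show "idx (pt n ga) = n" if "val n ga" for n
  unfolding idx_def using bij_betw_inv_into_left[OF bij_pt[OF ga]] that by simp
 have "(%w. \<lambda>x\<in>points ga. w (idx x)):PL ->M PiM (points ga) et"
  by (rule measurable_restrict) (auto intro: measurable_component_singleton cong: meas_cong)
 thus "(%w. \<lambda>x\<in>points ga. w (idx x)):Q ga ->M PiM (points ga) et"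
  by (simp cong: meas_cong)
qed

section \<open>The marked configuration and its projection as measurable maps\<close>

abbreviation GP :: "('x measure \<times> (nat => 'x list)) measure" where
 "GP \<equiv> Gamma_X XM PL"

definition Xi :: "'x measure \<times> (nat => 'x list) => ('x \<times> 'x list) measure" where
 "Xi p = point_sum Z_topology {n. val n (fst p)} (%n. (pt n (fst p), snd p n))"

definition Sig :: "'x measure \<times> (nat => 'x list) => 'x measure" where
 "Sig p = superpose euclidean {n. val n (fst p)} (%n. proj_p (snd p n))"

lemma nn_integral_val:
 "(NI (Cnt {n. val n ga}) f) = (\<Sum>n. if val n ga then f n else 0)"
proof -
 have "(NI (Cnt {n. val n ga}) f) = (NI (Cnt UNIV) (%n. f n*Ind {n. val n ga} n))"
  by (rule nn_integral_count_space_indicator) simp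
 also have "... = (\<Sum>n. if val n ga then f n else 0)"
  unfolding nn_integral_count_space_nat by (rule suminf_cong) simp
 finally show ?thesis .
qed

lemma space_GP: "p:space GP \<longleftrightarrow> fst p:space Gamma_X"
 by (cases p) (simp add: space_pair_measure)

lemma finite_val_compact:
 assumes "ga:space Gamma_X" "compact C"
 shows "finite {n. val n ga & pt n ga:C}"
proof (rule finite_imageD)
 have "(%n. pt n ga) ` {n. val n ga & pt n ga:C} <= points ga Int C"
  using bij_pt[OF assms(1)] by (auto simp: bij_betw_def)
 moreover have "finite (points ga Int C)"
  using assms compact_imp_closed[OF assms(2)]
  by (intro finite_points_compact[OF singletons_eu]) (auto simp: borel_of_eu)
 ultimately show "finite ((%n. pt n ga) ` {n. val n ga & pt n ga:C})" by (rule finite_subset)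
 show "inj_on (%n. pt n ga) {n. val n ga & pt n ga:C}"
  using bij_pt[OF assms(1)] unfolding bij_betw_def by (auto intro: inj_on_subset)
qed

lemma inj_Xi:
 assumes "fst p:space Gamma_X"
 shows "inj_on (%n. (pt n (fst p), snd p n)) {n. val n (fst p)}"
 using bij_pt[OF assms] by (auto simp: bij_betw_def inj_on_def)

lemma Xi_proper:
 assumes p: "fst p:space Gamma_X"
 shows "Xi p:proper_configurations Z_topology"
 unfolding Xi_def
proof (rule point_sum_proper)
 show "inj_on (%n. (pt n (fst p), snd p n)) {n. val n (fst p)}" by (rule inj_Xi[OF p])
 fix C :: "('x \<times> 'x list) set" assume "compactin Z_topology C"
 hence "compactin euclidean (fst ` C)" by (rule image_compactin[OF _ continuous_map_fst])
 hence "finite {n. val n (fst p) & pt n (fst p):fst ` C}"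
  by (intro finite_val_compact p) simp
 thus "finite {n:{n. val n (fst p)}. (pt n (fst p), snd p n):C}"
  by (rule rev_finite_subset) force
qed auto

lemma nn_integral_Xi:
 assumes "f:bm (borel XM LB)"
 shows "(NI (Xi p) f) = (\<Sum>n. if val n (fst p) then f (pt n (fst p), snd p n) else 0)"
proof -
 have "(NI (Xi p) f) = (NI (Cnt {n. val n (fst p)}) (%n. f (pt n (fst p), snd p n)))"
  unfolding Xi_def using assms by (intro nn_integral_point_sum) (auto simp: sets_Z cong: meas_cong)
 thus ?thesis unfolding nn_integral_val .
qed

lemma points_Xi: "points (Xi p) = (%n. (pt n (fst p), snd p n)) ` {n. val n (fst p)}"
 unfolding Xi_def by (rule points_point_sum[OF borel_singletons_Z]) simp

lemma val_fst_measurable [measurable]: "Measurable.pred GP (%p. val n (fst p))"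
 by (rule meas_comp[OF measurable_fst val_measurable])

lemma pt_fst_measurable [measurable]: "(%p. pt n (fst p)):GP ->M borel"
 by (rule meas_comp[OF measurable_fst pt_measurable])

lemma snd_component_measurable [measurable]: "(%p. snd p n):GP ->M LB"
 by (rule meas_comp[OF measurable_snd measurable_component_singleton]) simp

lemma measurable_Xi [measurable]: "Xi:GP ->M Gamma Z_topology"
proof (rule count_algebraI)
 show "Xi p:proper_configurations Z_topology" if "p:space GP" for p
  using that by (intro Xi_proper) (simp add: space_GP)
 fix B :: "('x \<times> 'x list) set" assume "B:sets (borel_of Z_topology)"
 hence [measurable]: "B:sets (borel XM LB)" by (simp add: sets_Z)
 have "em (Xi p) B = (NI (Xi p) (%z. Ind B z))" for p
  using \<open>B : sets (borel_of Z_topology)\<close> by (simp add: Xi_def)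
 hence e: "em (Xi p) B = (\<Sum>n. if val n (fst p) then Ind B (pt n (fst p), snd p n) else 0)" for p
  by (simp add: nn_integral_Xi)
 show "(%w. em (Xi w) B):bm GP" unfolding e by measurable
qed

lemma emeasure_Sig:
 assumes "B:sets borel"
 shows "em (Sig p) B = (\<Sum>n. if val n (fst p) then em (proj_p (snd p n)) B else 0)"
proof -
 have "em (Sig p) B = (NI (Cnt {n. val n (fst p)}) (%n. em (proj_p (snd p n)) B))"
  unfolding Sig_def using assms by (intro emeasure_superpose) (simp_all add: borel_of_eu)
 thus ?thesis unfolding nn_integral_val .
qed

lemma measurable_Sig [measurable]: "Sig:GP ->M Gamma_all euclidean"
proof (rule count_algebraI)
 show "Sig p:configurations euclidean" for p
  unfolding Sig_def by (intro superpose_in_configurations proj_p_configuration) simp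
 fix B :: "'x set" assume B': "B:sets (borel_of euclidean)"
 hence B: "B:sets borel" by (simp add: borel_of_eu)
 have [measurable]: "(%p. em (proj_p (snd p n)) B):bm GP" for n
  by (rule meas_comp[OF meas_comp[OF snd_component_measurable measurable_proj_p] count_em_meas[OF B']])
 show "(%w. em (Sig w) B):bm GP" unfolding emeasure_Sig[OF B] by measurable
qed

lemma proj_q_Xi:
 assumes p: "fst p:space Gamma_X"
 shows "proj_q (Xi p) = Sig p"
proof -
 have "bij_betw (%n. (pt n (fst p), snd p n)) {n. val n (fst p)} (points (Xi p))"
  using inj_Xi[OF p] points_Xi by (simp add: bij_betw_def)
 from superpose_reindex[OF this, of euclidean "%(x, ys). proj_p ys"] show ?thesis
  unfolding proj_q_def Sig_def by simp
qed

text \<open>Both laws are images of \<open>Q ga\<close>, and a sum of Dirac measures does not change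
  when it is reindexed along the enumeration.\<close>

lemma kernel_hat:
 assumes ga: "ga:space Gamma_X"
 shows "distr (PiM (points ga) et) (Gamma Z_topology) (%w. point_sum Z_topology (points ga) (%x. (x, w x)))
  = distr (Q ga) (Gamma Z_topology) (%w. Xi (ga, w))"
proof -
 define idx where "idx = inv_into {n. val n ga} (%n. pt n ga)"
 note r = reindex_Q[OF ga, folded idx_def]
 let ?R = "%w. \<lambda>x\<in>points ga. w (idx x)"
 let ?F = "%w. point_sum Z_topology (points ga) (%x. (x, w x))"
 have cp: "countable (points ga)" using config_points(2)[OF singletons_eu] ga by simp
 have F: "?F:PiM (points ga) et ->M Gamma Z_topology"
 proof (rule count_algebraI)
  fix w :: "'x => 'x list"
  show "?F w:proper_configurations Z_topology"
  proof (rule point_sum_proper[OF cp])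
   fix C :: "('x \<times> 'x list) set" assume "compactin Z_topology C"
   hence C: "compactin euclidean (fst ` C)" by (rule image_compactin[OF _ continuous_map_fst])
   hence "finite (points ga Int fst ` C)"
    using ga compact_imp_closed[of "fst ` C"]
    by (intro finite_points_compact[OF singletons_eu]) (auto simp: borel_of_eu)
   thus "finite {x:points ga. (x, w x):C}" by (rule rev_finite_subset) force
  qed (auto simp: inj_on_def)
 next
  fix B :: "('x \<times> 'x list) set" assume B: "B:sets (borel_of Z_topology)"
  have e: "em (?F w) B = (NI (Cnt (points ga)) (%x. Ind B (x, w x)))" for w
   by (rule emeasure_point_sum[OF _ B]) simp
  have B': "B:sets (borel XM LB)" using B by (simp add: sets_Z)
  have s: "(%ys. Ind B (x, ys) :: ennreal):bm (et x)" for x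
  proof -
   have "(%ys. (x, ys)):et x ->M borel XM LB"
    by (rule measurable_Pair) (simp_all cong: meas_cong)
   from meas_comp[OF this, of "Ind B" borel] B' show ?thesis by simp
  qed
  show "(%w. em (?F w) B):bm (PiM (points ga) et)"
   unfolding e
  proof (rule measurable_nn_integral_count_space[OF cp])
   fix x assume x: "x:points ga"
   show "(%w. Ind B (x, w x) :: ennreal):bm (PiM (points ga) et)"
    by (rule measurable_component_compose[where f="%ys. Ind B (x, ys)" and M=et and i=x, OF x s[of x]])
  qed
 qed
 have b: "bij_betw (%n. pt n ga) {n. val n ga} (points ga)" by (rule bij_pt[OF ga])
 have "distr (PiM (points ga) et) (Gamma Z_topology) ?F = distr (distr (Q ga) (PiM (points ga) et) ?R) (Gamma Z_topology) ?F"
  using r(1) by simp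
 also have "... = distr (Q ga) (Gamma Z_topology) (?F o ?R)" by (rule distr_distr[OF F r(3)])
 also have "?F o ?R = (%w. Xi (ga, w))"
 proof
  fix w :: "nat => 'x list"
  have "(?F o ?R) w = point_sum Z_topology {n. val n ga} (%n. (pt n ga, ?R w (pt n ga)))"
   unfolding comp_def by (rule point_sum_reindex[OF _ b, of "%x. (x, ?R w x)"]) simp
  also have "... = Xi (ga, w)"
   unfolding Xi_def fst_conv snd_conv using b r(2) by (intro point_sum_cong) (auto simp: bij_betw_def)
  finally show "(?F o ?R) w = Xi (ga, w)" .
 qed
 finally show ?thesis .
qed

text \<open>In \<open>cluster_measure\<close> the clusters are projected before they are superposed,
  so the product of the projected laws is first recognized as an image of the product of the
  \<open>et x\<close>.\<close>

lemma kernel_cl: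
 assumes ga: "ga:space Gamma_X"
 shows "distr (PiM (points ga) (%x. distr (et x) (Gamma_all euclidean) proj_p)) (Gamma_all euclidean) (superpose euclidean (points ga))
  = distr (Q ga) (Gamma_all euclidean) (%w. Sig (ga, w))"
proof -
 define idx where "idx = inv_into {n. val n ga} (%n. pt n ga)"
 note r = reindex_Q[OF ga, folded idx_def]
 let ?GA = "Gamma_all (euclidean :: 'x topology)"
 let ?R = "%w. \<lambda>x\<in>points ga. w (idx x)"
 let ?S = "%w. \<lambda>x\<in>points ga. proj_p (w x)"
 have cp: "countable (points ga)" using config_points(2)[OF singletons_eu] ga by simp
 have pp: "proj_p:et x ->M ?GA" for x using measurable_proj_p by (simp cong: meas_cong)
 have S: "?S:PiM (points ga) et ->M PiM (points ga) (%_. ?GA)"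
 proof (rule measurable_restrict)
  fix x assume x: "x:points ga"
  show "(%w. proj_p (w x)):PiM (points ga) et ->M ?GA"
   by (rule measurable_component_compose[where f=proj_p, OF x pp])
 qed
 have b: "bij_betw (%n. pt n ga) {n. val n ga} (points ga)" by (rule bij_pt[OF ga])
 have "distr (PiM (points ga) (%x. distr (et x) ?GA proj_p)) ?GA (superpose euclidean (points ga))
   = distr (distr (PiM (points ga) et) (PiM (points ga) (%_. ?GA)) ?S) ?GA (superpose euclidean (points ga))"
  using distr_PiM_map[of "points ga" et "%_. proj_p" "%_. ?GA", OF prob_eta pp] by simp
 also have "... = distr (PiM (points ga) et) ?GA (superpose euclidean (points ga) o ?S)"
  by (rule distr_distr[OF measurable_superpose[OF cp] S])
 also have "... = distr (distr (Q ga) (PiM (points ga) et) ?R) ?GA (superpose euclidean (points ga) o ?S)"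
  using r(1) by simp
 also have "... = distr (Q ga) ?GA ((superpose euclidean (points ga) o ?S) o ?R)"
  by (rule distr_distr[OF measurable_comp[OF S measurable_superpose[OF cp]] r(3)])
 also have "(superpose euclidean (points ga) o ?S) o ?R = (%w. Sig (ga, w))"
 proof
  fix w :: "nat => 'x list"
  have "((superpose euclidean (points ga) o ?S) o ?R) w = superpose euclidean {n. val n ga} (%n. ?S (?R w) (pt n ga))"
   unfolding comp_def by (rule superpose_reindex[OF b])
  also have "... = Sig (ga, w)"
   unfolding Sig_def fst_conv snd_conv using b r(2) by (intro superpose_cong) (auto simp: bij_betw_def)
  finally show "((superpose euclidean (points ga) o ?S) o ?R) w = Sig (ga, w)" .
 qed
 finally show ?thesis .
qed

end

locale cluster_process = cluster_kernel K et
 for K :: "nat => 'x::{t2_space,second_countable_topology} set" and et +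
 fixes mu :: "'x measure measure"
 assumes prob_mu: "prob_space mu" and sets_mu: "sets mu = sets Gamma_X"
begin

text \<open>The joint law of the centres and of one cluster for each natural number. The marked and
  the projected configuration become random variables on this one space.\<close>

definition P :: "('x measure \<times> (nat => 'x list)) measure" where
 "P = mu \<bind> (%ga. distr (Q ga) GP (Pair ga))"

lemma space_mu: "space mu = space Gamma_X"
 by (rule sets_eq_imp_space_eq[OF sets_mu])

lemma space_mu_ne: "space mu ~= {}"
 by (rule prob_space.not_empty[OF prob_mu])

lemma measurable_mu: "f:Gamma_X ->M N ==> f:mu ->M N"
 using meas_cong[OF sets_mu refl] by blast

lemma pair_kernel: "(%ga. distr (Q ga) GP (Pair ga)):mu ->M prob_algebra GP"
 by (intro measurable_mu measurable_distr_prob_space2[OF Q_measurable]) simp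

lemma pair_kernel_sub: "(%ga. distr (Q ga) GP (Pair ga)):mu ->M subprob_algebra GP"
 by (rule measurable_prob_algebraD[OF pair_kernel])

lemma sets_P [simp, measurable_cong]: "sets P = sets GP"
 unfolding P_def by (rule sets_bind) (use space_mu_ne in \<open>auto\<close>)

lemma space_P [simp]: "space P = space GP"
 by (rule sets_eq_imp_space_eq[OF sets_P])

lemma prob_P: "prob_space P"
proof -
 have "mu:space (prob_algebra Gamma_X)" using prob_mu sets_mu by (simp add: space_prob_algebra)
 thus ?thesis unfolding P_def
  by (rule prob_space_bind'[OF _ _]) (use pair_kernel meas_cong[OF sets_mu refl] in blast)
qed

lemma measurable_Pair_Q: "ga:space Gamma_X ==> Pair ga:Q ga ->M GP"
 using measurable_Pair1'[of ga Gamma_X PL] by (simp cong: meas_cong)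

lemma nn_integral_P:
 assumes f: "f:bm GP"
 shows "(NI P f) = (NI mu (%ga. (NI (Q ga) (%w. f (ga, w)))))"
 unfolding P_def nn_integral_bind[OF f pair_kernel_sub]
 by (intro nn_integral_cong nn_integral_distr measurable_Pair_Q) (use f in \<open>simp_all add: space_mu\<close>)

lemma AE_P:
 assumes R: "Measurable.pred GP R"
 shows "(AE p in P. R p) \<longleftrightarrow> (AE ga in mu. AE w in Q ga. R (ga, w))"
 unfolding P_def AE_bind[OF pair_kernel_sub R]
proof (rule AE_cong)
 fix ga assume "ga:space mu"
 hence g: "ga:space Gamma_X" by (simp add: space_mu)
 show "(AE p in distr (Q ga) GP (Pair ga). R p) \<longleftrightarrow> (AE w in Q ga. R (ga, w))"
  by (rule AE_distr_iff[OF measurable_Pair_Q[OF g]]) (use R in measurable)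
qed

lemma nn_integral_P_resample:
 assumes f: "f:bm GP"
 shows "(NI P f) = (NI P (%p. (NI (et (pt n (fst p))) (%ys. f (fst p, (snd p)(n:=ys))))))"
proof -
 have m: "(%p. \<integral>\<^sup>+ys. f (fst p, (snd p)(n:=ys)) \<partial>et (pt n (fst p))):bm GP"
 proof (rule nn_integral_measurable_subprob_algebra2)
  show "(%p. et (pt n (fst p))):GP ->M subprob_algebra LB"
   by (rule measurable_prob_algebraD[OF meas_comp[OF pt_fst_measurable eta_measurable]])
  have "(%q. (fst (fst q), (snd (fst q))(n:=snd q))):GP XM LB ->M GP"
  proof (rule measurable_Pair)
   show "(%q. (snd (fst q))(n:=snd q)):GP XM LB ->M PL"
   proof (rule measurable_PiM_single')
    fix i :: nat
    show "(%q. ((snd (fst q))(n:=snd q)) i):GP XM LB ->M LB"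
     by (cases "i = n") (auto intro: meas_comp[OF measurable_fst snd_component_measurable])
   qed (auto simp: space_pair_measure)
  qed simp
  from meas_comp[OF this f]
  show "(%(p, ys). f (fst p, (snd p)(n:=ys))):bm (GP XM LB)"
   by (simp add: split_beta')
 qed
 have s: "(%w. f (ga, w)):bm PL" if "ga:space Gamma_X" for ga
  using meas_comp[OF measurable_Pair1'[OF that] f] .
 show ?thesis unfolding nn_integral_P[OF f] nn_integral_P[OF m]
 proof (rule nn_integral_cong)
  fix ga assume "ga:space mu"
  hence "ga:space Gamma_X" by (simp add: space_mu)
  from nn_integral_Q_resample[OF s[OF this], of ga n]
  show "(NI (Q ga) (%w. f (ga, w))) = (NI (Q ga) (%w. (NI (et (pt n (fst (ga, w)))) (%ys. f (fst (ga, w), (snd (ga, w))(n:=ys))))))"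
   by simp
 qed
qed

lemma hat_measure_eq: "hat_measure mu et = distr P (Gamma Z_topology) Xi"
proof -
 have "distr P (Gamma Z_topology) Xi = mu \<bind> (%ga. distr (distr (Q ga) GP (Pair ga)) (Gamma Z_topology) Xi)"
  unfolding P_def by (rule distr_bind[OF pair_kernel_sub space_mu_ne measurable_Xi])
 also have "... = mu \<bind> (%ga. distr (PiM (points ga) et) (Gamma Z_topology) (%w. point_sum Z_topology (points ga) (%x. (x, w x))))"
 proof (rule bind_cong[OF refl])
  fix ga assume "ga:space mu"
  hence g: "ga:space Gamma_X" by (simp add: space_mu)
  have "distr (distr (Q ga) GP (Pair ga)) (Gamma Z_topology) Xi = distr (Q ga) (Gamma Z_topology) (Xi o Pair ga)"
   by (rule distr_distr[OF measurable_Xi measurable_Pair_Q[OF g]])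
  thus "distr (distr (Q ga) GP (Pair ga)) (Gamma Z_topology) Xi
    = distr (PiM (points ga) et) (Gamma Z_topology) (%w. point_sum Z_topology (points ga) (%x. (x, w x)))"
   unfolding kernel_hat[OF g] by (simp add: comp_def)
 qed
 finally show ?thesis unfolding hat_measure_def by (rule sym)
qed

lemma cluster_measure_eq:
 "cluster_measure mu et = restrict_space (distr P (Gamma_all euclidean) Sig) (space Gamma_X)"
proof -
 let ?GA = "Gamma_all (euclidean :: 'x topology)"
 have "distr P ?GA Sig = mu \<bind> (%ga. distr (distr (Q ga) GP (Pair ga)) ?GA Sig)"
  unfolding P_def by (rule distr_bind[OF pair_kernel_sub space_mu_ne measurable_Sig])
 also have "... = mu \<bind> (%ga. distr (PiM (points ga) (%x. distr (et x) ?GA proj_p)) ?GA (superpose euclidean (points ga)))"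
 proof (rule bind_cong[OF refl])
  fix ga assume "ga:space mu"
  hence g: "ga:space Gamma_X" by (simp add: space_mu)
  have "distr (distr (Q ga) GP (Pair ga)) ?GA Sig = distr (Q ga) ?GA (Sig o Pair ga)"
   by (rule distr_distr[OF measurable_Sig measurable_Pair_Q[OF g]])
  thus "distr (distr (Q ga) GP (Pair ga)) ?GA Sig
    = distr (PiM (points ga) (%x. distr (et x) ?GA proj_p)) ?GA (superpose euclidean (points ga))"
   unfolding kernel_cl[OF g] by (simp add: comp_def)
 qed
 finally show ?thesis unfolding cluster_measure_def by simp
qed

text \<open>A Campbell formula: integrating out the clusters turns the sum over valid indices into a
  sum over the points of the configuration.\<close>

lemma nn_integral_P_sum:
 assumes u: "u:bm (borel XM LB)"
 shows "(NI P (%p. (\<Sum>n. if val n (fst p) then u (pt n (fst p), snd p n) else 0)))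
  = (NI mu (%ga. (NI (Cnt (points ga)) (%x. (NI (et x) (%ys. u (x, ys)))))))"
proof -
 have s: "(%ys. u (x, ys)):bm LB" for x
  using meas_comp[OF measurable_Pair1' u, of x] by simp
 have m: "(%p. \<Sum>n. if val n (fst p) then u (pt n (fst p), snd p n) else 0):bm GP"
  using u by measurable
 show ?thesis unfolding nn_integral_P[OF m]
 proof (rule nn_integral_cong)
  fix ga assume "ga:space mu"
  hence g: "ga:space Gamma_X" by (simp add: space_mu)
  have "(NI (Q ga) (%w. (\<Sum>n. if val n (fst (ga, w)) then u (pt n (fst (ga, w)), snd (ga, w) n) else 0)))
    = (\<Sum>n. \<integral>\<^sup>+w. (if val n ga then u (pt n ga, w n) else 0) \<partial>Q ga)"
  proof (subst nn_integral_suminf[symmetric])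
   fix n
   have "(%w. u (pt n ga, w n)):bm PL"
    by (rule measurable_component_compose[where f="%ys. u (pt n ga, ys)" and M="%_. LB" and i=n, OF UNIV_I s[of "pt n ga"]])
   thus "(%w. if val n ga then u (pt n ga, w n) else 0):bm (Q ga)"
    by (simp cong: meas_cong)
  qed (simp only: fst_conv snd_conv)
  also have "... = (\<Sum>n. if val n ga then (NI (et (pt n ga)) (%ys. u (pt n ga, ys))) else 0)"
   by (rule suminf_cong) (simp add: nn_integral_Q_component[OF s])
  also have "... = (NI (Cnt {n. val n ga}) (%n. (NI (et (pt n ga)) (%ys. u (pt n ga, ys)))))"
   by (rule nn_integral_val[symmetric])
  also have "... = (NI (Cnt (points ga)) (%x. (NI (et x) (%ys. u (x, ys)))))"
   by (rule nn_integral_bij_count_space[OF bij_pt[OF g]])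
  finally show "(NI (Q ga) (%w. (\<Sum>n. if val n (fst (ga, w)) then u (pt n (fst (ga, w)), snd (ga, w) n) else 0)))
    = (NI (Cnt (points ga)) (%x. (NI (et x) (%ys. u (x, ys)))))" .
 qed
qed

end

section \<open>Calculus in charts\<close>

lemma matrix_mult_vector_linear: "linear f ==> matrix f *v x = f x" for f :: "real ^ 'n => real ^ 'm"
 by (simp add: matrix_works linear_matrix_vector_mul_eq)

lemma has_derivative_vecI:
 fixes f :: "'a::real_normed_vector => real ^ 'n"
 assumes "!!i. ((%y. f y $ i) has_derivative (%h. f' h $ i)) (at x)"
 shows "(f has_derivative f') (at x)"
 unfolding has_derivative_componentwise_within[of f f' x UNIV]
 using assms by (auto simp: Basis_vec_def inner_axis)

lemma has_derivative_matrixI: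
 fixes A :: "'a::real_normed_vector => real ^ 'n ^ 'm"
 assumes "!!i j. ((%y. A y $ i $ j) has_derivative (%h. A' h $ i $ j)) (at x)"
 shows "(A has_derivative A') (at x)"
 unfolding has_derivative_componentwise_within[of A A' x UNIV]
 using assms by (auto simp: Basis_vec_def inner_axis)

lemma has_derivative_nth: "(f has_derivative f') F ==> ((%y. f y $ i) has_derivative (%h. f' h $ i)) F"
 by (rule bounded_linear.has_derivative[OF bounded_linear_vec_nth])

text \<open>Every matrix on the segment from the identity to \<open>A\<close> is positive definite,
  hence invertible; by the intermediate value theorem the determinant cannot leave the positive
  numbers.\<close>

lemma det_pos_def:
 fixes A :: "real ^ 'n ^ 'n"
 assumes A: "!!u. u ~= 0 ==> u \<bullet> (A *v u) > 0"
 shows "det A > 0"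
proof (rule ccontr)
 assume n: "~ det A > 0"
 let ?B = "%t::real. (1-t) *R mat 1+t *R A"
 have c: "continuous_on {0..1} (%t. det (?B t))"
  unfolding det_def by (intro continuous_intros)
 have 0: "det (?B 0) = 1" by simp
 have 1: "det (?B 1) <= 0" using n by simp
 obtain t where t: "0 <= t" "t <= 1" "det (?B t) = 0"
  using IVT2'[of "%t. det (?B t)" 1 0 0] c 0 1 by auto
 hence "~ invertible (?B t)" by (simp add: invertible_det_nz)
 then obtain u where u: "?B t *v u = 0" "u ~= 0"
  unfolding invertible_left_inverse matrix_left_invertible_ker by blast
 have e: "?B t *v u = (1-t) *R u+t *R (A *v u)"
  by (simp add: matrix_vector_mult_add_rdistrib scaleR_matrix_vector_assoc[symmetric])
 have "0 = u \<bullet> (?B t *v u)" using u by simp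
 also have "... = (1-t)*(u \<bullet> u)+t*(u \<bullet> (A *v u))"
  unfolding e by (simp add: inner_add_right)
 also have "... > 0"
 proof (cases "t = 0")
  case True thus ?thesis using u by simp
 next
  case False
  hence "t*(u \<bullet> (A *v u)) > 0" using t A[OF u(2)] by simp
  moreover have "(1-t)*(u \<bullet> u) >= 0" using t by simp
  ultimately show ?thesis by linarith
 qed
 finally show False by simp
qed

lemma matrix_eq_bilinear:
 fixes A B :: "real ^ 'n ^ 'm"
 assumes "!!u w. u \<bullet> (A *v w) = u \<bullet> (B *v w)"
 shows "A = B"
 unfolding matrix_eq using assms vector_eq_ldot by blast

lemma inner_transpose_mult:
 fixes A :: "real ^ 'n ^ 'n"
 shows "(A *v u) \<bullet> w = u \<bullet> (transpose A *v w)"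
 by (metis dot_lmul_matrix inner_commute transpose_matrix_vector)

lemma matrix_inv_props:
 fixes A :: "real ^ 'n ^ 'n"
 assumes "invertible A"
 shows "matrix_inv A ** A = mat 1" "A ** matrix_inv A = mat 1"
 using assms unfolding invertible_def matrix_inv_def by (metis (mono_tags, lifting) someI_ex)+

locale riemann =
 fixes M :: "('x::{t2_space,second_countable_topology}, 'n::finite) riemannian"
 assumes manifold: "riemannian_manifold M"
begin

abbreviation dom :: "('x, 'n) chart => 'x set" where "dom c \<equiv> fst c"
abbreviation img :: "('x, 'n) chart => (real ^ 'n) set" where "img c \<equiv> snd c ` fst c"
abbreviation ch :: "'x => ('x, 'n) chart" where "ch x \<equiv> chart_at M x"
abbreviation tr :: "('x, 'n) chart => ('x, 'n) chart => real ^ 'n => real ^ 'n" where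
 "tr c d \<equiv> snd d o cinv c"

lemma open_dom: "c:atlas M ==> open (dom c)"
 and open_img: "c:atlas M ==> open (img c)"
 and chart_homeo: "c:atlas M ==> homeomorphism (dom c) (img c) (snd c) (cinv c)"
proof -
 assume c: "c:atlas M"
 have "ALL (U, ph):atlas M. open U & open (ph ` U) & homeomorphism U (ph ` U) ph (inv_into U ph)"
  using manifold unfolding riemannian_manifold_def by blast
 from bspec[OF this c] show "open (dom c)" "open (img c)" "homeomorphism (dom c) (img c) (snd c) (cinv c)"
  unfolding chart_inv_def by (simp_all add: case_prod_beta)
qed

lemma smooth_tr: "c:atlas M ==> d:atlas M ==> smooth_on (snd c ` (dom c Int dom d)) (tr c d)"
 and ch_atlas: "ch x:atlas M" and ch_dom: "x:dom (ch x)"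
 and metric_bilinear: "bilinear (metric M x)"
 and metric_sym: "metric M x u w = metric M x w u"
 and metric_pos: "u ~= 0 ==> metric M x u u > 0"
 and smooth_gram: "c:atlas M ==> smooth_on (img c) (%p. gram M c p $ i $ j)"
 using manifold unfolding riemannian_manifold_def by blast+

lemma chart_inv_eq: "c:atlas M ==> x:dom c ==> cinv c (snd c x) = x"
 using chart_homeo by (simp add: homeomorphism_def)

lemma chart_eq: "c:atlas M ==> p:img c ==> snd c (cinv c p) = p"
 using chart_homeo unfolding homeomorphism_def by blast

lemma chart_inv_dom: "c:atlas M ==> p:img c ==> cinv c p:dom c"
 using chart_homeo unfolding homeomorphism_def by blast

lemma chart_cont: "c:atlas M ==> continuous_on (dom c) (snd c)"
 using chart_homeo by (simp add: homeomorphism_def)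

lemma chart_inv_cont: "c:atlas M ==> continuous_on (img c) (cinv c)"
 using chart_homeo by (simp add: homeomorphism_def)

lemma chart_image_eq:
 assumes "c:atlas M"
 shows "snd c ` (dom c Int V) = {p:img c. cinv c p:V}"
proof (intro equalityI subsetI)
 fix p assume "p:snd c ` (dom c Int V)"
 thus "p:{p:img c. cinv c p:V}" using chart_inv_eq[OF assms] by auto
next
 fix p assume "p:{p:img c. cinv c p:V}"
 hence p: "p:img c" "cinv c p:V" by auto
 have "p = snd c (cinv c p)" using chart_eq[OF assms p(1)] by simp
 moreover have "cinv c p:dom c Int V" using chart_inv_dom[OF assms p(1)] p(2) by simp
 ultimately show "p:snd c ` (dom c Int V)" by (rule image_eqI)
qed

lemma open_chart_image:
 assumes c: "c:atlas M" and V: "open V"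
 shows "open (snd c ` (dom c Int V))"
proof -
 have "open (img c Int cinv c -` V)"
  by (rule continuous_open_preimage[OF chart_inv_cont[OF c] open_img[OF c] V])
 moreover have "img c Int cinv c -` V = snd c ` (dom c Int V)"
  unfolding chart_image_eq[OF c] by auto
 ultimately show ?thesis by simp
qed

lemma open_overlap: "c:atlas M ==> d:atlas M ==> open (snd c ` (dom c Int dom d))"
 by (intro open_chart_image open_dom)

lemma continuous_on_charts:
 fixes g :: "'x => 'b::topological_space"
 assumes "!!c. c:atlas M ==> continuous_on (img c) (g o cinv c)"
 shows "continuous_on UNIV g"
proof -
 have "isCont g x" for x
 proof -
  let ?c = "ch x"
  have "continuous_on (dom ?c) ((g o cinv ?c) o snd ?c)"
   by (rule continuous_on_compose[OF chart_cont[OF ch_atlas] assms[OF ch_atlas]])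
  hence "continuous_on (dom ?c) g"
   by (rule continuous_on_cong[THEN iffD1, rotated 2, OF _ refl]) (simp add: chart_inv_eq[OF ch_atlas])
  thus ?thesis using open_dom[OF ch_atlas] ch_dom continuous_on_eq_continuous_at by blast
 qed
 thus ?thesis by (simp add: continuous_at_imp_continuous_on)
qed

text \<open>The derivative of a chart transition, in a form that covers the conversions both to and
  from the preferred chart.\<close>

definition dT :: "('x, 'n) chart => ('x, 'n) chart => 'x => real ^ 'n => real ^ 'n" where
 "dT c d x = fder (tr c d) (snd c x)"

lemma from_tangent_eq: "from_tangent M c x = dT (ch x) c x"
 by (simp add: from_tangent_def dT_def)

lemma to_tangent_eq: "to_tangent M c x = dT c (ch x) x"
 by (simp add: to_tangent_def dT_def)

lemma tr_has_derivative:
 assumes "c:atlas M" "d:atlas M" "x:dom c" "x:dom d"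
 shows "(tr c d has_derivative dT c d x) (at (snd c x))"
 unfolding dT_def
 by (rule frechetI, rule smooth_diff[OF smooth_tr[OF assms(1,2)]]) (use assms in blast)

lemma dT_linear: "c:atlas M ==> d:atlas M ==> x:dom c ==> x:dom d ==> linear (dT c d x)"
 by (rule has_derivative_linear[OF tr_has_derivative])

lemma tr_at: "c:atlas M ==> x:dom c ==> tr c d (snd c x) = snd d x"
 by (simp add: chart_inv_eq)

lemma change_chart_derivative:
 assumes c: "c:atlas M" "x:dom c" and d: "d:atlas M" "x:dom d"
  and f: "((f o cinv c) has_derivative D) (at (snd c x))"
 shows "((f o cinv d) has_derivative (%u. D (dT d c x u))) (at (snd d x))"
proof -
 have "((%p. (f o cinv c) (tr d c p)) has_derivative (%u. D (dT d c x u))) (at (snd d x))"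
  by (rule has_derivative_compose[OF tr_has_derivative[OF d(1) c(1) d(2) c(2)]]) (simp only: tr_at[OF d] f)
 moreover have "open (snd d ` (dom d Int dom c))" by (rule open_overlap[OF d(1) c(1)])
 moreover have "snd d x:snd d ` (dom d Int dom c)" using c d by blast
 moreover have "(f o cinv c) (tr d c p) = (f o cinv d) p" if "p:snd d ` (dom d Int dom c)" for p
 proof -
  have "cinv d p:dom c" using that unfolding chart_image_eq[OF d(1)] by simp
  thus ?thesis by (simp add: chart_inv_eq[OF c(1)])
 qed
 ultimately show ?thesis by (rule has_derivative_transform_within_open)
qed

lemma dT_comp:
 assumes "c:atlas M" "d:atlas M" "e:atlas M" "x:dom c" "x:dom d" "x:dom e"
 shows "dT c e x u = dT d e x (dT c d x u)"
proof -
 have "(tr c e has_derivative (%u. dT d e x (dT c d x u))) (at (snd c x))"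
  by (rule change_chart_derivative[OF assms(2,5,1,4)]) (rule tr_has_derivative[OF assms(2,3,5,6)])
 thus ?thesis unfolding dT_def[of c e] by (simp add: frechet_eqI)
qed

lemma dT_self:
 assumes "c:atlas M" "x:dom c"
 shows "dT c c x u = u"
proof -
 have "((%p. p) has_derivative (%u. u)) (at (snd c x))" by (rule has_derivative_ident)
 hence "(tr c c has_derivative (%u. u)) (at (snd c x))"
  by (rule has_derivative_transform_within_open[OF _ open_img[OF assms(1)]]) (use assms chart_eq in auto)
 thus ?thesis unfolding dT_def by (simp add: frechet_eqI)
qed

lemma dT_inverse:
 assumes "c:atlas M" "d:atlas M" "x:dom c" "x:dom d"
 shows "dT d c x (dT c d x u) = u"
 using dT_comp[OF assms(1,2,1,3,4,3), of u] dT_self[OF assms(1,3)] by simp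

definition mdiff :: "('x => real) => 'x => bool" where
 "mdiff f x \<longleftrightarrow> (f o cinv (ch x)) differentiable (at (snd (ch x) x))"

lemma mdiff_has_derivative: "mdiff f x ==> ((f o cinv (ch x)) has_derivative differential M f x) (at (snd (ch x) x))"
 unfolding mdiff_def differential_def by (rule frechetI)

lemma differential_eqI:
 assumes "((f o cinv (ch x)) has_derivative D) (at (snd (ch x) x))"
 shows "mdiff f x" "differential M f x = D"
 using assms frechet_eqI[OF assms] by (auto simp: mdiff_def differential_def differentiable_def)

lemma differential_chart:
 assumes c: "c:atlas M" "x:dom c" and f: "((f o cinv c) has_derivative D) (at (snd c x))"
 shows "mdiff f x" "differential M f x u = D (from_tangent M c x u)"
 using differential_eqI[OF change_chart_derivative[OF c ch_atlas ch_dom f]]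
 by (auto simp: from_tangent_eq)

lemma mdiff_chart:
 assumes c: "c:atlas M" "x:dom c" and f: "mdiff f x"
 shows "((f o cinv c) has_derivative (%u. differential M f x (to_tangent M c x u))) (at (snd c x))"
 unfolding to_tangent_eq by (rule change_chart_derivative[OF ch_atlas ch_dom c mdiff_has_derivative[OF f]])

lemma differential_linear: "mdiff f x ==> linear (differential M f x)"
 by (rule has_derivative_linear[OF mdiff_has_derivative])

lemma metric_linear_left: "linear (%u. metric M x u w)" and metric_linear_right: "linear (metric M x u)"
 using metric_bilinear unfolding bilinear_def by blast+

lemma metric_add_left: "metric M x (u+v) w = metric M x u w+metric M x v w"
 and metric_scale_left: "metric M x (r *R u) w = r*metric M x u w"
 and metric_add_right: "metric M x w (u+v) = metric M x w u+metric M x w v"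
 and metric_scale_right: "metric M x w (r *R u) = r*metric M x w u"
 and metric_zero_left: "metric M x 0 w = 0" and metric_zero_right: "metric M x w 0 = 0"
 using linear_add[OF metric_linear_left] linear_cmul[OF metric_linear_left]
  linear_add[OF metric_linear_right] linear_cmul[OF metric_linear_right]
  linear_0[OF metric_linear_left] linear_0[OF metric_linear_right]
 by auto

lemma metric_nonneg: "metric M x u u >= 0"
 using metric_pos[of u x] metric_zero_left[of x 0] by (cases "u = 0") (auto intro: less_imp_le)

lemma metric_Cauchy_Schwarz: "abs (metric M x u w) <= tangent_norm M x u*tangent_norm M x w"
proof (cases "w = 0")
 case True
 thus ?thesis by (simp add: metric_zero_right tangent_norm_def)
next
 case False
 hence w: "metric M x w w > 0" by (rule metric_pos)
 let ?l = "metric M x u w/metric M x w w"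
 have "0 <= metric M x (u+(- ?l) *R w) (u+(- ?l) *R w)" by (rule metric_nonneg)
 also have "... = metric M x u u-2*?l*metric M x u w+?l*?l*metric M x w w"
  unfolding metric_add_left metric_add_right metric_scale_left metric_scale_right
  using metric_sym[of x w u] by (simp add: algebra_simps)
 also have "... = metric M x u u-(metric M x u w)\<^sup>2/metric M x w w"
  using w by (simp add: power2_eq_square field_simps)
 finally have "(metric M x u w)\<^sup>2/metric M x w w <= metric M x u u" by simp
 hence "(metric M x u w)\<^sup>2 <= metric M x u u*metric M x w w" using w by (simp add: field_simps)
 hence "sqrt ((metric M x u w)\<^sup>2) <= sqrt (metric M x u u*metric M x w w)" by (rule real_sqrt_le_mono)
 thus ?thesis by (simp add: tangent_norm_def real_sqrt_mult)
qed

text \<open>\<open>grad\<close> is a definite description. Existence: testing the metric against the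
  basis vectors is an injective linear map, hence onto in finite dimension. Uniqueness: the metric
  is positive on the difference of two solutions unless it is 0.\<close>

lemma grad_metric:
 assumes f: "linear (differential M f x)"
 shows "metric M x (grad M f x) u = differential M f x u"
proof -
 let ?g = "%w. (\<chi> i. metric M x w (axis i 1)) :: real ^ 'n"
 have lin: "linear ?g"
  by (rule linearI) (simp_all add: vec_eq_iff metric_add_left metric_scale_left)
 have exp: "F u = (\<Sum>i\<in>UNIV. (u $ i)*F (axis i 1))" if F: "linear F" for F :: "real ^ 'n => real" and u
 proof -
  have "F u = F (\<Sum>i\<in>UNIV. (u $ i) *R axis i 1)"
   using basis_expansion[of u] by (simp add: scalar_mult_eq_scaleR)
  thus ?thesis by (simp add: linear_sum[OF F] linear_cmul[OF F])
 qed
 have inj: "inj ?g"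
 proof (rule linear_injective_0[OF lin, THEN iffD2], intro allI impI)
  fix w assume z: "?g w = 0"
  have "metric M x w w = (\<Sum>i\<in>UNIV. (w $ i)*metric M x w (axis i 1))" by (rule exp[OF metric_linear_right])
  also have "... = 0" using z by (simp add: vec_eq_iff)
  finally show "w = 0" using metric_pos[of w x] by force
 qed
 have "surj ?g" by (rule linear_injective_imp_surjective[OF lin inj]) simp
 hence "EX w. (\<chi> i. differential M f x (axis i 1)) = ?g w" by (rule surjD)
 then obtain w where w: "(\<chi> i. differential M f x (axis i 1)) = ?g w" by (rule exE)
 hence wi: "metric M x w (axis i 1) = differential M f x (axis i 1)" for i by (simp add: vec_eq_iff)
 have ex: "ALL u. metric M x w u = differential M f x u"
 proof
  fix u
  have "metric M x w u = (\<Sum>i\<in>UNIV. u $ i*metric M x w (axis i 1))" by (rule exp[OF metric_linear_right])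
  also have "... = differential M f x u" unfolding wi by (rule exp[OF f, symmetric])
  finally show "metric M x w u = differential M f x u" .
 qed
 have "grad M f x = w"
  unfolding grad_def
 proof (rule the_equality, rule ex)
  fix w' assume a: "ALL u. metric M x w' u = differential M f x u"
  have "metric M x (w'+(-1) *R w) (w'+(-1) *R w) = 0"
   using a ex unfolding metric_add_left metric_scale_left by simp
  hence "w'+(-1) *R w = 0" using metric_pos[of "w'+(-1) *R w" x] by linarith
  thus "w' = w" by simp
 qed
 thus ?thesis using ex by simp
qed

lemma vec_linear_expand:
 fixes L :: "real ^ 'n => 'b::real_vector"
 assumes "linear L"
 shows "L u = (\<Sum>i\<in>UNIV. (u $ i) *R L (axis i 1))"
proof -
 have "L u = L (\<Sum>i\<in>UNIV. (u $ i) *R axis i 1)"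
  using basis_expansion[of u] by (simp add: scalar_mult_eq_scaleR)
 thus ?thesis by (simp add: linear_sum[OF assms] linear_cmul[OF assms])
qed

lemma gram_form:
 assumes c: "c:atlas M" "x:dom c"
 shows "u \<bullet> (gram M c (snd c x) *v w) = metric M x (to_tangent M c x u) (to_tangent M c x w)"
proof -
 let ?L = "to_tangent M c x"
 have L: "linear ?L" unfolding to_tangent_eq by (rule dT_linear[OF c(1) ch_atlas c(2) ch_dom])
 have "metric M x (?L u) (?L w) = (\<Sum>i\<in>UNIV. u $ i*metric M x (?L (axis i 1)) (?L w))"
  using vec_linear_expand[OF linear_compose[OF L metric_linear_left[of x "?L w"]], of u] by (simp add: o_def)
 also have "... = (\<Sum>i\<in>UNIV. u $ i*(\<Sum>j\<in>UNIV. w $ j*metric M x (?L (axis i 1)) (?L (axis j 1))))"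
  using vec_linear_expand[OF linear_compose[OF L metric_linear_right], of _ _ w] by (simp add: o_def)
 also have "... = (\<Sum>i\<in>UNIV. u $ i*(\<Sum>j\<in>UNIV. gram M c (snd c x) $ i $ j*w $ j))"
  by (simp add: gram_def Let_def chart_inv_eq[OF c] mult.commute)
 also have "... = u \<bullet> (gram M c (snd c x) *v w)"
  by (simp add: inner_vec_def matrix_vector_mult_def)
 finally show ?thesis ..
qed

lemma gram_det_pos:
 assumes c: "c:atlas M" "p:img c"
 shows "det (gram M c p) > 0"
proof (rule det_pos_def)
 fix u :: "real ^ 'n" assume u: "u ~= 0"
 let ?x = "cinv c p"
 have x: "?x:dom c" "snd c ?x = p" using chart_inv_dom[OF c] chart_eq[OF c] by auto
 have "to_tangent M c ?x u ~= 0"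
 proof
  assume "to_tangent M c ?x u = 0"
  hence "dT (ch ?x) c ?x (to_tangent M c ?x u) = 0"
   using linear_0[OF dT_linear[OF ch_atlas c(1) ch_dom x(1)]] by simp
  thus False using dT_inverse[OF c(1) ch_atlas x(1) ch_dom, of u] u unfolding to_tangent_eq by simp
 qed
 thus "u \<bullet> (gram M c p *v u) > 0"
  using gram_form[OF c(1) x(1), of u u] metric_pos unfolding x(2) by simp
qed

abbreviation Jac :: "('x, 'n) chart => ('x, 'n) chart => 'x => real ^ 'n ^ 'n" where
 "Jac c d x \<equiv> matrix (dT c d x)"

lemma Jac_mult:
 assumes "c:atlas M" "d:atlas M" "x:dom c" "x:dom d"
 shows "Jac c d x *v u = dT c d x u"
 by (rule matrix_mult_vector_linear[OF dT_linear[OF assms]])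

lemma Jac_det_nz:
 assumes "c:atlas M" "d:atlas M" "x:dom c" "x:dom d"
 shows "det (Jac c d x) ~= 0"
proof -
 have "Jac d c x ** Jac c d x = mat 1"
  unfolding matrix_eq matrix_vector_mul_assoc[symmetric]
  using Jac_mult[OF assms] Jac_mult[OF assms(2,1,4,3)] dT_inverse[OF assms] by simp
 hence "det (Jac d c x)*det (Jac c d x) = 1" by (metis det_I det_mul)
 thus ?thesis by auto
qed

lemma gram_change:
 assumes c: "c:atlas M" "x:dom c" and d: "d:atlas M" "x:dom d"
 shows "gram M c (snd c x) = transpose (Jac c d x) ** (gram M d (snd d x) ** Jac c d x)"
proof (rule matrix_eq_bilinear)
 fix u w :: "real ^ 'n"
 have t: "to_tangent M c x u = to_tangent M d x (dT c d x u)" for u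
  unfolding to_tangent_eq by (rule dT_comp[OF c(1) d(1) ch_atlas c(2) d(2) ch_dom])
 have "u \<bullet> (gram M c (snd c x) *v w) = metric M x (to_tangent M c x u) (to_tangent M c x w)" by (rule gram_form[OF c])
 also have "... = dT c d x u \<bullet> (gram M d (snd d x) *v dT c d x w)" unfolding t by (rule gram_form[OF d, symmetric])
 also have "... = (Jac c d x *v u) \<bullet> (gram M d (snd d x) *v (Jac c d x *v w))"
  unfolding Jac_mult[OF c(1) d(1) c(2) d(2)] ..
 also have "... = u \<bullet> ((transpose (Jac c d x) ** (gram M d (snd d x) ** Jac c d x)) *v w)"
  unfolding inner_transpose_mult matrix_vector_mul_assoc[symmetric] ..
 finally show "u \<bullet> (gram M c (snd c x) *v w) = u \<bullet> ((transpose (Jac c d x) ** (gram M d (snd d x) ** Jac c d x)) *v w)" .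
qed

lemma gram_det_change:
 assumes c: "c:atlas M" "x:dom c" and d: "d:atlas M" "x:dom d"
 shows "det (gram M c (snd c x)) = (det (Jac c d x))\<^sup>2*det (gram M d (snd d x))"
 unfolding gram_change[OF assms] det_mul det_transpose by (simp add: power2_eq_square)

lemma smooth_det_gram:
 assumes "c:atlas M"
 shows "smooth_on (img c) (%p. det (gram M c p))"
 unfolding det_def
 by (intro smooth_on_sum[OF open_img[OF assms]] smooth_on_mult[OF open_img[OF assms]] smooth_on_prod[OF open_img[OF assms]]
   smooth_on_const smooth_gram[OF assms])

section \<open>Chart independence of the divergence\<close>

definition field_in :: "('x => real ^ 'n) => ('x, 'n) chart => real ^ 'n => real ^ 'n" where
 "field_in v c p = from_tangent M c (cinv c p) (v (cinv c p))"

lemma field_in_eq: "c:atlas M ==> x:dom c ==> field_in v c (snd c x) = from_tangent M c x (v x)"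
 by (simp add: field_in_def chart_inv_eq)

lemma field_in_change:
 assumes c: "c:atlas M" "x:dom c" and d: "d:atlas M" "x:dom d"
 shows "field_in v d (snd d x) = dT c d x (field_in v c (snd c x))"
 unfolding field_in_eq[OF c] field_in_eq[OF d] from_tangent_eq
 by (rule dT_comp[OF ch_atlas c(1) d(1) ch_dom c(2) d(2)])

lemma smooth_field_in: "v:Vect0 M ==> c:atlas M ==> smooth_on (img c) (field_in v c)"
 unfolding Vect0_def field_in_def[abs_def] by blast

lemma to_tangent_field_in:
 assumes c: "c:atlas M" "x:dom c"
 shows "to_tangent M c x (field_in v c (snd c x)) = v x"
 unfolding field_in_eq[OF c] from_tangent_eq to_tangent_eq by (rule dT_inverse[OF ch_atlas c(1) ch_dom c(2)])

text \<open>The product rule removes the square root from the coordinate formula: div v = tr Dv +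
  v(G) / (2 G) with G = det g.\<close>

definition divc :: "('x, 'n) chart => ('x => real ^ 'n) => real ^ 'n => real" where
 "divc c v p = (\<Sum>i\<in>UNIV. fder (field_in v c) p (axis i 1) $ i) +
   fder (%p. det (gram M c p)) p (field_in v c p)/(2*det (gram M c p))"

lemma divergence_eq_divc:
 assumes v: "v:Vect0 M"
 shows "divergence M v x = divc (ch x) v (snd (ch x) x)"
proof -
 let ?c = "ch x" and ?p = "snd (ch x) x"
 let ?G = "%p. det (gram M ?c p)" and ?v = "field_in v ?c"
 have p: "?p:img ?c" using ch_dom by blast
 have G0: "?G ?p > 0" by (rule gram_det_pos[OF ch_atlas p])
 have G: "(?G has_derivative fder ?G ?p) (at ?p)"
  by (rule frechetI[OF smooth_diff[OF smooth_det_gram[OF ch_atlas] p]])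
 have V: "(?v has_derivative fder ?v ?p) (at ?p)"
  by (rule frechetI[OF smooth_diff[OF smooth_field_in[OF v ch_atlas] p]])
 have S: "((%q. sqrt (?G q)) has_derivative (%u. inverse (sqrt (?G ?p))/2*fder ?G ?p u)) (at ?p)"
  by (rule has_derivative_compose[OF G, of sqrt "%y. inverse (sqrt (?G ?p))/2*y"])
    (rule DERIV_real_sqrt[OF G0, unfolded has_field_derivative_def])
 have D: "fder (%q. sqrt (?G q)*?v q $ i) ?p u =
   sqrt (?G ?p)*fder ?v ?p u $ i+inverse (sqrt (?G ?p))/2*fder ?G ?p u*?v ?p $ i" for i u
  by (rule fun_cong[OF frechet_eqI]) (rule has_derivative_mult[OF S has_derivative_nth[OF V]])
 have s: "sqrt (?G ?p) ~= 0" "inverse (sqrt (?G ?p))/sqrt (?G ?p) = 1/?G ?p"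
  using G0 by (simp_all add: divide_inverse flip: inverse_mult_distrib)
 have "divergence M v x = (\<Sum>i\<in>UNIV. fder (%q. sqrt (?G q)*?v q $ i) ?p (axis i 1))/sqrt (?G ?p)"
  by (simp add: divergence_def Let_def field_in_def)
 also have "... = (\<Sum>i\<in>UNIV. fder ?v ?p (axis i 1) $ i+(1/?G ?p)/2*(?v ?p $ i*fder ?G ?p (axis i 1)))"
  unfolding D sum_divide_distrib
 proof (rule sum.cong[OF refl])
  fix i
  have "(sqrt (?G ?p)*a+inverse (sqrt (?G ?p))/2*b*e)/sqrt (?G ?p) = a+(1/?G ?p)/2*(e*b)" for a b e :: real
   using s(1) unfolding s(2)[symmetric] by (simp add: field_simps)
  thus "(sqrt (?G ?p)*fder ?v ?p (axis i 1) $ i+inverse (sqrt (?G ?p))/2*fder ?G ?p (axis i 1)*?v ?p $ i)/sqrt (?G ?p)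
   = fder ?v ?p (axis i 1) $ i+(1/?G ?p)/2*(?v ?p $ i*fder ?G ?p (axis i 1))" .
 qed
 also have "... = (\<Sum>i\<in>UNIV. fder ?v ?p (axis i 1) $ i)+(1/?G ?p)/2*(\<Sum>i\<in>UNIV. ?v ?p $ i*fder ?G ?p (axis i 1))"
  by (simp add: sum.distrib sum_distrib_left)
 also have "(\<Sum>i\<in>UNIV. ?v ?p $ i*fder ?G ?p (axis i 1)) = fder ?G ?p (?v ?p)"
  using vec_linear_expand[OF has_derivative_linear[OF G], of "?v ?p"] by simp
 finally show ?thesis unfolding divc_def by simp
qed

text \<open>Let J be the Jacobian of the transition T and K its derivative. Differentiating w o T =
  J v gives B J = J A + K u, where the symmetry of second derivatives has exchanged the arguments of
  K. Taking traces, tr B = tr A + tr (J^-1 K u). The same trace is what v(G) / (2 G) gains in the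
  chart \<open>c\<close>, by G_c = (det J)^2 G_d and Jacobi's formula.\<close>

lemma divc_change:
 assumes v: "v:Vect0 M" and c: "c:atlas M" "x:dom c" and d: "d:atlas M" "x:dom d"
 shows "divc c v (snd c x) = divc d v (snd d x)"
proof -
 define S where "S = snd c ` (dom c Int dom d)"
 define p where "p = snd c x"
 define q where "q = snd d x"
 define T where "T = tr c d"
 define u where "u = field_in v c p"
 define w where "w = field_in v d q"
 have S: "open S" "smooth_on S T" unfolding S_def T_def by (rule open_overlap[OF c(1) d(1)], rule smooth_tr[OF c(1) d(1)])
 have pS: "p:S" using c d by (simp add: S_def p_def)
 have Sd: "cinv c y:dom c" "cinv c y:dom d" "snd c (cinv c y) = y" "snd d (cinv c y) = T y" if "y:S" for y
  using that chart_eq[OF c(1)] chart_inv_dom[OF c(1)] unfolding S_def chart_image_eq[OF c(1)] T_def by auto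
 have Tp: "T p = q" unfolding T_def p_def q_def by (rule tr_at[OF c])
 define Jm where "Jm y = matrix (fder T y)" for y
 have Jm: "Jm y = Jac c d (cinv c y)" if "y:S" for y
  unfolding Jm_def dT_def Sd(3)[OF that] T_def ..
 have Jp: "Jm p = Jac c d x" unfolding Jm_def dT_def p_def T_def ..
 have Jinv: "invertible (Jm p)" unfolding Jp invertible_det_nz by (rule Jac_det_nz[OF c(1) d(1) c(2) d(2)])
 have Jnz: "det (Jm p) ~= 0" unfolding Jp by (rule Jac_det_nz[OF c(1) d(1) c(2) d(2)])
 \<comment> \<open>\<open>K z\<close> is the derivative of the Jacobian in the direction
   \<open>z\<close>. That it acts linearly on \<open>s\<close> is proved by exchanging the two
   derivatives.\<close>
 define K where "K z = matrix (%s. iter_deriv T [z, s] p)" for z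
 have dJ: "(Jm has_derivative K) (at p)"
 proof (rule has_derivative_matrixI)
  fix i j
  have "((%y. iter_deriv T [axis j 1] y $ i) has_derivative (%z. fder (iter_deriv T [axis j 1]) p z $ i)) (at p)"
   by (rule has_derivative_nth, rule frechetI, rule smooth_iter_diff[OF S(2) pS])
  thus "((%y. Jm y $ i $ j) has_derivative (%h. K h $ i $ j)) (at p)"
   by (simp add: Jm_def K_def matrix_def)
 qed
 have lin2: "linear (%s. iter_deriv T [z, s] p)" for z
 proof -
  have "iter_deriv T [z, s] p = iter_deriv T [s, z] p" for s by (rule iter_deriv_swap[OF S pS])
  moreover have "linear (%s. iter_deriv T [s, z] p)"
   using has_derivative_linear[OF frechetI[OF smooth_iter_diff[OF S(2) pS, of "[z]"]]] by simp
  ultimately show ?thesis by simp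
 qed
 have Kmult: "K z *v s = iter_deriv T [z, s] p" for z s unfolding K_def by (rule matrix_mult_vector_linear[OF lin2])
 let ?Gc = "%y. det (gram M c y)" and ?Gd = "%y. det (gram M d y)"
 have qd: "q:img d" and pc: "p:img c" using c d by (auto simp: q_def p_def)
 have Gd: "(?Gd has_derivative fder ?Gd q) (at q)"
  by (rule frechetI[OF smooth_diff[OF smooth_det_gram[OF d(1)] qd]])
 have dT': "(T has_derivative dT c d x) (at p)" unfolding T_def p_def by (rule tr_has_derivative[OF c(1) d(1) c(2) d(2)])
 have Tder: "((%y. ?Gd (T y)) has_derivative (%z. fder ?Gd q (dT c d x z))) (at p)"
  by (rule has_derivative_compose[OF dT']) (simp only: Tp Gd)
 have dd: "((%y. det (Jm y)) has_derivative (%z. det (Jm p)*trace (matrix_inv (Jm p) ** K z))) (at p)"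
  by (rule has_derivative_det[OF dJ Jinv])
 have "((%y. (det (Jm y)*det (Jm y))*?Gd (T y)) has_derivative
   (%z. (det (Jm p)*det (Jm p))*fder ?Gd q (dT c d x z)
    + (det (Jm p)*(det (Jm p)*trace (matrix_inv (Jm p) ** K z))+(det (Jm p)*trace (matrix_inv (Jm p) ** K z))*det (Jm p))*?Gd (T p))) (at p)"
  by (intro has_derivative_mult dd Tder)
 moreover have "(det (Jm y)*det (Jm y))*?Gd (T y) = ?Gc y" if "y:S" for y
  using gram_det_change[OF c(1) Sd(1)[OF that] d(1) Sd(2)[OF that]] unfolding Sd(3,4)[OF that] Jm[OF that]
  by (simp add: power2_eq_square)
 ultimately have Gc: "(?Gc has_derivative
   (%z. (det (Jm p)*det (Jm p))*fder ?Gd q (dT c d x z)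
    + (det (Jm p)*(det (Jm p)*trace (matrix_inv (Jm p) ** K z))+(det (Jm p)*trace (matrix_inv (Jm p) ** K z))*det (Jm p))*?Gd (T p))) (at p)"
  by (rule has_derivative_transform_within_open[OF _ S(1) pS])
 have Gcp: "?Gc p = det (Jm p)*det (Jm p)*?Gd q"
  using gram_det_change[OF c d] unfolding Jp unfolding p_def q_def by (simp only: power2_eq_square)
 have Gd0: "?Gd q > 0" by (rule gram_det_pos[OF d(1) qd])
 have w: "w = dT c d x u" unfolding w_def u_def p_def q_def by (rule field_in_change[OF c d])
 \<comment> \<open>The 2 from the logarithmic derivative of (det J)^2 cancels the 2 in the
   denominator.\<close>
 have r1: "fder ?Gc p u/(2*?Gc p) = fder ?Gd q w/(2*?Gd q)+trace (matrix_inv (Jm p) ** K u)"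
  unfolding frechet_eqI[OF Gc] Gcp Tp w[symmetric] using Jnz Gd0 by (simp add: field_simps)
 have Vc: "(field_in v c has_derivative fder (field_in v c) p) (at p)"
  by (rule frechetI[OF smooth_diff[OF smooth_field_in[OF v c(1)] pc]])
 have Vd: "(field_in v d has_derivative fder (field_in v d) q) (at q)"
  by (rule frechetI[OF smooth_diff[OF smooth_field_in[OF v d(1)] qd]])
 define A where "A = matrix (fder (field_in v c) p)"
 define B where "B = matrix (fder (field_in v d) q)"
 have Am: "A *v z = fder (field_in v c) p z" for z
  unfolding A_def by (rule matrix_mult_vector_linear[OF has_derivative_linear[OF Vc]])
 have Bm: "B *v z = fder (field_in v d) q z" for z
  unfolding B_def by (rule matrix_mult_vector_linear[OF has_derivative_linear[OF Vd]])
 have e1: "((%y. field_in v d (T y)) has_derivative (%z. B *v (Jm p *v z))) (at p)"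
  unfolding Bm Jp Jac_mult[OF c(1) d(1) c(2) d(2)]
  by (rule has_derivative_compose[OF dT']) (simp only: Tp Vd)
 have e2: "((%y. Jm y *v field_in v c y) has_derivative (%z. Jm p *v (A *v z)+K z *v u)) (at p)"
 proof (rule has_derivative_vecI)
  fix i
  have "((%y. \<Sum>j\<in>UNIV. Jm y $ i $ j*field_in v c y $ j) has_derivative
    (%z. \<Sum>j\<in>UNIV. Jm p $ i $ j*(A *v z) $ j+K z $ i $ j*field_in v c p $ j)) (at p)"
   unfolding Am by (intro has_derivative_sum has_derivative_mult has_derivative_nth dJ Vc)
  thus "((%y. (Jm y *v field_in v c y) $ i) has_derivative (%z. (Jm p *v (A *v z)+K z *v u) $ i)) (at p)"
   by (simp add: matrix_vector_mult_def sum.distrib u_def)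
 qed
 have eqS: "Jm y *v field_in v c y = field_in v d (T y)" if "y:S" for y
  unfolding Jm[OF that] Jac_mult[OF c(1) d(1) Sd(1,2)[OF that]]
  using field_in_change[OF c(1) Sd(1)[OF that] d(1) Sd(2)[OF that], of v] unfolding Sd(3,4)[OF that] by simp
 have e3: "((%y. field_in v d (T y)) has_derivative (%z. Jm p *v (A *v z)+K z *v u)) (at p)"
  by (rule has_derivative_transform_within_open[OF e2 S(1) pS eqS])
 have BJ: "B *v (Jm p *v z) = Jm p *v (A *v z)+K u *v z" for z
 proof -
  have "B *v (Jm p *v z) = Jm p *v (A *v z)+K z *v u"
   using fun_cong[OF has_derivative_unique[OF e1 e3], of z] .
  also have "K z *v u = K u *v z" unfolding Kmult by (rule iter_deriv_swap[OF S pS])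
  finally show ?thesis .
 qed
 have "B ** Jm p = Jm p ** A+K u"
  unfolding matrix_eq matrix_vector_mul_assoc[symmetric] matrix_vector_mult_add_rdistrib using BJ by blast
 hence "matrix_inv (Jm p) ** (B ** Jm p) = matrix_inv (Jm p) ** (Jm p ** A)+matrix_inv (Jm p) ** K u"
  by (simp only: matrix_add_ldistrib)
 hence "trace (matrix_inv (Jm p) ** (B ** Jm p)) = trace (matrix_inv (Jm p) ** (Jm p ** A))+trace (matrix_inv (Jm p) ** K u)"
  by (simp only: trace_add)
 moreover have "trace (matrix_inv (Jm p) ** (B ** Jm p)) = trace ((B ** Jm p) ** matrix_inv (Jm p))"
  by (rule trace_mul_sym)
 moreover have "(B ** Jm p) ** matrix_inv (Jm p) = B"
  unfolding matrix_mul_assoc[symmetric] matrix_inv_props[OF Jinv] by simp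
 moreover have "matrix_inv (Jm p) ** (Jm p ** A) = A"
  unfolding matrix_mul_assoc matrix_inv_props[OF Jinv] by simp
 ultimately have tr: "trace B = trace A+trace (matrix_inv (Jm p) ** K u)" by simp
 have tA: "trace A = (\<Sum>i\<in>UNIV. fder (field_in v c) p (axis i 1) $ i)"
  and tB: "trace B = (\<Sum>i\<in>UNIV. fder (field_in v d) q (axis i 1) $ i)"
  by (simp_all add: trace_def A_def B_def matrix_def)
 show ?thesis
  unfolding divc_def p_def[symmetric] q_def[symmetric] u_def[symmetric] w_def[symmetric] r1 tA[symmetric] tB[symmetric] tr by simp
qed

lemma divergence_chart:
 assumes v: "v:Vect0 M" and c: "c:atlas M" "x:dom c"
 shows "divergence M v x = divc c v (snd c x)"
 unfolding divergence_eq_divc[OF v] by (rule divc_change[OF v ch_atlas ch_dom c])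

lemma continuous_iter: "smooth_on S f ==> continuous_on S (%p. fder f p u)"
 by (rule smooth_cont[OF smooth_on_frechet])

lemma continuous_frechet_field:
 fixes f :: "real ^ 'n => real"
 assumes f: "smooth_on S f" and g: "continuous_on S g"
 shows "continuous_on S (%p. fder f p (g p))"
proof -
 have "fder f p (g p) = (\<Sum>i\<in>UNIV. g p $ i*fder f p (axis i 1))" if "p:S" for p
  using vec_linear_expand[OF has_derivative_linear[OF frechetI[OF smooth_diff[OF f that]]], of "g p"] by simp
 moreover have "continuous_on S (%p. \<Sum>i\<in>UNIV. g p $ i*fder f p (axis i 1))"
  by (intro continuous_intros continuous_iter[OF f] g)
 ultimately show ?thesis by (simp cong: continuous_on_cong)
qed

text \<open>The preferred chart may jump from point to point, so continuity becomes visible only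
  after the divergence is rewritten in one fixed chart.\<close>

lemma continuous_divergence:
 assumes v: "v:Vect0 M"
 shows "continuous_on UNIV (divergence M v)"
proof (rule continuous_on_charts)
 fix c assume c: "c:atlas M"
 have "continuous_on (img c) (divc c v)"
  unfolding divc_def[abs_def]
  using gram_det_pos[OF c]
  by (intro continuous_intros continuous_iter continuous_frechet_field smooth_det_gram[OF c] smooth_field_in[OF v c]
    smooth_cont[OF smooth_det_gram[OF c]] smooth_cont[OF smooth_field_in[OF v c]]) force
 thus "continuous_on (img c) (divergence M v o cinv c)"
  by (rule continuous_on_cong[THEN iffD1, rotated 2, OF _ refl])
    (simp add: divergence_chart[OF v c chart_inv_dom[OF c]] chart_eq[OF c])
qed

lemma continuous_metric_field:
 assumes v: "v:Vect0 M"
 shows "continuous_on UNIV (%x. metric M x (v x) (v x))"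
proof (rule continuous_on_charts)
 fix c assume c: "c:atlas M"
 have gc: "continuous_on (img c) (%p. gram M c p $ i $ j)" for i j
  by (rule smooth_cont[OF smooth_gram[OF c]])
 have fc: "continuous_on (img c) (field_in v c)" by (rule smooth_cont[OF smooth_field_in[OF v c]])
 have "continuous_on (img c) (%p. \<Sum>i\<in>UNIV. field_in v c p $ i*(\<Sum>j\<in>UNIV. gram M c p $ i $ j*field_in v c p $ j))"
  by (intro continuous_intros gc fc)
 moreover have "(\<Sum>i\<in>UNIV. field_in v c p $ i*(\<Sum>j\<in>UNIV. gram M c p $ i $ j*field_in v c p $ j)) =
   ((%x. metric M x (v x) (v x)) o cinv c) p" if p: "p:img c" for p
 proof -
  have x: "cinv c p:dom c" "snd c (cinv c p) = p" using chart_inv_dom[OF c p] chart_eq[OF c p] by auto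
  have "field_in v c p \<bullet> (gram M c p *v field_in v c p) = metric M (cinv c p) (v (cinv c p)) (v (cinv c p))"
   using gram_form[OF c x(1), of "field_in v c p" "field_in v c p"] to_tangent_field_in[OF c x(1), of v] unfolding x(2) by simp
  thus ?thesis by (simp add: inner_vec_def matrix_vector_mult_def)
 qed
 ultimately show "continuous_on (img c) ((%x. metric M x (v x) (v x)) o cinv c)"
  by (rule continuous_on_cong[THEN iffD1, rotated 2, OF _ refl])
qed

section \<open>Test functions, and bounds from compact support\<close>

lemma test_function_smooth: "f:test_functions M ==> c:atlas M ==> smooth_on (img c) (f o cinv c)"
 by (simp add: test_functions_def)

lemma test_function_mdiff: "f:test_functions M ==> mdiff f x"
 unfolding mdiff_def
 by (rule smooth_diff[OF test_function_smooth[OF _ ch_atlas]]) (use ch_dom in auto)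

lemma continuous_test_function: "f:test_functions M ==> continuous_on UNIV f"
 by (intro continuous_on_charts smooth_cont test_function_smooth)

lemma continuous_differential_field:
 assumes f: "f:test_functions M" and v: "v:Vect0 M"
 shows "continuous_on UNIV (%x. differential M f x (v x))"
proof (rule continuous_on_charts)
 fix c assume c: "c:atlas M"
 note sm = test_function_smooth[OF f c]
 have "continuous_on (img c) (%p. fder (f o cinv c) p (field_in v c p))"
  by (intro continuous_frechet_field sm smooth_cont[OF smooth_field_in[OF v c]])
 moreover have "fder (f o cinv c) p (field_in v c p) = ((%x. differential M f x (v x)) o cinv c) p"
  if p: "p:img c" for p
 proof -
  have x: "cinv c p:dom c" "snd c (cinv c p) = p" using chart_inv_dom[OF c p] chart_eq[OF c p] by auto
  have "((f o cinv c) has_derivative fder (f o cinv c) p) (at (snd c (cinv c p)))"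
   unfolding x(2) by (rule frechetI[OF smooth_diff[OF sm p]])
  from differential_chart(2)[OF c x(1) this] show ?thesis by (simp add: field_in_def)
 qed
 ultimately show "continuous_on (img c) ((%x. differential M f x (v x)) o cinv c)"
  by (rule continuous_on_cong[THEN iffD1, rotated 2, OF _ refl])
qed

lemma bounded_compact_support:
 fixes g :: "'x => real"
 assumes "continuous_on UNIV g" "compact C" "!!x. x ~: C ==> g x = 0"
 shows "EX B>=0. ALL x. abs (g x) <= B*Ind C x"
proof -
 have "compact (g ` C)" using assms by (intro compact_continuous_image) (auto intro: continuous_on_subset)
 then obtain B where B: "ALL y:g ` C. norm y <= B" using compact_imp_bounded bounded_iff by metis
 have "abs (g x) <= max 0 B*Ind C x" for x using B assms(3)[of x] by (cases "x:C") auto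
 thus ?thesis by (intro exI[of _ "max 0 B"]) simp
qed

definition supp :: "('x => 'b::zero) => 'x set" where
 "supp f = closure {x. f x ~= 0}"

lemma supp_outside: "x ~: supp f ==> f x = 0"
 unfolding supp_def using closure_subset[of "{x. f x ~= 0}"] by blast

lemma cpt_supp: "v:Vect0 M ==> compact (supp v)"
 by (simp add: Vect0_def supp_def)

lemma compact_supp_test: "f:test_functions M ==> compact (supp f)"
 by (simp add: test_functions_def supp_def)

lemma divergence_outside:
 assumes v: "v:Vect0 M" and x: "x ~: supp v"
 shows "divergence M v x = 0"
proof -
 let ?c = "ch x"
 let ?U = "snd ?c ` (dom ?c Int-supp v)"
 have U: "open ?U" by (rule open_chart_image[OF ch_atlas]) (simp add: supp_def open_Compl)
 have xU: "snd ?c x:?U" using x ch_dom by blast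
 have z: "field_in v ?c p = 0" if "p:?U" for p
 proof -
  have "cinv ?c p:dom ?c" "v (cinv ?c p) = 0"
   using that chart_inv_dom[OF ch_atlas] unfolding chart_image_eq[OF ch_atlas] by (auto simp: supp_outside)
  thus ?thesis unfolding field_in_def from_tangent_eq
   using linear_0[OF dT_linear[OF ch_atlas ch_atlas ch_dom]] by simp
 qed
 have "((%p. 0 :: real ^ 'n) has_derivative (%u. 0)) (at (snd ?c x))" by (rule has_derivative_const)
 hence "(field_in v ?c has_derivative (%u. 0)) (at (snd ?c x))"
  by (rule has_derivative_transform_within_open[OF _ U xU]) (simp add: z)
 hence f: "fder (field_in v ?c) (snd ?c x) = (%u. 0)" by (rule frechet_eqI)
 have "((%p. det (gram M ?c p)) has_derivative fder (%p. det (gram M ?c p)) (snd ?c x)) (at (snd ?c x))"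
  using ch_dom by (intro frechetI smooth_diff[OF smooth_det_gram[OF ch_atlas]]) blast
 hence "fder (%p. det (gram M ?c p)) (snd ?c x) 0 = 0" by (rule linear_0[OF has_derivative_linear])
 thus ?thesis unfolding divergence_eq_divc[OF v] divc_def f z[OF xU] by simp
qed

lemma divergence_bounded:
 assumes v: "v:Vect0 M"
 obtains B where "B >= 0" "!!x. abs (divergence M v x) <= B*Ind (supp v) x"
 using bounded_compact_support[OF continuous_divergence[OF v] cpt_supp[OF v] divergence_outside[OF v]] that by blast

lemma tangent_norm_bounded:
 assumes v: "v:Vect0 M"
 obtains B where "B >= 0" "!!x. tangent_norm M x (v x) <= B*Ind (supp v) x"
proof -
 have z: "metric M x (v x) (v x) = 0" if "x ~: supp v" for x
  using supp_outside[OF that] by (simp add: metric_zero_left)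
 obtain B where B: "B >= 0" "!!x. abs (metric M x (v x) (v x)) <= B*Ind (supp v) x"
  using bounded_compact_support[OF continuous_metric_field[OF v] cpt_supp[OF v] z] by blast
 show ?thesis
 proof (rule that[of "sqrt B"])
  fix x
  have "sqrt (metric M x (v x) (v x)) <= sqrt (B*Ind (supp v) x)"
   using B(2)[of x] by (intro real_sqrt_le_mono) linarith
  thus "tangent_norm M x (v x) <= sqrt B*Ind (supp v) x"
   by (cases "x:supp v") (simp_all add: tangent_norm_def)
 qed (use B in simp)
qed

lemma differential_zero: "mdiff f x ==> differential M f x 0 = 0"
 by (rule linear_0[OF differential_linear])

lemma differential_bounded:
 assumes f: "f:test_functions M" and v: "v:Vect0 M"
 obtains B where "B >= 0" "!!x. abs (differential M f x (v x)) <= B*Ind (supp v) x"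
proof -
 have "differential M f x (v x) = 0" if "x ~: supp v" for x
  using supp_outside[OF that] differential_zero[OF test_function_mdiff[OF f]] by simp
 from bounded_compact_support[OF continuous_differential_field[OF f v] cpt_supp[OF v] this]
 show ?thesis using that by blast
qed

end

section \<open>The Riemannian volume\<close>

text \<open>
  The change of variables formula of HOL-Analysis is stated for well-ordered index types only; \<open>idx\<close>
  is a well-ordered copy of a finite index type.
\<close>
typedef ('n::finite) idx = "{..<CARD('n)}" morphisms idx_rep idx_abs
 by (rule exI[of _ 0]) simp

instantiation idx :: (finite) wellorder
begin

definition less_eq_idx :: "'a idx => 'a idx => bool" where "less_eq_idx x y \<longleftrightarrow> idx_rep x <= idx_rep y"
definition less_idx :: "'a idx => 'a idx => bool" where "less_idx x y \<longleftrightarrow> idx_rep x < idx_rep y"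

instance
proof
 fix x y z :: "'a idx"
 show "(x < y) = (x <= y & ~ y <= x)" "x <= x" "x <= y | y <= x"
  by (auto simp: less_eq_idx_def less_idx_def)
 show "x <= y ==> y <= z ==> x <= z" by (simp add: less_eq_idx_def)
 show "x <= y ==> y <= x ==> x = y" by (simp add: less_eq_idx_def idx_rep_inject)
next
 fix P :: "'a idx => bool" and a :: "'a idx"
 assume s: "!!x. (!!y. y < x ==> P y) ==> P x"
 show "P a"
  by (induction a rule: measure_induct_rule[where f = idx_rep]) (rule s, simp add: less_idx_def)
qed

end

instance idx :: (finite) finite
 by standard (simp flip: type_definition.Abs_image[OF type_definition_idx])

definition idx_of :: "'n::finite idx => 'n" where
 "idx_of = (SOME e. bij_betw e UNIV UNIV)"

lemma bij_idx_of: "bij (idx_of :: 'n::finite idx => 'n)"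
proof -
 have "CARD('n idx) = card {..<CARD('n)}" by (rule type_definition.card[OF type_definition_idx])
 hence "CARD('n idx) = CARD('n)" by simp
 hence "EX e. bij_betw e (UNIV :: 'n idx set) (UNIV :: 'n set)" by (intro finite_same_card_bij) simp_all
 thus ?thesis unfolding idx_of_def by (rule someI_ex)
qed

definition to_idx :: "real ^ 'n => real ^ 'n::finite idx" where "to_idx x = (\<chi> i. x $ idx_of i)"
definition of_idx :: "real ^ 'n::finite idx => real ^ 'n" where "of_idx y = (\<chi> j. y $ inv idx_of j)"

lemma of_to_idx [simp]: "of_idx (to_idx x) = x"
 and to_of_idx [simp]: "to_idx (of_idx y) = y"
 by (simp_all add: of_idx_def to_idx_def vec_eq_iff surj_f_inv_f[OF bij_is_surj[OF bij_idx_of]] inv_f_f[OF bij_is_inj[OF bij_idx_of]])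

lemma bounded_linear_to_idx: "bounded_linear (to_idx :: real ^ 'n::finite => _)"
 by (subst linear_conv_bounded_linear[symmetric]) (rule linearI; simp add: to_idx_def vec_eq_iff)

lemma bounded_linear_of_idx: "bounded_linear (of_idx :: _ => real ^ 'n::finite)"
 by (subst linear_conv_bounded_linear[symmetric]) (rule linearI; simp add: of_idx_def vec_eq_iff)

lemma measurable_of_idx [measurable]: "of_idx:bm borel"
 by (rule borel_measurable_continuous_onI[OF linear_continuous_on[OF bounded_linear_of_idx]])

lemma prod_Basis_vec: "(\<Prod>b\<in>Basis. f (x \<bullet> b)) = (\<Prod>i\<in>UNIV. f (x $ i))" for x :: "real ^ 'n"
proof -
 have B: "Basis = (%i. axis i (1 :: real)) ` (UNIV :: 'n set)" by (auto simp: Basis_vec_def Basis_real_def)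
 have "inj (%i. axis i (1 :: real) :: real ^ 'n)" by (intro injI) (simp add: axis_eq_axis)
 thus ?thesis unfolding B by (simp add: prod.reindex inner_axis)
qed

lemma lborel_of_idx: "distr lborel borel of_idx = (lborel :: (real ^ 'n::finite) measure)"
proof (rule sym, rule lborel_eqI)
 fix l u :: "real ^ 'n" assume lu: "!!b. b:Basis ==> l \<bullet> b <= u \<bullet> b"
 have le: "l $ i <= u $ i" for i using lu[of "axis i 1"] by (simp add: inner_axis axis_in_Basis_iff)
 have s: "of_idx -` box l u = box (to_idx l) (to_idx u)"
 proof (rule set_eqI)
  fix y :: "real ^ 'n idx"
  have "(ALL j. l $ j < y $ inv idx_of j & y $ inv idx_of j < u $ j) \<longleftrightarrow>
   (ALL i. l $ idx_of i < y $ i & y $ i < u $ idx_of i)"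
   using surj_f_inv_f[OF bij_is_surj[OF bij_idx_of]] inv_f_f[OF bij_is_inj[OF bij_idx_of]] by metis
  thus "y:of_idx -` box l u \<longleftrightarrow> y:box (to_idx l) (to_idx u)"
   by (simp add: mem_box_cart of_idx_def to_idx_def)
 qed
 have "em (distr lborel borel of_idx) (box l u) = em lborel (box (to_idx l) (to_idx u))"
  by (subst emeasure_distr) (simp_all add: s)
 also have "... = ennreal (\<Prod>b\<in>Basis. (to_idx u-to_idx l) \<bullet> b)"
  using le by (intro emeasure_lborel_box) (auto simp: Basis_vec_def inner_axis to_idx_def)
 also have "(\<Prod>b\<in>Basis. (to_idx u-to_idx l) \<bullet> b) = (\<Prod>i\<in>UNIV. (u-l) $ idx_of i)"
  using prod_Basis_vec[of "%r. r" "to_idx u-to_idx l"] by (simp add: to_idx_def)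
 also have "... = (\<Prod>j\<in>UNIV. (u-l) $ j)" by (rule prod.reindex_bij_betw[OF bij_idx_of])
 also have "... = (\<Prod>b\<in>Basis. (u-l) \<bullet> b)" using prod_Basis_vec[of "%r. r" "u-l"] by simp
 finally show "em (distr lborel borel of_idx) (box l u) = ennreal (\<Prod>b\<in>Basis. (u-l) \<bullet> b)" .
qed simp

lemma nn_integral_of_idx:
 "f:bm borel ==> (NI lborel (%x. f (of_idx x))) = (NI (lborel :: (real ^ 'n::finite) measure) f)"
 using nn_integral_distr[of of_idx "lborel" borel f] unfolding lborel_of_idx by simp

text \<open>Relabelling conjugates the permutations in the Leibniz sum, which preserves their signs,
  and permutes the factors of each product.\<close>

lemma det_idx:
 fixes A :: "real ^ 'n ^ 'n::finite"
 shows "det (\<chi> i j. A $ idx_of i $ idx_of j) = det A"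
proof -
 let ?e = "idx_of :: 'n idx => 'n"
 let ?b = "%\<pi> x. ?e (\<pi> (inv ?e x))"
 have bij: "bij_betw (%\<pi> x. if x:UNIV then ?e (\<pi> (inv_into UNIV ?e x)) else x) {\<pi>. \<pi> permutes UNIV} {\<pi>. \<pi> permutes UNIV}"
  by (rule bij_betw_permutations[OF bij_idx_of])
 have sg: "sign (?b \<pi>) = sign \<pi>" if p: "\<pi> permutes (UNIV :: 'n idx set)" for \<pi>
 proof -
  have "map_permutation UNIV ?e \<pi> = ?b \<pi>"
   unfolding map_permutation_def by (simp add: bij_is_surj[OF bij_idx_of] fun_eq_iff restrict_id_def)
  thus ?thesis using sign_map_permutation[OF bij_is_inj[OF bij_idx_of] p] by simp
 qed
 have "det A = (\<Sum>\<pi> | \<pi> permutes (UNIV :: 'n idx set). of_int (sign (?b \<pi>))*(\<Prod>i\<in>UNIV. A $ i $ ?b \<pi> i))"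
  unfolding det_def using sum.reindex_bij_betw[OF bij, symmetric, of "%p. of_int (sign p)*(\<Prod>i\<in>UNIV. A $ i $ p i)"] by simp
 also have "... = (\<Sum>\<pi> | \<pi> permutes (UNIV :: 'n idx set). of_int (sign \<pi>)*(\<Prod>i\<in>UNIV. A $ ?e i $ ?e (\<pi> i)))"
 proof (rule sum.cong[OF refl])
  fix \<pi> assume "\<pi>:{\<pi>. \<pi> permutes (UNIV :: 'n idx set)}"
  hence p: "\<pi> permutes UNIV" by simp
  have "(\<Prod>i\<in>UNIV. A $ i $ ?b \<pi> i) = (\<Prod>i\<in>UNIV. A $ ?e i $ ?b \<pi> (?e i))"
   by (rule prod.reindex_bij_betw[OF bij_idx_of, symmetric])
  thus "of_int (sign (?b \<pi>))*(\<Prod>i\<in>UNIV. A $ i $ ?b \<pi> i) = of_int (sign \<pi>)*(\<Prod>i\<in>UNIV. A $ ?e i $ ?e (\<pi> i))"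
   unfolding sg[OF p] by (simp add: inv_f_f[OF bij_is_inj[OF bij_idx_of]])
 qed
 finally show ?thesis by (simp add: det_def)
qed

text \<open>The change of variables theorem speaks of absolute integrability on a set and of the
  value of the integral; for nonnegative Borel functions the nonnegative integral carries the same
  information.\<close>

lemma absolutely_integrable_on_iff_nn:
 fixes u :: "'a::euclidean_space => real"
 assumes m: "(%x. Ind S x*u x):bm borel" and u: "!!x. x:S ==> 0 <= u x"
 shows "u absolutely_integrable_on S \<longleftrightarrow> (NI lborel (%x. ennreal (Ind S x*u x))) < \<infinity>" (is ?A)
  and "u absolutely_integrable_on S ==> (NI lborel (%x. ennreal (Ind S x*u x))) = ennreal (integral S u)"
proof -
 have nn: "0 <= Ind S x*u x" for x using u by (auto split: split_indicator)
 have m': "(%x. Ind S x*u x):bm lborel" using m by simp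
 have i: "u absolutely_integrable_on S \<longleftrightarrow> integrable lborel (%x. Ind S x*u x)"
  unfolding set_integrable_def using integrable_completion[OF m'] by simp
 also have "... \<longleftrightarrow> (NI lborel (%x. ennreal (Ind S x*u x))) < \<infinity>"
  unfolding integrable_iff_bounded using m' nn by (simp add: abs_of_nonneg)
 finally show ?A .
 assume a: "u absolutely_integrable_on S"
 have "integral S u = (LINT x:S|lebesgue. u x)" using set_lebesgue_integral_eq_integral(2)[OF a] by simp
 also have "... = (LI lborel (%x. Ind S x*u x))"
  unfolding set_lebesgue_integral_def using integral_completion[OF m'] by simp
 finally show "(NI lborel (%x. ennreal (Ind S x*u x))) = ennreal (integral S u)"
  using nn_integral_eq_integral[OF i[THEN iffD1, OF a]] nn by simp
qed

lemma nn_integral_change_of_variables_wellorder: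
 fixes g :: "real ^ 'm::{finite,wellorder} => real ^ 'm::_" and F :: "real ^ 'm::_ => real"
 assumes S: "S:sets borel"
  and der: "!!x. x:S ==> (g has_derivative g' x) (at x)" and inj: "inj_on g S"
  and F: "(%y. Ind (g ` S) y*F y):bm borel" "!!y. y:g ` S ==> 0 <= F y"
  and m: "(%x. Ind S x*(abs (det (matrix (g' x)))*F (g x))):bm borel"
 shows "(NI lborel (%y. ennreal (Ind (g ` S) y*F y))) =
  (NI lborel (%x. ennreal (Ind S x*(abs (det (matrix (g' x)))*F (g x)))))"
proof -
 let ?u = "%x. abs (det (matrix (g' x)))*F (g x)"
 have u: "0 <= ?u x" if "x:S" for x using F(2) that by simp
 have cov: "?u absolutely_integrable_on S & integral S ?u = b \<longleftrightarrow> F absolutely_integrable_on (g ` S) & integral (g ` S) F = b" for b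
 proof -
  \<comment> \<open>The theorem concerns vector-valued functions, so \<open>F\<close> is embedded
    into \<open>real ^ 1\<close>.\<close>
  have "((%x. abs (det (matrix (g' x))) *R (vec (F (g x)) :: real ^ 1)) absolutely_integrable_on S &
      integral S (%x. abs (det (matrix (g' x))) *R (vec (F (g x)) :: real ^ 1)) = vec b)
   \<longleftrightarrow> ((%x. vec (F x) :: real ^ 1) absolutely_integrable_on (g ` S) & integral (g ` S) (%x. vec (F x) :: real ^ 1) = vec b)"
  proof (rule has_absolute_integral_change_of_variables[OF _ _ inj])
   show "S:sets lebesgue" using S by simp
   show "(g has_derivative g' x) (at x within S)" if "x:S" for x
    by (rule has_derivative_at_withinI[OF der[OF that]])
  qed
  thus ?thesis
   by (simp add: absolutely_integrable_on_1_iff integral_on_1_eq vec_eq_iff)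
 qed
 show ?thesis
 proof (cases "F absolutely_integrable_on (g ` S)")
  case True
  hence t: "?u absolutely_integrable_on S" "integral S ?u = integral (g ` S) F" using cov by auto
  show ?thesis
   using absolutely_integrable_on_iff_nn(2)[OF F True] absolutely_integrable_on_iff_nn(2)[OF m u t(1)] t(2) by simp
 next
  case False
  \<comment> \<open>Failure of integrability passes to the other side, so both nonnegative integrals
    are infinite.\<close>
  hence "~ ?u absolutely_integrable_on S" using cov by auto
  thus ?thesis
   using False absolutely_integrable_on_iff_nn(1)[OF F] absolutely_integrable_on_iff_nn(1)[OF m u] by (simp add: less_top[symmetric])
 qed
qed

text \<open>Transport along \<open>of_idx\<close>, which preserves Lebesgue measure, and under which
  the Jacobian matrix is only relabelled.\<close>

lemma nn_integral_change_of_variables: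
 fixes g :: "real ^ 'n::finite => real ^ 'n" and F :: "real ^ 'n => real"
 assumes S: "S:sets borel"
  and der: "!!x. x:S ==> (g has_derivative g' x) (at x)" and inj: "inj_on g S"
  and F: "(%y. Ind (g ` S) y*F y):bm borel" "!!y. y:g ` S ==> 0 <= F y"
  and m: "(%x. Ind S x*(abs (det (matrix (g' x)))*F (g x))):bm borel"
 shows "(NI lborel (%y. ennreal (Ind (g ` S) y*F y))) =
  (NI lborel (%x. ennreal (Ind S x*(abs (det (matrix (g' x)))*F (g x)))))"
proof -
 let ?g = "%x. to_idx (g (of_idx x))" and ?S = "of_idx -` S"
 let ?g' = "%x u. to_idx (g' (of_idx x) (of_idx u))"
 have ax: "of_idx (axis j 1) = axis (idx_of j) (1 :: real)" for j :: "'n idx"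
 proof -
  have "inv idx_of i = j \<longleftrightarrow> i = idx_of j" for i
   using inv_f_f[OF bij_is_inj[OF bij_idx_of], of j] surj_f_inv_f[OF bij_is_surj[OF bij_idx_of], of i] by auto
  thus ?thesis by (simp add: of_idx_def axis_def vec_eq_iff)
 qed
 have dt: "det (matrix (%u. to_idx (L (of_idx u)))) = det (matrix L)" for L :: "real ^ 'n => real ^ 'n"
 proof -
  have "matrix (%u. to_idx (L (of_idx u))) = (\<chi> i j. matrix L $ idx_of i $ idx_of j)"
   unfolding vec_eq_iff matrix_def by (simp add: ax to_idx_def)
  thus ?thesis using det_idx[of "matrix L"] by simp
 qed
 have mem: "of_idx y:g ` S \<longleftrightarrow> y:?g ` ?S" for y
 proof
  assume "of_idx y:g ` S"
  then obtain x where x: "x:S" "of_idx y = g x" by blast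
  hence "y = ?g (to_idx x)" using to_of_idx[of y] by simp
  thus "y:?g ` ?S" using x by (intro image_eqI[of _ _ "to_idx x"]) simp_all
 qed auto
 have ind: "Ind (?g ` ?S) y = (Ind (g ` S) (of_idx y) :: real)" for y
  using mem[of y] by (simp add: indicator_def)
 have "(NI lborel (%y. ennreal (Ind (?g ` ?S) y*F (of_idx y)))) =
  (NI lborel (%x. ennreal (Ind ?S x*(abs (det (matrix (?g' x)))*F (of_idx (?g x))))))"
 proof (rule nn_integral_change_of_variables_wellorder)
  show "?S:sets borel" using measurable_sets[OF measurable_of_idx S] by simp
  show "(?g has_derivative ?g' x) (at x)" if "x:?S" for x
  proof -
   have "((%x. g (of_idx x)) has_derivative (%u. g' (of_idx x) (of_idx u))) (at x)"
    using that by (intro has_derivative_compose[OF bounded_linear_imp_has_derivative[OF bounded_linear_of_idx]] der) simp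
   thus ?thesis by (rule bounded_linear.has_derivative[OF bounded_linear_to_idx])
  qed
  show "inj_on ?g ?S"
  proof (rule inj_onI)
   fix x y assume xy: "x:?S" "y:?S" "?g x = ?g y"
   hence "g (of_idx x) = g (of_idx y)" using of_to_idx by metis
   hence "of_idx x = of_idx y" using inj_onD[OF inj] xy by simp
   thus "x = y" using to_of_idx by metis
  qed
  show "(%y. Ind (?g ` ?S) y*F (of_idx y)):bm borel"
   unfolding ind using meas_comp[OF measurable_of_idx F(1)] .
  show "0 <= F (of_idx y)" if "y:?g ` ?S" for y using F(2)[of "of_idx y"] mem[of y] that by blast
  show "(%x. Ind ?S x*(abs (det (matrix (?g' x)))*F (of_idx (?g x)))):bm borel"
   using meas_comp[OF measurable_of_idx m] by (simp add: dt indicator_def)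
 qed
 hence "(NI lborel (%y. ennreal (Ind (g ` S) (of_idx y)*F (of_idx y)))) =
  (NI lborel (%x. ennreal (Ind S (of_idx x)*(abs (det (matrix (g' (of_idx x))))*F (g (of_idx x))))))"
  unfolding ind dt by (simp add: indicator_def)
 moreover have "(%y. ennreal (Ind (g ` S) y*F y)):bm borel" using F(1) by simp
 moreover have "(%x. ennreal (Ind S x*(abs (det (matrix (g' x)))*F (g x)))):bm borel" using m by simp
 ultimately show ?thesis
  using nn_integral_of_idx[of "%y. ennreal (Ind (g ` S) y*F y)"]
   nn_integral_of_idx[of "%x. ennreal (Ind S x*(abs (det (matrix (g' x)))*F (g x)))"] by simp
qed

lemma seq_cover:
 fixes N :: "'a::second_countable_topology => 'a set"
 assumes N: "!!x. open (N x)" "!!x. x:N x"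
 obtains a :: "nat => 'a" where "(\<Union>i. N (a i)) = UNIV"
proof -
 obtain F where F: "F <= range N" "countable F" "\<Union>F = \<Union>(range N)"
  by (rule Lindelof[of "range N"]) (use N(1) in blast)+
 have U: "\<Union>F = UNIV" unfolding F(3) using N(2) by blast
 hence ne: "F ~= {}" by auto
 have "ALL i. EX x. N x = from_nat_into F i"
 proof
  fix i have "from_nat_into F i:range N" using F(1) from_nat_into[OF ne] by blast
  thus "EX x. N x = from_nat_into F i" by (metis imageE)
 qed
 from choice[OF this] obtain a where a: "!!i. N (a i) = from_nat_into F i" by blast
 have "(\<Union>i. N (a i)) = UNIV" unfolding a using U range_from_nat_into[OF ne F(2)] by simp
 thus thesis by (rule that)
qed

section \<open>Chart volumes and their gluing\<close>

context riemann
begin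

definition dens :: "('x, 'n) chart => real ^ 'n => real" where
 "dens c p = sqrt (det (gram M c p))"

lemma dens_pos: "c:atlas M ==> p:img c ==> 0 < dens c p"
 unfolding dens_def using gram_det_pos by simp

lemma continuous_dens: "c:atlas M ==> continuous_on (img c) (dens c)"
 unfolding dens_def[abs_def] by (intro continuous_intros smooth_cont smooth_det_gram)

lemma borel_img: "c:atlas M ==> img c:sets borel"
 using open_img by (rule borel_open)

lemma borel_dom: "c:atlas M ==> dom c:sets borel"
 using open_dom by (rule borel_open)

lemma measurable_dens: "c:atlas M ==> (%p. Ind (img c) p*dens c p):bm borel"
 using borel_measurable_continuous_on_indicator[OF borel_img continuous_dens] by simp

text \<open>A total version of the inverse chart: the constant value off the image keeps it Borel,
  so that measures can be pushed forward along it.\<close>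

definition chart_point :: "('x, 'n) chart => real ^ 'n => 'x" where
 "chart_point c p = (if p:img c then cinv c p else undefined)"

lemma measurable_chart_point: "c:atlas M ==> chart_point c:bm borel"
 unfolding chart_point_def[abs_def]
 by (rule borel_measurable_continuous_on_if[OF borel_img chart_inv_cont continuous_on_const])

lemma chart_image_vimage: "c:atlas M ==> B <= dom c ==> snd c ` B = img c Int chart_point c -` B"
 using chart_image_eq[of c B] by (auto simp: chart_point_def Int_absorb1)

lemma chart_image_borel:
 assumes "c:atlas M" "B <= dom c" "B:sets borel"
 shows "snd c ` B:sets borel"
proof -
 have "chart_point c -` B:sets borel" using measurable_sets[OF measurable_chart_point[OF assms(1)] assms(3)] by simp
 thus ?thesis unfolding chart_image_vimage[OF assms(1,2)] using borel_img[OF assms(1)] by (rule sets.Int[rotated])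
qed

definition chart_volume :: "('x, 'n) chart => 'x measure" where
 "chart_volume c = distr (density lborel (%p. ennreal (Ind (img c) p*dens c p))) borel (chart_point c)"

lemma sets_chart_volume [simp]: "sets (chart_volume c) = sets borel"
 by (simp add: chart_volume_def)

lemma emeasure_chart_volume:
 assumes c: "c:atlas M" and B: "B:sets borel" "B <= dom c"
 shows "em (chart_volume c) B = (\<integral>\<^sup>+p\<in>snd c ` B. ennreal (dens c p) \<partial>lborel)"
proof -
 have V: "chart_point c -` B:sets borel" using measurable_sets[OF measurable_chart_point[OF c] B(1)] by simp
 have "em (chart_volume c) B = (NI lborel (%p. ennreal (Ind (img c) p*dens c p)*Ind (chart_point c -` B) p))"
  unfolding chart_volume_def using measurable_chart_point[OF c] B(1) V measurable_dens[OF c]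
  by (simp add: emeasure_distr emeasure_density)
 also have "... = (\<integral>\<^sup>+p\<in>snd c ` B. ennreal (dens c p) \<partial>lborel)"
  unfolding chart_image_vimage[OF c B(2)] by (intro nn_integral_cong) (simp split: split_indicator)
 finally show ?thesis .
qed

text \<open>The Jacobian of the transition compensates the change of density, since det g transforms
  with the square of det J.\<close>

lemma chart_volume_agree:
 assumes c: "c:atlas M" and d: "d:atlas M" and B: "B:sets borel" "B <= dom c" "B <= dom d"
 shows "em (chart_volume c) B = em (chart_volume d) B"
proof -
 let ?S = "snd c ` B"
 have S: "?S:sets borel" by (rule chart_image_borel[OF c B(2,1)])
 have img: "tr c d ` ?S = snd d ` B"
  using chart_inv_eq[OF c] B(2) by (force simp: image_image image_iff)
 have Jac: "abs (det (matrix (fder (tr c d) p)))*dens d (tr c d p) = dens c p" if p: "p:?S" for p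
 proof -
  obtain x where x: "x:B" "p = snd c x" using p by blast
  have xc: "x:dom c" "x:dom d" using x B by auto
  have "dens c p = sqrt ((det (Jac c d x))\<^sup>2*det (gram M d (snd d x)))"
   unfolding dens_def x gram_det_change[OF c xc(1) d xc(2)] ..
  thus ?thesis by (simp add: real_sqrt_mult dens_def x(2) dT_def chart_inv_eq[OF c xc(1)])
 qed
 have "(NI lborel (%y. ennreal (Ind (tr c d ` ?S) y*dens d y))) =
  (NI lborel (%p. ennreal (Ind ?S p*(abs (det (matrix (fder (tr c d) p)))*dens d (tr c d p)))))"
 proof (rule nn_integral_change_of_variables[OF S])
  show "(tr c d has_derivative fder (tr c d) p) (at p)" if p: "p:?S" for p
   using p B by (intro frechetI smooth_diff[OF smooth_tr[OF c d]]) auto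
  show "inj_on (tr c d) ?S"
  proof (rule inj_onI)
   fix p q assume pq: "p:?S" "q:?S" "tr c d p = tr c d q"
   then obtain x y where x: "x:B" "p = snd c x" and y: "y:B" "q = snd c y" by blast
   have "snd d x = snd d y" using pq(3) x y B(2) by (simp add: chart_inv_eq[OF c] subsetD)
   hence "x = y" using chart_inv_eq[OF d] x y B(3) by (metis subsetD)
   thus "p = q" using x y by simp
  qed
  show "(%y. Ind (tr c d ` ?S) y*dens d y):bm borel"
  proof -
   have "(%y. Ind (snd d ` B) y*(Ind (img d) y*dens d y)):bm borel"
    using chart_image_borel[OF d B(3,1)] measurable_dens[OF d] by simp
   moreover have "Ind (snd d ` B) y*(Ind (img d) y*dens d y) = Ind (tr c d ` ?S) y*dens d y" for y
    unfolding img using B(3) by (auto split: split_indicator)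
   ultimately show ?thesis by simp
  qed
  show "0 <= dens d y" if "y:tr c d ` ?S" for y
  proof -
   have "y:img d" using that B(3) unfolding img by blast
   thus ?thesis using dens_pos[OF d] less_imp_le by blast
  qed
  have "(%p. Ind ?S p*(Ind (img c) p*dens c p)):bm borel"
   using S measurable_dens[OF c] by simp
  moreover have "Ind ?S p*(Ind (img c) p*dens c p) =
    Ind ?S p*(abs (det (matrix (fder (tr c d) p)))*dens d (tr c d p))" for p
   using Jac[of p] B(2) by (auto split: split_indicator)
  ultimately show "(%p. Ind ?S p*(abs (det (matrix (fder (tr c d) p)))*dens d (tr c d p))):bm borel"
   by simp
 qed
 moreover have "ennreal (Ind ?S p*(abs (det (matrix (fder (tr c d) p)))*dens d (tr c d p))) = ennreal (dens c p)*Ind ?S p" for p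
  using Jac[of p] by (simp split: split_indicator)
 moreover have "ennreal (Ind (tr c d ` ?S) y*dens d y) = ennreal (dens d y)*Ind (snd d ` B) y" for y
  unfolding img by (simp split: split_indicator)
 ultimately show ?thesis
  unfolding emeasure_chart_volume[OF c B(1,2)] emeasure_chart_volume[OF d B(1,3)] by simp
qed

definition cseq :: "nat => ('x, 'n) chart" where
 "cseq = (SOME c. (ALL i. c i:atlas M) & (\<Union>i. fst (c i)) = UNIV)"

lemma cseq_atlas: "cseq i:atlas M" and cseq_cover: "(\<Union>i. dom (cseq i)) = UNIV"
proof -
 obtain a :: "nat => 'x" where "(\<Union>i. dom (ch (a i))) = UNIV" by (rule seq_cover[OF open_dom[OF ch_atlas] ch_dom])
 hence "EX c :: nat => ('x, 'n) chart. (ALL i. c i:atlas M) & (\<Union>i. dom (c i)) = UNIV"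
 proof (intro exI[where x="%i. ch (a i)"] conjI allI)
  show "ch (a i):atlas M" for i by (rule ch_atlas)
 qed
 from someI_ex[OF this] show "cseq i:atlas M" "(\<Union>i. dom (cseq i)) = UNIV" unfolding cseq_def by blast+
qed

definition piece :: "nat => 'x set" where "piece = disjointed (%i. dom (cseq i))"

lemma piece: "disjoint_family piece" "(\<Union>i. piece i) = UNIV" "piece i <= dom (cseq i)" "piece i:sets borel"
proof -
 show "disjoint_family piece" unfolding piece_def by (rule disjoint_family_disjointed)
 show "(\<Union>i. piece i) = UNIV" unfolding piece_def UN_disjointed_eq cseq_cover ..
 show "piece i <= dom (cseq i)" unfolding piece_def by (rule disjointed_subset)
 show "piece i:sets borel" unfolding piece_def
  using sets.range_disjointed_sets[of "%i. dom (cseq i)" borel] borel_dom[OF cseq_atlas] by blast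
qed

lemma is_volume_unique:
 assumes "sets nu = sets borel" "sets nu' = sets borel"
  and "!!c B. c:atlas M ==> B:sets borel ==> B <= dom c ==> em nu B = em nu' B"
 shows "nu = nu'"
proof (rule measure_eqI)
 fix B assume "B:sets nu"
 hence B: "B:sets borel" using assms(1) by simp
 have BP: "B = (\<Union>i. B Int piece i)" using piece(2) by blast
 have dj: "disjoint_family (%i. B Int piece i)" using piece(1) by (auto simp: disjoint_family_on_def)
 have "em nu B = (\<Sum>i. em nu (B Int piece i))"
  by (subst (1) BP, rule suminf_emeasure[symmetric]) (use dj B piece(4) assms in auto)
 also have "... = (\<Sum>i. em nu' (B Int piece i))"
  by (intro suminf_cong assms(3)[OF cseq_atlas]) (use B piece(3,4) in auto)
 also have "... = em nu' B"
  by (subst (2) BP, rule suminf_emeasure) (use dj B piece(4) assms in auto)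
 finally show "em nu B = em nu' B" .
qed (use assms in simp)

text \<open>\<open>volume\<close> is a definite description. Existence: chart volumes agree on
  overlaps, so cutting them down to disjoint pieces and adding up gives a measure with the right
  values in every chart. Uniqueness: a Borel set is the disjoint union of its parts in the
  pieces.\<close>

lemma volume_props:
 shows sets_volume: "sets (volume M) = sets borel"
  and emeasure_volume: "c:atlas M ==> B:sets borel ==> B <= dom c ==>
   em (volume M) B = (\<integral>\<^sup>+p\<in>snd c ` B. ennreal (dens c p) \<partial>lborel)"
proof -
 define om where "om i = density (chart_volume (cseq i)) (Ind (piece i))" for i :: nat
 define nu where "nu = superpose euclidean UNIV om"
 have som: "sets (om i) = sets (borel_of euclidean)" for i unfolding om_def borel_of_eu by simp
 have snu: "sets nu = sets borel"
  unfolding nu_def superpose_def borel_of_eu using sets.sets_measure_of_eq[of "borel :: 'x measure"] by simp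
 have enu: "em nu B = (\<Sum>i. em (chart_volume (cseq i)) (B Int piece i))" if B: "B:sets borel" for B
 proof -
  have "em nu B = (\<Sum>i. em (om i) B)"
   unfolding nu_def using emeasure_superpose[of UNIV om euclidean B, OF som] B
   unfolding borel_of_eu nn_integral_count_space_nat by simp
  also have "... = (\<Sum>i. em (chart_volume (cseq i)) (B Int piece i))"
  proof (rule suminf_cong)
   fix i
   have "em (om i) B = (NI (chart_volume (cseq i)) (%x. Ind (piece i) x*Ind B x))"
    unfolding om_def using B piece(4)
    by (intro emeasure_density borel_measurable_indicator) simp_all
   also have "... = (NI (chart_volume (cseq i)) (%x. Ind (B Int piece i) x))"
    by (intro nn_integral_cong) (simp split: split_indicator)
   also have "... = em (chart_volume (cseq i)) (B Int piece i)"
    using B piece(4) by (intro nn_integral_indicator) simp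
   finally show "em (om i) B = em (chart_volume (cseq i)) (B Int piece i)" .
  qed
  finally show ?thesis .
 qed
 have vnu: "em nu B = (\<integral>\<^sup>+p\<in>snd c ` B. ennreal (dens c p) \<partial>lborel)"
  if c: "c:atlas M" and B: "B:sets borel" "B <= dom c" for c B
 proof -
  have "em nu B = (\<Sum>i. em (chart_volume c) (B Int piece i))"
   unfolding enu[OF B(1)] using B piece(3,4) by (intro suminf_cong chart_volume_agree[OF cseq_atlas c]) auto
  also have "... = em (chart_volume c) (\<Union>i. B Int piece i)"
   using piece(1,4) B by (intro suminf_emeasure) (auto simp: disjoint_family_on_def)
  also have "(\<Union>i. B Int piece i) = B" using piece(2) by blast
  finally show ?thesis using emeasure_chart_volume[OF c B] by simp
 qed
 let ?P = "%nu. sets nu = sets borel & (ALL c:atlas M. ALL B:sets borel. B <= dom c -->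
    em nu B = (\<integral>\<^sup>+p\<in>snd c ` B. ennreal (sqrt (det (gram M c p))) \<partial>lborel))"
 have Pnu: "?P nu" using snu vnu unfolding dens_def by simp
 have "volume M = nu"
  unfolding volume_def
 proof (rule the_equality, rule Pnu)
  fix nu' assume "?P nu'"
  thus "nu' = nu" using Pnu by (intro is_volume_unique) auto
 qed
 thus "sets (volume M) = sets borel" "c:atlas M ==> B:sets borel ==> B <= dom c ==>
   em (volume M) B = (\<integral>\<^sup>+p\<in>snd c ` B. ennreal (dens c p) \<partial>lborel)"
  using snu vnu by auto
qed

lemma emeasure_volume_point: "em (volume M) {x} = 0"
proof -
 have "em (volume M) {x} = (\<integral>\<^sup>+p\<in>snd (ch x) ` {x}. ennreal (dens (ch x) p) \<partial>lborel)"
  by (rule emeasure_volume[OF ch_atlas]) (use ch_dom in auto)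
 also have "... = (NI lborel (%p. ennreal (dens (ch x) (snd (ch x) x))*Ind {snd (ch x) x} p))"
  by (intro nn_integral_cong) (simp split: split_indicator)
 also have "... = 0" by (subst nn_integral_cmult_indicator) simp_all
 finally show ?thesis .
qed

section \<open>Small coordinate balls\<close>

definition cnbhd :: "'x => real => 'x set" where
 "cnbhd x r = cinv (ch x) ` cball (snd (ch x) x) r"

definition onbhd :: "'x => real => 'x set" where
 "onbhd x r = cinv (ch x) ` ball (snd (ch x) x) r"

lemma chart_inv_image:
 assumes c: "c:atlas M" and A: "A <= img c"
 shows "cinv c ` A <= dom c" "snd c ` cinv c ` A = A"
proof -
 show "cinv c ` A <= dom c" using chart_inv_dom[OF c] A by blast
 have "(%p. snd c (cinv c p)) ` A = (%p. p) ` A" using chart_eq[OF c] A by (intro image_cong) auto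
 thus "snd c ` cinv c ` A = A" by (simp add: image_image)
qed

lemma open_chart_inv_image:
 assumes c: "c:atlas M" and A: "A <= img c" "open A"
 shows "open (cinv c ` A)"
proof -
 have "open (dom c Int snd c -` A)"
  by (rule continuous_open_preimage[OF chart_cont[OF c] open_dom[OF c] A(2)])
 moreover have "dom c Int snd c -` A = cinv c ` A"
  using chart_inv_eq[OF c] chart_inv_image[OF c A(1)] chart_eq[OF c] A(1) by (auto simp: image_iff) (metis+)?
 ultimately show ?thesis by simp
qed

lemma small_radius:
 assumes "open U" "x:U"
 obtains r where "r > 0" "cball (snd (ch x) x) r <= img (ch x)" "cnbhd x r <= U"
proof -
 have "open (snd (ch x) ` (dom (ch x) Int U))" by (rule open_chart_image[OF ch_atlas assms(1)])
 moreover have "snd (ch x) x:snd (ch x) ` (dom (ch x) Int U)" using ch_dom assms(2) by blast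
 ultimately obtain r where r: "r > 0" "cball (snd (ch x) x) r <= snd (ch x) ` (dom (ch x) Int U)"
  unfolding open_contains_cball by blast
 thus thesis unfolding chart_image_eq[OF ch_atlas] 
 proof (intro that[of r])
  assume a: "cball (snd (ch x) x) r <= {p:img (ch x). cinv (ch x) p:U}"
  thus "cball (snd (ch x) x) r <= img (ch x)" "cnbhd x r <= U" unfolding cnbhd_def by blast+
 qed
qed

lemma nbhd:
 assumes r: "r > 0" "cball (snd (ch x) x) r <= img (ch x)"
 shows "compact (cnbhd x r)" "open (onbhd x r)" "x:onbhd x r" "onbhd x r <= cnbhd x r"
  "cnbhd x r <= dom (ch x)" "onbhd x r <= dom (ch x)"
  "em (volume M) (cnbhd x r) < \<infinity>"
proof -
 let ?c = "ch x" and ?p = "snd (ch x) x"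
 have b: "ball ?p r <= img ?c" using r ball_subset_cball by blast
 show cp: "compact (cnbhd x r)" unfolding cnbhd_def
  by (intro compact_continuous_image continuous_on_subset[OF chart_inv_cont[OF ch_atlas] r(2)]) simp
 show "open (onbhd x r)" unfolding onbhd_def by (rule open_chart_inv_image[OF ch_atlas b]) simp
 show "x:onbhd x r" unfolding onbhd_def using r(1) chart_inv_eq[OF ch_atlas ch_dom, of x]
  by (intro image_eqI[of _ _ ?p]) simp_all
 show "onbhd x r <= cnbhd x r" unfolding onbhd_def cnbhd_def using ball_subset_cball by blast
 show d: "cnbhd x r <= dom ?c" unfolding cnbhd_def by (rule chart_inv_image(1)[OF ch_atlas r(2)])
 show "onbhd x r <= dom ?c" unfolding onbhd_def by (rule chart_inv_image(1)[OF ch_atlas b])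
 have "compact (dens ?c ` cball ?p r)"
  by (intro compact_continuous_image continuous_on_subset[OF continuous_dens[OF ch_atlas] r(2)]) simp
 then obtain B where B: "!!p. p:cball ?p r ==> norm (dens ?c p) <= B"
  using bounded_iff[THEN iffD1, OF compact_imp_bounded] by (metis imageI)
 have "em (volume M) (cnbhd x r) = (\<integral>\<^sup>+p\<in>cball ?p r. ennreal (dens ?c p) \<partial>lborel)"
  using emeasure_volume[OF ch_atlas _ d] cp chart_inv_image(2)[OF ch_atlas r(2)]
  unfolding cnbhd_def by (simp add: borel_compact)
 also have "... <= (NI lborel (%p. ennreal B*Ind (cball ?p r) p))"
  using B by (intro nn_integral_mono) (auto split: split_indicator intro!: ennreal_leI dest: abs_le_D1)
 also have "... = ennreal B*em lborel (cball ?p r)"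
  by (rule nn_integral_cmult_indicator) (simp add: borel_closed)
 also have "... < \<infinity>"
  using emeasure_bounded_finite[OF bounded_cball, of ?p r] by (simp add: ennreal_mult_less_top less_top)
 finally show "em (volume M) (cnbhd x r) < \<infinity>" .
qed

text \<open>The density is positive on a coordinate ball, so a vanishing integral would make the
  ball Lebesgue null. Positivity matters because volumes of small balls later appear in a
  denominator.\<close>

lemma emeasure_volume_open_pos:
 assumes U: "open U" "x:U"
 shows "em (volume M) U > 0"
proof -
 obtain r where r: "r > 0" "cball (snd (ch x) x) r <= img (ch x)" "cnbhd x r <= U" by (rule small_radius[OF U])
 let ?c = "ch x" and ?p = "snd (ch x) x"
 have b: "ball ?p r <= img ?c" using r ball_subset_cball by blast
 note n = nbhd[OF r(1,2)]
 have "em (volume M) (onbhd x r) = (\<integral>\<^sup>+p\<in>ball ?p r. ennreal (dens ?c p) \<partial>lborel)"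
  using emeasure_volume[OF ch_atlas borel_open[OF n(2)] n(6)] chart_inv_image(2)[OF ch_atlas b] unfolding onbhd_def by simp
 moreover have "(\<integral>\<^sup>+p\<in>ball ?p r. ennreal (dens ?c p) \<partial>lborel) ~= 0"
 proof
  assume z: "(\<integral>\<^sup>+p\<in>ball ?p r. ennreal (dens ?c p) \<partial>lborel) = 0"
  have m: "(%p. ennreal (dens ?c p)*Ind (ball ?p r) p):bm lborel"
  proof -
   have "(%p. ennreal (Ind (img ?c) p*dens ?c p)*Ind (ball ?p r) p):bm lborel"
    by (intro borel_measurable_times_ennreal borel_measurable_indicator)
      (use measurable_dens[OF ch_atlas, of x] borel_open[OF open_ball, of ?p r] in simp_all)
   moreover have "ennreal (Ind (img ?c) p*dens ?c p)*Ind (ball ?p r) p = ennreal (dens ?c p)*Ind (ball ?p r) p" for p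
    using b by (auto split: split_indicator)
   ultimately show ?thesis by simp
  qed
  have "AE p in lborel. ennreal (dens ?c p)*Ind (ball ?p r) p = 0"
   using nn_integral_0_iff_AE[OF m] z by simp
  hence "AE p in lborel. p ~: ball ?p r"
  proof (rule AE_mp, intro AE_I2 impI notI)
   fix p assume p: "ennreal (dens ?c p)*Ind (ball ?p r) p = 0" "p:ball ?p r"
   hence "dens ?c p > 0" using b dens_pos[OF ch_atlas] by blast
   thus False using p by simp
  qed
  hence "em lborel (ball ?p r) = 0" 
  proof (rule AE_iff_measurable[THEN iffD1, rotated 2])
   show "{q:space lborel. ~ q ~: ball ?p r} = ball ?p r" by auto
  qed simp
  hence "negligible (ball ?p r)" by (simp add: negligible_iff_null_sets null_sets_def)
  thus False using open_not_negligible[of "ball ?p r"] r(1) by simp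
 qed
 moreover have "em (volume M) (onbhd x r) <= em (volume M) U"
  using n(4) r(3) U(1) by (intro emeasure_mono) (auto simp: sets_volume)
 ultimately show ?thesis using order_less_le_trans by (metis not_gr_zero)
qed

lemma nbhd_seq:
 obtains U C :: "nat => 'x set" where "(\<Union>i. U i) = UNIV" "!!i. open (U i)" "!!i. U i <= C i" "!!i. compact (C i)"
  "!!i. em (volume M) (C i) < \<infinity>"
proof -
 have "EX r. r > 0 & cball (snd (ch x) x) r <= img (ch x)" for x
  by (rule small_radius[OF open_UNIV UNIV_I, of x]) (intro exI conjI)
 hence "ALL x. EX r. r > 0 & cball (snd (ch x) x) r <= img (ch x)" ..
 from choice[OF this] obtain r where r: "!!x. r x > 0" "!!x. cball (snd (ch x) x) (r x) <= img (ch x)" by blast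
 note n = nbhd[OF r]
 obtain a :: "nat => 'x" where cov: "(\<Union>i. onbhd (a i) (r (a i))) = UNIV" by (rule seq_cover[OF n(2,3)])
 show thesis
 proof (rule that[OF cov n(2)])
  fix i
  show "onbhd (a i) (r (a i)) <= cnbhd (a i) (r (a i))" by (rule n(4))
  show "compact (cnbhd (a i) (r (a i)))" by (rule n(1))
  show "em (volume M) (cnbhd (a i) (r (a i))) < \<infinity>" by (rule n(7))
 qed
qed

lemma sigma_finite_volume: "sigma_finite_measure (volume M)"
proof -
 obtain U C :: "nat => 'x set" where n: "(\<Union>i. U i) = UNIV" "!!i. open (U i)" "!!i. U i <= C i" "!!i. compact (C i)"
  "!!i. em (volume M) (C i) < \<infinity>" by (rule nbhd_seq) (rule that)
 show ?thesis
 proof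
  show "EX A. countable A & A <= sets (volume M) & \<Union>A = space (volume M) & (ALL a:A. em (volume M) a ~= \<infinity>)"
  proof (intro exI[of _ "range C"] conjI ballI)
   show "range C <= sets (volume M)" using n(4) by (auto simp: sets_volume borel_compact)
   show "\<Union>(range C) = space (volume M)" using UN_mono[of UNIV UNIV U C] n(1,3) sets_eq_imp_space_eq[OF sets_volume] by auto
   show "em (volume M) a ~= \<infinity>" if a: "a:range C" for a
   proof -
    obtain i where "a = C i" using a by blast
    thus ?thesis using n(5)[of i] by simp
   qed
  qed simp
 qed
qed

text \<open>Finite unions of compact coordinate balls: a compact set is already covered by finitely
  many of the open balls inside them.\<close>

lemma exhaustion_exists: "EX K :: nat => 'x set. exhaustion K"
proof -
 obtain U C :: "nat => 'x set" where n: "(\<Union>i. U i) = UNIV" "!!i. open (U i)" "!!i. U i <= C i" "!!i. compact (C i)"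
  by (rule nbhd_seq) (rule that)
 have "exhaustion (%m. \<Union>i<m. C i)"
 proof
  show "compact (\<Union>i<m. C i)" for m using n(4) by (intro compact_UN) auto
  fix L :: "'x set" assume L: "compact L"
  have "L <= (\<Union>i\<in>UNIV. U i)" using n(1) by simp
  from compactE_image[OF L n(2) this] obtain I where I: "finite I" "L <= (\<Union>i\<in>I. U i)" by metis
  obtain m where "ALL i:I. i < m" using I(1) unfolding finite_nat_set_iff_bounded by (rule exE)
  hence "(\<Union>i\<in>I. U i) <= (\<Union>i<m. C i)"
   using \<open>ALL i:I. i < m\<close> n(3) by (intro UN_mono) auto
  thus "EX m. L <= (\<Union>i<m. C i)" by (intro exI[of _ m] subset_trans[OF I(2)])
 qed
 thus ?thesis by (rule exI[where P = exhaustion])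
qed

end

section \<open>Cut-off functions\<close>

lemma compact_closed_subset: "compact C ==> closed A ==> A <= C ==> compact A" for A :: "'a::t2_space set"
 using compact_Int_closed[of C A] by (simp add: Int_absorb1)

context riemann
begin

lemma bump_near:
 assumes "open U" "x:U"
 shows "EX f:test_functions M. (ALL y. 0 <= f y & f y <= 1) & (EX W. open W & x:W & (ALL y:W. f y = 1))"
proof -
 let ?c = "ch x" and ?p = "snd (ch x) x"
 obtain r where r: "r > 0" "cball ?p r <= img ?c" "cnbhd x r <= U" by (rule small_radius[OF assms])
 note n = nbhd[OF r(1,2)]
 have r2: "0 < r/2" using r(1) by simp
 obtain b :: "real ^ 'n => real" where b: "smooth_on UNIV b" "!!p. 0 <= b p" "!!p. b p <= 1"
  "!!p. dist p ?p <= r/2 ==> b p = 1" "!!p. dist p ?p >= 2*(r/2) ==> b p = 0"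
  by (rule bump_function_exists[OF r2, where a = ?p]) blast
 define f where "f y = (if y:dom ?c then b (snd ?c y) else 0)" for y
 have out: "f y = 0" if "y ~: cnbhd x r" for y
 proof (cases "y:dom ?c")
  case True
  have "snd ?c y ~: cball ?p r"
  proof
   assume "snd ?c y:cball ?p r"
   hence "cinv ?c (snd ?c y):cnbhd x r" unfolding cnbhd_def by (rule imageI)
   thus False using that chart_inv_eq[OF ch_atlas True] by simp
  qed
  hence "dist (snd ?c y) ?p >= 2*(r/2)" by (simp add: dist_commute)
  thus ?thesis using b(5) by (simp add: f_def)
 qed (simp add: f_def)
 have cl: "closed (cnbhd x r)" using n(1) by (rule compact_imp_closed)
 have "closure {y. f y ~= 0} <= cnbhd x r" using out cl by (intro closure_minimal) auto
 hence supp: "compact (closure {y. f y ~= 0})"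
  by (rule compact_closed_subset[OF n(1) closed_closure])
 have sm: "smooth_on (img d) (f o cinv d)" if d: "d:atlas M" for d
 proof (rule smooth_on_local)
  fix q assume q: "q:img d"
  note y = chart_inv_dom[OF d q] chart_eq[OF d q]
  \<comment> \<open>At a point of the chart domain the function is locally the transported bump; any
    other point has a neighbourhood disjoint from the closed ball, where the function is 0.\<close>
  show "EX T. q:T & smooth_on T (f o cinv d)"
  proof (cases "cinv d q:dom ?c")
   case True
   let ?T = "snd d ` (dom d Int dom ?c)"
   have T: "open ?T" by (rule open_overlap[OF d ch_atlas])
   have "smooth_on ?T (%p. b (tr d ?c p))"
    by (rule smooth_on_compose[OF T smooth_tr[OF d ch_atlas] b(1)]) simp
   hence "smooth_on ?T (f o cinv d)"
   proof (rule smooth_on_cong[OF T, rotated])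
    fix p assume "p:?T"
    thus "b (tr d ?c p) = (f o cinv d) p" unfolding chart_image_eq[OF d] by (simp add: f_def)
   qed
   moreover have "q:?T" unfolding chart_image_eq[OF d] using q True by simp
   ultimately show ?thesis by (intro exI[of _ ?T] conjI)
  next
   case False
   let ?T = "snd d ` (dom d Int-cnbhd x r)"
   have T: "open ?T" by (rule open_chart_image[OF d]) (rule open_Compl[OF cl])
   have "smooth_on ?T (f o cinv d)"
   proof (rule smooth_on_cong[OF T _ smooth_on_const])
    fix p assume "p:?T"
    thus "0 = (f o cinv d) p" unfolding chart_image_eq[OF d] using out by simp
   qed
   moreover have "q:?T" unfolding chart_image_eq[OF d] using q False n(5) by blast
   ultimately show ?thesis by (intro exI[of _ ?T] conjI)
  qed
 qed
 have "f:test_functions M" using sm supp by (simp add: test_functions_def)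
 moreover have "ALL y. 0 <= f y & f y <= 1" using b by (simp add: f_def)
 moreover have "EX W. open W & x:W & (ALL y:W. f y = 1)"
 proof -
  have rr: "cball ?p (r/2) <= img ?c" using r(1,2) subset_cball[of "r/2" r ?p] by simp
  note n2 = nbhd[OF r2 rr]
  have "f y = 1" if "y:onbhd x (r/2)" for y
  proof -
   obtain p where p: "p:ball ?p (r/2)" "y = cinv ?c p" using \<open>y : onbhd x (r / 2)\<close> unfolding onbhd_def by blast
   hence "p:img ?c" using rr ball_subset_cball by blast
   hence "snd ?c y = p" "y:dom ?c" using p chart_eq[OF ch_atlas] chart_inv_dom[OF ch_atlas] by auto
   thus ?thesis using p(1) b(4)[of p] by (simp add: f_def dist_commute)
  qed
  thus ?thesis using n2(2,3) by blast
 qed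
 ultimately show ?thesis by blast
qed

text \<open>The function 1 - prod (1 - f x) equals 1 as soon as one of the bumps does. It is 1 on an
  open set around \<open>C\<close>, so that its differential vanishes there.\<close>

lemma cutoff_exists:
 assumes C: "compact C"
 obtains ka W where "ka:test_functions M" "!!y. 0 <= ka y" "!!y. ka y <= 1" "open W" "C <= W" "!!y. y:W ==> ka y = 1"
proof -
 have "ALL x. EX f W. f:test_functions M & (ALL y. 0 <= f y & f y <= 1) & open W & x:W & (ALL y:W. f y = 1)"
 proof
  fix x show "EX f W. f:test_functions M & (ALL y. 0 <= f y & f y <= 1) & open W & x:W & (ALL y:W. f y = 1)"
   using bump_near[OF open_UNIV UNIV_I, of x] by blast
 qed
 then obtain f W where f: "!!x. f x:test_functions M" "!!x y. 0 <= f x y" "!!x y. f x y <= 1"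
  and W: "!!x. open (W x)" "!!x. x:W x" "!!x y. y:W x ==> f x y = 1"
  unfolding choice_iff by blast
 have "C <= (\<Union>x\<in>UNIV. W x)" using W(2) by blast
 from compactE_image[OF C W(1) this] obtain I where I: "finite I" "C <= (\<Union>x\<in>I. W x)" by metis
 define ka where "ka y = 1-(\<Prod>x\<in>I. 1-f x y)" for y
 have b: "0 <= (\<Prod>x\<in>I. 1-f x y)" "(\<Prod>x\<in>I. 1-f x y) <= 1" for y
  using f by (auto intro!: prod_nonneg prod_le_1)
 have sm: "smooth_on (img c) (ka o cinv c)" if c: "c:atlas M" for c
 proof -
  note o = open_img[OF c]
  have "smooth_on (img c) (%p. 1-(\<Prod>x\<in>I. 1-(f x o cinv c) p))"
   by (intro smooth_on_diff[OF o] smooth_on_prod[OF o] smooth_on_const test_function_smooth[OF f(1) c])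
  thus ?thesis by (simp add: ka_def o_def)
 qed
 have "{y. ka y ~= 0} <= (\<Union>x\<in>I. supp (f x))"
 proof
  fix y assume "y:{y. ka y ~= 0}"
  hence "(\<Prod>x\<in>I. 1-f x y) ~= 1" by (simp add: ka_def)
  then obtain x where "x:I" "f x y ~= 0" by (metis (no_types, lifting) diff_zero prod.neutral)
  thus "y:(\<Union>x\<in>I. supp (f x))" using supp_outside by blast
 qed
 moreover have cs: "compact (\<Union>x\<in>I. supp (f x))" using compact_supp_test[OF f(1)] I(1) by (intro compact_UN) auto
 ultimately have "closure {y. ka y ~= 0} <= (\<Union>x\<in>I. supp (f x))" by (intro closure_minimal compact_imp_closed)
 hence "compact (closure {y. ka y ~= 0})"
  by (rule compact_closed_subset[OF cs closed_closure])
 hence 1: "ka:test_functions M" using sm by (simp add: test_functions_def)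
 show thesis
 proof (rule that[of ka "\<Union>x\<in>I. W x"])
  show "ka y = 1" if "y:(\<Union>x\<in>I. W x)" for y
  proof -
   obtain x where x: "x:I" "y:W x" using \<open>y : (\<Union>x\<in>I. W x)\<close> by blast
   hence "EX x:I. 1-f x y = 0" using W(3)[of y x] by (intro bexI[of _ x]) simp_all
   hence "(\<Prod>x\<in>I. 1-f x y) = 0" by (rule prod_zero[OF I(1)])
   thus ?thesis by (simp add: ka_def)
  qed
  show "0 <= ka y" "ka y <= 1" for y using b[of y] by (simp_all add: ka_def)
  show "open (\<Union>x\<in>I. W x)" using W(1) by (intro open_UN) simp
 qed (rule 1, rule I(2))
qed

section \<open>Directional derivatives as limits of Borel functions\<close>

definition piece_index :: "'x => nat" where
 "piece_index y = (LEAST i. y:dom (cseq i))"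

lemma piece_index: "y:dom (cseq (piece_index y))"
proof -
 have "y:(\<Union>i. dom (cseq i))" unfolding cseq_cover by simp
 then obtain i where "y:dom (cseq i)" by (rule UN_E)
 thus ?thesis unfolding piece_index_def by (rule LeastI)
qed

lemma measurable_piece_index: "piece_index:borel ->M Cnt UNIV"
 unfolding piece_index_def[abs_def]
 by (rule measurable_Least) (use borel_dom[OF cseq_atlas] in \<open>simp add: pred_def\<close>)

text \<open>A coordinate step of size \<open>s\<close> along \<open>v\<close>. A point whose step
  would leave the chart stays put, which keeps the map total and Borel.\<close>

definition step_in :: "('x => real ^ 'n) => real => ('x, 'n) chart => 'x => 'x" where
 "step_in v s c y = (if y:{y:dom c. snd c y+s *R field_in v c (snd c y):img c}
   then cinv c (snd c y+s *R field_in v c (snd c y)) else y)"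

text \<open>Difference quotients along \<open>flow_step\<close> express derivatives along \<open>v\<close> as limits of Borel functions.\<close>
definition flow_step :: "('x => real ^ 'n) => nat => 'x => 'x" where
 "flow_step v m y = step_in v (1/(real m+1)) (cseq (piece_index y)) y"

lemma continuous_step:
 assumes v: "v:Vect0 M" and c: "c:atlas M"
 shows "continuous_on (dom c) (%y. snd c y+s *R field_in v c (snd c y))"
proof -
 have "continuous_on (dom c) (%y. field_in v c (snd c y))"
  by (rule continuous_on_compose2[OF smooth_cont[OF smooth_field_in[OF v c]] chart_cont[OF c]]) simp
 thus ?thesis by (intro continuous_intros chart_cont[OF c])
qed

lemma measurable_step_in:
 assumes v: "v:Vect0 M" and c: "c:atlas M"
 shows "step_in v s c:bm borel"
proof -
 let ?A = "{y:dom c. snd c y+s *R field_in v c (snd c y):img c}"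
 have "open (dom c Int (%y. snd c y+s *R field_in v c (snd c y)) -` img c)"
  by (rule continuous_open_preimage[OF continuous_step[OF v c] open_dom[OF c] open_img[OF c]])
 moreover have "dom c Int (%y. snd c y+s *R field_in v c (snd c y)) -` img c = ?A" by blast
 ultimately have A: "?A:sets borel" by (simp add: borel_open)
 have "continuous_on ?A (%y. cinv c (snd c y+s *R field_in v c (snd c y)))"
  by (rule continuous_on_compose2[OF chart_inv_cont[OF c] continuous_on_subset[OF continuous_step[OF v c]]]) blast+
 from borel_measurable_continuous_on_if[OF A this continuous_on_id] show ?thesis
  unfolding step_in_def[abs_def] .
qed

lemma measurable_flow_step: "v:Vect0 M ==> flow_step v m:bm borel"
 unfolding flow_step_def[abs_def]
 by (rule measurable_compose_countable[OF measurable_step_in[OF _ cseq_atlas] measurable_piece_index])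

text \<open>The step size 1/(m+1) is eventually small enough for the step to remain in the chart, so
  the default branch of \<open>step_in\<close> does not affect the limit.\<close>

lemma flow_step_LIMSEQ:
 assumes f: "mdiff f y"
 shows "(%m. (real m+1)*(f (flow_step v m y)-f y)) \<longlonglongrightarrow> differential M f y (v y)"
proof -
 define c where "c = cseq (piece_index y)"
 have c: "c:atlas M" "y:dom c" unfolding c_def by (rule cseq_atlas, rule piece_index)
 define p where "p = snd c y"
 define u where "u = field_in v c p"
 let ?g = "f o cinv c"
 have D: "(?g has_derivative (%u. differential M f y (to_tangent M c y u))) (at p)"
  unfolding p_def by (rule mdiff_chart[OF c f])
 have "?g differentiable (at (p+0 *R u))" using D by (auto simp: differentiable_def)
 from DERIV_along_line[OF this]
 have "((%s. ?g (p+s *R u)) has_real_derivative differential M f y (to_tangent M c y u)) (at 0)"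
  using frechet_eqI[OF D] by simp
 moreover have "to_tangent M c y u = v y" unfolding u_def p_def by (rule to_tangent_field_in[OF c])
 ultimately have L: "((%s. (?g (p+s *R u)-?g p)/s) \<longlongrightarrow> differential M f y (v y)) (at 0)"
  unfolding DERIV_def by simp
 have z: "(%m. 1/(real m+1)) \<longlonglongrightarrow> 0" by real_asymp
 have "filterlim (%m. 1/(real m+1)) (at 0) sequentially"
  by (rule filterlim_atI[OF z]) (simp add: add_nonneg_pos)
 from filterlim_compose[OF L this]
 have "(%m. (?g (p+(1/(real m+1)) *R u)-?g p)/(1/(real m+1))) \<longlonglongrightarrow> differential M f y (v y)" .
 moreover have "\<forall>\<^sub>F m in sequentially. (?g (p+(1/(real m+1)) *R u)-?g p)/(1/(real m+1)) =
  (real m+1)*(f (flow_step v m y)-f y)"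
 proof -
  have "(%m. p+(1/(real m+1)) *R u) \<longlonglongrightarrow> p+0 *R u" by (intro tendsto_intros z)
  hence "\<forall>\<^sub>F m in sequentially. p+(1/(real m+1)) *R u:img c"
   by (rule topological_tendstoD[OF _ open_img[OF c(1)]]) (use c in \<open>simp add: p_def\<close>)
  thus ?thesis
  proof eventually_elim
   case (elim m)
   have "flow_step v m y = cinv c (p+(1/(real m+1)) *R u)"
    unfolding flow_step_def c_def[symmetric] step_in_def
    using elim c(2) by (simp add: p_def u_def)
   moreover have "?g p = f y" unfolding p_def by (simp add: chart_inv_eq[OF c])
   ultimately show ?case by (simp add: mult.commute)
  qed
 qed
 ultimately show ?thesis by (rule Lim_transform_eventually)
qed

end

section \<open>Borel measurability of the logarithmic derivative\<close>

locale cluster_density = riemann M + cluster_kernel K et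
 for M :: "('x::{t2_space,second_countable_topology}, 'n::finite) riemannian"
  and K :: "nat => 'x set" and et :: "'x => 'x list measure" +
 fixes h :: "'x => 'x list => real"
 assumes h_nonneg: "0 <= h x ys"
  and eta_density: "et x = density (list_volume M) (%ys. ennreal (h x ys))"
  and h_differentiable: "list_differentiable M (h x) ys"
begin

lemma list_volume_eq: "list_volume M = tuple_measure (volume M)"
 unfolding list_volume_def tuple_measure_def ..

lemma h_continuous:
 assumes "ep > 0"
 shows "EX Us. (ALL U:set Us. open U) & ys:lbox Us & (ALL zs:lbox Us. abs (h x zs-h x ys) < ep)"
proof -
 let ?F = "in_charts (map ch ys) (h x)" and ?as = "map (%y. snd (ch y) y) ys"
 obtain L where L: "list_has_deriv ?F L ?as" using h_differentiable unfolding list_differentiable_def by blast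
 obtain de where de: "de > 0" "!!bs. length bs = length ?as ==> ldist ?as bs < de ==> abs (?F bs-?F ?as) < ep"
  using list_has_deriv_continuous[OF L assms] by blast
 let ?de = "de/(real (length ys)+1)"
 define U where "U y = dom (ch y) Int snd (ch y) -` ball (snd (ch y) y) ?de" for y
 have oU: "open (U y)" for y
  unfolding U_def by (rule continuous_open_preimage[OF chart_cont[OF ch_atlas] open_dom[OF ch_atlas] open_ball])
 have d: "0 < ?de" using de(1) by simp
 have yU: "y:U y" for y unfolding U_def using ch_dom d by simp
 have F: "?F (map2 (%y z. snd (ch y) z) ys zs) = h x zs" if zs: "length zs = length ys" "!!i. i < length ys ==> zs!i:dom (ch (ys!i))" for zs
 proof -
  have "map2 cinv (map ch ys) (map2 (%y z. snd (ch y) z) ys zs) = zs"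
   using zs by (intro nth_equalityI) (simp_all add: chart_inv_eq[OF ch_atlas])
  thus ?thesis by (simp add: in_charts_def)
 qed
 have as: "map2 (%y z. snd (ch y) z) ys ys = ?as" by (intro nth_equalityI) simp_all
 have F0: "?F ?as = h x ys" using F[of ys] ch_dom unfolding as by simp
 have "abs (h x zs-h x ys) < ep" if zs: "zs:lbox (map U ys)" for zs
 proof -
  let ?bs = "map2 (%y z. snd (ch y) z) ys zs"
  have l: "length zs = length ys" and z: "!!i. i < length ys ==> zs!i:U (ys!i)"
   using zs by (auto simp: lbox_def)
  have "ldist ?as ?bs = (\<Sum>i<length ys. norm (snd (ch (ys!i)) (zs!i)-snd (ch (ys!i)) (ys!i)))"
   unfolding ldist_def using l by simp
  also have "... <= (\<Sum>i<length ys. ?de)"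
  proof (rule sum_mono)
   fix i assume "i:{..<length ys}"
   thus "norm (snd (ch (ys!i)) (zs!i)-snd (ch (ys!i)) (ys!i)) <= ?de"
    using z[of i] by (simp add: U_def dist_norm norm_minus_commute)
  qed
  also have "... < de" using de(1) by (simp add: field_simps)
  finally have "abs (?F ?bs-?F ?as) < ep" using l by (intro de(2)) simp_all
  moreover have "?F ?bs = h x zs" by (rule F[OF l]) (use z in \<open>simp add: U_def\<close>)
  ultimately show ?thesis unfolding F0 by simp
 qed
 moreover have "ys:lbox (map U ys)" using yU by (simp add: lbox_def)
 ultimately show ?thesis using oU by (intro exI[of _ "map U ys"] conjI ballI) auto
qed

lemma h_borel: "h x:bm LB"
 by (rule list_continuous_measurable[OF h_continuous])

lemma h_LIMSEQ:
 assumes l: "!!n. length (zs n) = length ys"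
  and c: "!!i U. i < length ys ==> open U ==> ys!i:U ==> \<forall>\<^sub>F n in sequentially. zs n!i:U"
 shows "(%n. h x (zs n)) \<longlonglongrightarrow> h x ys"
proof (rule tendstoI)
 fix ep :: real assume "ep > 0"
 from h_continuous[OF this] obtain Us where Us: "ALL U:set Us. open U" "ys:lbox Us" "ALL zs:lbox Us. abs (h x zs-h x ys) < ep"
  by blast
 have "\<forall>\<^sub>F n in sequentially. ALL i:{..<length ys}. zs n!i:Us!i"
  using Us(1,2) by (intro eventually_ball_finite ballI c) (auto simp: lbox_def)
 thus "\<forall>\<^sub>F n in sequentially. dist (h x (zs n)) (h x ys) < ep"
 proof eventually_elim
  case (elim n)
  hence "zs n:lbox Us" using l Us(2) by (simp add: lbox_def)
  thus ?case using Us(3) by (simp add: dist_real_def)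
 qed
qed

section \<open>Joint measurability of the density\<close>

definition rad :: "'x => real" where
 "rad y = (SOME r. r > 0 & cball (snd (ch y) y) r <= img (ch y))"

lemma rad: "rad y > 0" "cball (snd (ch y) y) (rad y) <= img (ch y)"
proof -
 have "EX r. r > 0 & cball (snd (ch y) y) r <= img (ch y)"
  by (rule small_radius[OF open_UNIV UNIV_I, of y]) (intro exI conjI)
 from someI_ex[OF this] show "rad y > 0" "cball (snd (ch y) y) (rad y) <= img (ch y)" unfolding rad_def by blast+
qed

definition Bn :: "nat => 'x => 'x set" where
 "Bn m y = onbhd y (rad y/(real m+1))"

lemma Bn_radius: "0 < rad y/(real m+1)" "cball (snd (ch y) y) (rad y/(real m+1)) <= img (ch y)"
proof -
 show "0 < rad y/(real m+1)" using rad(1)[of y] by simp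
 have "rad y/(real m+1) <= rad y" using rad(1)[of y] by (simp add: divide_le_eq)
 thus "cball (snd (ch y) y) (rad y/(real m+1)) <= img (ch y)"
  using rad(2)[of y] subset_cball by blast
qed

lemma Bn: "open (Bn m y)" "y:Bn m y" "em (volume M) (Bn m y) < \<infinity>" "em (volume M) (Bn m y) > 0"
proof -
 note n = nbhd[OF Bn_radius]
 show o: "open (Bn m y)" and y: "y:Bn m y" unfolding Bn_def by (rule n)+
 show "em (volume M) (Bn m y) > 0" by (rule emeasure_volume_open_pos[OF o y])
 have "em (volume M) (Bn m y) <= em (volume M) (cnbhd y (rad y/(real m+1)))"
  unfolding Bn_def by (intro emeasure_mono n(4)) (simp add: sets_volume borel_compact n(1))
 thus "em (volume M) (Bn m y) < \<infinity>" using n(7) by (rule order.strict_trans1)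
qed

lemma Bn_eventually:
 assumes "open U" "y:U"
 shows "\<forall>\<^sub>F m in sequentially. Bn m y <= U"
proof -
 obtain r where r: "r > 0" "cball (snd (ch y) y) r <= img (ch y)" "cnbhd y r <= U" by (rule small_radius[OF assms])
 have "(%m. rad y/(real m+1)) \<longlonglongrightarrow> 0" by real_asymp
 hence "\<forall>\<^sub>F m in sequentially. rad y/(real m+1) < r" using r(1) by (rule order_tendstoD)
 thus ?thesis
 proof eventually_elim
  case (elim m)
  hence "ball (snd (ch y) y) (rad y/(real m+1)) <= cball (snd (ch y) y) r"
   using ball_subset_cball subset_cball by (metis less_imp_le subset_trans)
  hence "Bn m y <= cnbhd y r" unfolding Bn_def onbhd_def cnbhd_def by (rule image_mono)
  thus ?case using r(3) by (rule subset_trans)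
 qed
qed

definition bx :: "nat => 'x list => 'x list set" where
 "bx m ys = lbox (map (Bn m) ys)"

lemma bx_sets: "bx m ys:sets LB"
 unfolding bx_def by (rule box_borel_sets) (simp add: Bn(1) borel_open)

lemma bx_volume: "0 < measure (list_volume M) (bx m ys)"
 "em (list_volume M) (bx m ys) = ennreal (measure (list_volume M) (bx m ys))"
proof -
 have e: "em (list_volume M) (bx m ys) = (\<Prod>i<length ys. em (volume M) (Bn m (ys!i)))"
  unfolding bx_def list_volume_eq
  using emeasure_tuple_measure_box[OF sets_volume sigma_finite_volume, of "map (Bn m) ys"] by (simp add: Bn(1) borel_open)
 have "em (list_volume M) (bx m ys) < top"
 proof -
  have "(\<Prod>i<n. em (volume M) (Bn m (ys!i))) < top" for n
   using Bn(3) by (induction n) (auto simp: ennreal_mult_less_top lessThan_Suc)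
  thus ?thesis unfolding e .
 qed
 thus E: "em (list_volume M) (bx m ys) = ennreal (measure (list_volume M) (bx m ys))"
  by (intro emeasure_eq_ennreal_measure) simp
 have "em (list_volume M) (bx m ys) ~= 0"
  unfolding e using Bn(4) by (simp add: zero_less_iff_neq_zero)
 thus "0 < measure (list_volume M) (bx m ys)" unfolding E by (simp add: zero_less_measure_iff less_le)
qed

text \<open>The quotient is the mean of \<open>h x\<close> over a shrinking box. As
  \<open>h x\<close> is continuous, the means converge at every point, not merely almost everywhere.
  The numerator is measurable in \<open>x\<close>, and that is the source of measurability of
  \<open>h\<close> in its first variable.\<close>

lemma h_as_limit: "(%m. measure (et x) (bx m ys)/measure (list_volume M) (bx m ys)) \<longlonglongrightarrow> h x ys"
proof (rule LIMSEQ_I)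
 fix ep' :: real assume "ep' > 0"
 \<comment> \<open>Half of the tolerance, since the bounds on a mean are not strict.\<close>
 define ep where "ep = ep'/2"
 have ep: "ep > 0" "ep < ep'" using \<open>ep' > 0\<close> by (auto simp: ep_def)
 from h_continuous[OF ep(1), of ys x] obtain Us where Us: "ALL U:set Us. open U" "ys:lbox Us" "ALL zs:lbox Us. abs (h x zs-h x ys) < ep"
  by blast
 have len: "length Us = length ys" and yU: "!!i. i < length ys ==> ys!i:Us!i" using Us(2) by (auto simp: lbox_def)
 have "\<forall>\<^sub>F m in sequentially. ALL i:{..<length ys}. Bn m (ys!i) <= Us!i"
  using Us(1) len yU by (intro eventually_ball_finite ballI Bn_eventually) auto
 then obtain N where N: "!!m i. m >= N ==> i < length ys ==> Bn m (ys!i) <= Us!i"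
  unfolding eventually_sequentially by auto
 have "norm (measure (et x) (bx m ys)/measure (list_volume M) (bx m ys)-h x ys) < ep'" if m: "m >= N" for m
 proof -
  let ?e = "measure (et x) (bx m ys)" and ?w = "measure (list_volume M) (bx m ys)"
  have sub: "zs:lbox Us" if "zs:bx m ys" for zs
   using that N[OF m] len unfolding bx_def lbox_def by fastforce
  have E: "ennreal ?e = (NI (list_volume M) (%zs. ennreal (h x zs)*Ind (bx m ys) zs))"
  proof -
   have "ennreal ?e = em (et x) (bx m ys)"
    using finite_measure.emeasure_eq_measure[OF prob_space.finite_measure[OF prob_eta]] by simp
   also have "... = (NI (list_volume M) (%zs. ennreal (h x zs)*Ind (bx m ys) zs))"
    unfolding eta_density using h_borel bx_sets by (intro emeasure_density) (simp_all add: list_volume_eq meas_cong[OF sets_tuple_measure refl])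
   finally show ?thesis .
  qed
  have W: "(NI (list_volume M) (%zs. ennreal a*Ind (bx m ys) zs)) = ennreal (a*?w)" for a
   using bx_sets[of m ys] by (subst nn_integral_cmult_indicator) (simp_all add: list_volume_eq bx_volume(2)[unfolded list_volume_eq] ennreal_mult'')
  have "ennreal ?e <= ennreal ((h x ys+ep)*?w)"
   unfolding E W[symmetric]
  proof (intro nn_integral_mono)
   fix zs
   show "ennreal (h x zs)*Ind (bx m ys) zs <= ennreal (h x ys+ep)*Ind (bx m ys) zs"
    using sub[of zs] Us(3) by (cases "zs:bx m ys") (auto intro!: ennreal_leI simp: abs_less_iff dest!: bspec)
  qed
  hence u: "?e <= (h x ys+ep)*?w"
   using ennreal_le_iff[of "(h x ys+ep)*?w" ?e] h_nonneg[of x ys] ep(1) by simp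
  have "ennreal ((h x ys-ep)*?w) <= ennreal ?e"
   unfolding E W[symmetric]
  proof (intro nn_integral_mono)
   fix zs
   show "ennreal (h x ys-ep)*Ind (bx m ys) zs <= ennreal (h x zs)*Ind (bx m ys) zs"
    using sub[of zs] Us(3) by (cases "zs:bx m ys") (auto intro!: ennreal_leI simp: abs_less_iff dest!: bspec)
  qed
  hence l: "(h x ys-ep)*?w <= ?e" by (simp add: ennreal_le_iff)
  have w: "?w > 0" by (rule bx_volume)
  have "?e/?w <= h x ys+ep" "h x ys-ep <= ?e/?w"
   using u l w by (simp_all add: pos_divide_le_eq pos_le_divide_eq)
  thus ?thesis using ep by (simp add: abs_if)
 qed
 thus "EX no. ALL n>=no. norm (measure (et x) (bx n ys)/measure (list_volume M) (bx n ys)-h x ys) < ep'" by blast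
qed

lemma h_fixed_measurable: "(%x. h x ys):bm borel"
proof (rule borel_measurable_LIMSEQ_real[OF h_as_limit])
 fix m
 have "(%x. measure (et x) (bx m ys)):bm borel"
  unfolding measure_def by (intro borel_measurable_enn2real emeasure_eta bx_sets)
 thus "(%x. measure (et x) (bx m ys)/measure (list_volume M) (bx m ys)):bm borel" by simp
qed

text \<open>One point is chosen for each code. Passing from a tuple to its codes and back to the
  chosen points gives an approximation with countably many values.\<close>

definition code_rep :: "nat => bool list => 'x" where
 "code_rep n S = (SOME z. code n z = S)"

lemma code_code_rep: "code n (code_rep n (code n y)) = code n y"
 unfolding code_rep_def by (rule someI[of _ y]) (rule refl)

lemma code_rep_eventually:
 assumes "open U" "y:U"
 shows "\<forall>\<^sub>F n in sequentially. code_rep n (code n y):U"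
proof -
 obtain B where B: "B:base_sets" "y:B" "B <= U" using base_sets_exists[OF assms] by blast
 obtain k where k: "Ob k = B" unfolding Ob_def using from_nat_into_surj[OF base_sets(1) B(1)] by blast
 have "code_rep n (code n y):U" if n: "n > k" for n
 proof -
  have "code n (code_rep n (code n y))!k = code n y!k" unfolding code_code_rep ..
  hence "(code_rep n (code n y):Ob k) = (y:Ob k)" using n by (simp add: code_def)
  thus ?thesis using B k by blast
 qed
 thus ?thesis unfolding eventually_sequentially by (intro exI[of _ "Suc k"]) auto
qed

lemma code_borel: "{y. code n y = S}:sets borel"
proof (cases "length S = n")
 case True
 have "{y. code n y = S} = (\<Union>m. cell (m, S))"
 proof (rule set_eqI)
  fix y
  show "y:{y. code n y = S} \<longleftrightarrow> y:(\<Union>m. cell (m, S))"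
   using UN_piece[of y] True by (simp add: in_cell_iff)
 qed
 thus ?thesis using cell_borel by simp
next
 case False
 hence "{y. code n y = S} = {}" using length_code by blast
 thus ?thesis by simp
qed

lemma measurable_map_code: "map (code n):LB ->M Cnt UNIV"
proof -
 have "map (code n) -` {S} Int space LB:sets (LB :: 'x list measure)" for S
 proof -
  have "lbox (map (%s. {y. code n y = s}) S):sets LB"
   by (rule box_borel_sets) (simp add: code_borel)
  moreover have "lbox (map (%s. {y. code n y = s}) S) = map (code n) -` {S} Int space LB"
  proof (rule set_eqI)
   fix ys
   have "map (code n) ys = S \<longleftrightarrow> length ys = length S & (ALL i<length S. code n (ys!i) = S!i)"
    unfolding list_eq_iff_nth_eq by (simp cong: conj_cong)
   thus "ys:lbox (map (%s. {y. code n y = s}) S) \<longleftrightarrow> ys:map (code n) -` {S} Int space LB"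
    by (simp add: lbox_def cong: conj_cong)
  qed
  ultimately show ?thesis by simp
 qed
 thus ?thesis by (subst measurable_count_space_eq2_countable) auto
qed

text \<open>A function measurable in one variable and continuous in the other is jointly measurable:
  the second variable is replaced by approximations with countably many values.\<close>

lemma h_measurable: "(%p. h (fst p) (snd p)):bm (borel XM LB)"
proof (rule borel_measurable_LIMSEQ_real)
 fix n
 have "(%p. map (code n) (snd p)):borel XM LB ->M Cnt UNIV"
  by (rule meas_comp[OF measurable_snd measurable_map_code])
 from measurable_compose_countable[OF meas_comp[OF measurable_fst h_fixed_measurable] this]
 show "(%p. h (fst p) (map (code_rep n) (map (code n) (snd p)))):bm (borel XM LB)" .
next
 fix p
 show "(%n. h (fst p) (map (code_rep n) (map (code n) (snd p)))) \<longlonglongrightarrow> h (fst p) (snd p)"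
  by (rule h_LIMSEQ) (simp_all add: code_rep_eventually)
qed

lemma slot_mdiff:
 assumes i: "i < length ys"
 shows "mdiff (%y. h x (ys[i:=y])) (ys!i)"
proof -
 let ?F = "in_charts (map ch ys) (h x)" and ?as = "map (%y. snd (ch y) y) ys"
 obtain L where L: "list_has_deriv ?F L ?as" using h_differentiable unfolding list_differentiable_def by blast
 have "?F (?as[i:=b]) = ((%y. h x (ys[i:=y])) o cinv (ch (ys!i))) b" for b
 proof -
  have "map2 cinv (map ch ys) (?as[i:=b]) = ys[i:=cinv (ch (ys!i)) b]"
  proof (rule nth_equalityI)
   fix j assume "j < length (map2 cinv (map ch ys) (?as[i:=b]))"
   hence "j < length ys" by simp
   thus "map2 cinv (map ch ys) (?as[i:=b])!j = ys[i:=cinv (ch (ys!i)) b]!j"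
    by (cases "j = i") (simp_all add: chart_inv_eq[OF ch_atlas ch_dom])
  qed simp
  thus ?thesis by (simp add: in_charts_def)
 qed
 thus ?thesis
  using list_has_deriv_slot[OF L, of i] i unfolding mdiff_def differentiable_def o_def by auto
qed

definition slot_deriv :: "('x => real ^ 'n) => nat => 'x \<times> 'x list => real" where
 "slot_deriv v i p = (if i < length (snd p) then
   differential M (%y. h (fst p) ((snd p)[i:=y])) (snd p!i) (v (snd p!i)) else 0)"

lemma measurable_update:
 assumes ps: "ps:bm borel"
 shows "(%ys. ys[i:=ps (ys!i)]):LB ->M (LB :: 'x list measure)"
proof (rule measurable_list_borelI2)
 show "{w:space list_borel. length (w[i:=ps (w!i)]) = n}:sets LB" for n
  using list_borel_length[of n] by simp
 fix j and U :: "'x set" assume U: "open U"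
 show "{w:space list_borel. j < length (w[i:=ps (w!i)]) & w[i:=ps (w!i)]!j:U}:sets LB"
 proof (cases "j = i")
  case True
  have "ps -` U:sets borel" using measurable_sets[OF ps borel_open[OF U]] by simp
  from nth_borel_sets[OF this, of i] show ?thesis using True by (simp cong: conj_cong)
 next
  case False
  thus ?thesis using nth_borel_sets[OF borel_open[OF U], of j] by simp
 qed
qed

text \<open>The difference quotients along \<open>flow_step\<close> are Borel in centre and cluster
  jointly, and differentiability of \<open>h\<close> in each slot makes them converge.\<close>

lemma slot_deriv_measurable:
 assumes v: "v:Vect0 M"
 shows "slot_deriv v i:bm (borel XM LB)"
proof (rule borel_measurable_LIMSEQ_real)
 fix m
 let ?u = "%ys. ys[i:=flow_step v m (ys!i)]"
 have "(%p. (fst p, ?u (snd p))):borel XM LB ->M borel XM LB"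
  by (intro measurable_Pair measurable_fst meas_comp[OF measurable_snd measurable_update] measurable_flow_step v)
 from meas_comp[OF this h_measurable]
 show "(%p. (real m+1)*(h (fst p) (?u (snd p))-h (fst p) (snd p))):bm (borel XM LB)"
  using h_measurable by simp
next
 fix p
 show "(%m. (real m+1)*(h (fst p) ((snd p)[i:=flow_step v m (snd p!i)])-h (fst p) (snd p))) \<longlonglongrightarrow> slot_deriv v i p"
 proof (cases "i < length (snd p)")
  case True
  from flow_step_LIMSEQ[OF slot_mdiff[OF True, of "fst p"], of v] show ?thesis
   using True by (simp add: slot_deriv_def)
 next
  case False
  thus ?thesis by (simp add: slot_deriv_def list_update_beyond)
 qed
qed

lemma metric_beta:
 assumes i: "i < length ys"
 shows "metric M (ys!i) (beta M h x ys i) (v (ys!i)) = slot_deriv v i (x, ys)/h x ys"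
 unfolding beta_def metric_scale_left
 using grad_metric[OF differential_linear[OF slot_mdiff[OF i]]] i by (simp add: slot_deriv_def field_simps)

lemma borel_div: "v:Vect0 M ==> divergence M v:bm borel"
 by (rule borel_measurable_continuous_onI[OF continuous_divergence])

lemma measurable_beta_along:
 assumes v: "v:Vect0 M"
 shows "(%p. beta_along M h v (fst p) (snd p)):bm (borel XM LB)"
proof -
 have "(%p. \<Sum>i<n. slot_deriv v i p/h (fst p) (snd p)):bm (borel XM LB)" for n
  by (intro borel_measurable_sum borel_measurable_divide slot_deriv_measurable[OF v] h_measurable)
 from measurable_compose_countable[OF this meas_comp[OF measurable_snd measurable_length]]
 have "(%p. \<Sum>i<length (snd p). slot_deriv v i p/h (fst p) (snd p)):bm (borel XM LB)" .
 moreover have "(%p. \<Sum>i<length (snd p). divergence M v (snd p!i)):bm (borel XM LB)"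
  by (rule meas_comp[OF measurable_snd measurable_list_sum[OF borel_div[OF v]]])
 ultimately have "(%p. (\<Sum>i<length (snd p). slot_deriv v i p/h (fst p) (snd p))+(\<Sum>i<length (snd p). divergence M v (snd p!i)))
   : bm (borel XM LB)" by (rule borel_measurable_add)
 thus ?thesis unfolding beta_along_def by (simp add: metric_beta)
qed

text \<open>Cauchy-Schwarz in each tangent space; compact support lets a cluster contribute only
  when it meets the support of \<open>v\<close>. The two terms on the right are those made
  integrable by (A4) and (A2).\<close>

lemma beta_along_bound:
 assumes v: "v:Vect0 M"
 obtains C where "C >= 0" "!!x ys. abs (beta_along M h v x ys) <=
  C*(Ind (hits (supp v)) ys*beta_norm1 M h x ys+hitlen (supp v) ys)"
proof -
 obtain B where B: "B >= 0" "!!x. tangent_norm M x (v x) <= B*Ind (supp v) x" using tangent_norm_bounded[OF v] by blast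
 obtain B' where B': "B' >= 0" "!!x. abs (divergence M v x) <= B'*Ind (supp v) x" using divergence_bounded[OF v] by blast
 let ?I = "%ys. Ind (hits (supp v)) ys :: real"
 have I: "Ind (supp v) (ys!i) <= ?I ys" if "i < length ys" for ys i
  using that by (auto simp: indicator_def hits_iff)
 have tn: "0 <= tangent_norm M x u" for x u unfolding tangent_norm_def by (simp add: metric_nonneg)
 show thesis
 proof (rule that[of "max B B'"])
  show "max B B' >= 0" using B(1) by simp
  fix x ys
  have "abs (\<Sum>i<length ys. metric M (ys!i) (beta M h x ys i) (v (ys!i))) <=
   (\<Sum>i<length ys. tangent_norm M (ys!i) (beta M h x ys i)*(max B B'*?I ys))"
  proof (rule order_trans[OF sum_abs], rule sum_mono)
   fix i assume "i:{..<length ys}"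
   hence i: "i < length ys" by simp
   have "abs (metric M (ys!i) (beta M h x ys i) (v (ys!i))) <= tangent_norm M (ys!i) (beta M h x ys i)*tangent_norm M (ys!i) (v (ys!i))"
    by (rule metric_Cauchy_Schwarz)
   also have "tangent_norm M (ys!i) (v (ys!i)) <= max B B'*?I ys"
    using B(2)[of "ys!i"] mult_mono[OF max.cobounded1[of B B'] I[OF i]] B(1) by (simp add: le_max_iff_disj)
   finally show "abs (metric M (ys!i) (beta M h x ys i) (v (ys!i))) <= tangent_norm M (ys!i) (beta M h x ys i)*(max B B'*?I ys)"
    using tn by (simp add: mult_left_mono)
  qed
  also have "... = max B B'*(?I ys*beta_norm1 M h x ys)" unfolding beta_norm1_def sum_distrib_right[symmetric] by simp
  finally have 1: "abs (\<Sum>i<length ys. metric M (ys!i) (beta M h x ys i) (v (ys!i))) <= max B B'*(?I ys*beta_norm1 M h x ys)" .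
  have "abs (\<Sum>i<length ys. divergence M v (ys!i)) <= (\<Sum>i<length ys. max B B'*?I ys)"
  proof (rule order_trans[OF sum_abs], rule sum_mono)
   fix i assume "i:{..<length ys}"
   hence i: "i < length ys" by simp
   show "abs (divergence M v (ys!i)) <= max B B'*?I ys"
    using B'(2)[of "ys!i"] mult_mono[OF max.cobounded2[of B' B] I[OF i]] B'(1) by (simp add: le_max_iff_disj)
  qed
  hence 2: "abs (\<Sum>i<length ys. divergence M v (ys!i)) <= max B B'*(?I ys*real (length ys))" by (simp add: mult.commute mult.left_commute)
  show "abs (beta_along M h v x ys) <= max B B'*(?I ys*beta_norm1 M h x ys+?I ys*real (length ys))"
   unfolding beta_along_def distrib_left using 1 2 by linarith
 qed
qed

end

section \<open>Integration by parts in a single cluster\<close>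

text \<open>\<open>list_has_deriv\<close> compares only lists of one length, so derivatives and
  smoothness may be checked for each length separately.\<close>

lemma list_has_deriv_cong_length:
 assumes "!!bs. length bs = length as ==> F bs = G bs"
 shows "list_has_deriv F L as \<longleftrightarrow> list_has_deriv G L as"
proof -
 have "list_has_deriv G L as" if "list_has_deriv F L as" and "!!bs. length bs = length as ==> F bs = G bs" for F G
  by (rule list_has_deriv_cong_local[OF that(1) zero_less_one that(2)])
 from this[of F G] this[of G F] show ?thesis using assms by auto
qed

lemma list_iter_deriv_cong_length:
 assumes "!!bs. length bs = n ==> F bs = G bs" and "length as = n"
 shows "list_iter_deriv F ds as = list_iter_deriv G ds as"
 using assms(2)
proof (induction ds arbitrary: as)
 case Nil thus ?case using assms(1) by simp
next
 case (Cons d ds)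
 obtain i u where d: "d = (i, u)" by (cases d)
 have "list_has_deriv (list_iter_deriv F ds) L as \<longleftrightarrow> list_has_deriv (list_iter_deriv G ds) L as" for L
  by (rule list_has_deriv_cong_length) (use Cons in simp)
 thus ?case unfolding d by (simp add: list_grad_def)
qed

lemma list_smooth_on_cong_length:
 assumes eq: "!!bs. length bs = n ==> F bs = G bs" and S: "!!as. as:S ==> length as = n" and F: "list_smooth_on n S F"
 shows "list_smooth_on n S G"
 unfolding list_smooth_on_def
proof (intro allI impI ballI)
 fix ds :: "(nat \<times> 'a) list" and as assume ds: "fst ` set ds <= {..<n}" and as: "as:S"
 obtain L where L: "list_has_deriv (list_iter_deriv F ds) L as" using F ds as unfolding list_smooth_on_def by blast
 have "list_has_deriv (list_iter_deriv F ds) L as \<longleftrightarrow> list_has_deriv (list_iter_deriv G ds) L as"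
  by (rule list_has_deriv_cong_length, rule list_iter_deriv_cong_length[OF eq]) (use S[OF as] in simp_all)
 thus "EX L. list_has_deriv (list_iter_deriv G ds) L as" using L by blast
qed

lemma list_smooth_has_deriv:
 "list_smooth_on k {as. length as = k} f ==> length as = k ==> list_has_deriv f (list_grad f as) as"
 by (rule list_smooth_on_has_deriv) auto

lemma list_smooth_measurable:
 fixes a :: "nat => 'w => real"
 assumes f: "list_smooth_on k {as. length as = k} f" and a: "!!l. l < k ==> a l:bm N"
 shows "(%w. f (map (%l. a l w) [0..<k])):bm N"
proof -
 \<comment> \<open>Different lengths lie in different open components of
   \<open>list_topology\<close>, so the value 0 at other lengths leaves the function
   continuous.\<close>
 let ?f = "%as. if length as = k then f as else 0"
 have "?f:bm LB"
 proof (rule list_continuous_measurable)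
  fix as :: "real list" and ep :: real assume e: "ep > 0"
  show "EX Us. (ALL U:set Us. open U) & as:lbox Us & (ALL bs:lbox Us. abs (?f bs-?f as) < ep)"
  proof (cases "length as = k")
   case True
   obtain de where de: "de > 0" "!!bs. length bs = length as ==> ldist as bs < de ==> abs (f bs-f as) < ep"
    using list_has_deriv_continuous[OF list_smooth_has_deriv[OF f True] e] by blast
   let ?de = "de/(real (length as)+1)"
   have d: "0 < ?de" using de(1) by simp
   have "abs (?f bs-?f as) < ep" if bs: "bs:lbox (map (%y. ball y ?de) as)" for bs
   proof -
    have l: "length bs = length as" and b: "!!i. i < length as ==> norm (bs!i-as!i) < ?de"
     using bs by (auto simp: lbox_def dist_norm norm_minus_commute)
    have "ldist as bs <= (\<Sum>i<length as. ?de)"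
     unfolding ldist_def using b by (intro sum_mono) (simp add: less_imp_le)
    also have "... < de" using de(1) by (simp add: field_simps)
    finally show ?thesis using de(2)[OF l] l True by simp
   qed
   moreover have "as:lbox (map (%y. ball y ?de) as)" using d by (simp add: lbox_def)
   ultimately show ?thesis by (intro exI[of _ "map (%y. ball y ?de) as"] conjI ballI) auto
  next
   case False
   thus ?thesis using e
    by (intro exI[of _ "replicate (length as) UNIV"]) (auto simp: lbox_def)
  qed
 qed
 moreover have "(%w. map (%l. a l w) [0..<k]):N ->M LB"
 proof (rule measurable_list_borelI2)
  show "{w:space N. length (map (%l. a l w) [0..<k]) = n}:sets N" for n by (cases "n = k") auto
  fix i and U :: "real set" assume U: "open U"
  show "{w:space N. i < length (map (%l. a l w) [0..<k]) & map (%l. a l w) [0..<k]!i:U}:sets N"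
  proof (cases "i < k")
   case True
   have m: "a i -` U Int space N:sets N" by (rule measurable_sets[OF a[OF True] borel_open[OF U]])
   have eq: "a i -` U Int space N = {w:space N. i < length (map (%l. a l w) [0..<k]) & map (%l. a l w) [0..<k]!i:U}"
    using True by auto
   show ?thesis using m unfolding eq .
  qed simp
 qed
 ultimately have "(%w. ?f (map (%l. a l w) [0..<k])):bm N" by (rule meas_comp[rotated])
 thus ?thesis by simp
qed

lemma C1b_has_deriv: "C1b k f ==> length as = k ==> list_has_deriv f (list_grad f as) as"
 unfolding C1b_def by (auto intro: list_smooth_has_deriv)

lemma C1b_measurable:
 "C1b k f ==> (!!l. l < k ==> a l:bm N) ==> (%w. f (map (%l. a l w) [0..<k])):bm N"
 unfolding C1b_def by (auto intro: list_smooth_measurable)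

lemma C1b_grad_measurable:
 assumes f: "C1b k f" and l: "l < k" and a: "!!l. l < k ==> a l:bm N"
 shows "(%w. list_grad f (map (%l. a l w) [0..<k])!l):bm N"
 using list_smooth_measurable[OF list_smooth_on_list_iter_deriv[of k _ f "[(l, 1)]"] a] f l by (simp add: C1b_def)

section \<open>Cylinder functions of a single cluster\<close>

context riemann
begin

lemma differential_mult:
 assumes "mdiff f x" "mdiff g x"
 shows "mdiff (%y. f y*g y) x" "differential M (%y. f y*g y) x u = f x*differential M g x u+differential M f x u*g x"
proof -
 have "((%p. (f o cinv (ch x)) p*(g o cinv (ch x)) p) has_derivative
  (%u. (f o cinv (ch x)) (snd (ch x) x)*differential M g x u+differential M f x u*(g o cinv (ch x)) (snd (ch x) x)))
   (at (snd (ch x) x))"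
  by (rule has_derivative_mult[OF mdiff_has_derivative[OF assms(1)] mdiff_has_derivative[OF assms(2)]])
 hence D: "((%y. f y*g y) o cinv (ch x) has_derivative
   (%u. f x*differential M g x u+differential M f x u*g x)) (at (snd (ch x) x))"
  by (simp add: o_def chart_inv_eq[OF ch_atlas ch_dom])
 from differential_eqI[OF D] show "mdiff (%y. f y*g y) x"
  "differential M (%y. f y*g y) x u = f x*differential M g x u+differential M f x u*g x" by simp_all
qed

lemma differential_local:
 assumes U: "open U" "x:U" and eq: "!!y. y:U ==> f y = g y" and g: "mdiff g x"
 shows "mdiff f x" "differential M f x = differential M g x"
proof -
 have "((f o cinv (ch x)) has_derivative differential M g x) (at (snd (ch x) x))"
 proof (rule has_derivative_transform_within_open[OF mdiff_has_derivative[OF g] open_chart_image[OF ch_atlas U(1)]])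
  show "snd (ch x) x:snd (ch x) ` (dom (ch x) Int U)" using ch_dom U(2) by blast
  show "(g o cinv (ch x)) p = (f o cinv (ch x)) p" if "p:snd (ch x) ` (dom (ch x) Int U)" for p
   using that eq unfolding chart_image_eq[OF ch_atlas] by simp
 qed
 thus "mdiff f x" "differential M f x = differential M g x" by (rule differential_eqI)+
qed

lemma differential_const: "mdiff (%_. c) x" "differential M (%_. c) x u = 0"
proof -
 have D: "(((%_. c) o cinv (ch x)) has_derivative (%u. 0)) (at (snd (ch x) x))" by (simp add: o_def)
 from differential_eqI[OF D] show "mdiff (%_. c) x" "differential M (%_. c) x u = 0" by simp_all
qed

lemma differential_cylinder:
 assumes f: "C1b k f" and ph: "!!l. l < k ==> mdiff (ph l) x"
 shows "mdiff (%y. f (map (%l. c l+ph l y) [0..<k])) x"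
  "differential M (%y. f (map (%l. c l+ph l y) [0..<k])) x u =
   (\<Sum>l<k. list_grad f (map (%l. c l+ph l x) [0..<k])!l*differential M (ph l) x u)"
proof -
 let ?p = "snd (ch x) x"
 have "((%p. f (map (%l. c l+(ph l o cinv (ch x)) p) [0..<k])) has_derivative
   (%u. \<Sum>l<k. list_grad f (map (%l. c l+ph l x) [0..<k])!l*differential M (ph l) x u)) (at ?p)"
 proof (rule has_derivative_list_comp)
  show "list_has_deriv f (list_grad f (map (%l. c l+ph l x) [0..<k])) (map (%l. c l+(ph l o cinv (ch x)) ?p) [0..<k])"
   using C1b_has_deriv[OF f, of "map (%l. c l+ph l x) [0..<k]"] by (simp add: chart_inv_eq[OF ch_atlas ch_dom])
  fix l assume "l < k"
  from has_derivative_add[OF has_derivative_const mdiff_has_derivative[OF ph[OF this]]]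
  show "((%p. c l+(ph l o cinv (ch x)) p) has_derivative differential M (ph l) x) (at ?p)" by simp
 qed
 hence D: "((%y. f (map (%l. c l+ph l y) [0..<k])) o cinv (ch x) has_derivative
   (%u. \<Sum>l<k. list_grad f (map (%l. c l+ph l x) [0..<k])!l*differential M (ph l) x u)) (at ?p)"
  by (simp add: o_def)
 from differential_eqI[OF D] show "mdiff (%y. f (map (%l. c l+ph l y) [0..<k])) x"
  "differential M (%y. f (map (%l. c l+ph l y) [0..<k])) x u =
   (\<Sum>l<k. list_grad f (map (%l. c l+ph l x) [0..<k])!l*differential M (ph l) x u)" by simp_all
qed

definition tsum :: "('x => real) => 'x list => real" where
 "tsum g ys = (\<Sum>i<length ys. g (ys!i))"

lemma tsum_update:
 assumes "i < length ys"
 shows "tsum g (ys[i:=y]) = (tsum g ys-g (ys!i))+g y"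
proof -
 have "tsum g (ys[i:=y]) = g y+(\<Sum>j\<in>{..<length ys}-{i}. g (ys[i:=y]!j))"
  unfolding tsum_def using assms by (subst sum.remove[of _ i]) auto
 also have "(\<Sum>j\<in>{..<length ys}-{i}. g (ys[i:=y]!j)) = (\<Sum>j\<in>{..<length ys}-{i}. g (ys!j))"
  by (intro sum.cong) auto
 also have "tsum g ys = g (ys!i)+(\<Sum>j\<in>{..<length ys}-{i}. g (ys!j))"
  unfolding tsum_def using assms by (subst sum.remove[of _ i]) auto
 ultimately show ?thesis by simp
qed

lemma measurable_tsum: "g:bm borel ==> tsum g:bm LB"
 unfolding tsum_def[abs_def] by (rule measurable_list_sum)

lemma prod_update:
 assumes "i < length ys"
 shows "(\<Prod>j<length ys. g (ys[i:=y]!j) :: real) = (\<Prod>j\<in>{..<length ys}-{i}. g (ys!j))*g y"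
proof -
 have "(\<Prod>j<length ys. g (ys[i:=y]!j)) = g y*(\<Prod>j\<in>{..<length ys}-{i}. g (ys[i:=y]!j))"
  using assms by (subst prod.remove[of _ i]) auto
 also have "(\<Prod>j\<in>{..<length ys}-{i}. g (ys[i:=y]!j)) = (\<Prod>j\<in>{..<length ys}-{i}. g (ys!j))"
  by (intro prod.cong) auto
 finally show ?thesis by (simp add: mult.commute)
qed

text \<open>The constants \<open>c l\<close> stand for the contribution of all other clusters, which
  are frozen while this one varies.\<close>

definition cylfun :: "nat => (real list => real) => (nat => real) => (nat => 'x => real) => 'x list => real" where
 "cylfun k f c ph ys = f (map (%l. c l+tsum (ph l) ys) [0..<k])"

definition cylderiv :: "('x => real ^ 'n) => nat => (real list => real) => (nat => real) => (nat => 'x => real) => 'x list => real" where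
 "cylderiv v k f c ph ys = (\<Sum>l<k. list_grad f (map (%l. c l+tsum (ph l) ys) [0..<k])!l *
   tsum (Dv M (ph l) v) ys)"

text \<open>A compact set of tuples has bounded length as well as entries in a compact set, so the
  cut-off has to restrict both.\<close>

definition cutfun :: "nat => ('x => real) => 'x list => real" where
 "cutfun m ka ys = (if length ys <= m then \<Prod>i<length ys. ka (ys!i) else 0)"

text \<open>In a product of charts the function is built from smooth functions of single slots and
  so lies in \<open>list_alg\<close>; for more than \<open>m\<close> slots it is 0.\<close>

lemma cut_cyl_test_function:
 assumes f: "C1b k f" and ph: "!!l. l < k ==> ph l:test_functions M" and ka: "ka:test_functions M"
 shows "(%ys. cylfun k f c ph ys*cutfun m ka ys):list_test_functions M"
 unfolding list_test_functions_def mem_Collect_eq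
proof (intro conjI allI impI)
 fix cs :: "('x, 'n) chart list" assume cs: "set cs <= atlas M"
 let ?n = "length cs" and ?S = "%i. img (cs!i)"
 have csi: "cs!i:atlas M" if "i < ?n" for i using that cs by (meson nth_mem subsetD)
 define g where "g as = (if ?n <= m then f (map (%l. c l+(\<Sum>i<?n. (ph l o cinv (cs!i)) (as!i))) [0..<k])
   * (\<Prod>i<?n. (ka o cinv (cs!i)) (as!i)) else 0)" for as
 have "g:list_alg ?n ?S"
 proof (cases "?n <= m")
  case True
  have "(%as. f (map (%l. c l+(\<Sum>i<?n. (ph l o cinv (cs!i)) (as!i))) [0..<k])
   * (\<Prod>i<?n. (ka o cinv (cs!i)) (as!i))):list_alg ?n ?S"
  proof (intro list_alg.mult)
   show "(%as. f (map (%l. c l+(\<Sum>i<?n. (ph l o cinv (cs!i)) (as!i))) [0..<k])):list_alg ?n ?S"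
   proof (rule list_alg.comp[where ps = "%l as. c l+(\<Sum>i<?n. (ph l o cinv (cs!i)) (as!i))"])
    show "list_smooth_on k {rs. length rs = k} f" using f by (simp add: C1b_def)
    fix l assume l: "l < k"
    show "(%as. c l+(\<Sum>i<?n. (ph l o cinv (cs!i)) (as!i))):list_alg ?n ?S"
    proof (rule list_alg.add[OF list_alg.const list_alg_sum])
     fix i assume "i:{..<?n}"
     hence i: "i < ?n" by simp
     show "(%as. (ph l o cinv (cs!i)) (as!i)):list_alg ?n ?S"
      by (rule list_alg.slot[where g = "ph l o cinv (cs!i)"]) (rule i, rule test_function_smooth[OF ph[OF l] csi[OF i]])
    qed
   qed
   show "(%as. \<Prod>i<?n. (ka o cinv (cs!i)) (as!i)):list_alg ?n ?S"
   proof (rule list_alg_prod)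
    fix i assume "i:{..<?n}"
    hence i: "i < ?n" by simp
    show "(%as. (ka o cinv (cs!i)) (as!i)):list_alg ?n ?S"
     by (rule list_alg.slot[where g = "ka o cinv (cs!i)"]) (rule i, rule test_function_smooth[OF ka csi[OF i]])
   qed
  qed
  thus ?thesis unfolding g_def[abs_def] using True by simp
 next
  case False
  thus ?thesis unfolding g_def[abs_def] by (simp add: list_alg.const)
 qed
 from list_smooth_on_list_alg[OF open_img[OF csi] this]
 have "list_smooth_on ?n {as. length as = ?n & (ALL i<?n. as!i:?S i)} g" .
 hence "list_smooth_on ?n {as. length as = ?n & (ALL i<?n. as!i:?S i)} (in_charts cs (%ys. cylfun k f c ph ys*cutfun m ka ys))"
 proof (rule list_smooth_on_cong_length[rotated 2])
  fix bs :: "(real ^ 'n) list" assume bs: "length bs = ?n"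
  show "g bs = in_charts cs (%ys. cylfun k f c ph ys*cutfun m ka ys) bs"
   unfolding in_charts_def g_def cylfun_def cutfun_def tsum_def using bs by simp
 qed simp
 moreover have "{as. length as = ?n & (ALL i<?n. as!i:?S i)} = {as. list_all2 (%c a. a:img c) cs as}"
  unfolding list_all2_conv_all_nth by auto
 ultimately show "list_smooth_on ?n {as. list_all2 (%c a. a:img c) cs as} (in_charts cs (%ys. cylfun k f c ph ys*cutfun m ka ys))"
  by simp
next
 show "compactin list_topology (list_topology closure_of {ys. cylfun k f c ph ys*cutfun m ka ys ~= 0})"
 proof (rule compactin_closure_list_bounded[OF compact_supp_test[OF ka], of _ m], rule subsetI)
  fix ys assume "ys:{ys. cylfun k f c ph ys*cutfun m ka ys ~= 0}"
  hence "cutfun m ka ys ~= 0" by simp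
  hence l: "length ys <= m" and p: "(\<Prod>i<length ys. ka (ys!i)) ~= 0" by (auto simp: cutfun_def split: if_splits)
  have "ys!i:supp ka" if "i < length ys" for i
   using p that supp_outside[of "ys!i" ka] by auto
  thus "ys:{ys. length ys <= m & set ys <= supp ka}" using l by (auto simp: in_set_conv_nth)
 qed
qed

text \<open>The cut-off is constant near the support of \<open>v\<close>, so the derivative along
  \<open>v\<close> never falls on it and it passes through as a factor.\<close>

lemma hat_deriv_cut_cyl:
 assumes f: "C1b k f" and ph: "!!l. l < k ==> ph l:test_functions M" and ka: "ka:test_functions M"
  and W: "open W" "supp v <= W" "!!y. y:W ==> ka y = 1"
 shows "hat_deriv M v (%ys. cylfun k f c ph ys*cutfun m ka ys) ys = cutfun m ka ys*cylderiv v k f c ph ys"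
proof (cases "length ys <= m")
 case False
 thus ?thesis by (simp add: hat_deriv_def cutfun_def differential_const(2))
next
 case True
 let ?as = "map (%l. c l+tsum (ph l) ys) [0..<k]"
 have ka0: "differential M ka y (v y) = 0" for y
 proof (cases "y:supp v")
  case True
  hence "differential M ka y = differential M (%_. 1) y"
   using W by (intro differential_local(2)[OF W(1) _ _ differential_const(1)]) auto
  thus ?thesis by (simp add: differential_const(2))
 next
  case False
  thus ?thesis using supp_outside[OF False] differential_zero[OF test_function_mdiff[OF ka]] by simp
 qed
 have "differential M (%y. cylfun k f c ph (ys[i:=y])*cutfun m ka (ys[i:=y])) (ys!i) (v (ys!i))
   = cutfun m ka ys*(\<Sum>l<k. list_grad f ?as!l*differential M (ph l) (ys!i) (v (ys!i)))" if i: "i < length ys" for i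
 proof -
  define R where "R = (\<Prod>j\<in>{..<length ys}-{i}. ka (ys!j))"
  define c' where "c' l = c l+(tsum (ph l) ys-ph l (ys!i))" for l
  let ?A = "%y. f (map (%l. c' l+ph l y) [0..<k])"
  have eA: "cylfun k f c ph (ys[i:=y]) = ?A y" for y
   unfolding cylfun_def tsum_update[OF i] c'_def by (simp add: add.assoc)
  have eC: "cutfun m ka (ys[i:=y]) = R * ka y" for y
   unfolding cutfun_def R_def using prod_update[OF i, of ka y] True by simp
  have as: "map (%l. c' l+ph l (ys!i)) [0..<k] = ?as" by (simp add: c'_def)
  have dA: "mdiff ?A (ys!i)" "differential M ?A (ys!i) u = (\<Sum>l<k. list_grad f ?as!l*differential M (ph l) (ys!i) u)" for u
   using differential_cylinder[OF f, of ph "ys!i" c'] test_function_mdiff[OF ph] unfolding as by auto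
  note d1 = differential_mult[OF differential_const(1)[of R "ys!i"] test_function_mdiff[OF ka, of "ys!i"]]
  note d2 = differential_mult(2)[OF dA(1) d1(1), of "v (ys!i)"]
  have "cutfun m ka ys = R * ka (ys!i)" using eC[of "ys!i"] by simp
  thus ?thesis unfolding eA eC d2 d1(2) differential_const(2) dA(2) ka0 by (simp add: mult.commute)
 qed
 hence "hat_deriv M v (%ys. cylfun k f c ph ys*cutfun m ka ys) ys =
   (\<Sum>i<length ys. cutfun m ka ys*(\<Sum>l<k. list_grad f ?as!l*differential M (ph l) (ys!i) (v (ys!i))))"
  unfolding hat_deriv_def by (intro sum.cong) auto
 also have "... = cutfun m ka ys*cylderiv v k f c ph ys"
  unfolding cylderiv_def tsum_def sum_distrib_left by (subst sum.swap) (simp add: mult.assoc)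
 finally show ?thesis .
qed

lemma borel_test: "ph:test_functions M ==> ph:bm borel"
 by (rule borel_measurable_continuous_onI[OF continuous_test_function])

lemma borel_diff_field: "ph:test_functions M ==> v:Vect0 M ==> (%y. differential M ph y (v y)):bm borel"
 by (rule borel_measurable_continuous_onI[OF continuous_differential_field])

lemma borel_supp: "supp g:sets borel"
 unfolding supp_def by simp

lemma tsum_bound:
 assumes "!!y. abs (g y) <= B*Ind C y" "B >= 0"
 shows "abs (tsum g ys) <= B*(Ind (hits C) ys*real (length ys))"
proof -
 have "abs (tsum g ys) <= (\<Sum>i<length ys. B*Ind (hits C) ys)"
  unfolding tsum_def
 proof (rule order_trans[OF sum_abs], rule sum_mono)
  fix i assume i: "i:{..<length ys}"
  have "abs (g (ys!i)) <= B*Ind C (ys!i)" by (rule assms)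
  also have "... <= B*Ind (hits C) ys"
   using i assms(2) by (intro mult_left_mono) (auto simp: indicator_def hits_iff)
  finally show "abs (g (ys!i)) <= B*Ind (hits C) ys" .
 qed
 thus ?thesis by (simp add: mult.commute mult.left_commute)
qed

lemma grad_cyl_bound:
 assumes f: "C1b k f" and ph: "!!l. l < k ==> ph l:test_functions M" and v: "v:Vect0 M"
 shows "EX C>=0. ALL as ys. length as = k -->
   abs (\<Sum>l<k. list_grad f as!l*tsum (Dv M (ph l) v) ys) <= C*(hitlen (supp v) ys)"
proof -
 have "ALL l. EX C. l < k --> C >= 0 & (ALL as ys. length as = k -->
   abs (list_grad f as!l*tsum (Dv M (ph l) v) ys) <= C*(hitlen (supp v) ys))"
 proof
  fix l
  show "EX C. l < k --> C >= 0 & (ALL as ys. length as = k -->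
   abs (list_grad f as!l*tsum (Dv M (ph l) v) ys) <= C*(hitlen (supp v) ys))"
  proof (cases "l < k")
   case True
   obtain B where B: "B >= 0" "!!y. abs (differential M (ph l) y (v y)) <= B*Ind (supp v) y"
    using differential_bounded[OF ph[OF True] v] by blast
   obtain C where C: "!!as. length as = k ==> abs (list_grad f as!l) <= C"
    using C1b_grad_bounded[OF f True] by blast
   have C0: "C >= 0" using C[of "replicate k 0"] by simp
   have "abs (list_grad f as!l*tsum (Dv M (ph l) v) ys) <= C*(B*(hitlen (supp v) ys))"
    if "length as = k" for as ys
    unfolding abs_mult by (intro mult_mono C that tsum_bound B C0) simp_all
   thus ?thesis using C0 B(1) by (intro exI[of _ "C*B"]) (simp add: mult.assoc)
  qed simp
 qed
 from choice[OF this] obtain C where C: "!!l. l < k ==> C l >= 0" "!!l as ys. l < k ==> length as = k ==>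
   abs (list_grad f as!l*tsum (Dv M (ph l) v) ys) <= C l*(hitlen (supp v) ys)"
  by blast
 show ?thesis
 proof (intro exI[of _ "\<Sum>l<k. C l"] conjI allI impI)
  show "0 <= (\<Sum>l<k. C l)" using C(1) by (intro sum_nonneg) simp
  fix as :: "real list" and ys :: "'x list" assume "length as = k"
  hence "abs (\<Sum>l<k. list_grad f as!l*tsum (Dv M (ph l) v) ys) <=
   (\<Sum>l<k. C l*(hitlen (supp v) ys))"
   using C(2) by (intro order_trans[OF sum_abs] sum_mono) simp
  thus "abs (\<Sum>l<k. list_grad f as!l*tsum (Dv M (ph l) v) ys) <=
   (\<Sum>l<k. C l)*(hitlen (supp v) ys)" by (simp add: sum_distrib_right)
 qed
qed

end

locale cluster_ibp = cluster_density M K et h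
 for M :: "('x::{t2_space,second_countable_topology}, 'n::finite) riemannian"
  and K :: "nat => 'x set" and et :: "'x => 'x list measure" and h +
 assumes ibp: "w:Vect0 M ==> f:list_test_functions M ==>
  integrable (et x) (%ys. f ys*beta_along M h w x ys) &
  (LI (et x) (%ys. hat_deriv M w f ys)) = - (LI (et x) (%ys. f ys*beta_along M h w x ys))"
begin

lemma measurable_eta_iff: "g:bm (et x) \<longleftrightarrow> g:bm LB"
 by (simp cong: meas_cong)

lemma beta_borel: "v:Vect0 M ==> (%ys. beta_along M h v x ys):bm LB"
 using meas_comp[OF measurable_Pair1' measurable_beta_along, of x] by simp

text \<open>The integrability premises hold for the centres of almost every configuration, by
  \<open>AE_good_center\<close>; they supply the majorants for removing the cut-off.\<close>

lemma cluster_ibp_formula: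
 assumes f: "C1b k f" and ph: "!!l. l < k ==> ph l:test_functions M" and v: "v:Vect0 M"
  and be: "integrable (et x) (beta_along M h v x)"
  and len: "integrable (et x) (%ys. hitlen (supp v) ys)"
 shows "integrable (et x) (cylderiv v k f c ph)"
  "integrable (et x) (%ys. cylfun k f c ph ys*beta_along M h v x ys)"
  "(LI (et x) (%ys. cylderiv v k f c ph ys)) = - (LI (et x) (%ys. cylfun k f c ph ys*beta_along M h v x ys))"
proof -
 let ?A = "cylfun k f c ph" and ?D = "cylderiv v k f c ph" and ?b = "beta_along M h v x"
 let ?I = "%ys. hitlen (supp v) ys"
 have ms: "(%ys. c l+tsum (ph l) ys):bm LB" if "l < k" for l
  by (intro borel_measurable_add borel_measurable_const measurable_tsum borel_test ph that)
 have mA: "?A:bm LB" unfolding cylfun_def[abs_def] by (rule C1b_measurable[OF f ms])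
 have mD: "?D:bm LB"
  unfolding cylderiv_def[abs_def]
 proof (intro borel_measurable_sum borel_measurable_times)
  fix l assume "l:{..<k}"
  hence l: "l < k" by simp
  show "(%ys. list_grad f (map (%l. c l+tsum (ph l) ys) [0..<k])!l):bm LB"
   by (rule C1b_grad_measurable[OF f l ms])
  show "tsum (Dv M (ph l) v):bm LB"
   by (rule measurable_tsum[OF borel_diff_field[OF ph[OF l] v]])
 qed
 obtain C where C0: "C >= 0" "ALL as ys. length as = k -->
   abs (\<Sum>l<k. list_grad f as!l*tsum (Dv M (ph l) v) ys) <= C*(hitlen (supp v) ys)"
 proof -
  have "EX C>=0. ALL as ys. length as = k -->
   abs (\<Sum>l<k. list_grad f as!l*tsum (Dv M (ph l) v) ys) <= C*(hitlen (supp v) ys)"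
   by (rule grad_cyl_bound[OF f _ v]) (rule ph)
  thus thesis by (elim exE conjE) (rule that)
 qed
 note C = C0(1) C0(2)[rule_format]
 have Db: "abs (?D ys) <= C*?I ys" for ys unfolding cylderiv_def by (rule C(2)) simp
 obtain B where B: "!!as. length as = k ==> abs (f as) <= B" using C1b_bounded[OF f] by blast
 have Ab: "abs (?A ys) <= B" for ys unfolding cylfun_def by (rule B) simp
 have B0: "B >= 0" using Ab[of "[]"] by linarith
 have mb: "?b:bm LB" by (rule beta_borel[OF v])
 \<comment> \<open>Containing the support of \<open>v\<close> makes the cut-off constant near it;
   containing the sets of the exhaustion makes the cut-offs tend to 1 at each tuple.\<close>
 define Cm where "Cm m = supp v Un (\<Union>j\<le>m. K j)" for m
 have cCm: "compact (Cm m)" for m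
  unfolding Cm_def by (intro compact_Un cpt_supp[OF v] compact_UN compact_K) simp_all
 have "ALL m. EX ka. ka:test_functions M & (ALL y. 0 <= ka y) & (ALL y. ka y <= 1) & (EX W. open W & Cm m <= W & (ALL y:W. ka y = 1))"
 proof
  fix m
  obtain ka W where "ka:test_functions M" "!!y. 0 <= ka y" "!!y. ka y <= 1" "open W" "Cm m <= W" "!!y. y:W ==> ka y = 1"
   using cutoff_exists[OF cCm, of m] by blast
  thus "EX ka. ka:test_functions M & (ALL y. 0 <= ka y) & (ALL y. ka y <= 1) & (EX W. open W & Cm m <= W & (ALL y:W. ka y = 1))"
   by (intro exI[of _ ka] conjI exI[of _ W]) auto
 qed
 from choice[OF this] obtain ka where ka: "!!m. ka m:test_functions M" "!!m y. 0 <= ka m y" "!!m y. ka m y <= 1"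
  "!!m. EX W. open W & Cm m <= W & (ALL y:W. ka m y = 1)" by blast
 let ?q = "%m. cutfun m (ka m)"
 have q01: "0 <= ?q m ys" "?q m ys <= 1" for m ys
  unfolding cutfun_def using ka(2,3) by (auto intro!: prod_nonneg prod_le_1)
 have qlim: "(%m. ?q m ys) \<longlonglongrightarrow> 1" for ys
 proof -
  obtain j where j: "set ys <= K j" using cover_K[OF finite_imp_compact[of "set ys"]] by auto
  have "?q m ys = 1" if m: "m >= max j (length ys)" for m
  proof -
   obtain W where W: "Cm m <= W" "ALL y:W. ka m y = 1" using ka(4)[of m] by blast
   have "K j <= Cm m" unfolding Cm_def using m by auto
   hence "ka m (ys!i) = 1" if "i < length ys" for i using W j that nth_mem by blast
   thus ?thesis using m by (simp add: cutfun_def)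
  qed
  hence "\<forall>\<^sub>F m in sequentially. ?q m ys = 1" unfolding eventually_sequentially by blast
  thus ?thesis by (rule tendsto_eventually)
 qed
 have mq: "?q m:bm LB" for m
 proof -
  have "(%ys. \<Prod>i<n. if i < length ys then ka m (ys!i) else 1):bm LB" for n
  proof (intro borel_measurable_prod)
   fix i
   have "(%ys. if i < length ys then ka m (if i < length ys then ys!i else undefined) else 1):bm LB"
    by (intro measurable_If meas_comp[OF measurable_nth_default borel_test[OF ka(1)]] borel_measurable_const)
      (simp_all add: borel_of_openin[OF openin_length_less])
   thus "(%ys. if i < length ys then ka m (ys!i) else 1):bm LB"
    by (simp cong: if_cong)
  qed
  from measurable_compose_countable[OF this measurable_length]
  have "(%ys. \<Prod>i<length ys. if i < length ys then ka m (ys!i) else 1):bm LB" .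
  hence "(%ys. \<Prod>i<length ys. ka m (ys!i)):bm LB" by simp
  thus ?thesis unfolding cutfun_def[abs_def]
   by (intro measurable_If borel_measurable_const) (simp_all add: borel_of_openin[OF openin_length_le])
 qed
 have ID: "integrable (et x) (%ys. C*?I ys)" using len by simp
 have Ib: "integrable (et x) (%ys. B*abs (?b ys))" using be by simp
 have L1: "(%m. \<integral>ys. ?q m ys*?D ys \<partial>et x) \<longlonglongrightarrow> (LI (et x) (%ys. ?D ys))"
 proof (rule integral_dominated_convergence[OF _ _ ID])
  show "AE ys in et x. (%m. ?q m ys*?D ys) \<longlonglongrightarrow> ?D ys"
   using tendsto_mult[OF qlim tendsto_const] by (intro AE_I2) force
  show "AE ys in et x. norm (?q m ys*?D ys) <= C*?I ys" for m
  proof (rule AE_I2)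
   fix ys
   have "norm (?q m ys*?D ys) <= 1*abs (?D ys)" unfolding norm_mult using q01 by (intro mult_mono) simp_all
   thus "norm (?q m ys*?D ys) <= C*?I ys" using Db[of ys] by linarith
  qed
 qed (use mD mq in \<open>simp_all add: measurable_eta_iff\<close>)
 have L2: "(%m. \<integral>ys. ?A ys*?q m ys*?b ys \<partial>et x) \<longlonglongrightarrow> (LI (et x) (%ys. ?A ys*?b ys))"
 proof (rule integral_dominated_convergence[OF _ _ Ib])
  show "AE ys in et x. (%m. ?A ys*?q m ys*?b ys) \<longlonglongrightarrow> ?A ys*?b ys"
   using tendsto_mult[OF tendsto_mult[OF tendsto_const qlim] tendsto_const] by (intro AE_I2) force
  show "AE ys in et x. norm (?A ys*?q m ys*?b ys) <= B*abs (?b ys)" for m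
  proof (rule AE_I2)
   fix ys
   have "norm (?A ys*?q m ys*?b ys) <= B*1*abs (?b ys)"
    unfolding norm_mult using q01 Ab B0 by (intro mult_mono) simp_all
   thus "norm (?A ys*?q m ys*?b ys) <= B*abs (?b ys)" by simp
  qed
 qed (use mA mb mq in \<open>simp_all add: measurable_eta_iff\<close>)
 \<comment> \<open>(A3) for the truncated function, whose derivative along \<open>v\<close> is the
   truncated derivative.\<close>
 have eq: "(LI (et x) (%ys. ?q m ys*?D ys)) = - (LI (et x) (%ys. ?A ys*?q m ys*?b ys))" for m
 proof -
  obtain W where W: "open W" "Cm m <= W" "ALL y:W. ka m y = 1" using ka(4)[of m] by blast
  have "hat_deriv M v (%ys. ?A ys*?q m ys) ys = ?q m ys*?D ys" for ys
   by (rule hat_deriv_cut_cyl[OF f _ ka(1) W(1)]) (use W ph in \<open>auto simp: Cm_def\<close>)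
  moreover have "(%ys. ?A ys*?q m ys):list_test_functions M"
   by (rule cut_cyl_test_function[OF f _ ka(1)]) (rule ph)
  ultimately show ?thesis using ibp[OF v, of "%ys. ?A ys*?q m ys" x] by simp
 qed
 show "integrable (et x) ?D"
  using Db by (intro integrable_boundB[OF ID]) (auto simp: measurable_eta_iff mD abs_of_nonneg C(1))
 show "integrable (et x) (%ys. ?A ys*?b ys)"
 proof (rule integrable_boundB[OF Ib])
  show "AE ys in et x. norm (?A ys*?b ys) <= norm (B*abs (?b ys))"
   using Ab B0 by (intro AE_I2) (simp add: abs_mult mult_right_mono)
 qed (use mA mb in \<open>simp add: measurable_eta_iff\<close>)
 show "(LI (et x) (%ys. ?D ys)) = - (LI (et x) (%ys. ?A ys*?b ys))"
  by (rule LIMSEQ_unique[OF L1]) (unfold eq, rule tendsto_minus[OF L2])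
qed

end

section \<open>Summation over the clusters\<close>

lemma enn2real_inj: "a < top ==> b < top ==> enn2real a = enn2real b ==> a = b"
 by (metis ennreal_enn2real)

locale cluster_setting = cluster_ibp M K et h + cluster_process K et mu
 for M :: "('x::{t2_space,second_countable_topology}, 'n::finite) riemannian"
  and K :: "nat => 'x set" and et :: "'x => 'x list measure" and h and mu :: "'x measure measure" +
 fixes th :: "'x measure"
 assumes sets_theta: "sets th = sets borel"
  and theta_M1: "mu:M1 th"
  and hits_finite: "compact B ==> (NI th (%x. em (et x) (hits B))) < \<infinity>"
  and length_finite: "compact B ==> (NI th (%x. (\<integral>\<^sup>+ys\<in>hits B. of_nat (length ys) \<partial>et x))) < \<infinity>"
  and beta_integrable: "compact B ==> set_integrable (sigma_hat et th) (UNIV \<times> hits B) (%(x, ys). beta_norm1 M h x ys)"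
begin

abbreviation ZB :: "('x \<times> 'x list) measure" where "ZB \<equiv> borel XM LB"

lemma space_theta: "space th = UNIV"
 using sets_eq_imp_space_eq[OF sets_theta] by simp

lemma pair_eta_kernel: "(%x. distr (et x) ZB (Pair x)):th ->M subprob_algebra ZB"
proof -
 have "(%x. distr (et x) ZB (Pair x)):borel ->M prob_algebra ZB"
  by (intro measurable_distr_prob_space2[OF eta_measurable]) simp
 thus ?thesis using measurable_prob_algebraD meas_cong[OF sets_theta refl] by blast
qed

lemma Pair_eta: "Pair x:et x ->M ZB"
 using measurable_Pair1'[of x borel LB] by (simp cong: meas_cong)

text \<open>\<open>sigma_hat\<close> is given by a set function only. Recognizing it as the
  composition of \<open>th\<close> with a kernel shows that it takes these values, and yields the
  iterated integral.\<close>

lemma sigma_hat_eq: "sigma_hat et th = th \<bind> (%x. distr (et x) ZB (Pair x))"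
proof -
 let ?ta = "th \<bind> (%x. distr (et x) ZB (Pair x))"
 have s: "sets ?ta = sets ZB" by (rule sets_bind) (simp_all add: space_theta)
 have sp: "space ?ta = UNIV" using sets_eq_imp_space_eq[OF s] by (simp add: space_pair_measure)
 have e: "em ?ta C = (NI th (%x. em (et x) {ys. (x, ys):C}))" if C: "C:sets ZB" for C
 proof -
  have "em ?ta C = (NI th (%x. em (distr (et x) ZB (Pair x)) C))"
   by (rule emeasure_bind[OF _ pair_eta_kernel C]) (simp add: space_theta)
  also have "... = (NI th (%x. em (et x) {ys. (x, ys):C}))"
   using C by (intro nn_integral_cong) (simp add: emeasure_distr[OF Pair_eta] vimage_def)
  finally show ?thesis .
 qed
 have "sigma_hat et th = measure_of UNIV (sets ?ta) (em ?ta)"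
  unfolding sigma_hat_def s sets_Z
 proof (rule measure_of_eq)
  show "sets ZB <= Pow UNIV" by simp
  fix C :: "('x \<times> 'x list) set" assume "C:sigma_sets UNIV (sets ZB)"
  hence "C:sets ZB" using sets.sigma_sets_eq[of ZB] by (simp add: space_pair_measure)
  thus "(NI th (%x. em (et x) {ys. (x, ys):C})) = em ?ta C" by (simp add: e)
 qed
 also have "... = ?ta" using measure_of_of_measure[of ?ta] sp by simp
 finally show ?thesis .
qed

lemma sets_sigma_hat: "sets (sigma_hat et th) = sets ZB"
 unfolding sigma_hat_eq by (rule sets_bind) (simp_all add: space_theta)

lemma nn_integral_sigma_hat:
 assumes u: "u:bm ZB"
 shows "(NI (sigma_hat et th) u) = (NI th (%x. (NI (et x) (%ys. u (x, ys)))))"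
 unfolding sigma_hat_eq nn_integral_bind[OF u pair_eta_kernel]
 by (intro nn_integral_cong nn_integral_distr Pair_eta) (use u in simp)

lemma inner_measurable:
 assumes u: "u:bm ZB"
 shows "(%x. \<integral>\<^sup>+ys. u (x, ys) \<partial>et x):bm borel"
 by (rule nn_integral_measurable_subprob_algebra2[OF _ measurable_prob_algebraD[OF eta_measurable]]) (use u in simp)

section \<open>Consequences of (A1)\<close>

lemma M1_D:
 fixes g :: "'x => real"
 assumes "integrable th g"
 shows "AE ga in mu. g summable_on points ga" "integrable mu (%ga. abs (pairing g ga))"
  "integrable th g' ==> AE x in th. g x = g' x ==> AE ga in mu. pairing g ga = pairing g' ga"
 using theta_M1 assms unfolding M1_def by blast+

text \<open>The indicator of a null set represents the class of 0, so by the last clause of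
  \<open>M1\<close> its pairing is almost surely 0. A vanishing sum of nonnegative terms has only
  zero terms, hence no point lies in \<open>N\<close>.\<close>

lemma M1_null:
 assumes N: "N:sets borel" "em th N = 0"
 shows "AE ga in mu. points ga Int N = {}"
proof -
 let ?f = "Ind N :: 'x => real"
 have i: "integrable th ?f" using N by (simp add: sets_theta)
 have "AE x in th. x ~: N" using N by (intro AE_not_in null_setsI) (simp_all add: sets_theta)
 hence "AE x in th. ?f x = 0" by eventually_elim simp
 from M1_D(3)[OF i _ this] have "AE ga in mu. pairing ?f ga = pairing (%_. 0) ga" by simp
 with M1_D(1)[OF i] show ?thesis
 proof eventually_elim
  case (elim ga)
  have int: "integrable (Cnt (points ga)) ?f" using elim(1) by (simp add: summable_on_real_iff_integrable)
  have "(LI (Cnt (points ga)) (%x. ?f x)) = 0"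
   using elim(2) unfolding pairing_def infsum_real_eq_integral by simp
  hence "AE x in Cnt (points ga). ?f x = 0"
   using integral_nonneg_eq_0_iff_AE[OF int] by simp
  thus ?case by (auto simp: AE_count_space indicator_def split: if_splits)
 qed
qed

text \<open>(A1) concerns real functions, whereas \<open>G\<close> may be infinite. The set where it
  is infinite is null and is avoided by almost every configuration; elsewhere \<open>G\<close>
  agrees with an integrable real function.\<close>

lemma M1_finite:
 assumes G: "G:bm borel" "(NI th (%x. G x)) < \<infinity>"
 shows "(NI mu (%ga. (NI (Cnt (points ga)) (%x. G x)))) < \<infinity>"
proof -
 let ?g = "%x. enn2real (G x)"
 have Gm: "G:bm th" using G(1) by (simp add: meas_cong[OF sets_theta refl])
 have NS: "{x. G x = \<infinity>}:sets borel" using measurable_sets[OF G(1), of "{\<infinity>}"] by (simp add: vimage_def)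
 have "AE x in th. G x ~= \<infinity>" using nn_integral_PInf_AE[OF Gm] G(2) by simp
 hence "em th {x. G x = \<infinity>} = 0"
  by (rule AE_iff_measurable[THEN iffD1, rotated 2]) (use NS in \<open>simp_all add: sets_theta space_theta\<close>)
 from M1_null[OF NS this] have av: "AE ga in mu. points ga Int {x. G x = \<infinity>} = {}" .
 have gi: "integrable th ?g"
 proof (rule integrableI_nonneg)
  show "?g:bm th" using Gm by simp
  have "(NI th (%x. ennreal (?g x))) <= (NI th (%x. G x))"
   by (intro nn_integral_mono) (metis ennreal_enn2real_if infinity_ennreal_def order_refl top_greatest zero_le)
  thus "(NI th (%x. ennreal (?g x))) < \<infinity>" using G(2) by (rule order.strict_trans1)
 qed simp
 have "(NI mu (%ga. (NI (Cnt (points ga)) (%x. G x)))) = (NI mu (%ga. ennreal (abs (pairing ?g ga))))"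
 proof (rule nn_integral_cong_AE)
  show "AE ga in mu. (NI (Cnt (points ga)) (%x. G x)) = ennreal (abs (pairing ?g ga))"
   using av M1_D(1)[OF gi]
  proof eventually_elim
   case (elim ga)
   have int: "integrable (Cnt (points ga)) ?g" using elim(2) by (simp add: summable_on_real_iff_integrable)
   have "(NI (Cnt (points ga)) (%x. G x)) = (NI (Cnt (points ga)) (%x. ennreal (?g x)))"
    using elim(1) by (intro nn_integral_cong) (auto simp: less_top[symmetric] ennreal_enn2real_if)
   also have "... = ennreal (pairing ?g ga)"
    unfolding pairing_def infsum_real_eq_integral by (rule nn_integral_eq_integral[OF int]) simp
   also have "pairing ?g ga = abs (pairing ?g ga)"
    unfolding pairing_def infsum_real_eq_integral by (simp add: Bochner_Integration.integral_nonneg)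
   finally show ?case .
  qed
 qed
 also have "... < \<infinity>" using M1_D(2)[OF gi] unfolding integrable_iff_bounded by simp
 finally show ?thesis .
qed

lemma campbell_finite:
 assumes u: "u:bm ZB" and fin: "(NI th (%x. (NI (et x) (%ys. u (x, ys))))) < \<infinity>"
 shows "(NI P (%p. (\<Sum>n. if val n (fst p) then u (pt n (fst p), snd p n) else 0))) < \<infinity>"
 unfolding nn_integral_P_sum[OF u] by (rule M1_finite[OF inner_measurable[OF u] fin])

text \<open>Up to constants this bounds all that one cluster contributes to the identity: the
  logarithmic derivative and the derivative of a cylinder function along \<open>v\<close>.\<close>

definition majorant :: "('x => real ^ 'n) => 'x \<times> 'x list => real" where
 "majorant v z = abs (beta_along M h v (fst z) (snd z))+Ind (hits (supp v)) (snd z)*real (length (snd z))"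

lemma majorant_nonneg: "0 <= majorant v z"
 by (simp add: majorant_def)

lemma hits_length_measurable:
 assumes "B:sets borel"
 shows "(%ys. Ind (hits B) ys*real (length ys)):bm (LB :: 'x list measure)"
 using hits_sets[OF assms] by (intro borel_measurable_times borel_measurable_indicator meas_comp[OF measurable_length]) simp_all

lemma majorant_measurable: "v:Vect0 M ==> majorant v:bm ZB"
 unfolding majorant_def[abs_def]
 by (intro borel_measurable_add borel_measurable_abs measurable_beta_along meas_comp[OF measurable_snd hits_length_measurable] borel_supp)

lemma majorant_finite:
 assumes v: "v:Vect0 M"
 shows "(NI th (%x. (NI (et x) (%ys. ennreal (majorant v (x, ys)))))) < \<infinity>"
proof -
 let ?B = "supp v"
 obtain C where C: "C >= 0" "!!x ys. abs (beta_along M h v x ys) <=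
  C*(Ind (hits ?B) ys*beta_norm1 M h x ys+Ind (hits ?B) ys*real (length ys))"
  using beta_along_bound[OF v] by blast
 let ?b = "%z. Ind (UNIV \<times> hits ?B) z *R (case z of (x, ys) => beta_norm1 M h x ys) :: real"
 let ?l = "%z. Ind (hits ?B) (snd z)*real (length (snd z)) :: real"
 have i: "integrable (sigma_hat et th) ?b"
  using beta_integrable[OF cpt_supp[OF v]] unfolding set_integrable_def .
 hence bm: "?b:bm ZB" using meas_cong[OF sets_sigma_hat refl] borel_measurable_integrable by blast
 have lm: "?l:bm ZB"
  by (intro meas_comp[OF measurable_snd hits_length_measurable] borel_supp)
 have sm: "g:bm (sigma_hat et th)" if "g:bm ZB" for g :: "'x \<times> 'x list => ennreal"
  using that meas_cong[OF sets_sigma_hat refl] by blast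
 have "(NI th (%x. (NI (et x) (%ys. ennreal (majorant v (x, ys)))))) = (NI (sigma_hat et th) (%z. ennreal (majorant v z)))"
  using nn_integral_sigma_hat[of "%z. ennreal (majorant v z)"] majorant_measurable[OF v] by simp
 also have "... <= (NI (sigma_hat et th) (%z. ennreal C*ennreal (norm (?b z))+ennreal (C+1)*ennreal (?l z)))"
 proof (rule nn_integral_mono)
  fix z :: "'x \<times> 'x list"
  have b: "abs (beta_along M h v (fst z) (snd z)) <= C*(?b z+?l z)"
   using C(2)[of "fst z" "snd z"] by (cases z) (simp add: indicator_def)
  \<comment> \<open>\<open>C\<close> comes from the bound on the logarithmic derivative, the
    additional 1 from the second summand of \<open>majorant\<close>.\<close>
  have "majorant v z <= C*norm (?b z)+(C+1)*?l z"
  proof -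
   have "C*?b z <= C*norm (?b z)" using C(1) by (intro mult_left_mono) (simp_all only: real_norm_def abs_ge_self)
   thus ?thesis unfolding majorant_def using b by (simp add: distrib_left distrib_right)
  qed
  hence "ennreal (majorant v z) <= ennreal (C*norm (?b z)+(C+1)*?l z)" by (rule ennreal_leI)
  also have "... = ennreal C*ennreal (norm (?b z))+ennreal (C+1)*ennreal (?l z)"
   using C(1) by (simp add: ennreal_plus ennreal_mult)
  finally show "ennreal (majorant v z) <= ennreal C*ennreal (norm (?b z))+ennreal (C+1)*ennreal (?l z)" .
 qed
 also have "... = ennreal C*(NI (sigma_hat et th) (%z. ennreal (norm (?b z))))+ennreal (C+1)*(NI (sigma_hat et th) (%z. ennreal (?l z)))"
 proof -
  have 1: "(%z. ennreal (norm (?b z))):bm (sigma_hat et th)" by (rule sm) (use bm in measurable)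
  have 2: "(%z. ennreal (?l z)):bm (sigma_hat et th)" by (rule sm) (rule meas_comp[OF lm measurable_ennreal])
  show ?thesis
   by (subst nn_integral_add) (intro borel_measurable_times_ennreal borel_measurable_const 1 2, intro borel_measurable_times_ennreal borel_measurable_const 1 2,
     simp only: nn_integral_cmult[OF 1] nn_integral_cmult[OF 2])
 qed
 also have "... < \<infinity>"
 proof -
  have 1: "(NI (sigma_hat et th) (%z. ennreal (norm (?b z)))) < \<infinity>" using i unfolding integrable_iff_bounded by blast
  have "(NI (sigma_hat et th) (%z. ennreal (?l z))) = (NI th (%x. (NI (et x) (%ys. ennreal (?l (x, ys))))))"
   by (rule nn_integral_sigma_hat) (rule meas_comp[OF lm measurable_ennreal])
  also have "... = (NI th (%x. (\<integral>\<^sup>+ys\<in>hits ?B. of_nat (length ys) \<partial>et x)))"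
   by (intro nn_integral_cong) (simp add: indicator_def ennreal_of_nat_eq_real_of_nat)
  also have "... < \<infinity>" by (rule length_finite[OF cpt_supp[OF v]])
  finally show ?thesis using 1 by (simp add: ennreal_mult_less_top)
 qed
 finally show ?thesis .
qed

lemma P_majorant_finite:
 assumes v: "v:Vect0 M"
 shows "(NI P (%p. (\<Sum>n. if val n (fst p) then ennreal (majorant v (pt n (fst p), snd p n)) else 0))) < \<infinity>"
 by (rule campbell_finite[of "%z. ennreal (majorant v z)"]) (use majorant_measurable[OF v] majorant_finite[OF v] in simp_all)

section \<open>Only finitely many clusters meet a compact set\<close>

definition fin_hits :: "'x measure \<times> (nat => 'x list) => bool" where
 "fin_hits p \<longleftrightarrow> (ALL m. finite {n. val n (fst p) & snd p n:hits (K m)})"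

text \<open>By (A2) and the Campbell formula the expected number of clusters that meet
  \<open>K m\<close> is finite, so the number itself is almost surely finite; countably many
  \<open>m\<close> suffice.\<close>

lemma AE_fin_hits: "AE p in P. fin_hits p"
 unfolding fin_hits_def AE_all_countable
proof
 fix m
 let ?u = "%z. Ind (hits (K m)) (snd z) :: ennreal"
 have h: "hits (K m):sets LB" by (rule hits_sets[OF K_borel])
 have u: "?u:bm ZB"
  by (rule meas_comp[OF measurable_snd borel_measurable_indicator[OF h]])
 let ?s = "%p. \<Sum>n. if val n (fst p) then ?u (pt n (fst p), snd p n) else 0"
 have "(NI th (%x. (NI (et x) (%ys. ?u (x, ys))))) < \<infinity>"
  using hits_finite[OF compact_K[of m]] h by simp
 from campbell_finite[OF u this] have f: "(NI P (%p. ?s p)) ~= \<infinity>" by simp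
 have "?s:bm P" using u by (simp cong: meas_cong) 
 from nn_integral_PInf_AE[OF this f] show "AE p in P. finite {n. val n (fst p) & snd p n:hits (K m)}"
 proof eventually_elim
  case (elim p)
  let ?N = "{n. val n (fst p) & snd p n:hits (K m)}"
  have "?s p = (\<Sum>n. Ind ?N n)" by (intro suminf_cong) (simp add: indicator_def)
  also have "... = em (Cnt UNIV) ?N"
   by (simp add: nn_integral_count_space_nat[symmetric])
  finally show ?case using elim by (auto simp: emeasure_count_space split: if_splits)
 qed
qed

lemma finite_hits_compact:
 assumes "fin_hits p" "compact C"
 shows "finite {n. val n (fst p) & snd p n:hits C}"
proof -
 obtain m where m: "C <= K m" using cover_K[OF assms(2)] by blast
 have "{n. val n (fst p) & snd p n:hits C} <= {n. val n (fst p) & snd p n:hits (K m)}"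
  using m by (auto simp: hits_def)
 thus ?thesis using assms(1) unfolding fin_hits_def by (meson finite_subset)
qed

lemma fin_hits_update: "fin_hits p ==> fin_hits (fst p, (snd p)(n:=ys))"
proof -
 assume p: "fin_hits p"
 have "finite {i. val i (fst p) & ((snd p)(n:=ys)) i:hits (K m)}" for m
 proof (rule finite_subset)
  show "{i. val i (fst p) & ((snd p)(n:=ys)) i:hits (K m)} <= insert n {i. val i (fst p) & snd p i:hits (K m)}"
   by (auto split: if_splits)
  show "finite (insert n {i. val i (fst p) & snd p i:hits (K m)})" using p unfolding fin_hits_def by simp
 qed
 thus ?thesis unfolding fin_hits_def by simp
qed

text \<open>Invalid indices contribute 0, so dummy clusters never enter. If \<open>u\<close>
  vanishes for clusters that miss a compact set, the series is a finite sum on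
  \<open>fin_hits\<close>.\<close>

definition vsum :: "('x \<times> 'x list => real) => 'x measure \<times> (nat => 'x list) => real" where
 "vsum u p = (\<Sum>n. if val n (fst p) then u (pt n (fst p), snd p n) else 0)"

definition tot :: "('x => real) => 'x measure \<times> (nat => 'x list) => real" where
 "tot g p = vsum (%z. tsum g (snd z)) p"

lemma vsum_term_measurable:
 assumes u: "u:bm ZB"
 shows "(%p. if val n (fst p) then u (pt n (fst p), snd p n) else 0 :: real):bm GP"
 using u by measurable

lemma vsum_measurable: "u:bm ZB ==> vsum u:bm GP"
 unfolding vsum_def[abs_def] by (intro borel_measurable_suminf vsum_term_measurable)

lemma tot_measurable: "g:bm borel ==> tot g:bm GP"
 unfolding tot_def[abs_def] by (intro vsum_measurable meas_comp[OF measurable_snd measurable_tsum])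

lemma vsum_summable:
 assumes p: "fin_hits p" and C: "compact C" and u: "!!x ys. ys ~: hits C ==> u (x, ys) = 0"
 shows "summable (%n. if val n (fst p) then u (pt n (fst p), snd p n) else 0 :: real)"
  "vsum u p = (\<Sum>n\<in>{n. val n (fst p) & snd p n:hits C}. u (pt n (fst p), snd p n))"
proof -
 note fin = finite_hits_compact[OF p C]
 show "summable (%n. if val n (fst p) then u (pt n (fst p), snd p n) else 0 :: real)"
  by (rule summable_finite[OF fin]) (use u in auto)
 have "vsum u p = (\<Sum>n\<in>{n. val n (fst p) & snd p n:hits C}. if val n (fst p) then u (pt n (fst p), snd p n) else 0)"
  unfolding vsum_def by (rule suminf_finite[OF fin]) (use u in auto)
 also have "... = (\<Sum>n\<in>{n. val n (fst p) & snd p n:hits C}. u (pt n (fst p), snd p n))"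
  by (rule sum.cong) simp_all
 finally show "vsum u p = (\<Sum>n\<in>{n. val n (fst p) & snd p n:hits C}. u (pt n (fst p), snd p n))" .
qed

lemma tsum_outside: "(!!x. x ~: C ==> g x = 0) ==> ys ~: hits C ==> tsum g ys = 0"
 unfolding tsum_def by (rule sum.neutral) (auto simp: hits_iff)

lemma tot_update:
 assumes p: "fin_hits p" and C: "compact C" "!!x. x ~: C ==> g x = 0" and n: "val n (fst p)"
 shows "tot g (fst p, (snd p)(n:=ys)) = tot g (fst p, (snd p)(n:=[]))+tsum g ys"
proof -
 let ?t = "%ys i. if val i (fst p) then tsum g (((snd p)(n:=ys)) i) else 0"
 have s: "summable (?t ys)" for ys
  using vsum_summable(1)[OF fin_hits_update[OF p] C(1), of "%z. tsum g (snd z)" n ys, unfolded fst_conv snd_conv, OF tsum_outside[OF C(2)]] .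
 have "(\<Sum>i. ?t ys i) = (\<Sum>i. ?t [] i+(if i = n then tsum g ys else 0))"
  using n by (intro suminf_cong) (simp add: tsum_def)
 also have "... = (\<Sum>i. ?t [] i)+(\<Sum>i. if i = n then tsum g ys else 0)"
  by (rule suminf_add[symmetric, OF s]) (rule sums_summable[OF sums_single])
 also have "(\<Sum>i. if i = n then tsum g ys else 0) = tsum g ys"
  using sums_unique[OF sums_single[of n "%_. tsum g ys"]] by simp
 finally show ?thesis unfolding tot_def vsum_def fst_conv snd_conv .
qed

text \<open>Given all other clusters, the mean over cluster \<open>n\<close> is 0. The resampling
  identity is one for nonnegative functions, so it is applied to the positive and the negative part
  and these are compared.\<close>

lemma integral_zero_by_resampling:
 fixes Y :: "_ => real"
 assumes Y: "integrable P Y"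
  and z: "AE p in P. integrable (et (pt n (fst p))) (%ys. Y (fst p, (snd p)(n:=ys))) &
   (LI (et (pt n (fst p))) (%ys. Y (fst p, (snd p)(n:=ys)))) = 0"
 shows "(LI P (%p. Y p)) = 0"
proof -
 have m: "Y:bm GP" using borel_measurable_integrable[OF Y] by (simp cong: meas_cong)
 have "(NI P (%p. ennreal (Y p))) = (NI P (%p. (NI (et (pt n (fst p))) (%ys. ennreal (Y (fst p, (snd p)(n:=ys)))))))"
  by (rule nn_integral_P_resample) (use m in simp)
 also have "... = (NI P (%p. (NI (et (pt n (fst p))) (%ys. ennreal (- Y (fst p, (snd p)(n:=ys)))))))"
 proof (rule nn_integral_cong_AE)
  from z show "AE p in P. (NI (et (pt n (fst p))) (%ys. ennreal (Y (fst p, (snd p)(n:=ys))))) =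
    (NI (et (pt n (fst p))) (%ys. ennreal (- Y (fst p, (snd p)(n:=ys)))))"
  proof eventually_elim
   case (elim p)
   let ?y = "%ys. Y (fst p, (snd p)(n:=ys))" and ?E = "et (pt n (fst p))"
   have f: "(NI ?E (%ys. ennreal (?y ys))) ~= \<infinity>" "(NI ?E (%ys. ennreal (- ?y ys))) ~= \<infinity>"
    using elim unfolding real_integrable_def by auto
   have "enn2real (NI ?E (%ys. ennreal (?y ys))) = enn2real (NI ?E (%ys. ennreal (- ?y ys)))"
    using real_lebesgue_integral_def[of ?E ?y] elim by simp
   thus ?case using f by (intro enn2real_inj) (simp_all add: less_top)
  qed
 qed
 also have "... = (NI P (%p. ennreal (- Y p)))"
  by (rule nn_integral_P_resample[symmetric, where f = "%p. ennreal (- Y p)"]) (use m in simp)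
 finally show ?thesis using real_lebesgue_integral_def[OF Y] by simp
qed

text \<open>The double integral of the majorant is finite, so the centres whose cluster law does not
  integrate it form a null set of \<open>th\<close>; by \<open>M1_null\<close> almost no
  configuration contains such a centre.\<close>

lemma AE_good_center:
 assumes v: "v:Vect0 M"
 shows "AE p in P. ALL n. val n (fst p) --> integrable (et (pt n (fst p))) (beta_along M h v (pt n (fst p))) &
  integrable (et (pt n (fst p))) (%ys. hitlen (supp v) ys)"
proof -
 let ?G = "%x. \<integral>\<^sup>+ys. ennreal (majorant v (x, ys)) \<partial>et x"
 have Gm: "?G:bm borel"
  by (rule inner_measurable[of "%z. ennreal (majorant v z)"]) (use majorant_measurable[OF v] in simp)
 let ?N = "{x. ?G x = \<infinity>}"
 have NS: "?N:sets borel" using measurable_sets[OF Gm, of "{\<infinity>}"] by (simp add: vimage_def)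
 have Gm': "?G:bm th" using Gm by (simp add: meas_cong[OF sets_theta refl])
 have "AE x in th. ?G x ~= \<infinity>" using nn_integral_PInf_AE[OF Gm'] majorant_finite[OF v] by simp
 hence "em th ?N = 0"
  by (rule AE_iff_measurable[THEN iffD1, rotated 2]) (use NS in \<open>simp_all add: sets_theta space_theta\<close>)
 from M1_null[OF NS this] have av: "AE ga in mu. points ga Int ?N = {}" .
 have R: "Measurable.pred GP (%p. em (fst p) ?N = 0)"
 proof -
  have "(%ga. em ga ?N):bm Gamma_X"
   by (rule count_em_meas) (use NS in \<open>simp add: borel_of_eu\<close>)
  from meas_comp[OF measurable_fst this, of PL] show ?thesis by measurable
 qed
 have "AE p in P. em (fst p) ?N = 0"
  unfolding AE_P[OF R]
 proof (rule AE_mp[OF av], rule AE_I2, rule impI)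
  fix ga assume "ga:space mu" "points ga Int ?N = {}"
  hence "em ga ?N = 0" using emeasure_proper_cell[OF _ NS, of ga] by (simp add: space_mu)
  thus "AE w in Q ga. em (fst (ga, w)) ?N = 0" by simp
 qed
 thus ?thesis
 proof (rule AE_mp, intro AE_I2 impI allI)
  fix p n assume p: "p:space P" "em (fst p) ?N = 0" and n: "val n (fst p)"
  have g: "fst p:space Gamma_X" using p(1) by (simp add: space_GP)
  let ?x = "pt n (fst p)"
  have "points (fst p) Int ?N = {}"
   using p(2) emeasure_count_space_nonzero[of "points (fst p) Int ?N" "points (fst p)"]
   unfolding emeasure_proper_cell[OF g NS] by simp
  moreover have "?x:points (fst p)" using bij_pt[OF g] n by (auto simp: bij_betw_def)
  ultimately have "~ ?G ?x = \<infinity>" by blast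
  hence fin: "?G ?x < \<infinity>" by (simp add: less_top)
  have b: "integrable (et ?x) (%ys. majorant v (?x, ys))"
  proof (rule integrableI_nonneg)
   show "(%ys. majorant v (?x, ys)):bm (et ?x)"
    using meas_comp[OF Pair_eta majorant_measurable[OF v]] .
  qed (use fin in \<open>simp_all add: majorant_nonneg\<close>)
  show "integrable (et ?x) (beta_along M h v ?x) & integrable (et ?x) (%ys. hitlen (supp v) ys)"
  proof
   show "integrable (et ?x) (beta_along M h v ?x)"
    by (rule integrable_boundB[OF b]) (use beta_borel[OF v] in \<open>simp_all add: measurable_eta_iff majorant_def\<close>)
   show "integrable (et ?x) (%ys. hitlen (supp v) ys)"
    by (rule integrable_boundB[OF b]) (use hits_length_measurable[OF borel_supp] in \<open>simp_all add: measurable_eta_iff majorant_def\<close>)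
  qed
 qed
qed

section \<open>The one-cluster identities and their sum\<close>

definition Fp :: "nat => (real list => real) => (nat => 'x => real) => 'x measure \<times> (nat => 'x list) => real" where
 "Fp k f ph p = f (map (%l. tot (ph l) p) [0..<k])"

definition beta_z :: "('x => real ^ 'n) => 'x \<times> 'x list => real" where
 "beta_z v z = beta_along M h v (fst z) (snd z)"

text \<open>The one-cluster identity for cluster \<open>n\<close>, with both of its terms on one
  side, so that the integral over that cluster is 0.\<close>

definition Yn :: "('x => real ^ 'n) => nat => (real list => real) => (nat => 'x => real) => nat => 'x measure \<times> (nat => 'x list) => real" where
 "Yn v k f ph n p = (if val n (fst p) then
   (\<Sum>l<k. list_grad f (map (%l. tot (ph l) p) [0..<k])!l*tsum (Dv M (ph l) v) (snd p n))
   + Fp k f ph p*beta_z v (pt n (fst p), snd p n) else 0)"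

lemma beta_outside: "v:Vect0 M ==> ys ~: hits (supp v) ==> beta_z v (x, ys) = 0"
proof -
 assume v: "v:Vect0 M" and ys: "ys ~: hits (supp v)"
 obtain C where C: "C >= 0" "!!x ys. abs (beta_along M h v x ys) <=
  C*(Ind (hits (supp v)) ys*beta_norm1 M h x ys+hitlen (supp v) ys)"
  using beta_along_bound[OF v] by blast
 show ?thesis using C(2)[of x ys] ys by (simp add: beta_z_def)
qed

lemma beta_z_measurable: "v:Vect0 M ==> beta_z v:bm ZB"
 unfolding beta_z_def[abs_def] by (rule measurable_beta_along)

context
 fixes v k f ph
 assumes v: "v:Vect0 M" and f: "C1b k f" and ph: "!!l. l < k ==> ph l:test_functions M"
begin

lemma tot_phi_measurable: "l < k ==> tot (ph l):bm GP"
 by (intro tot_measurable borel_test ph)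

lemma Fp_measurable: "Fp k f ph:bm GP"
 unfolding Fp_def[abs_def] by (rule C1b_measurable[OF f tot_phi_measurable])

lemma grad_measurable: "l < k ==> (%p. list_grad f (map (%l. tot (ph l) p) [0..<k])!l):bm GP"
 by (rule C1b_grad_measurable[OF f _ tot_phi_measurable])

lemma Yn_measurable: "Yn v k f ph n:bm GP"
proof -
 have 1: "(%p. tsum (Dv M (ph l) v) (snd p n)):bm GP" if "l < k" for l
  by (rule meas_comp[OF snd_component_measurable measurable_tsum[OF borel_diff_field[OF ph[OF that] v]]])
 have 2: "(%p. beta_z v (pt n (fst p), snd p n)):bm GP"
  by (rule meas_comp[OF measurable_Pair[OF pt_fst_measurable snd_component_measurable] beta_z_measurable[OF v]])
 show ?thesis unfolding Yn_def[abs_def]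
  by (intro measurable_If borel_measurable_add borel_measurable_sum borel_measurable_times Fp_measurable 2 1 grad_measurable borel_measurable_const)
    (use val_fst_measurable in \<open>simp_all add: pred_def\<close>)
qed

lemma Yn_bound: "EX C>=0. ALL n p. abs (Yn v k f ph n p) <= (if val n (fst p) then C*majorant v (pt n (fst p), snd p n) else 0)"
proof -
 obtain C where C0: "C >= 0" "ALL as ys. length as = k -->
   abs (\<Sum>l<k. list_grad f as!l*tsum (Dv M (ph l) v) ys) <= C*(hitlen (supp v) ys)"
 proof -
  have "EX C>=0. ALL as ys. length as = k -->
   abs (\<Sum>l<k. list_grad f as!l*tsum (Dv M (ph l) v) ys) <= C*(hitlen (supp v) ys)"
   by (rule grad_cyl_bound[OF f _ v]) (rule ph)
  thus thesis by (elim exE conjE) (rule that)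
 qed
 note C = C0(1) C0(2)[rule_format]
 obtain B where B: "!!as. length as = k ==> abs (f as) <= B" using C1b_bounded[OF f] by blast
 have B0: "B >= 0" using B[of "replicate k 0"] by simp
 have "abs (Yn v k f ph n p) <= (if val n (fst p) then max B C*majorant v (pt n (fst p), snd p n) else 0)" for n p
 proof (cases "val n (fst p)")
  case True
  let ?z = "(pt n (fst p), snd p n)"
  let ?L = "Ind (hits (supp v)) (snd p n)*real (length (snd p n))"
  let ?S = "\<Sum>l<k. list_grad f (map (%l. tot (ph l) p) [0..<k])!l*tsum (Dv M (ph l) v) (snd p n)"
  have "abs ?S <= C*?L" by (rule C(2)) simp
  also have "... <= max B C*?L" by (intro mult_right_mono) simp_all
  finally have 1: "abs ?S <= max B C*?L" .
  have "abs (Fp k f ph p*beta_z v ?z) <= max B C*abs (beta_z v ?z)"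
   unfolding abs_mult using B[of "map (%l. tot (ph l) p) [0..<k]"] by (intro mult_right_mono) (auto simp: Fp_def)
  with 1 have "abs ?S+abs (Fp k f ph p*beta_z v ?z) <= max B C*majorant v ?z"
   by (simp add: majorant_def beta_z_def distrib_left)
  thus ?thesis using True abs_triangle_ineq[of ?S "Fp k f ph p*beta_z v ?z"] by (simp add: Yn_def)
 qed (simp add: Yn_def)
 thus ?thesis using B0 by (intro exI[of _ "max B C"]) simp
qed

text \<open>A constant times the sum of majorants dominates the series. This is the hypothesis under
  which sum and integral are exchanged below.\<close>

lemma Yn_sum_finite: "(NI P (%p. (\<Sum>n. ennreal (abs (Yn v k f ph n p))))) < \<infinity>"
proof -
 obtain C where C: "C >= 0" "!!n p. abs (Yn v k f ph n p) <= (if val n (fst p) then C*majorant v (pt n (fst p), snd p n) else 0)"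
  using Yn_bound by blast
 let ?m = "%n p. if val n (fst p) then ennreal (majorant v (pt n (fst p), snd p n)) else 0"
 have "(NI P (%p. (\<Sum>n. ennreal (abs (Yn v k f ph n p))))) <= (NI P (%p. ennreal C*(\<Sum>n. ?m n p)))"
 proof (rule nn_integral_mono)
  fix p
  have "(\<Sum>n. ennreal (abs (Yn v k f ph n p))) <= (\<Sum>n. ennreal C*?m n p)"
  proof (rule suminf_le)
   fix n
   have "ennreal (abs (Yn v k f ph n p)) <= ennreal (if val n (fst p) then C*majorant v (pt n (fst p), snd p n) else 0)"
    by (rule ennreal_leI[OF C(2)])
   also have "... = ennreal C*?m n p" using C(1) majorant_nonneg by (simp add: ennreal_mult)
   finally show "ennreal (abs (Yn v k f ph n p)) <= ennreal C*?m n p" .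
  qed simp_all
  thus "(\<Sum>n. ennreal (abs (Yn v k f ph n p))) <= ennreal C*(\<Sum>n. ?m n p)" by simp
 qed
 also have "... = ennreal C*(NI P (%p. (\<Sum>n. ?m n p)))"
 proof (rule nn_integral_cmult)
  have mm: "(%z. ennreal (majorant v z)):bm ZB" using majorant_measurable[OF v] by simp
  have "(%p. \<Sum>n. ?m n p):bm GP" using mm by measurable
  thus "(%p. \<Sum>n. ?m n p):bm P" by (simp cong: meas_cong)
 qed
 also have "... < \<infinity>" using P_majorant_finite[OF v] by (simp add: ennreal_mult_less_top)
 finally show ?thesis .
qed

lemma measurable_P: "g:bm GP ==> g:bm P" for g :: "_ => real"
 by (simp cong: meas_cong)

lemma Yn_nn: "(\<Sum>n. \<integral>\<^sup>+p. ennreal (abs (Yn v k f ph n p)) \<partial>P) < \<infinity>"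
 using Yn_sum_finite measurable_P[OF Yn_measurable] by (subst nn_integral_suminf[symmetric]) simp_all

lemma Yn_integrable: "integrable P (Yn v k f ph n)"
 unfolding integrable_iff_bounded
proof
 show "Yn v k f ph n:bm P" by (rule measurable_P[OF Yn_measurable])
 have "(NI P (%p. ennreal (abs (Yn v k f ph n p)))) <= (\<Sum>n. \<integral>\<^sup>+p. ennreal (abs (Yn v k f ph n p)) \<partial>P)"
  using sum_le_suminf[of "%n. \<integral>\<^sup>+p. ennreal (abs (Yn v k f ph n p)) \<partial>P" "{n}"] by simp
 thus "(NI P (%p. ennreal (norm (Yn v k f ph n p)))) < \<infinity>" using Yn_nn by simp
qed

lemma Yn_integral: "(LI P (%p. Yn v k f ph n p)) = 0"
proof (rule integral_zero_by_resampling[OF Yn_integrable, of n])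
 from AE_fin_hits AE_good_center[OF v]
 show "AE p in P. integrable (et (pt n (fst p))) (%ys. Yn v k f ph n (fst p, (snd p)(n:=ys))) &
   (LI (et (pt n (fst p))) (%ys. Yn v k f ph n (fst p, (snd p)(n:=ys)))) = 0"
 proof eventually_elim
  case (elim p)
  show ?case
  proof (cases "val n (fst p)")
   case True
   let ?x = "pt n (fst p)"
   \<comment> \<open>The other clusters enter through these constants only, which puts the cylinder
     function into the form of \<open>cylfun\<close>.\<close>
   define c where "c l = tot (ph l) (fst p, (snd p)(n:=[]))" for l
   have u: "tot (ph l) (fst p, (snd p)(n:=ys)) = c l+tsum (ph l) ys" if "l < k" for l ys
    unfolding c_def by (rule tot_update[OF elim(1) compact_supp_test[OF ph[OF that]] _ True]) (rule supp_outside)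
   have args: "map (%l. tot (ph l) (fst p, (snd p)(n:=ys))) [0..<k] = map (%l. c l+tsum (ph l) ys) [0..<k]" for ys
    using u by simp
   have Y: "Yn v k f ph n (fst p, (snd p)(n:=ys)) = cylderiv v k f c ph ys+cylfun k f c ph ys*beta_along M h v ?x ys" for ys
    unfolding Yn_def Fp_def args cylderiv_def cylfun_def beta_z_def using True by simp
   have b: "integrable (et ?x) (beta_along M h v ?x)" "integrable (et ?x) (%ys. hitlen (supp v) ys)"
    using elim(2) True by blast+
   have "integrable (et ?x) (cylderiv v k f c ph)"
    by (rule cluster_ibp_formula(1)[OF f _ v b]) (rule ph)
   moreover have "integrable (et ?x) (%ys. cylfun k f c ph ys*beta_along M h v ?x ys)"
    by (rule cluster_ibp_formula(2)[OF f _ v b]) (rule ph)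
   moreover have "(LI (et ?x) (%ys. cylderiv v k f c ph ys)) = - (LI (et ?x) (%ys. cylfun k f c ph ys*beta_along M h v ?x ys))"
    by (rule cluster_ibp_formula(3)[OF f _ v b]) (rule ph)
   ultimately show ?thesis unfolding Y by simp
  qed (simp add: Yn_def)
 qed
qed

lemma summable_Yn_integrals: "summable (%n. \<integral>p. norm (Yn v k f ph n p) \<partial>P)"
proof -
 have "(\<Sum>n. ennreal (LI P (%p. norm (Yn v k f ph n p)))) = (\<Sum>n. \<integral>\<^sup>+p. ennreal (abs (Yn v k f ph n p)) \<partial>P)"
  using nn_integral_eq_integral[OF integrable_norm[OF Yn_integrable]] by simp
 hence "(\<Sum>n. ennreal (LI P (%p. norm (Yn v k f ph n p)))) ~= top" using Yn_nn by simp
 thus ?thesis by (intro summable_suminf_not_top) simp_all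
qed

lemma Yn_summable_AE: "AE p in P. summable (%n. norm (Yn v k f ph n p))"
proof -
 have "(%p. \<Sum>n. ennreal (abs (Yn v k f ph n p))):bm P" using measurable_P[OF Yn_measurable] by simp
 from nn_integral_PInf_AE[OF this] have "AE p in P. (\<Sum>n. ennreal (abs (Yn v k f ph n p))) ~= \<infinity>" using Yn_sum_finite by simp
 thus ?thesis by eventually_elim (intro summable_suminf_not_top, simp_all)
qed

lemma Yn_suminf:
 "integrable P (%p. \<Sum>n. Yn v k f ph n p)" "(LI P (%p. (\<Sum>n. Yn v k f ph n p))) = 0"
 using integrable_suminf[OF Yn_integrable Yn_summable_AE summable_Yn_integrals]
  integral_suminf[OF Yn_integrable Yn_summable_AE summable_Yn_integrals] Yn_integral by simp_all

text \<open>Only finitely many clusters meet the support of \<open>v\<close>, so the series is a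
  finite sum and the sum over clusters can be moved inside the sum over the arguments of
  \<open>f\<close>.\<close>

lemma Yn_suminf_eq:
 assumes p: "fin_hits p"
 shows "(\<Sum>n. Yn v k f ph n p) = (\<Sum>l<k. list_grad f (map (%l. tot (ph l) p) [0..<k])!l*tot (Dv M (ph l) v) p)
   + Fp k f ph p * vsum (beta_z v) p"
proof -
 let ?N = "{n. val n (fst p) & snd p n:hits (supp v)}"
 let ?g = "%l. list_grad f (map (%l. tot (ph l) p) [0..<k])!l" and ?d = "%l y. differential M (ph l) y (v y)"
 have cs: "compact (supp v)" by (rule cpt_supp[OF v])
 note fin = finite_hits_compact[OF p cs]
 have d0: "?d l y = 0" if "l < k" "y ~: supp v" for l y
  using supp_outside[OF that(2)] differential_zero[OF test_function_mdiff[OF ph[OF that(1)]]] by simp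
 have d: "tsum (?d l) ys = 0" if "l < k" "ys ~: hits (supp v)" for l ys
  by (rule tsum_outside[OF d0[OF that(1)] that(2)])
 have "(\<Sum>n. Yn v k f ph n p) = (\<Sum>n\<in>?N. Yn v k f ph n p)"
 proof (rule suminf_finite[OF fin])
  fix n assume "n ~: ?N"
  thus "Yn v k f ph n p = 0" using d beta_outside[OF v] by (auto simp: Yn_def)
 qed
 also have "... = (\<Sum>n\<in>?N. (\<Sum>l<k. ?g l*tsum (?d l) (snd p n))+Fp k f ph p*beta_z v (pt n (fst p), snd p n))"
  by (rule sum.cong) (simp_all add: Yn_def)
 also have "... = (\<Sum>l<k. ?g l*(\<Sum>n\<in>?N. tsum (?d l) (snd p n)))+Fp k f ph p*(\<Sum>n\<in>?N. beta_z v (pt n (fst p), snd p n))"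
  unfolding sum.distrib sum_distrib_left by (subst sum.swap) (rule refl)
 also have "(\<Sum>n\<in>?N. beta_z v (pt n (fst p), snd p n)) = vsum (beta_z v) p"
  by (rule vsum_summable(2)[OF p cs, symmetric]) (rule beta_outside[OF v])
 also have "(\<Sum>l<k. ?g l*(\<Sum>n\<in>?N. tsum (?d l) (snd p n))) = (\<Sum>l<k. ?g l*tot (?d l) p)"
 proof (rule sum.cong[OF refl])
  fix l assume "l:{..<k}"
  hence l: "l < k" by simp
  have "vsum (%z. tsum (?d l) (snd z)) p = (\<Sum>n\<in>?N. tsum (?d l) (snd p n))"
   using vsum_summable(2)[OF p cs, of "%z. tsum (?d l) (snd z)"] d[OF l] by simp
  thus "?g l*(\<Sum>n\<in>?N. tsum (?d l) (snd p n)) = ?g l*tot (?d l) p" by (simp add: tot_def)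
 qed
 finally show ?thesis .
qed

end

end

section \<open>Conditional expectation given the image of a map\<close>

text \<open>The image of the measure with density \<open>g\<close> is absolutely continuous with
  respect to the image of \<open>P\<close>; its Radon-Nikodym derivative is the conditional
  expectation of \<open>g\<close> given \<open>S\<close>.\<close>

lemma pushforward_density_nonneg:
 fixes g :: "'a => real"
 assumes P: "prob_space P" and S: "S:P ->M N" and g: "integrable P g" "!!p. 0 <= g p"
 shows "EX H. integrable (distr P N S) H &
  (ALL F:bm N. (LI (distr P N S) (%ga. F ga*H ga)) = (LI P (%p. F (S p)*g p)))"
proof -
 let ?D = "distr P N S" and ?g = "density P (%p. ennreal (g p))"
 interpret D: prob_space ?D by (rule prob_space.prob_space_distr[OF P S])
 let ?nu = "distr ?g N S"
 have gm: "g:bm P" using g(1) by simp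
 have S': "S:?g ->M N" using S by simp
 have ac: "absolutely_continuous ?D ?nu"
  unfolding absolutely_continuous_def
 proof
  fix A assume "A:null_sets ?D"
  hence A: "A:sets N" "em P (S -` A Int space P) = 0"
   by (auto simp: null_sets_def emeasure_distr[OF S])
  have "absolutely_continuous P ?g" by (rule absolutely_continuousI_density) (use gm in simp)
  moreover have "S -` A Int space P:null_sets P" using A S by (intro null_setsI) auto
  ultimately have "em ?g (S -` A Int space P) = 0" unfolding absolutely_continuous_def by auto
  thus "A:null_sets ?nu" using A(1) by (intro null_setsI) (simp_all add: emeasure_distr[OF S'])
 qed
 define R where "R = RN_deriv ?D ?nu"
 have dR: "density ?D R = ?nu" unfolding R_def by (rule D.density_RN_deriv[OF ac]) simp
 have Rm: "R:bm N" unfolding R_def using borel_measurable_RN_deriv[of ?D ?nu] by simp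
 have "(NI ?D (%x. R x)) = em (density ?D R) (space N)"
  using Rm by (simp add: emeasure_density) (intro nn_integral_cong, simp add: indicator_def)
 also have "... = em ?g (space P)"
  unfolding dR using measurable_space[OF S] by (subst emeasure_distr[OF S']) (auto intro!: arg_cong[where f = "em ?g"])
 also have "... = (NI P (%p. ennreal (g p)))"
  using gm by (simp add: emeasure_density)
 also have "... < \<infinity>" using g by (simp add: nn_integral_eq_integral)
 finally have Rf: "(NI ?D (%x. R x)) < \<infinity>" .
 have RmD: "R:bm ?D" using Rm by simp
 have "AE x in ?D. R x ~= \<infinity>" using nn_integral_PInf_AE[OF RmD] Rf by simp
 hence Rae: "AE x in ?D. ennreal (enn2real (R x)) = R x" by eventually_elim (simp add: less_top)
 define H where "H x = enn2real (R x)" for x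
 have Hm: "H:bm N" unfolding H_def[abs_def] using Rm by simp
 have Hi: "integrable ?D H"
 proof (rule integrableI_nonneg)
  show "H:bm ?D" using Hm by simp
  have "(NI ?D (%x. ennreal (H x))) = (NI ?D (%x. R x))"
   using Rae unfolding H_def by (rule nn_integral_cong_AE)
  thus "(NI ?D (%x. ennreal (H x))) < \<infinity>" using Rf by simp
 qed (simp add: H_def)
 have "density ?D (%x. ennreal (H x)) = density ?D R"
  using Rae Rm unfolding H_def by (intro density_cong) simp_all
 hence dH: "density ?D (%x. ennreal (H x)) = ?nu" using dR by simp
 have "(LI ?D (%ga. F ga*H ga)) = (LI P (%p. F (S p)*g p))" if F: "F:bm N" for F :: "'b => real"
 proof -
  have FD: "F:bm ?D" using F by simp
  have HD: "H:bm ?D" using Hm by simp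
  have "(LI ?D (%ga. F ga*H ga)) = (LI (density ?D (%x. ennreal (H x))) (%ga. F ga))"
   using integral_density[OF FD HD] by (simp add: H_def mult.commute)
  also have "... = (LI ?g (%p. F (S p)))" unfolding dH by (rule integral_distr[OF S' F])
  also have "... = (LI P (%p. F (S p)*g p))"
   using integral_density[OF meas_comp[OF S F] gm] g(2) by (simp add: mult.commute)
  finally show ?thesis .
 qed
 thus ?thesis using Hi by blast
qed

lemma integrable_mult_bounded:
 fixes F H :: "'a => real"
 assumes "integrable M H" "F:bm M" "AE x in M. abs (F x) <= C"
 shows "integrable M (%x. F x*H x)"
proof (rule integrable_boundB)
 show "integrable M (%x. C*abs (H x))" using assms(1) by simp
 show "AE x in M. norm (F x*H x) <= norm (C*abs (H x))"
  using assms(3)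
 proof eventually_elim
  case (elim x)
  hence "abs (F x)*abs (H x) <= C*abs (H x)" by (rule mult_right_mono) simp
  moreover have "C*abs (H x) <= abs C*abs (H x)" by (rule mult_right_mono) simp_all
  ultimately show ?case by (simp add: abs_mult)
 qed
qed (use assms in simp)

text \<open>Positive and negative parts are treated separately; boundedness of \<open>F\<close>
  makes both products integrable, so that they can be subtracted.\<close>

lemma pushforward_density:
 fixes g :: "'a => real"
 assumes P: "prob_space P" and S: "S:P ->M N" and g: "integrable P g"
 shows "EX H. integrable (distr P N S) H &
  (ALL F:bm N. (EX C. AE ga in distr P N S. abs (F ga) <= C) -->
    (LI (distr P N S) (%ga. F ga*H ga)) = (LI P (%p. F (S p)*g p)))"
proof -
 let ?D = "distr P N S"
 have g1: "integrable P (%p. max 0 (g p))" and g2: "integrable P (%p. max 0 (- g p))" using g by auto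
 obtain H1 where H1: "integrable ?D H1" "!!F. F:bm N ==> (LI ?D (%ga. F ga*H1 ga)) = (LI P (%p. F (S p)*max 0 (g p)))"
  using pushforward_density_nonneg[OF P S g1] by auto
 obtain H2 where H2: "integrable ?D H2" "!!F. F:bm N ==> (LI ?D (%ga. F ga*H2 ga)) = (LI P (%p. F (S p)*max 0 (- g p)))"
  using pushforward_density_nonneg[OF P S g2] by auto
 have "(LI ?D (%ga. F ga*(H1 ga-H2 ga))) = (LI P (%p. F (S p)*g p))"
  if F: "F:bm N" and C: "AE ga in ?D. abs (F ga) <= C" for F C
 proof -
  have FD: "F:bm ?D" using F by simp
  have FS: "(%p. F (S p)):bm P" by (rule meas_comp[OF S F])
  have CS: "AE p in P. abs (F (S p)) <= C" by (rule AE_distrD[OF S C])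
  have "(LI ?D (%ga. F ga*(H1 ga-H2 ga))) = (LI ?D (%ga. F ga*H1 ga))-(LI ?D (%ga. F ga*H2 ga))"
   unfolding right_diff_distrib
   by (rule Bochner_Integration.integral_diff; rule integrable_mult_bounded[OF _ FD C]) (rule H1 H2)+
  also have "... = (LI P (%p. F (S p)*max 0 (g p)-F (S p)*max 0 (- g p)))"
   unfolding H1(2)[OF F] H2(2)[OF F]
   by (rule Bochner_Integration.integral_diff[symmetric]; rule integrable_mult_bounded[OF _ FS CS]) (rule g1 g2)+
  also have "... = (LI P (%p. F (S p)*g p))"
   by (intro integral_congB refl) (simp add: max_def right_diff_distrib[symmetric])
  finally show ?thesis .
 qed
 thus ?thesis using H1(1) H2(1) by (intro exI[of _ "%ga. H1 ga-H2 ga"]) auto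
qed

lemma infsum_finite_support:
 fixes g :: "'a => real"
 assumes "finite B" "B <= A" "!!x. x:A-B ==> g x = 0"
 shows "infsum g A = sum g B"
proof -
 have "infsum g A = infsum g B" by (rule infsum_cong_neutral) (use assms in auto)
 thus ?thesis using assms(1) by simp
qed

section \<open>Almost sure properness of the projected configuration\<close>

context cluster_setting
begin

lemma eta_null:
 assumes "A:sets LB" "em (list_volume M) A = 0"
 shows "em (et x) A = 0"
proof -
 have "absolutely_continuous (list_volume M) (density (list_volume M) (%ys. ennreal (h x ys)))"
  by (rule absolutely_continuousI_density)
    (use h_borel in \<open>simp add: list_volume_eq meas_cong[OF sets_tuple_measure refl]\<close>)
 moreover have "A:null_sets (list_volume M)" using assms by (intro null_setsI) (simp_all add: list_volume_eq)
 ultimately show ?thesis unfolding eta_density[of x] absolutely_continuous_def by auto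
qed

lemma eta_not_distinct: "em (et x) {ys. ~ distinct ys} = 0"
 by (rule eta_null[OF not_distinct_sets])
   (simp add: list_volume_eq tuple_measure_not_distinct[OF sets_volume sigma_finite_volume emeasure_volume_point])

lemma eta_hits_finite:
 assumes "finite Z"
 shows "em (et x) (hits Z) = 0"
proof -
 have "hits {z}:null_sets (et x)" for z
 proof (rule null_setsI)
  show "hits {z}:sets (et x)" using hits_sets[of "{z}"] by simp
  show "em (et x) (hits {z}) = 0"
   by (rule eta_null[OF hits_sets])
     (simp_all add: list_volume_eq tuple_measure_hits_point[OF sets_volume sigma_finite_volume emeasure_volume_point])
 qed
 hence "(\<Union>z\<in>Z. hits {z}):null_sets (et x)" using assms by (intro null_sets.finite_UN) auto
 moreover have "(\<Union>z\<in>Z. hits {z}) = hits Z" by (auto simp: hits_def)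
 ultimately show ?thesis by auto
qed

text \<open>If cluster \<open>n\<close> falls into the slice of \<open>A\<close> with probability 0
  whatever the rest is, resampling that cluster shows that \<open>A\<close> is null.\<close>

lemma AE_P_resample_null:
 assumes A: "A:sets GP" and z: "!!p. p:space GP ==> em (et (pt n (fst p))) {ys. (fst p, (snd p)(n:=ys)):A} = 0"
 shows "AE p in P. p ~: A"
proof -
 have Am: "Ind A:bm GP" using A by simp
 have "(NI P (%p. Ind A p)) = (NI P (%p. (NI (et (pt n (fst p))) (%ys. Ind A (fst p, (snd p)(n:=ys))))))"
  by (rule nn_integral_P_resample[OF Am])
 also have "... = (NI P (%p. 0))"
 proof (rule nn_integral_cong)
  fix p assume p: "p:space P"
  have m: "(%ys. (fst p, (snd p)(n:=ys))):et (pt n (fst p)) ->M GP"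
  proof (rule measurable_Pair)
   show "(%ys. fst p):et (pt n (fst p)) ->M Gamma_X" using p by (simp add: space_GP)
   show "(%ys. (snd p)(n:=ys)):et (pt n (fst p)) ->M PL"
   proof (rule measurable_PiM_single')
    fix i :: nat
    show "(%ys. ((snd p)(n:=ys)) i):et (pt n (fst p)) ->M LB"
     by (cases "i = n") (simp_all cong: meas_cong)
   qed (auto simp: space_PiM)
  qed
  have s: "{ys. (fst p, (snd p)(n:=ys)):A}:sets (et (pt n (fst p)))"
   using measurable_sets[OF m A] by (simp add: vimage_def)
  have "(NI (et (pt n (fst p))) (%ys. Ind A (fst p, (snd p)(n:=ys))))
    = (NI (et (pt n (fst p))) (%ys. Ind {ys. (fst p, (snd p)(n:=ys)):A} ys))"
   by (intro nn_integral_cong) (simp add: indicator_def)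
  also have "... = 0" using nn_integral_indicator[OF s] z[of p] p by simp
  finally show "(NI (et (pt n (fst p))) (%ys. Ind A (fst p, (snd p)(n:=ys)))) = 0" .
 qed
 finally have "(NI P (%p. Ind A p)) = 0" by simp
 hence "em P A = 0" using A by simp
 thus ?thesis using A by (intro AE_not_in null_setsI) simp_all
qed

lemma AE_distinct: "AE p in P. ALL n. distinct (snd p n)"
 unfolding AE_all_countable
proof
 fix n
 have A: "{p:space GP. snd p n:{ys. ~ distinct ys}}:sets GP"
  using measurable_sets[OF snd_component_measurable not_distinct_sets, of n] by (simp add: vimage_def Int_def conj_commute)
 have "AE p in P. p ~: {p:space GP. snd p n:{ys. ~ distinct ys}}"
 proof (rule AE_P_resample_null[OF A, of n])
  fix p assume p: "p:space GP"
  hence "{ys. (fst p, (snd p)(n:=ys)):{p:space GP. snd p n:{ys. ~ distinct ys}}} = {ys. ~ distinct ys}"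
   by (simp add: space_GP)
  thus "em (et (pt n (fst p))) {ys. (fst p, (snd p)(n:=ys)):{p:space GP. snd p n:{ys. ~ distinct ys}}} = 0"
   by (simp add: eta_not_distinct)
 qed
 thus "AE p in P. distinct (snd p n)" by (rule AE_mp) (auto intro!: AE_I2)
qed

lemma meet_sets: "{p:space GP. set (snd p n) Int set (snd p n') ~= {}}:sets GP"
proof -
 let ?f = "%n i p. if i < length (snd p n) then snd p n!i else undefined"
 have f: "?f n i:GP ->M (borel :: 'x measure)" for n i
  by (rule meas_comp[OF snd_component_measurable measurable_nth_default])
 have l: "{p:space GP. i < length (snd p n)}:sets GP" for n i
  using measurable_sets[OF meas_comp[OF snd_component_measurable measurable_length], of "{i<..}" n]
  by (simp add: vimage_def Int_def conj_commute)
 have e: "{p:space GP. ?f n i p = ?f n' j p}:sets GP" for i j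
  by (rule measurable_equality_set) (rule f)+
 have "(\<Union>i. \<Union>j. {p:space GP. i < length (snd p n)} Int {p:space GP. j < length (snd p n')} Int {p:space GP. ?f n i p = ?f n' j p}):sets GP"
  by (intro sets.countable_UN'' sets.Int l e) simp_all
 moreover have "(\<Union>i. \<Union>j. {p:space GP. i < length (snd p n)} Int {p:space GP. j < length (snd p n')} Int {p:space GP. ?f n i p = ?f n' j p})
  = {p:space GP. set (snd p n) Int set (snd p n') ~= {}}"
 proof (rule set_eqI)
  fix p :: "'x measure \<times> (nat => 'x list)"
  have "set (snd p n) Int set (snd p n') ~= {} \<longleftrightarrow> (EX i j. i < length (snd p n) & j < length (snd p n') & snd p n!i = snd p n'!j)"
   unfolding ex_in_conv[symmetric] by (auto simp: in_set_conv_nth) metis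
  thus "p:(\<Union>i. \<Union>j. {p:space GP. i < length (snd p n)} Int {p:space GP. j < length (snd p n')} Int {p:space GP. ?f n i p = ?f n' j p})
   \<longleftrightarrow> p:{p:space GP. set (snd p n) Int set (snd p n') ~= {}}" by auto
 qed
 ultimately show ?thesis by simp
qed

lemma AE_disjoint: "AE p in P. ALL n n'. n ~= n' --> set (snd p n) Int set (snd p n') = {}"
 unfolding AE_all_countable
proof (intro allI)
 fix n n' :: nat
 show "AE p in P. n ~= n' --> set (snd p n) Int set (snd p n') = {}"
 proof (cases "n = n'")
  case False
  let ?A = "{p:space GP. set (snd p n) Int set (snd p n') ~= {}}"
  have "AE p in P. p ~: ?A"
  proof (rule AE_P_resample_null[OF meet_sets, of n])
   fix p assume p: "p:space GP"
   \<comment> \<open>The fresh cluster \<open>n\<close> is tested against the finitely many points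
     of the fixed cluster \<open>n'\<close>, a set that its law does not charge.\<close>
   hence "{ys. (fst p, (snd p)(n:=ys)):?A} = hits (set (snd p n'))"
    using False by (simp add: space_GP hits_def)
   thus "em (et (pt n (fst p))) {ys. (fst p, (snd p)(n:=ys)):?A} = 0"
    by (simp add: eta_hits_finite)
  qed
  thus ?thesis by (rule AE_mp) (auto intro!: AE_I2)
 qed simp
qed

text \<open>The event of full measure on which the projection is proper: local finiteness comes from
  \<open>fin_hits\<close>, absence of multiple points from the last two conditions.\<close>

definition good :: "'x measure \<times> (nat => 'x list) => bool" where
 "good p \<longleftrightarrow> fst p:space Gamma_X & fin_hits p & (ALL n. distinct (snd p n)) &
   (ALL n n'. n ~= n' --> set (snd p n) Int set (snd p n') = {})"

lemma AE_good: "AE p in P. good p"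
 using AE_fin_hits AE_distinct AE_disjoint AE_space[of P]
 by eventually_elim (simp add: good_def space_GP)

definition slots :: "'x measure \<times> (nat => 'x list) => (nat \<times> nat) set" where
 "slots p = Sigma {n. val n (fst p)} (%n. {..<length (snd p n)})"

definition slot_pt :: "'x measure \<times> (nat => 'x list) => nat \<times> nat => 'x" where
 "slot_pt p = (%(n, i). snd p n!i)"

lemma Sig_point_sum: "Sig p = point_sum euclidean (slots p) (slot_pt p)"
 unfolding Sig_def proj_p_def slots_def slot_pt_def by (rule superpose_point_sum) simp

lemma slots_hits_finite:
 assumes "fin_hits p" "compact C"
 shows "finite {s:slots p. slot_pt p s:C}"
proof (rule finite_subset)
 show "{s:slots p. slot_pt p s:C} <= Sigma {n. val n (fst p) & snd p n:hits C} (%n. {..<length (snd p n)})"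
  by (auto simp: slots_def slot_pt_def hits_iff)
 show "finite (Sigma {n. val n (fst p) & snd p n:hits C} (%n. {..<length (snd p n)}))"
  by (intro finite_SigmaI finite_hits_compact[OF assms]) simp
qed

lemma good_inj: "good p ==> inj_on (slot_pt p) (slots p)"
proof (rule inj_onI)
 fix s t assume g: "good p" and s: "s:slots p" and t: "t:slots p" and eq: "slot_pt p s = slot_pt p t"
 obtain n i m j where st: "s = (n, i)" "t = (m, j)" by (cases s, cases t) auto
 have i: "i < length (snd p n)" and j: "j < length (snd p m)" using s t by (simp_all add: st slots_def)
 have e: "snd p n!i = snd p m!j" using eq by (simp add: st slot_pt_def)
 have "n = m"
 proof (rule ccontr)
  assume "n ~= m"
  hence "set (snd p n) Int set (snd p m) = {}" using g unfolding good_def by blast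
  thus False using nth_mem[OF i] nth_mem[OF j] e by auto
 qed
 moreover have "distinct (snd p n)" using g unfolding good_def by blast
 ultimately show "s = t" using i j e unfolding st by (simp add: nth_eq_iff_index_eq)
qed

lemma good_Sig: "good p ==> Sig p:space Gamma_X"
 unfolding Sig_point_sum space_count_algebra
proof (rule point_sum_proper)
 assume g: "good p"
 show "inj_on (slot_pt p) (slots p)" by (rule good_inj[OF g])
 show "finite {s:slots p. slot_pt p s:C}" if "compactin euclidean C" for C
  using slots_hits_finite[of p C] g that by (simp add: good_def)
qed simp_all

text \<open>No point is counted twice, so the sum over the set of points equals the sum over
  clusters and slots; the compact set leaves finitely many terms.\<close>

lemma pairing_Sig:
 assumes g: "good p" and C: "compact C" "!!x. x ~: C ==> u x = 0"
 shows "pairing u (Sig p) = tot u p"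
proof -
 let ?N = "{n. val n (fst p) & snd p n:hits C}"
 have fh: "fin_hits p" using g by (simp add: good_def)
 have pts: "points (Sig p) = slot_pt p ` slots p"
  unfolding Sig_point_sum by (rule points_point_sum[OF singletons_eu]) simp
 have "pairing u (Sig p) = infsum (u o slot_pt p) (slots p)"
  unfolding pairing_def pts by (rule infsum_reindex[OF good_inj[OF g]])
 also have "... = sum (u o slot_pt p) (Sigma ?N (%n. {..<length (snd p n)}))"
 proof (rule infsum_finite_support)
  show "finite (Sigma ?N (%n. {..<length (snd p n)}))"
   by (intro finite_SigmaI finite_hits_compact[OF fh C(1)]) simp
  show "Sigma ?N (%n. {..<length (snd p n)}) <= slots p" by (auto simp: slots_def)
  show "(u o slot_pt p) s = 0" if "s:slots p-Sigma ?N (%n. {..<length (snd p n)})" for s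
   using that C(2) by (auto simp: slots_def slot_pt_def hits_iff)
 qed
 also have "... = (\<Sum>n\<in>?N. \<Sum>i<length (snd p n). u (snd p n!i))"
  by (subst sum.Sigma) (simp_all add: finite_hits_compact[OF fh C(1)] slot_pt_def o_def case_prod_beta')
 also have "... = tot u p"
  unfolding tot_def using vsum_summable(2)[OF fh C(1), of "%z. tsum u (snd z)"] tsum_outside[of C u] C(2)
  by (simp add: tsum_def)
 finally show ?thesis .
qed

definition empty_conf :: "'x measure" where
 "empty_conf = point_sum euclidean ({} :: nat set) (%_. undefined)"

lemma empty_conf: "empty_conf:space Gamma_X"
 unfolding empty_conf_def space_count_algebra by (rule point_sum_proper) simp_all

text \<open>A measurable retraction onto the proper configurations. It turns the projection into a
  total map to \<open>Gamma_X\<close>; along \<open>Sig\<close> the default value occurs on a null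
  set only.\<close>

definition proper_part :: "'x measure => 'x measure" where
 "proper_part ga = (if ga:space Gamma_X then ga else empty_conf)"

lemma measurable_proper_part: "proper_part:Gamma_all euclidean ->M Gamma_X"
proof (rule count_algebraI)
 show "proper_part ga:proper_configurations euclidean" for ga
  using empty_conf by (simp add: proper_part_def)
 fix B :: "'x set" assume B: "B:sets (borel_of euclidean)"
 have "(%ga. if ga:proper_configurations euclidean then em ga B else em empty_conf B):bm (Gamma_all (euclidean :: 'x topology))"
 proof (rule measurable_If)
  have "{ga:space (Gamma_all (euclidean :: 'x topology)). ga:proper_configurations euclidean} = proper_configurations euclidean"
   using proper_configuration by auto
  thus "{ga:space (Gamma_all (euclidean :: 'x topology)). ga:proper_configurations euclidean}:sets (Gamma_all euclidean)"
   using proper_sets by simp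
 qed (use B in \<open>simp_all add: count_em_meas\<close>)
 moreover have "em (proper_part ga) B = (if ga:proper_configurations euclidean then em ga B else em empty_conf B)" for ga
  by (simp add: proper_part_def)
 ultimately show "(%ga. em (proper_part ga) B):bm (Gamma_all euclidean)" by simp
qed

abbreviation Sp :: "'x measure \<times> (nat => 'x list) => 'x measure" where
 "Sp p \<equiv> proper_part (Sig p)"

lemma measurable_Sp: "Sp:P ->M Gamma_X"
proof -
 have "Sp:GP ->M Gamma_X" by (rule meas_comp[OF measurable_Sig measurable_proper_part])
 thus ?thesis by (simp cong: meas_cong)
qed

lemma good_Sp: "good p ==> Sp p = Sig p"
 using good_Sig by (simp add: proper_part_def)

abbreviation mucl :: "'x measure measure" where "mucl \<equiv> cluster_measure mu et"

lemma sets_restrict_Gamma: "sets (restrict_space (Gamma_all (euclidean :: 'x topology)) (space Gamma_X)) = sets Gamma_X"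
proof -
 let ?R = "restrict_space (Gamma_all (euclidean :: 'x topology)) (space Gamma_X)"
 have sp: "space ?R = space Gamma_X" using proper_configuration by (auto simp: space_restrict_space)
 have 1: "id:Gamma_X ->M ?R"
  by (intro measurable_restrict_space2 count_algebraI) (auto simp: proper_configuration count_em_meas)
 have 2: "id:?R ->M Gamma_X"
 proof (rule count_algebraI)
  show "id ga:proper_configurations euclidean" if "ga:space ?R" for ga :: "'x measure" using that unfolding sp by simp
  show "(%ga. em (id ga) B):bm ?R" if "B:sets (borel_of euclidean)" for B :: "'x set"
   using that by (intro measurable_restrict_space1) (simp add: count_em_meas)
 qed
 show ?thesis
 proof (intro equalityI subsetI)
  fix A assume A: "A:sets ?R"
  hence "id -` A Int space Gamma_X:sets Gamma_X" by (rule measurable_sets[OF 1])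
  moreover have "id -` A Int space Gamma_X = A" using sets.sets_into_space[OF A] unfolding sp by auto
  ultimately show "A:sets Gamma_X" by simp
 next
  fix A :: "'x measure set" assume A: "A:sets Gamma_X"
  hence "id -` A Int space ?R:sets ?R" by (rule measurable_sets[OF 2])
  moreover have "id -` A Int space ?R = A" using sets.sets_into_space[OF A] unfolding sp by auto
  ultimately show "A:sets ?R" by simp
 qed
qed

text \<open>\<open>cluster_measure\<close> restricts a law on all configurations. As
  \<open>Sig p\<close> is almost surely proper, the restriction loses no mass and is the law of
  \<open>Sp\<close>.\<close>

lemma mucl_eq: "mucl = distr P Gamma_X Sp"
proof (rule measure_eqI)
 let ?GA = "Gamma_all (euclidean :: 'x topology)"
 have SigP: "Sig:P ->M ?GA" using measurable_Sig by (simp cong: meas_cong)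
 have propr: "space Gamma_X:sets ?GA" using proper_sets by simp
 have s: "sets mucl = sets Gamma_X"
  unfolding cluster_measure_eq sets_restrict_Gamma[symmetric] by (intro sets_restrict_space_cong) simp
 thus "sets mucl = sets (distr P Gamma_X Sp)" by simp
 fix A assume "A:sets mucl"
 hence A: "A:sets Gamma_X" using s by simp
 hence As: "A <= space Gamma_X" by (rule sets.sets_into_space)
 have "A:sets (restrict_space ?GA (space Gamma_X))" using A sets_restrict_Gamma by simp
 then obtain A' where "A = space Gamma_X Int A'" "A':sets ?GA" unfolding sets_restrict_space by (rule imageE)
 hence AG: "A:sets ?GA" using propr by (simp only: sets.Int)
 have "em mucl A = em (distr P ?GA Sig) A"
  unfolding cluster_measure_eq using As
  by (intro emeasure_restrict_space) (simp_all only: space_distr sets_distr, intro sets.Int propr sets.top)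
 also have "... = em P (Sig -` A Int space P)" by (rule emeasure_distr[OF SigP AG])
 also have "... = em P (Sp -` A Int space P)"
 proof (rule emeasure_eq_AE)
  show "AE p in P. p:Sig -` A Int space P \<longleftrightarrow> p:Sp -` A Int space P"
   using AE_good by eventually_elim (simp add: good_Sp)
 qed (use measurable_sets[OF SigP AG] measurable_sets[OF measurable_Sp A] in simp_all)
 also have "... = em (distr P Gamma_X Sp) A" by (rule emeasure_distr[OF measurable_Sp A, symmetric])
 finally show "em mucl A = em (distr P Gamma_X Sp) A" .
qed

section \<open>Integrability of sums over clusters\<close>

lemma vsum_integrable:
 assumes v: "v:Vect0 M" and u: "u:bm ZB" "!!z. abs (u z) <= C*majorant v z" "C >= 0"
  and u0: "!!x ys. ys ~: hits (supp v) ==> u (x, ys) = 0"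
 shows "integrable P (vsum u)"
proof -
 let ?m = "%p n. if val n (fst p) then ennreal (majorant v (pt n (fst p), snd p n)) else 0"
 have "(NI P (%p. ennreal (norm (vsum u p)))) <= (NI P (%p. ennreal C*(\<Sum>n. ?m p n)))"
 proof (rule nn_integral_mono_AE)
  show "AE p in P. ennreal (norm (vsum u p)) <= ennreal C*(\<Sum>n. ?m p n)"
   using AE_fin_hits
  proof eventually_elim
   case (elim p)
   let ?N = "{n. val n (fst p) & snd p n:hits (supp v)}"
   have eq: "vsum u p = (\<Sum>n\<in>?N. u (pt n (fst p), snd p n))"
    by (rule vsum_summable(2)[OF elim cpt_supp[OF v]]) (rule u0)
   have "norm (vsum u p) <= (\<Sum>n\<in>?N. C*majorant v (pt n (fst p), snd p n))"
    unfolding eq using u(2) by (intro order_trans[OF norm_sum] sum_mono) simp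
   hence "ennreal (norm (vsum u p)) <= (\<Sum>n\<in>?N. ennreal (C*majorant v (pt n (fst p), snd p n)))"
    using majorant_nonneg u(3) by (subst sum_ennreal) (simp_all add: ennreal_leI)
   also have "... = ennreal C*(\<Sum>n\<in>?N. ?m p n)"
    using majorant_nonneg u(3) unfolding sum_distrib_left by (intro sum.cong) (simp_all add: ennreal_mult)
   also have "... <= ennreal C*(\<Sum>n. ?m p n)"
    by (intro mult_left_mono sum_le_suminf finite_hits_compact[OF elim cpt_supp[OF v]]) simp_all
   finally show ?case .
  qed
 qed
 also have "... = ennreal C*(NI P (%p. (\<Sum>n. ?m p n)))"
 proof (rule nn_integral_cmult)
  have mm: "(%z. ennreal (majorant v z)):bm ZB" using majorant_measurable[OF v] by simp
  have "(%p. \<Sum>n. ?m p n):bm GP" using mm by measurable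
  thus "(%p. \<Sum>n. ?m p n):bm P" by (simp cong: meas_cong)
 qed
 also have "... < \<infinity>" using P_majorant_finite[OF v] by (simp add: ennreal_mult_less_top)
 finally have "(NI P (%p. ennreal (norm (vsum u p)))) < \<infinity>" .
 moreover have "vsum u:bm P" using vsum_measurable[OF u(1)] by (simp cong: meas_cong)
 ultimately show ?thesis unfolding integrable_iff_bounded by blast
qed

lemma beta_vsum_integrable: "v:Vect0 M ==> integrable P (vsum (beta_z v))"
 by (rule vsum_integrable[where C = 1]) (auto simp: beta_z_measurable beta_outside, simp add: majorant_def beta_z_def)

lemma tot_deriv_integrable:
 assumes v: "v:Vect0 M" and ph: "ph:test_functions M"
 shows "integrable P (tot (%y. differential M ph y (v y)))"
proof -
 let ?d = "%y. differential M ph y (v y)"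
 obtain B where B: "B >= 0" "!!y. abs (?d y) <= B*Ind (supp v) y" using differential_bounded[OF ph v] by blast
 have d0: "?d y = 0" if "y ~: supp v" for y using B(2)[of y] that by simp
 show ?thesis unfolding tot_def[abs_def]
 proof (rule vsum_integrable[OF v _ _ B(1)])
  show "(%z. tsum ?d (snd z)):bm ZB"
   by (rule meas_comp[OF measurable_snd measurable_tsum[OF borel_diff_field[OF ph v]]])
  show "abs (tsum ?d (snd z)) <= B*majorant v z" for z
  proof -
   have "B*(Ind (hits (supp v)) (snd z)*real (length (snd z))) <= B*majorant v z"
    using B(1) by (intro mult_left_mono) (simp_all add: majorant_def)
   thus ?thesis using tsum_bound[OF B(2,1), of "snd z"] by linarith
  qed
  show "tsum ?d (snd (x, ys)) = 0" if "ys ~: hits (supp v)" for x ys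
   using tsum_outside[OF d0 that] by simp
 qed
qed

section \<open>The adjoint of the projection\<close>

lemma measurable_proj_q: "proj_q:Gamma Z_topology ->M Gamma_all (euclidean :: 'x topology)"
proof (rule count_algebraI)
 fix xi :: "('x \<times> 'x list) measure" assume "xi:space (Gamma Z_topology)"
 hence xi: "xi:proper_configurations Z_topology" by simp
 have "countable (points xi)" by (rule config_points(2)[OF borel_singletons_Z xi])
 thus "proj_q xi:configurations euclidean"
  unfolding proj_q_def by (rule superpose_in_configurations) (auto simp: proj_p_configuration)
next
 fix B :: "'x set" assume B': "B:sets (borel_of euclidean)"
 let ?e = "%z. em (proj_p (snd z)) B :: ennreal"
 have "?e:bm ZB"
  by (rule meas_comp[OF meas_comp[OF measurable_snd measurable_proj_p] count_em_meas[OF B']])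
 hence e: "?e:bm (borel_of Z_topology)" by (simp add: meas_cong[OF sets_Z refl])
 have "(%xi. integral\<^sup>N xi ?e):bm (Gamma Z_topology)"
  by (rule measurable_count_nn_integral[OF e]) (rule sets_configuration[OF proper_configuration])
 moreover have "integral\<^sup>N xi ?e = em (proj_q xi) B" if "xi:space (Gamma Z_topology)" for xi
 proof -
  have "integral\<^sup>N xi ?e = (NI (Cnt (points xi)) (%z. ?e z))"
   using that by (intro nn_integral_proper[OF borel_singletons_Z _ e]) simp
  also have "... = em (proj_q xi) B"
   unfolding proj_q_def
   by (subst emeasure_superpose) (use B' in \<open>simp_all add: case_prod_beta' sets_configuration[OF proj_p_configuration] borel_of_eu\<close>)
  finally show ?thesis .
 qed
 ultimately show "(%xi. em (proj_q xi) B):bm (Gamma Z_topology)"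
  by (rule measurable_cong[THEN iffD1, rotated])
qed

lemma B_hat_pairing: "B_hat M h v = pairing (beta_z v)"
 unfolding B_hat_def[abs_def] pairing_def[abs_def] beta_z_def[abs_def] case_prod_beta' ..

lemma B_hat_measurable: "v:Vect0 M ==> B_hat M h v:bm (Gamma Z_topology)"
 unfolding B_hat_pairing
 by (rule measurable_pairing[OF borel_singletons_Z]) (simp add: meas_cong[OF sets_Z refl] beta_z_measurable)

lemma B_hat_Xi:
 assumes g: "good p" and v: "v:Vect0 M"
 shows "B_hat M h v (Xi p) = vsum (beta_z v) p"
proof -
 have ga: "fst p:space Gamma_X" and fh: "fin_hits p" using g by (simp_all add: good_def)
 let ?N = "{n. val n (fst p) & snd p n:hits (supp v)}"
 have "B_hat M h v (Xi p) = infsum (beta_z v o (%n. (pt n (fst p), snd p n))) {n. val n (fst p)}"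
  unfolding B_hat_pairing pairing_def points_Xi by (rule infsum_reindex[OF inj_Xi[OF ga]])
 also have "... = sum (beta_z v o (%n. (pt n (fst p), snd p n))) ?N"
  by (rule infsum_finite_support) (use finite_hits_compact[OF fh cpt_supp[OF v]] beta_outside[OF v] in auto)
 also have "... = vsum (beta_z v) p"
  using vsum_summable(2)[where u = "beta_z v", OF fh cpt_supp[OF v] beta_outside[OF v]] by simp
 finally show ?thesis .
qed

text \<open>Moves the integral in the definition of \<open>I_star\<close> from marked configurations
  to \<open>P\<close>, where the marked configurations with improper projection form a null
  set.\<close>

lemma hat_integral_eq:
 assumes v: "v:Vect0 M" and F: "F:bm Gamma_X"
 shows "(LINT xi:{xi:space (hat_measure mu et). proj_q xi:space Gamma_X}|hat_measure mu et. F (proj_q xi)*B_hat M h v xi)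
  = (LI P (%p. F (Sp p) * vsum (beta_z v) p))"
proof -
 let ?H = "distr P (Gamma Z_topology) Xi" and ?A = "{xi:space (Gamma (Z_topology :: ('x \<times> 'x list) topology)). proj_q xi:space Gamma_X}"
 let ?f = "%xi. Ind ?A xi*(F (proper_part (proj_q xi))*B_hat M h v xi)"
 have XiP: "Xi:P ->M Gamma Z_topology" using measurable_Xi by (simp cong: meas_cong)
 have A: "?A:sets (Gamma Z_topology)"
 proof -
  have m: "proj_q -` proper_configurations euclidean Int space (Gamma Z_topology):sets (Gamma (Z_topology :: ('x \<times> 'x list) topology))"
   by (rule measurable_sets[OF measurable_proj_q proper_sets])
  have eq: "proj_q -` proper_configurations euclidean Int space (Gamma Z_topology) = ?A" by auto
  show ?thesis using m unfolding eq .
 qed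
 have fm: "?f:bm (Gamma Z_topology)"
  by (intro borel_measurable_times borel_measurable_indicator A B_hat_measurable v
    meas_comp[OF meas_comp[OF measurable_proj_q measurable_proper_part] F])
 have "(LINT xi:{xi:space (hat_measure mu et). proj_q xi:space Gamma_X}|hat_measure mu et. F (proj_q xi)*B_hat M h v xi) = (LI ?H (%xi. ?f xi))"
  unfolding set_lebesgue_integral_def hat_measure_eq space_distr
  by (intro integral_congB refl) (auto simp: indicator_def proper_part_def)
 also have "... = (LI P (%p. ?f (Xi p)))" by (rule integral_distr[OF XiP fm])
 also have "... = (LI P (%p. F (Sp p) * vsum (beta_z v) p))"
 proof (rule integral_cong_AE)
  show "(%p. ?f (Xi p)):bm P" by (rule meas_comp[OF XiP fm])
  show "(%p. F (Sp p) * vsum (beta_z v) p):bm P"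
   by (intro borel_measurable_times meas_comp[OF measurable_Sp F] borel_measurable_integrable beta_vsum_integrable v)
  show "AE p in P. ?f (Xi p) = F (Sp p) * vsum (beta_z v) p"
   using AE_good
  proof eventually_elim
   case (elim p)
   have ga: "fst p:space Gamma_X" using elim by (simp add: good_def)
   have "Xi p:?A" using Xi_proper[OF ga] good_Sig[OF elim] proj_q_Xi[OF ga] by simp
   thus ?case using proj_q_Xi[OF ga] B_hat_Xi[OF elim v] by simp
  qed
 qed
 finally show ?thesis .
qed

lemma mucl_measurable: "F:bm mucl \<longleftrightarrow> F:bm Gamma_X"
 unfolding mucl_eq by simp

text \<open>\<open>I_star\<close> is chosen by \<open>SOME\<close>. The density of
  \<open>pushforward_density\<close> is a witness, so the chosen function has the defining property
  whichever one it is.\<close>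

lemma B_cl_props:
 fixes F :: "'x measure => real"
 assumes v: "v:Vect0 M"
 shows "integrable mucl (B_cl M mu et h v)"
  and "F:bm Gamma_X ==> (!!ga. ga:space Gamma_X ==> abs (F ga) <= C) ==>
   (LI mucl (%ga. F ga*B_cl M mu et h v ga)) = (LI P (%p. F (Sp p) * vsum (beta_z v) p))"
proof -
 let ?Q = "%H :: 'x measure => real. integrable mucl H &
   (ALL F:bm mucl. (EX C. AE ga in mucl. abs (F ga) <= C) -->
    (LI mucl (%ga. F ga*H ga)) =
    (LINT xi:{xi:space (hat_measure mu et). proj_q xi:space Gamma_X}|hat_measure mu et. F (proj_q xi)*B_hat M h v xi))"
 obtain H :: "'x measure => real" where H: "integrable mucl H" "ALL F:bm Gamma_X. (EX C. AE ga in mucl. abs (F ga) <= C) -->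
    (LI mucl (%ga. F ga*H ga)) = (LI P (%p. F (Sp p) * vsum (beta_z v) p))"
  using pushforward_density[OF prob_P measurable_Sp beta_vsum_integrable[OF v]] unfolding mucl_eq[symmetric] by (elim exE conjE)
 have "?Q H"
 proof (intro conjI ballI impI H(1))
  fix F :: "'x measure => real" assume F: "F:bm mucl" and b: "EX C. AE ga in mucl. abs (F ga) <= C"
  have F': "F:bm Gamma_X" using F by (simp add: mucl_measurable)
  show "(LI mucl (%ga. F ga*H ga)) =
    (LINT xi:{xi:space (hat_measure mu et). proj_q xi:space Gamma_X}|hat_measure mu et. F (proj_q xi)*B_hat M h v xi)"
   unfolding hat_integral_eq[OF v F'] using H(2) F' b by blast
 qed
 hence Q: "?Q (B_cl M mu et h v)" unfolding B_cl_def I_star_def by (rule someI[of ?Q])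
 thus "integrable mucl (B_cl M mu et h v)" by (rule conjunct1)
 assume F: "F:bm Gamma_X" and b: "!!ga. ga:space Gamma_X ==> abs (F ga) <= C"
 have F': "F:bm mucl" using F by (simp add: mucl_measurable)
 have "AE ga in mucl. abs (F ga) <= C" by (rule AE_I2) (simp add: b mucl_eq)
 hence "EX C. AE ga in mucl. abs (F ga) <= C" by (rule exI)
 with Q F' show "(LI mucl (%ga. F ga*B_cl M mu et h v ga)) = (LI P (%p. F (Sp p) * vsum (beta_z v) p))"
  unfolding hat_integral_eq[OF v F, symmetric] by blast
qed

end

section \<open>The cluster measure\<close>

context riemann
begin

lemma fin_pts:
 fixes ga :: "'x measure"
 assumes "ga:space Gamma_X" "compact C"
 shows "finite (points ga Int C)"
 using assms compact_imp_closed[of C]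
 by (intro finite_points_compact[OF singletons_eu]) (simp_all add: borel_of_eu)

lemma pairing_finite:
 fixes ga :: "'x measure"
 assumes "ga:space Gamma_X" "compact C" "!!x. x ~: C ==> g x = 0"
 shows "pairing g ga = (\<Sum>x\<in>points ga Int C. g x)"
 unfolding pairing_def by (rule infsum_finite_support[OF fin_pts[OF assms(1,2)]]) (use assms(3) in auto)

section \<open>Moving one point of a configuration\<close>

lemma move_point:
 fixes ga :: "'x measure"
 assumes ga: "ga:space Gamma_X"
 shows "move_point ga x y:space Gamma_X" "points (move_point ga x y) = (points ga-{x}) Un {y}"
proof -
 have ga': "ga:proper_configurations euclidean" using ga by simp
 have c: "countable (points ga)" by (rule config_points(2)[OF singletons_eu ga'])
 show "move_point ga x y:space Gamma_X"
  unfolding move_point_def space_count_algebra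
 proof (rule point_sum_proper)
  show "countable (points ga-{x} Un {y})" using c by simp
  fix C :: "'x set" assume "compactin euclidean C"
  hence "finite (points ga Int C)" using fin_pts[OF ga] by simp
  hence "finite (insert y (points ga Int C))" by simp
  thus "finite {s:points ga-{x} Un {y}. s:C}" by (rule rev_finite_subset) auto
 qed simp_all
 show "points (move_point ga x y) = (points ga-{x}) Un {y}"
  unfolding move_point_def by (subst points_point_sum[OF singletons_eu]) simp_all
qed

lemma move_point_self:
 fixes ga :: "'x measure"
 assumes ga: "ga:space Gamma_X" and x: "x:points ga"
 shows "move_point ga x x = ga"
proof -
 have "(points ga-{x}) Un {x} = points ga" using x by blast
 thus ?thesis
  using config_points(1)[OF singletons_eu, of ga] ga by (simp add: move_point_def)
qed

text \<open>Local finiteness leaves finitely many other points in a compact ball around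
  \<open>x\<close>, and removing them keeps the neighbourhood open.\<close>

lemma isolated_point:
 fixes ga :: "'x measure"
 assumes ga: "ga:space Gamma_X"
 obtains U where "open U" "x:U" "U Int (points ga-{x}) = {}"
proof -
 obtain r where r: "r > 0" "cball (snd (ch x) x) r <= img (ch x)" "cnbhd x r <= UNIV"
  by (rule small_radius[OF open_UNIV UNIV_I])
 note n = nbhd[OF r(1,2)]
 let ?F = "points ga Int cnbhd x r-{x}"
 have "finite ?F" using fin_pts[OF ga n(1)] by simp
 hence "open (onbhd x r-?F)" using n(2) by (intro open_Diff finite_imp_closed)
 moreover have "x:onbhd x r-?F" using n(3) by simp
 moreover have "(onbhd x r-?F) Int (points ga-{x}) = {}" using n(4) by blast
 ultimately show thesis by (rule that)
qed

text \<open>\<open>move_point\<close> forms a union of sets, so a point moved onto another one would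
  merge with it; the premise on \<open>y\<close> excludes this and holds near \<open>x\<close> by
  \<open>isolated_point\<close>.\<close>

lemma pairing_move:
 assumes ga: "ga:space Gamma_X" and ph: "ph:test_functions M" and x: "x:points ga" and y: "y ~: points ga-{x}"
 shows "pairing ph (move_point ga x y) = (pairing ph ga-ph x)+ph y"
proof -
 let ?C = "supp ph Un {x, y}"
 have C: "compact ?C" by (rule compact_Un[OF compact_supp_test[OF ph] finite_imp_compact]) simp
 have z: "ph w = 0" if "w ~: ?C" for w using that supp_outside by auto
 have f: "finite (points ga Int ?C)" by (rule fin_pts[OF ga C])
 have e: "pairing ph ga = (\<Sum>w\<in>points ga Int ?C. ph w)" by (rule pairing_finite[OF ga C]) (rule z)
 have "pairing ph (move_point ga x y) = (\<Sum>w\<in>points (move_point ga x y) Int ?C. ph w)"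
  by (rule pairing_finite[OF move_point(1)[OF ga] C]) (rule z)
 also have "... = (\<Sum>w\<in>insert y (points ga Int ?C-{x}). ph w)"
  unfolding move_point(2)[OF ga] by (rule sum.cong) auto
 also have "... = ph y+(\<Sum>w\<in>points ga Int ?C-{x}. ph w)" using f y by (intro sum.insert) auto
 also have "(\<Sum>w\<in>points ga Int ?C-{x}. ph w) = pairing ph ga-ph x"
  unfolding e using sum.remove[OF f, of x ph] x by simp
 finally show ?thesis by simp
qed

section \<open>Cylinder functions on the configuration space\<close>

text \<open>The outer function is taken from \<open>C1b\<close>, for which stability under products
  has been established; the products F1 F2 G_j must be cylinder functions again.\<close>

definition cyl_rep :: "('x measure => real) => nat => (real list => real) => (nat => 'x => real) => bool" where
 "cyl_rep F k f ph \<longleftrightarrow> C1b k f & (ALL l<k. ph l:test_functions M) &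
   (ALL ga:space Gamma_X. F ga = f (map (%l. pairing (ph l) ga) [0..<k]))"

definition cyl :: "('x measure => real) => bool" where
 "cyl F \<longleftrightarrow> (EX k f ph. cyl_rep F k f ph)"

lemma FC_rep: "cyl F ==> (!!k f ph. cyl_rep F k f ph ==> thesis) ==> thesis"
 unfolding cyl_def by blast

lemma cylI: "cyl_rep F k f ph ==> cyl F"
 unfolding cyl_def by blast

lemma FC_cyl:
 assumes "F:FC M"
 shows "cyl F"
proof -
 obtain f phs where r: "Cb_smooth (length phs) f" "set phs <= test_functions M"
  "ALL ga:space Gamma_X. F ga = f (map (%ph. pairing ph ga) phs)" using assms unfolding FC_def by blast
 have "map (%ph. pairing ph ga) phs = map (%l. pairing (phs!l) ga) [0..<length phs]" for ga
  by (rule nth_equalityI) simp_all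
 hence "cyl_rep F (length phs) f (%l. phs!l)" using r unfolding cyl_rep_def by (auto intro: nth_mem C1b_Cb_smooth)
 thus ?thesis unfolding cyl_def by blast
qed

lemma cyl_mult:
 assumes F: "cyl F1" "cyl F2"
 shows "cyl (%ga. F1 ga*F2 ga)"
proof -
 obtain k f ph where r1: "cyl_rep F1 k f ph" by (rule FC_rep[OF F(1)])
 obtain m g ps where r2: "cyl_rep F2 m g ps" by (rule FC_rep[OF F(2)])
 let ?\<chi> = "%l. if l < k then ph l else ps (l-k)"
 let ?f = "%as. f (map (%l. as!(0+l)) [0..<k])*g (map (%l. as!(k+l)) [0..<m])"
 have "cyl_rep (%ga. F1 ga*F2 ga) (k+m) ?f ?\<chi>"
  unfolding cyl_rep_def
 proof (intro conjI allI impI ballI)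
  show "C1b (k+m) ?f" using r1 r2 by (intro C1b_mult) (simp_all add: cyl_rep_def)
  show "?\<chi> l:test_functions M" if "l < k+m" for l using r1 r2 that by (auto simp: cyl_rep_def)
  fix ga :: "'x measure" assume ga: "ga:space Gamma_X"
  have "map (%l. map (%l. pairing (?\<chi> l) ga) [0..<k+m]!(0+l)) [0..<k] = map (%l. pairing (ph l) ga) [0..<k]"
   by (rule nth_equalityI) simp_all
  moreover have "map (%l. map (%l. pairing (?\<chi> l) ga) [0..<k+m]!(k+l)) [0..<m] = map (%l. pairing (ps l) ga) [0..<m]"
   by (rule nth_equalityI) simp_all
  ultimately show "F1 ga*F2 ga = ?f (map (%l. pairing (?\<chi> l) ga) [0..<k+m])"
   using r1 r2 ga by (simp only: cyl_rep_def)
 qed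
 thus ?thesis unfolding cyl_def by blast
qed

text \<open>Differentiation at \<open>x\<close> is local, and for \<open>y\<close> near
  \<open>x\<close> moving the point changes each pairing by \<open>ph l y\<close> minus
  \<open>ph l x\<close>. The formula for one varying slot then applies with the rest of the pairing
  as constant.\<close>

lemma FC_differential:
 assumes F: "cyl_rep F k f ph" and ga: "ga:space Gamma_X" and x: "x:points ga"
 shows "mdiff (%y. F (move_point ga x y)) x"
  "differential M (%y. F (move_point ga x y)) x u =
    (\<Sum>l<k. list_grad f (map (%l. pairing (ph l) ga) [0..<k])!l*differential M (ph l) x u)"
proof -
 obtain U where U: "open U" "x:U" "U Int (points ga-{x}) = {}" by (rule isolated_point[OF ga])
 let ?c = "%l. pairing (ph l) ga-ph l x"
 let ?g = "%y. f (map (%l. ?c l+ph l y) [0..<k])"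
 have f: "C1b k f" and ph: "!!l. l < k ==> ph l:test_functions M" using F by (auto simp: cyl_rep_def)
 have md: "mdiff (ph l) x" if "l < k" for l by (rule test_function_mdiff[OF ph[OF that]])
 have eq: "F (move_point ga x y) = ?g y" if "y:U" for y
 proof -
  have "y ~: points ga-{x}" using that U(3) by blast
  hence m: "map (%l. pairing (ph l) (move_point ga x y)) [0..<k] = map (%l. ?c l+ph l y) [0..<k]"
   by (intro map_cong refl pairing_move[OF ga ph x]) simp_all
  have "F (move_point ga x y) = f (map (%l. pairing (ph l) (move_point ga x y)) [0..<k])"
   using F move_point(1)[OF ga, of x y] unfolding cyl_rep_def by blast
  thus ?thesis unfolding m .
 qed
 have g: "mdiff ?g x" by (rule differential_cylinder(1)[OF f md])
 show "mdiff (%y. F (move_point ga x y)) x" by (rule differential_local(1)[OF U(1,2) eq g])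
 have "differential M (%y. F (move_point ga x y)) x = differential M ?g x" by (rule differential_local(2)[OF U(1,2) eq g])
 moreover have "differential M ?g x u = (\<Sum>l<k. list_grad f (map (%l. ?c l+ph l x) [0..<k])!l*differential M (ph l) x u)"
  by (rule differential_cylinder(2)[OF f md])
 ultimately show "differential M (%y. F (move_point ga x y)) x u =
    (\<Sum>l<k. list_grad f (map (%l. pairing (ph l) ga) [0..<k])!l*differential M (ph l) x u)" by simp
qed

abbreviation cdiff :: "('x measure => real) => 'x measure => 'x => real ^ 'n => real" where
 "cdiff F ga x \<equiv> differential M (%y. F (move_point ga x y)) x"

lemma FC_mdiff: "cyl F ==> ga:space Gamma_X ==> x:points ga ==> mdiff (%y. F (move_point ga x y)) x"
 by (rule FC_rep) (auto intro: FC_differential(1))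

lemma config_deriv_finite:
 assumes F: "cyl F" and ga: "ga:space Gamma_X" and C: "compact C" "!!x. x:points ga ==> x ~: C ==> w x = 0"
 shows "config_deriv M F w ga = (\<Sum>x\<in>points ga Int C. cdiff F ga x (w x))"
proof -
 have "config_deriv M F w ga = (\<Sum>x\<in>points ga Int C. metric M x (config_grad M x F ga) (w x))"
  unfolding config_deriv_def
  by (rule infsum_finite_support[OF fin_pts[OF ga C(1)]]) (use C(2) metric_zero_right in auto)
 also have "... = (\<Sum>x\<in>points ga Int C. cdiff F ga x (w x))"
  unfolding config_grad_def
  by (intro sum.cong refl grad_metric differential_linear FC_mdiff[OF F ga]) simp
 finally show ?thesis .
qed

text \<open>Written through pairings, the derivative is visibly measurable in the configuration and
  can be matched with the sums over clusters on \<open>P\<close>.\<close>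

lemma config_deriv_rep:
 assumes F: "cyl_rep F k f ph" and ga: "ga:space Gamma_X" and v: "v:Vect0 M"
 shows "config_deriv M F v ga = (\<Sum>l<k. list_grad f (map (%l. pairing (ph l) ga) [0..<k])!l *
   pairing (Dv M (ph l) v) ga)"
proof -
 let ?g = "%l. list_grad f (map (%l. pairing (ph l) ga) [0..<k])!l"
 have cs: "compact (supp v)" by (rule cpt_supp[OF v])
 have "config_deriv M F v ga = (\<Sum>x\<in>points ga Int supp v. cdiff F ga x (v x))"
  by (rule config_deriv_finite[OF cylI[OF F] ga cs supp_outside])
 also have "... = (\<Sum>x\<in>points ga Int supp v. \<Sum>l<k. ?g l*differential M (ph l) x (v x))"
  by (intro sum.cong refl FC_differential(2)[OF F ga]) simp
 also have "... = (\<Sum>l<k. ?g l*(\<Sum>x\<in>points ga Int supp v. differential M (ph l) x (v x)))"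
  unfolding sum_distrib_left by (rule sum.swap)
 also have "... = (\<Sum>l<k. ?g l*pairing (Dv M (ph l) v) ga)"
 proof (rule sum.cong[OF refl])
  fix l assume "l:{..<k}"
  hence "ph l:test_functions M" using F by (simp add: cyl_rep_def)
  hence "differential M (ph l) y (v y) = 0" if "y ~: supp v" for y
   using supp_outside[OF that] differential_zero[OF test_function_mdiff] by simp
  from pairing_finite[OF ga cs this]
  show "?g l*(\<Sum>x\<in>points ga Int supp v. differential M (ph l) x (v x)) = ?g l*pairing (Dv M (ph l) v) ga"
   by simp
 qed
 finally show ?thesis .
qed

lemma config_deriv_mult:
 assumes F: "cyl F1" "cyl F2" and ga: "ga:space Gamma_X" and v: "v:Vect0 M"
 shows "config_deriv M (%ga. F1 ga*F2 ga) v ga = F1 ga*config_deriv M F2 v ga+config_deriv M F1 v ga*F2 ga"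
proof -
 have cs: "compact (supp v)" by (rule cpt_supp[OF v])
 have c: "config_deriv M F v ga = (\<Sum>x\<in>points ga Int supp v. cdiff F ga x (v x))" if "cyl F" for F
  by (rule config_deriv_finite[OF that ga cs]) (rule supp_outside)
 have "cdiff (%ga. F1 ga*F2 ga) ga x u = F1 ga*cdiff F2 ga x u+cdiff F1 ga x u*F2 ga" if "x:points ga" for x u
  using differential_mult(2)[OF FC_mdiff[OF F(1) ga that] FC_mdiff[OF F(2) ga that], of u]
  unfolding move_point_self[OF ga that] .
 thus ?thesis
  unfolding c[OF cyl_mult[OF F]] c[OF F(1)] c[OF F(2)] sum_distrib_left sum_distrib_right sum.distrib[symmetric]
  by (intro sum.cong refl) simp
qed

lemma config_deriv_linear:
 fixes k :: nat
 assumes F: "cyl F" and ga: "ga:space Gamma_X" and v: "!!j. j < k ==> v j:Vect0 M"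
  and w: "!!x. x:points ga ==> w x = (\<Sum>j<k. g j *R v j x)"
 shows "config_deriv M F w ga = (\<Sum>j<k. g j*config_deriv M F (v j) ga)"
proof -
 let ?C = "\<Union>j<k. supp (v j)"
 have C: "compact ?C" by (intro compact_UN cpt_supp[OF v]) simp_all
 have v0: "v j x = 0" if "j < k" "x ~: ?C" for j x using that supp_outside by blast
 have "config_deriv M F w ga = (\<Sum>x\<in>points ga Int ?C. cdiff F ga x (w x))"
 proof (rule config_deriv_finite[OF F ga C])
  fix x assume "x:points ga" "x ~: ?C"
  thus "w x = 0" unfolding w[OF \<open>x : points ga\<close>] using v0 by (intro sum.neutral) simp
 qed
 also have "... = (\<Sum>x\<in>points ga Int ?C. \<Sum>j<k. g j*cdiff F ga x (v j x))"
 proof (rule sum.cong[OF refl])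
  fix x assume "x:points ga Int ?C"
  hence x: "x:points ga" by simp
  have L: "linear (cdiff F ga x)" by (rule differential_linear[OF FC_mdiff[OF F ga x]])
  show "cdiff F ga x (w x) = (\<Sum>j<k. g j*cdiff F ga x (v j x))"
   unfolding w[OF x] linear_sum[OF L] linear_cmul[OF L] by simp
 qed
 also have "... = (\<Sum>j<k. g j*(\<Sum>x\<in>points ga Int ?C. cdiff F ga x (v j x)))"
  unfolding sum_distrib_left by (rule sum.swap)
 also have "... = (\<Sum>j<k. g j*config_deriv M F (v j) ga)"
 proof (rule sum.cong[OF refl])
  fix j assume "j:{..<k}"
  hence "config_deriv M F (v j) ga = (\<Sum>x\<in>points ga Int ?C. cdiff F ga x (v j x))"
   by (intro config_deriv_finite[OF F ga C] v0) simp_all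
  thus "g j*(\<Sum>x\<in>points ga Int ?C. cdiff F ga x (v j x)) = g j*config_deriv M F (v j) ga" by simp
 qed
 finally show ?thesis .
qed

lemma measurable_pairing_test: "g:bm borel ==> pairing g:bm (Gamma_X :: 'x measure measure)"
 by (rule measurable_pairing[OF singletons_eu]) (simp add: borel_of_eu)

lemma FC_measurable: "cyl F ==> F:bm Gamma_X"
proof (rule FC_rep)
 fix k f ph assume F: "cyl_rep F k f ph"
 have "(%ga. f (map (%l. pairing (ph l) ga) [0..<k])):bm (Gamma_X :: 'x measure measure)"
  by (rule C1b_measurable) (use F in \<open>auto simp: cyl_rep_def intro!: measurable_pairing_test borel_test\<close>)
 thus "F:bm Gamma_X"
  by (rule measurable_cong[THEN iffD2, rotated]) (use F in \<open>simp add: cyl_rep_def\<close>)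
qed

lemma FC_bounded:
 assumes "cyl F"
 obtains C where "!!ga. ga:space Gamma_X ==> abs (F ga) <= C"
proof -
 obtain k f ph where F: "cyl_rep F k f ph" by (rule FC_rep[OF assms])
 then obtain C where C: "!!as. length as = k ==> abs (f as) <= C"
  using C1b_bounded[of k f] unfolding cyl_rep_def by blast
 have "abs (F ga) <= C" if "ga:space Gamma_X" for ga
  using F C[of "map (%l. pairing (ph l) ga) [0..<k]"] that by (simp add: cyl_rep_def)
 thus thesis by (rule that)
qed

lemma config_deriv_measurable:
 assumes F: "cyl F" and v: "v:Vect0 M"
 shows "config_deriv M F v:bm Gamma_X"
proof -
 obtain k f ph where r: "cyl_rep F k f ph" by (rule FC_rep[OF F])
 have f: "C1b k f" and ph: "!!l. l < k ==> ph l:test_functions M" using r by (auto simp: cyl_rep_def)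
 have m: "pairing (ph l):bm (Gamma_X :: 'x measure measure)" if "l < k" for l
  by (rule measurable_pairing_test[OF borel_test[OF ph[OF that]]])
 have "(%ga. \<Sum>l<k. list_grad f (map (%l. pairing (ph l) ga) [0..<k])!l *
   pairing (Dv M (ph l) v) ga):bm (Gamma_X :: 'x measure measure)"
 proof (intro borel_measurable_sum borel_measurable_times)
  fix l assume "l:{..<k}"
  hence l: "l < k" by simp
  show "(%ga. list_grad f (map (%l. pairing (ph l) ga) [0..<k])!l):bm (Gamma_X :: 'x measure measure)"
   by (rule C1b_grad_measurable[OF f l m])
  show "pairing (Dv M (ph l) v):bm (Gamma_X :: 'x measure measure)"
   by (rule measurable_pairing_test[OF borel_diff_field[OF ph[OF l] v]])
 qed
 thus ?thesis by (rule measurable_cong[THEN iffD2, rotated]) (simp add: config_deriv_rep[OF r _ v])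
qed

end

section \<open>Integration by parts for the cluster measure\<close>

context cluster_setting
begin

lemma good_config_deriv:
 assumes g: "good p" and r: "cyl_rep F k f ph" and v: "v:Vect0 M"
 shows "F (Sp p) = Fp k f ph p"
  "config_deriv M F v (Sp p) = (\<Sum>l<k. list_grad f (map (%l. tot (ph l) p) [0..<k])!l*tot (Dv M (ph l) v) p)"
proof -
 have ga: "Sig p:space Gamma_X" by (rule good_Sig[OF g])
 have ph: "ph l:test_functions M" if "l < k" for l using r that by (simp add: cyl_rep_def)
 have "pairing (ph l) (Sig p) = tot (ph l) p" if "l < k" for l
  by (rule pairing_Sig[OF g compact_supp_test[OF ph[OF that]]]) (rule supp_outside)
 hence args: "map (%l. pairing (ph l) (Sig p)) [0..<k] = map (%l. tot (ph l) p) [0..<k]" by simp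
 show "F (Sp p) = Fp k f ph p"
 proof -
  have "F (Sig p) = f (map (%l. pairing (ph l) (Sig p)) [0..<k])" using r ga unfolding cyl_rep_def by blast
  thus ?thesis unfolding good_Sp[OF g] Fp_def args .
 qed
 have d: "pairing (Dv M (ph l) v) (Sig p) = tot (Dv M (ph l) v) p" if "l < k" for l
 proof (rule pairing_Sig[OF g cpt_supp[OF v]])
  fix y assume "y ~: supp v"
  thus "differential M (ph l) y (v y) = 0"
   using supp_outside[of y v] differential_zero[OF test_function_mdiff[OF ph[OF that]]] by simp
 qed
 show "config_deriv M F v (Sp p) = (\<Sum>l<k. list_grad f (map (%l. tot (ph l) p) [0..<k])!l*tot (Dv M (ph l) v) p)"
  unfolding good_Sp[OF g] config_deriv_rep[OF r ga v] args by (intro sum.cong refl) (simp add: d)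
qed

lemma config_deriv_integrable:
 assumes F: "cyl F" and v: "v:Vect0 M"
 shows "integrable mucl (config_deriv M F v)" "integrable P (%p. config_deriv M F v (Sp p))"
proof -
 obtain k f ph where r: "cyl_rep F k f ph" by (rule FC_rep[OF F])
 have f: "C1b k f" and ph: "!!l. l < k ==> ph l:test_functions M" using r by (auto simp: cyl_rep_def)
 have m: "(%p. config_deriv M F v (Sp p)):bm P"
  by (rule meas_comp[OF measurable_Sp config_deriv_measurable[OF F v]])
 have "integrable P (%p. \<Sum>l<k. list_grad f (map (%l. tot (ph l) p) [0..<k])!l*tot (Dv M (ph l) v) p)"
 proof (rule integrable_sumB)
  fix l assume "l:{..<k}"
  hence l: "l < k" by simp
  obtain C where C: "!!as. length as = k ==> abs (list_grad f as!l) <= C"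
   using C1b_grad_bounded[OF f l] by blast
  have gm: "(%p. list_grad f (map (%l. tot (ph l) p) [0..<k])!l):bm GP"
   by (rule C1b_grad_measurable[OF f l tot_measurable[OF borel_test[OF ph]]])
  show "integrable P (%p. list_grad f (map (%l. tot (ph l) p) [0..<k])!l*tot (Dv M (ph l) v) p)"
  proof (rule integrable_mult_bounded[OF tot_deriv_integrable[OF v ph[OF l]]])
   show "(%p. list_grad f (map (%l. tot (ph l) p) [0..<k])!l):bm P"
    using gm by (simp cong: meas_cong)
   show "AE p in P. abs (list_grad f (map (%l. tot (ph l) p) [0..<k])!l) <= C"
    by (rule AE_I2) (rule C, simp)
  qed
 qed
 thus i: "integrable P (%p. config_deriv M F v (Sp p))"
 proof (rule integrable_cong_AE_imp[OF _ m])
  show "AE p in P. (\<Sum>l<k. list_grad f (map (%l. tot (ph l) p) [0..<k])!l*tot (Dv M (ph l) v) p) = config_deriv M F v (Sp p)"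
   using AE_good by eventually_elim (rule good_config_deriv(2)[OF _ r v, symmetric])
 qed
 show "integrable mucl (config_deriv M F v)"
  unfolding mucl_eq using i integrable_distr_eq[OF measurable_Sp config_deriv_measurable[OF F v]] by simp
qed

text \<open>On \<open>good\<close> the sum over \<open>n\<close> of \<open>Yn\<close> is the
  derivative of \<open>F\<close> plus \<open>F\<close> times the total logarithmic derivative. Its
  integral is 0, and passing to the image turns the second term into the one with
  \<open>B_cl\<close>.\<close>

lemma cluster_measure_ibp:
 assumes F: "cyl F" and v: "v:Vect0 M"
 shows "(LI mucl (%ga. config_deriv M F v ga)) = - (LI mucl (%ga. F ga*B_cl M mu et h v ga))"
proof -
 obtain k f ph where r: "cyl_rep F k f ph" by (rule FC_rep[OF F])
 have f: "C1b k f" and ph: "!!l. l < k ==> ph l:test_functions M" using r by (auto simp: cyl_rep_def)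
 obtain C where C: "!!ga. ga:space Gamma_X ==> abs (F ga) <= C" using FC_bounded[OF F] by blast
 note Fm = FC_measurable[OF F]
 have FSm: "(%p. F (Sp p)):bm P" by (rule meas_comp[OF measurable_Sp Fm])
 have i2: "integrable P (%p. F (Sp p) * vsum (beta_z v) p)"
 proof (rule integrable_mult_bounded[OF beta_vsum_integrable[OF v] FSm])
  show "AE p in P. abs (F (Sp p)) <= C"
   by (rule AE_I2, rule C) (rule measurable_space[OF measurable_Sp])
 qed
 have Ys: "(LI P (%p. (\<Sum>n. Yn v k f ph n p))) = 0" by (rule Yn_suminf(2)[OF v f ph])
 have "(LI P (%p. config_deriv M F v (Sp p)+F (Sp p) * vsum (beta_z v) p)) = (LI P (%p. (\<Sum>n. Yn v k f ph n p)))"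
 proof (rule integral_cong_AE)
  show "(%p. config_deriv M F v (Sp p)+F (Sp p) * vsum (beta_z v) p):bm P"
   using config_deriv_integrable(2)[OF F v] i2 by (intro borel_measurable_add) (rule borel_measurable_integrable, assumption)+
  show "(%p. \<Sum>n. Yn v k f ph n p):bm P"
   by (rule borel_measurable_integrable, rule Yn_suminf(1)[OF v f ph])
  show "AE p in P. config_deriv M F v (Sp p)+F (Sp p) * vsum (beta_z v) p = (\<Sum>n. Yn v k f ph n p)"
   using AE_good
  proof eventually_elim
   case (elim p)
   hence fh: "fin_hits p" by (simp add: good_def)
   have "(\<Sum>n. Yn v k f ph n p) = (\<Sum>l<k. list_grad f (map (%l. tot (ph l) p) [0..<k])!l*tot (Dv M (ph l) v) p)
     + Fp k f ph p * vsum (beta_z v) p" by (rule Yn_suminf_eq[OF v f ph fh])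
   thus ?case unfolding good_config_deriv[OF elim r v] by simp
  qed
 qed
 hence "(LI P (%p. config_deriv M F v (Sp p)))+(LI P (%p. F (Sp p) * vsum (beta_z v) p)) = 0"
  using Ys Bochner_Integration.integral_add[OF config_deriv_integrable(2)[OF F v] i2] by simp
 moreover have "(LI mucl (%ga. config_deriv M F v ga)) = (LI P (%p. config_deriv M F v (Sp p)))"
  unfolding mucl_eq by (rule integral_distr[OF measurable_Sp config_deriv_measurable[OF F v]])
 moreover have "(LI mucl (%ga. F ga*B_cl M mu et h v ga)) = (LI P (%p. F (Sp p) * vsum (beta_z v) p))"
  by (rule B_cl_props(2)[OF v Fm C])
 ultimately show ?thesis by simp
qed

lemma mucl_mult_bounded:
 fixes H :: "'x measure => real"
 assumes "integrable mucl H" and F: "cyl F"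
 shows "integrable mucl (%ga. F ga*H ga)"
proof -
 obtain C where C: "!!ga. ga:space Gamma_X ==> abs (F ga) <= C" using FC_bounded[OF F] by blast
 show ?thesis
 proof (rule integrable_mult_bounded[OF assms(1)])
  show "F:bm mucl" using FC_measurable[OF F] by (simp add: mucl_measurable)
  show "AE ga in mucl. abs (F ga) <= C" by (rule AE_I2) (simp add: C mucl_eq)
 qed
qed

lemma space_mucl: "space mucl = space Gamma_X"
 by (simp add: mucl_eq)

lemma vector_field_ibp:
 assumes F: "cyl F1" "cyl F2" and V: "FV_rep M k G v V"
 shows "integrable mucl (%ga. config_deriv M F1 (V ga) ga*F2 ga) &
  integrable mucl (%ga. F1 ga*config_deriv M F2 (V ga) ga) &
  integrable mucl (%ga. F1 ga*F2 ga*B_cl_field M mu et h k G v ga) &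
  (LI mucl (%ga. config_deriv M F1 (V ga) ga*F2 ga)) =
   - (LI mucl (%ga. F1 ga*config_deriv M F2 (V ga) ga))
   - (LI mucl (%ga. F1 ga*F2 ga*B_cl_field M mu et h k G v ga))"
  (is "integrable _ ?a & integrable _ ?b & integrable _ ?c & ?A = - ?B-?C")
proof -
 have G: "cyl (G j)" and v: "v j:Vect0 M" if "j < k" for j
  using V that FC_cyl by (auto simp: FV_rep_def)
 have Vx: "V ga x = (\<Sum>j<k. G j ga *R v j x)" if "ga:space Gamma_X" "x:points ga" for ga x
  using V that by (simp add: FV_rep_def)
 \<comment> \<open>\<open>a\<close>, \<open>b\<close> and \<open>d\<close> are the three terms of
   the product rule for F1 F2 G_j, and \<open>c\<close> is the term with the logarithmic derivative.
   \<open>c\<close> and \<open>d\<close> add up to F1 F2 times the j-th summand of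
   \<open>B_cl_field\<close>.\<close>
 define a where "a j ga = F2 ga*(G j ga*config_deriv M F1 (v j) ga)" for j ga
 define b where "b j ga = F1 ga*(G j ga*config_deriv M F2 (v j) ga)" for j ga
 define c where "c j ga = F1 ga*(F2 ga*(G j ga*B_cl M mu et h (v j) ga))" for j ga
 define d where "d j ga = F1 ga*(F2 ga*config_deriv M (G j) (v j) ga)" for j ga
 have ia: "integrable mucl (a j)" if "j < k" for j
  unfolding a_def by (intro mucl_mult_bounded config_deriv_integrable F G v that)
 have ib: "integrable mucl (b j)" if "j < k" for j
  unfolding b_def by (intro mucl_mult_bounded config_deriv_integrable F G v that)
 have ic: "integrable mucl (c j)" if "j < k" for j
  unfolding c_def by (intro mucl_mult_bounded B_cl_props(1) F G v that)
 have id: "integrable mucl (d j)" if "j < k" for j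
  unfolding d_def by (intro mucl_mult_bounded config_deriv_integrable F G v that)
 have A: "config_deriv M F1 (V ga) ga*F2 ga = (\<Sum>j<k. a j ga)" if "ga:space mucl" for ga
 proof -
  have ga: "ga:space Gamma_X" using that unfolding space_mucl .
  have "config_deriv M F1 (V ga) ga = (\<Sum>j<k. G j ga*config_deriv M F1 (v j) ga)"
   by (rule config_deriv_linear[OF F(1) ga v Vx[OF ga]])
  thus ?thesis unfolding a_def by (simp add: sum_distrib_left mult.commute)
 qed
 have B: "F1 ga*config_deriv M F2 (V ga) ga = (\<Sum>j<k. b j ga)" if "ga:space mucl" for ga
 proof -
  have ga: "ga:space Gamma_X" using that unfolding space_mucl .
  have "config_deriv M F2 (V ga) ga = (\<Sum>j<k. G j ga*config_deriv M F2 (v j) ga)"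
   by (rule config_deriv_linear[OF F(2) ga v Vx[OF ga]])
  thus ?thesis unfolding b_def by (simp add: sum_distrib_left)
 qed
 have D: "F1 ga*F2 ga*B_cl_field M mu et h k G v ga = (\<Sum>j<k. c j ga+d j ga)" for ga
  unfolding B_cl_field_def c_def d_def sum_distrib_left by (rule sum.cong) (simp_all add: distrib_left mult.assoc)
 have I: "(LI mucl (a j))+(LI mucl (b j))+((LI mucl (c j))+(LI mucl (d j))) = 0" if j: "j < k" for j
 proof -
  let ?F = "%ga. F1 ga*(F2 ga*G j ga)"
  have F2G: "cyl (%ga. F2 ga*G j ga)" by (rule cyl_mult[OF F(2) G[OF j]])
  have FF: "cyl ?F" by (rule cyl_mult[OF F(1) F2G])
  have e: "config_deriv M ?F (v j) ga = a j ga+(b j ga+d j ga)" if "ga:space mucl" for ga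
  proof -
   have ga: "ga:space Gamma_X" using that unfolding space_mucl .
   show ?thesis
    unfolding config_deriv_mult[OF F(1) F2G ga v[OF j]] config_deriv_mult[OF F(2) G[OF j] ga v[OF j]] a_def b_def d_def
    by (simp add: algebra_simps)
  qed
  have "(LI mucl (a j))+((LI mucl (b j))+(LI mucl (d j))) = (LI mucl (%ga. a j ga+(b j ga+d j ga)))"
   using ia[OF j] ib[OF j] id[OF j] by simp
  also have "... = (LI mucl (%ga. config_deriv M ?F (v j) ga))"
   by (rule integral_congB[OF refl]) (simp add: e)
  also have "... = - (LI mucl (%ga. ?F ga*B_cl M mu et h (v j) ga))" by (rule cluster_measure_ibp[OF FF v[OF j]])
  also have "(LI mucl (%ga. ?F ga*B_cl M mu et h (v j) ga)) = (LI mucl (c j))" unfolding c_def by (simp add: mult.assoc)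
  finally show ?thesis by simp
 qed
 have SA: "integrable mucl (%ga. \<Sum>j<k. a j ga)" using ia by (intro integrable_sumB) simp
 have SB: "integrable mucl (%ga. \<Sum>j<k. b j ga)" using ib by (intro integrable_sumB) simp
 have icd: "integrable mucl (%ga. c j ga+d j ga)" if "j < k" for j by (intro Bochner_Integration.integrable_add ic id that)
 have SD: "integrable mucl (%ga. \<Sum>j<k. c j ga+d j ga)" using icd by (intro integrable_sumB) simp
 have IA: "?A = (\<Sum>j<k. \<integral>ga. a j ga \<partial>mucl)"
  using ia by (simp add: A integral_sumB cong: integral_congB)
 have IB: "?B = (\<Sum>j<k. \<integral>ga. b j ga \<partial>mucl)"
  using ib by (simp add: B integral_sumB cong: integral_congB)
 have ID: "?C = (\<Sum>j<k. (LI mucl (c j))+(LI mucl (d j)))"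
  unfolding D using icd ic id by (simp add: integral_sumB Bochner_Integration.integral_add)
 have "(\<Sum>j<k. (LI mucl (a j))+(LI mucl (b j))+((LI mucl (c j))+(LI mucl (d j)))) = 0"
  using I by (intro sum.neutral) simp
 hence "?A+?B
   + ?C = 0"
  unfolding IA IB ID sum.distrib by simp
 moreover have "integrable mucl ?a"
  by (rule Bochner_Integration.integrable_cong[THEN iffD2, OF refl _ SA]) (rule A)
 moreover have "integrable mucl ?b"
  by (rule Bochner_Integration.integrable_cong[THEN iffD2, OF refl _ SB]) (rule B)
 moreover have "integrable mucl ?c"
  unfolding D by (rule SD)
 ultimately show ?thesis by linarith
qed

end

theorem theorem4p12:
  fixes M :: "('x::{t2_space,second_countable_topology}, 'n::finite) riemannian"
    and \<mu> :: "'x measure measure"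
    and \<eta> :: "'x \<Rightarrow> 'x list measure"
    and \<theta> :: "'x measure"
    and h :: "'x \<Rightarrow> 'x list \<Rightarrow> real"
    and F1 F2 :: "'x measure \<Rightarrow> real"
    and k :: nat
    and G :: "nat \<Rightarrow> 'x measure \<Rightarrow> real"
    and v :: "nat \<Rightarrow> 'x \<Rightarrow> real ^ 'n"
    and V :: "'x measure \<Rightarrow> 'x \<Rightarrow> real ^ 'n"
  defines "\<mu>cl \<equiv> cluster_measure \<mu> \<eta>"
  assumes manifold: "riemannian_manifold M"
    and mu: "prob_space \<mu>" "sets \<mu> = sets Gamma_X"
    and eta: "cluster_family \<eta>"
    and A1: "sets \<theta> = sets borel" "\<And>K. compact K \<Longrightarrow> emeasure \<theta> K < \<infinity>" "\<mu> \<in> M1 \<theta>"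
    and A2: "\<And>B. compact B \<Longrightarrow> (\<integral>\<^sup>+x. emeasure (\<eta> x) (hits B) \<partial>\<theta>) < \<infinity>"
            "\<And>B. compact B \<Longrightarrow> (\<integral>\<^sup>+x. (\<integral>\<^sup>+ys\<in>hits B. of_nat (length ys) \<partial>\<eta> x) \<partial>\<theta>) < \<infinity>"
    and A3: "\<And>x ys. 0 \<le> h x ys"
            "\<And>x. \<eta> x = density (list_volume M) (\<lambda>ys. ennreal (h x ys))"
            "\<And>x ys. list_differentiable M (h x) ys"
            "\<And>x w f. w \<in> Vect0 M \<Longrightarrow> f \<in> list_test_functions M \<Longrightarrow>
               integrable (\<eta> x) (\<lambda>ys. f ys * beta_along M h w x ys) \<and>
               (\<integral>ys. hat_deriv M w f ys \<partial>\<eta> x) = - (\<integral>ys. f ys * beta_along M h w x ys \<partial>\<eta> x)"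
    and A4: "\<And>B. compact B \<Longrightarrow>
               set_integrable (sigma_hat \<eta> \<theta>) (UNIV \<times> hits B) (\<lambda>(x, ys). beta_norm1 M h x ys)"
    and F: "F1 \<in> FC M" "F2 \<in> FC M"
    and V: "FV_rep M k G v V"
  shows "integrable \<mu>cl (\<lambda>\<gamma>. config_deriv M F1 (V \<gamma>) \<gamma> * F2 \<gamma>) \<and>
    integrable \<mu>cl (\<lambda>\<gamma>. F1 \<gamma> * config_deriv M F2 (V \<gamma>) \<gamma>) \<and>
    integrable \<mu>cl (\<lambda>\<gamma>. F1 \<gamma> * F2 \<gamma> * B_cl_field M \<mu> \<eta> h k G v \<gamma>) \<and>
    (\<integral>\<gamma>. config_deriv M F1 (V \<gamma>) \<gamma> * F2 \<gamma> \<partial>\<mu>cl) =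
      - (\<integral>\<gamma>. F1 \<gamma> * config_deriv M F2 (V \<gamma>) \<gamma> \<partial>\<mu>cl)
      - (\<integral>\<gamma>. F1 \<gamma> * F2 \<gamma> * B_cl_field M \<mu> \<eta> h k G v \<gamma> \<partial>\<mu>cl)"
proof -
  interpret R: riemann M by standard (rule manifold)
  \<comment> \<open>The exhaustion is an auxiliary choice; none of the measures in the statement
    depends on it.\<close>
  obtain K :: "nat \<Rightarrow> 'x set" where K: "exhaustion K" using R.exhaustion_exists by (rule exE)
  have ck: "cluster_kernel K \<eta>" by (intro cluster_kernel.intro K cluster_kernel_axioms.intro eta)
  have cp: "cluster_process K \<eta> \<mu>" by (intro cluster_process.intro ck cluster_process_axioms.intro mu)
  have cd: "cluster_density M K \<eta> h"
    by (intro cluster_density.intro R.riemann_axioms ck cluster_density_axioms.intro A3(1,2,3))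
  have ci: "cluster_ibp M K \<eta> h" by (intro cluster_ibp.intro cd cluster_ibp_axioms.intro A3(4))
  interpret cluster_setting M K \<eta> h \<mu> \<theta>
    by (intro cluster_setting.intro ci cp cluster_setting_axioms.intro A1(1,3) A2 A4)
  show ?thesis unfolding \<mu>cl_def by (rule vector_field_ibp[OF R.FC_cyl[OF F(1)] R.FC_cyl[OF F(2)] V])
qed

end
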